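(* Assume that $p=2$ or $p=3$, and let $X$ and $Y$ be anisotropic quasilinear $p$-hypersurfaces over $F$. Suppose that there exists a rational morphism $X \dashrightarrow Y$. Then: (1) $\dim_{Izh}(X) \leq \dim_{Izh}(Y)$. (2) $\dim_{Izh}(X) = \dim_{Izh}(Y)$ if and only if there exists a rational morphism $Y \dashrightarrow X$.
   Context: $p$ is a prime and $F$ is a non-perfect field of characteristic $p$. Rational morphisms are over the base field and need not be dominant. A quasilinear $p$-form over a field $E$ of characteristic $p$ is a map $\varphi\colon V_\varphi \to E$ on a finite-dimensional $E$-vector space $V_\varphi$ with $\varphi(\lambda v)=\lambda^p\varphi(v)$ and $\varphi(v+w)=\varphi(v)+\varphi(w)$ for all $\lambda\in E$, $v,w\in V_\varphi$ (in coordinates, $a_1x_1^p+\dots+a_nx_n^p$). Its dimension is $\dim V_\varphi$, and $\varphi_L$ denotes its scalar extension to a field $L\supset E$. It is isotropic if $\varphi(v)=0$ for some $v\ne 0$, and anisotropic otherwise. The isotropic vectors form a subspace of $V_\varphi$, whose dimension is the defect index $\mathfrak{i}_0(\varphi)$. For a quasilinear $p$-form $\varphi$ over $F$ of dimension $d+2\ge 2$, $X_\varphi=\{\varphi=0\}\subset\mathbb{P}(V_\varphi)$ is the associated projective hypersurface, of dimension $d$; schemes of this type are called quasilinear $p$-hypersurfaces. $X_\varphi$ is called anisotropic if $\varphi$ is; in that case it is integral and $F(\varphi)$ denotes its function field. For anisotropic $\varphi$, put $\mathfrak{i}_1(X_\varphi)=\mathfrak{i}_1(\varphi):=\mathfrak{i}_0(\varphi_{F(\varphi)})$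 and $\dim_{Izh}(X_\varphi):=\dim(X_\varphi)-\mathfrak{i}_1(X_\varphi)+1$ (the Izhboldin dimension). *)

theory Defs
  imports
    Complex_Main
    "HOL-Computational_Algebra.Primes"
    "HOL-Library.Poly_Mapping"
    "Jordan_Normal_Form.Missing_VectorSpace"
begin

section \<open>Quasilinear forms and their hypersurfaces\<close>

locale quasilinear_form = finite_dimensional_vector_space scale Basis
  for scale :: "'a::field \<Rightarrow> 'v::ab_group_add \<Rightarrow> 'v" and Basis :: "'v set" +
  fixes p :: nat and \<phi> :: "'v \<Rightarrow> 'a"
  assumes prime_p: "prime p"
    and char_p: "CHAR('a) = p"
    and form_scale: "\<phi> (scale c v) = c ^ p * \<phi> v"
    and form_add: "\<phi> (v + w) = \<phi> v + \<phi> w"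

text \<open>
  \<open>Basis\<close> is an arbitrary basis of \<open>V\<^sub>\<phi>\<close>; it only serves to fix homogeneous coordinates on
  \<open>P(V\<^sub>\<phi>)\<close> and on the scalar extensions of \<open>V\<^sub>\<phi>\<close>.
\<close>

locale anisotropic_hypersurface = quasilinear_form +
  assumes dim_ge_2: "2 \<le> dim UNIV"
    and anisotropic: "\<phi> v = 0 \<Longrightarrow> v = 0"

section \<open>The homogeneous ideal of a hypersurface\<close>

text \<open>
  Polynomials over \<open>'a\<close> whose variables are indexed by \<open>'v\<close>. For a basis \<open>B\<close> of \<open>V\<close> the variable
  with index \<open>b \<in> B\<close> is the coordinate function dual to \<open>b\<close>, so that \<open>poly_ring B\<close> is the
  homogeneous coordinate ring of \<open>P(V)\<close>.
\<close>

type_synonym ('v, 'a) mpoly = "('v \<Rightarrow>\<^sub>0 nat) \<Rightarrow>\<^sub>0 'a"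

definition poly_ring :: "'v set \<Rightarrow> ('v, 'a::zero) mpoly set" where
  "poly_ring B = {f. \<forall>m\<in>Poly_Mapping.keys f. Poly_Mapping.keys m \<subseteq> B}"

definition homogeneous :: "'v set \<Rightarrow> nat \<Rightarrow> ('v, 'a::zero) mpoly set" where
  "homogeneous B e = {f \<in> poly_ring B. \<forall>m\<in>Poly_Mapping.keys f. (\<Sum>x\<in>Poly_Mapping.keys m. Poly_Mapping.lookup m x) = e}"

definition const_poly :: "'a \<Rightarrow> ('v, 'a::zero) mpoly" where
  "const_poly c = Poly_Mapping.single 0 c"

definition var_poly :: "'v \<Rightarrow> ('v, 'a::zero_neq_one) mpoly" where
  "var_poly b = Poly_Mapping.single (Poly_Mapping.single b 1) 1"

text \<open>
  By quasilinearity \<open>\<phi> (\<Sum>b\<in>B. x\<^sub>b b) = (\<Sum>b\<in>B. \<phi> b * x\<^sub>b ^ p)\<close>, so this is \<open>\<phi>\<close> in coordinates.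
\<close>

definition form_poly :: "nat \<Rightarrow> 'v set \<Rightarrow> ('v \<Rightarrow> 'a::comm_ring_1) \<Rightarrow> ('v, 'a) mpoly" where
  "form_poly p B \<phi> = (\<Sum>b\<in>B. const_poly (\<phi> b) * var_poly b ^ p)"

definition form_ideal :: "nat \<Rightarrow> 'v set \<Rightarrow> ('v \<Rightarrow> 'a::comm_ring_1) \<Rightarrow> ('v, 'a) mpoly set" where
  "form_ideal p B \<phi> = {h * form_poly p B \<phi> | h. h \<in> poly_ring B}"

section \<open>The function field\<close>

text \<open>
  The function field of the integral hypersurface \<open>X\<^sub>\<phi>\<close>: degree-zero homogeneous fractions over its
  homogeneous coordinate ring, that is, fractions \<open>f/g\<close> of homogeneous polynomials of the same
  degree with \<open>g\<close> outside the ideal of \<open>X\<^sub>\<phi>\<close>, identified when they agree on \<open>X\<^sub>\<phi>\<close>.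
\<close>

definition fractions ::
  "nat \<Rightarrow> 'v set \<Rightarrow> ('v \<Rightarrow> 'a::comm_ring_1) \<Rightarrow> (('v, 'a) mpoly \<times> ('v, 'a) mpoly) set" where
  "fractions p B \<phi> =
     {(f, g). (\<exists>e. f \<in> homogeneous B e \<and> g \<in> homogeneous B e) \<and> g \<notin> form_ideal p B \<phi>}"

definition fraction_rel ::
  "nat \<Rightarrow> 'v set \<Rightarrow> ('v \<Rightarrow> 'a::comm_ring_1) \<Rightarrow> (('v, 'a) mpoly \<times> ('v, 'a) mpoly) rel" where
  "fraction_rel p B \<phi> =
     {((f, g), (f', g')). (f, g) \<in> fractions p B \<phi> \<and> (f', g') \<in> fractions p B \<phi> \<and>
        f * g' - f' * g \<in> form_ideal p B \<phi>}"

definition fraction_class ::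
  "nat \<Rightarrow> 'v set \<Rightarrow> ('v \<Rightarrow> 'a::comm_ring_1) \<Rightarrow> ('v, 'a) mpoly \<Rightarrow> ('v, 'a) mpoly \<Rightarrow>
     (('v, 'a) mpoly \<times> ('v, 'a) mpoly) set" where
  "fraction_class p B \<phi> f g = fraction_rel p B \<phi> `` {(f, g)}"

definition function_field ::
  "nat \<Rightarrow> 'v set \<Rightarrow> ('v \<Rightarrow> 'a::comm_ring_1) \<Rightarrow> (('v, 'a) mpoly \<times> ('v, 'a) mpoly) set ring" where
  "function_field p B \<phi> =
     \<lparr>carrier = fractions p B \<phi> // fraction_rel p B \<phi>,
      mult = (\<lambda>S T. \<Union>(f, g)\<in>S. \<Union>(f', g')\<in>T. fraction_class p B \<phi> (f * f') (g * g')),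
      one = fraction_class p B \<phi> 1 1,
      zero = fraction_class p B \<phi> 0 1,
      add = (\<lambda>S T. \<Union>(f, g)\<in>S. \<Union>(f', g')\<in>T. fraction_class p B \<phi> (f * g' + f' * g) (g * g'))\<rparr>"

definition base_embedding ::
  "nat \<Rightarrow> 'v set \<Rightarrow> ('v \<Rightarrow> 'a::comm_ring_1) \<Rightarrow> 'a \<Rightarrow> (('v, 'a) mpoly \<times> ('v, 'a) mpoly) set" where
  "base_embedding p B \<phi> c = fraction_class p B \<phi> (const_poly c) 1"

section \<open>Scalar extension, defect index, Izhboldin dimension\<close>

text \<open>
  For a field embedding \<open>\<sigma>\<close> into \<open>L\<close>, the space \<open>L \<otimes> V\<^sub>\<phi>\<close> is identified with \<open>ring.func_space L B\<close>,
  the functions \<open>B \<rightarrow> L\<close>, via the basis \<open>B\<close>.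
\<close>

definition scalar_extension ::
  "('l, 'm) ring_scheme \<Rightarrow> ('a \<Rightarrow> 'l) \<Rightarrow> nat \<Rightarrow> 'v set \<Rightarrow> ('v \<Rightarrow> 'a) \<Rightarrow> ('v \<Rightarrow> 'l) \<Rightarrow> 'l" where
  "scalar_extension L \<sigma> p B \<phi> v = (\<Oplus>\<^bsub>L\<^esub>b\<in>B. \<sigma> (\<phi> b) \<otimes>\<^bsub>L\<^esub> (v b [^]\<^bsub>L\<^esub> p))"

definition defect_index ::
  "('l, 'm) ring_scheme \<Rightarrow> ('l, 'w, 'n) module_scheme \<Rightarrow> ('w \<Rightarrow> 'l) \<Rightarrow> nat" where
  "defect_index L W \<psi> =
     vectorspace.dim L (W\<lparr>carrier := {w \<in> carrier W. \<psi> w = \<zero>\<^bsub>L\<^esub>}\<rparr>)"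

definition i1_index :: "nat \<Rightarrow> 'v set \<Rightarrow> ('v \<Rightarrow> 'a::comm_ring_1) \<Rightarrow> nat" where
  "i1_index p B \<phi> =
     (let L = function_field p B \<phi>
      in defect_index L (ring.func_space L B)
           (scalar_extension L (base_embedding p B \<phi>) p B \<phi>))"

definition hypersurface_dim :: "('a::field \<Rightarrow> 'v::ab_group_add \<Rightarrow> 'v) \<Rightarrow> int" where
  "hypersurface_dim scale = int (vector_space.dim scale UNIV) - 2"

definition izhboldin_dim ::
  "('a::field \<Rightarrow> 'v::ab_group_add \<Rightarrow> 'v) \<Rightarrow> 'v set \<Rightarrow> nat \<Rightarrow> ('v \<Rightarrow> 'a) \<Rightarrow> int" where
  "izhboldin_dim scale B p \<phi> = hypersurface_dim scale - int (i1_index p B \<phi>) + 1"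

section \<open>Rational morphisms\<close>

text \<open>
  A rational morphism \<open>X\<^sub>\<phi> --> X\<^sub>\<psi>\<close>, in homogeneous coordinates: a tuple of homogeneous
  polynomials of one common degree over the base field, not all vanishing on \<open>X\<^sub>\<phi>\<close>, whose
  substitution into \<open>\<psi>\<close> vanishes on \<open>X\<^sub>\<phi>\<close>. Two tuples define the same rational morphism iff they are
  proportional on \<open>X\<^sub>\<phi>\<close>. Vanishing on \<open>X\<^sub>\<phi>\<close> means membership in its ideal (rational points would
  not do: \<open>X\<^sub>\<phi>\<close> has none). Dominance is not required.
\<close>

definition morphism_tuples ::
  "nat \<Rightarrow> 'v set \<Rightarrow> ('v \<Rightarrow> 'a::comm_ring_1) \<Rightarrow> 'w set \<Rightarrow> ('w \<Rightarrow> 'a) \<Rightarrow> ('w \<Rightarrow> ('v, 'a) mpoly) set" where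
  "morphism_tuples p B \<phi> C \<psi> =
     {g. (\<exists>e. g \<in> C \<rightarrow>\<^sub>E homogeneous B e) \<and>
         (\<exists>c\<in>C. g c \<notin> form_ideal p B \<phi>) \<and>
         (\<Sum>c\<in>C. const_poly (\<psi> c) * g c ^ p) \<in> form_ideal p B \<phi>}"

definition tuple_rel ::
  "nat \<Rightarrow> 'v set \<Rightarrow> ('v \<Rightarrow> 'a::comm_ring_1) \<Rightarrow> 'w set \<Rightarrow> ('w \<Rightarrow> 'a) \<Rightarrow> ('w \<Rightarrow> ('v, 'a) mpoly) rel" where
  "tuple_rel p B \<phi> C \<psi> =
     {(g, h). g \<in> morphism_tuples p B \<phi> C \<psi> \<and> h \<in> morphism_tuples p B \<phi> C \<psi> \<and>
        (\<forall>c\<in>C. \<forall>d\<in>C. g c * h d - g d * h c \<in> form_ideal p B \<phi>)}"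

definition rational_morphisms ::
  "nat \<Rightarrow> 'v set \<Rightarrow> ('v \<Rightarrow> 'a::comm_ring_1) \<Rightarrow> 'w set \<Rightarrow> ('w \<Rightarrow> 'a) \<Rightarrow> ('w \<Rightarrow> ('v, 'a) mpoly) set set" where
  "rational_morphisms p B \<phi> C \<psi> = morphism_tuples p B \<phi> C \<psi> // tuple_rel p B \<phi> C \<psi>"

end

theory Submission
  imports
    Defs
    "HOL-Computational_Algebra.Fraction_Field"
    "HOL-Computational_Algebra.Formal_Power_Series"
    "HOL-Computational_Algebra.Polynomial"
begin

text \<open>
  Let \<open>a\<^sub>b\<close> (\<open>b \<in> B\<close>) and \<open>d\<^sub>c\<close> (\<open>c \<in> C\<close>) be the coefficients of the forms defining \<open>X\<close> and \<open>Y\<close>. A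
  rational morphism \<open>X --> Y\<close> is a linear dependence of the \<open>d\<^sub>c\<close> over \<open>F(X)\<^sup>p\<close>, and
  \<open>dim\<^sub>I\<^sub>z\<^sub>h X + 1\<close> is the rank of the \<open>a\<^sub>b\<close> over \<open>F(X)\<^sup>p\<close>.

  Both are tested at another kind of point: a generic root \<open>\<alpha>\<close> of a polynomial
  \<open>\<Sum>b. a\<^sub>b y\<^sub>b(T)\<close>, where the \<open>y\<^sub>b\<close> are polynomials of degree below \<open>p\<close> over \<open>F\<^sup>p\<close>, to which
  parameters have been adjoined. Dependences over the field generated by \<open>\<alpha>\<close> and the \<open>p\<close>-th powers
  specialise to dependences over \<open>F(X)\<^sup>p\<close> (degeneration of the root) and, conversely, dependences over
  \<open>F(X)\<^sup>p\<close> hold at every simple root of such a polynomial. If there is a morphism \<open>X --> Y\<close>, the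
  generic root \<open>\<alpha>\<close> for \<open>X\<close> is therefore also a root of a polynomial \<open>\<Sum>c. d\<^sub>c w\<^sub>c(T)\<close>; for \<open>p \<le> 3\<close> it
  can be taken to be a simple root. Choose the \<open>w\<^sub>c\<close> as generic as possible. The pair of polynomials
  is then parametrised from the side of \<open>X\<close> and from the side of \<open>Y\<close>; comparing the numbers of
  parameters gives the inequality, and in case of equality \<open>\<alpha>\<close> is a generic root for \<open>Y\<close> as well.
\<close>

section \<open>Evaluation of multivariate polynomials\<close>

text \<open>A function on a hypersurface is represented by its \<open>p\<close>-th power. The free
  coordinates then become transcendentals, the constants become \<open>Fp\<close>, and all fields
  lie in one rational function field, without adjoining radicals. The coefficients of the forms stay
  in \<open>F\<close>; the linear disjointness of \<open>F\<close> and the root field over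
  \<open>Fp\<close> keeps them apart from the parameters.

  Degree below \<open>p\<close> is natural because \<alpha> has degree \<open>p\<close> over the
  root field \<open>K\<close>: a dependence over \<open>K(\<alpha>)\<close> is the same as such a
  polynomial with the root \<alpha>. In contrast to the generic point of \<open>X\<close>, a pair of
  polynomials with a common root treats \<open>X\<close> and \<open>Y\<close> alike.

  The delicate count is the one from \<open>Y\<close>: the \<open>y b\<close> with \<open>b\<close>
  in an independent set must be recovered from \<open>w\<close>, \<open>\<alpha> ^ p\<close> and the
  other \<open>y b\<close>. They satisfy a linear equation whose coefficients involve \<alpha>, and
  disjointness applies to it only once \<alpha> is known to lie in the compositum of
  \<open>F\<close> with these data. A simple root lies there, since \<open>T - \<alpha>\<close> is
  then the greatest common divisor of its polynomial and
  \<open>T ^ p - \<alpha> ^ p\<close>.\<close>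

locale rhom =
  fixes h :: "'a::comm_ring_1 \<Rightarrow> 'r::comm_ring_1"
  assumes hom_add: "h (x + y) = h x + h y"
    and hom_mult: "h (x * y) = h x * h y"
    and hom_one [simp]: "h 1 = 1"
begin

lemma hom_zero [simp]: "h 0 = 0"
  using hom_add[of 0 0] by simp

lemma hom_uminus: "h (- x) = - h x"
  using hom_add[of x "- x"] by (simp add: eq_neg_iff_add_eq_0 add.commute)

lemma hom_diff: "h (x - y) = h x - h y"
  using hom_add[of x "- y"] by (simp add: hom_uminus)

lemma hom_sum: "h (sum f A) = (\<Sum>a\<in>A. h (f a))"
  by (induction A rule: infinite_finite_induct) (auto simp: hom_add)

lemma hom_prod: "h (prod f A) = (\<Prod>a\<in>A. h (f a))"
  by (induction A rule: infinite_finite_induct) (auto simp: hom_mult)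

lemma hom_power: "h (x ^ n) = h x ^ n"
  by (induction n) (auto simp: hom_mult)

end

lemma rhom_id: "rhom (\<lambda>x. x)"
  by unfold_locales auto

lemma rhom_field_inj:
  fixes h :: "'a::field \<Rightarrow> 'r::comm_ring_1"
  assumes "rhom h"
  shows "h x = 0 \<longleftrightarrow> x = 0"
proof -
  interpret rhom h by fact
  have "x \<noteq> 0 \<Longrightarrow> h x * h (inverse x) = 1"
    by (metis hom_mult hom_one right_inverse)
  then show ?thesis by fastforce
qed

definition mono_ev :: "('i \<Rightarrow> 'r::comm_ring_1) \<Rightarrow> ('i \<Rightarrow>\<^sub>0 nat) \<Rightarrow> 'r" where
  "mono_ev z m = (\<Prod>i\<in>Poly_Mapping.keys m. z i ^ Poly_Mapping.lookup m i)"

text \<open>The map \<open>h\<close> on coefficients lets one operation serve for constants in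
  polynomials and power series, for field embeddings and for the Frobenius twist.\<close>

definition meval :: "('a::comm_ring_1 \<Rightarrow> 'r::comm_ring_1) \<Rightarrow> ('i \<Rightarrow> 'r) \<Rightarrow> ('i, 'a) mpoly \<Rightarrow> 'r" where
  "meval h z P = (\<Sum>m\<in>Poly_Mapping.keys P. h (Poly_Mapping.lookup P m) * mono_ev z m)"

lemma mono_ev_superset:
  assumes "finite S" "Poly_Mapping.keys m \<subseteq> S"
  shows "mono_ev z m = (\<Prod>i\<in>S. z i ^ Poly_Mapping.lookup m i)"
  unfolding mono_ev_def using assms
  by (intro prod.mono_neutral_left) (auto simp: in_keys_iff)

lemma mono_ev_0 [simp]: "mono_ev z 0 = 1"
  by (simp add: mono_ev_def)

lemma mono_ev_single [simp]: "mono_ev z (Poly_Mapping.single i n) = z i ^ n"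
  by (subst mono_ev_superset[where S = "{i}"]) auto

lemma mono_ev_add: "mono_ev z (m + n) = mono_ev z m * mono_ev z n"
proof -
  define S where "S = Poly_Mapping.keys m \<union> Poly_Mapping.keys n"
  have "Poly_Mapping.keys (m + n) \<subseteq> S" by (auto simp: S_def dest: subsetD[OF keys_add])
  moreover have "finite S" by (auto simp: S_def)
  moreover have "Poly_Mapping.keys m \<subseteq> S" "Poly_Mapping.keys n \<subseteq> S" by (auto simp: S_def)
  ultimately show ?thesis
    by (simp add: mono_ev_superset[of S] prod.distrib[symmetric] lookup_add power_add)
qed

lemma mono_ev_cong:
  "(\<And>i. i \<in> Poly_Mapping.keys m \<Longrightarrow> z i = z' i) \<Longrightarrow> mono_ev z m = mono_ev z' m"
  by (simp add: mono_ev_def)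

lemma meval_cong:
  "(\<And>m i. m \<in> Poly_Mapping.keys P \<Longrightarrow> i \<in> Poly_Mapping.keys m \<Longrightarrow> z i = z' i) \<Longrightarrow> meval h z P = meval h z' P"
  unfolding meval_def by (intro sum.cong refl arg_cong2[where f = "(*)"] mono_ev_cong) auto

lemma mpoly_single_sum: "P = (\<Sum>m\<in>Poly_Mapping.keys P. Poly_Mapping.single m (Poly_Mapping.lookup P m))"
  by (rule poly_mapping_eqI)
     (auto simp: lookup_sum lookup_single when_def in_keys_iff if_distrib sum.delta)

context rhom begin

lemma meval_superset:
  assumes "finite S" "Poly_Mapping.keys P \<subseteq> S"
  shows "meval h z P = (\<Sum>m\<in>S. h (Poly_Mapping.lookup P m) * mono_ev z m)"
  unfolding meval_def using assms
  by (intro sum.mono_neutral_left) (auto simp: in_keys_iff)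

lemma meval_0 [simp]: "meval h z 0 = 0"
  by (simp add: meval_def)

lemma meval_single [simp]: "meval h z (Poly_Mapping.single m c) = h c * mono_ev z m"
  by (subst meval_superset[where S = "{m}"]) auto

lemma meval_add: "meval h z (P + Q) = meval h z P + meval h z Q"
proof -
  define S where "S = Poly_Mapping.keys P \<union> Poly_Mapping.keys Q"
  have "Poly_Mapping.keys (P + Q) \<subseteq> S" by (auto simp: S_def dest: subsetD[OF keys_add])
  moreover have "finite S" by (auto simp: S_def)
  moreover have "Poly_Mapping.keys P \<subseteq> S" "Poly_Mapping.keys Q \<subseteq> S" by (auto simp: S_def)
  ultimately show ?thesis
    by (simp add: meval_superset[of S] sum.distrib[symmetric] lookup_add hom_add algebra_simps)
qed

lemma meval_sum: "meval h z (sum f A) = (\<Sum>a\<in>A. meval h z (f a))"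
  by (induction A rule: infinite_finite_induct) (auto simp: meval_add)

lemma meval_mult: "meval h z (P * Q) = meval h z P * meval h z Q"
proof -
  have "P * Q = (\<Sum>m\<in>Poly_Mapping.keys P. \<Sum>n\<in>Poly_Mapping.keys Q.
      Poly_Mapping.single (m + n) (Poly_Mapping.lookup P m * Poly_Mapping.lookup Q n))"
    by (subst mpoly_single_sum[of P], subst mpoly_single_sum[of Q])
       (simp add: sum_product mult_single)
  then have "meval h z (P * Q) = (\<Sum>m\<in>Poly_Mapping.keys P. \<Sum>n\<in>Poly_Mapping.keys Q.
      h (Poly_Mapping.lookup P m) * h (Poly_Mapping.lookup Q n) * (mono_ev z m * mono_ev z n))"
    by (simp add: meval_sum mono_ev_add hom_mult)
  also have "\<dots> = meval h z P * meval h z Q"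
    by (simp add: meval_def sum_product algebra_simps)
  finally show ?thesis .
qed

lemma meval_const [simp]: "meval h z (const_poly c) = h c"
  by (simp add: const_poly_def)

lemma meval_var [simp]: "meval h z (var_poly i) = z i"
  by (simp add: var_poly_def)

lemma meval_one [simp]: "meval h z 1 = 1"
  using meval_const[of z 1] by (simp add: const_poly_def)

lemma rhom_meval: "rhom (meval h z)"
  by unfold_locales (auto simp: meval_add meval_mult)

lemmas meval_uminus = rhom.hom_uminus[OF rhom_meval]
lemmas meval_diff = rhom.hom_diff[OF rhom_meval]
lemmas meval_power = rhom.hom_power[OF rhom_meval]
lemmas meval_prod = rhom.hom_prod[OF rhom_meval]

end

lemma rhom_const_poly: "rhom (const_poly :: 'a::comm_ring_1 \<Rightarrow> ('i, 'a) mpoly)"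
  by unfold_locales (auto simp: const_poly_def single_add mult_single)

lemma meval_hom:
  assumes "rhom h" "rhom g"
  shows "g (meval h z P) = meval (\<lambda>x. g (h x)) (\<lambda>i. g (z i)) P"
proof -
  interpret g: rhom g by fact
  show ?thesis
    by (simp add: meval_def mono_ev_def g.hom_sum g.hom_mult g.hom_prod g.hom_power)
qed

section \<open>Subrings and subfields\<close>

text \<open>Substructures are subsets of a fixed type, because the proof moves between many
  intermediate fields of one large field.\<close>

definition sring :: "'a::comm_ring_1 set \<Rightarrow> bool" where
  "sring R \<longleftrightarrow> 1 \<in> R \<and> (\<forall>x\<in>R. - x \<in> R) \<and> (\<forall>x\<in>R. \<forall>y\<in>R. x + y \<in> R \<and> x * y \<in> R)"

definition sfield :: "'a::field set \<Rightarrow> bool" where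
  "sfield K \<longleftrightarrow> sring K \<and> (\<forall>x\<in>K. inverse x \<in> K)"

lemma sring_one: "sring R \<Longrightarrow> 1 \<in> R"
  and sring_uminus: "sring R \<Longrightarrow> x \<in> R \<Longrightarrow> - x \<in> R"
  and sring_add: "sring R \<Longrightarrow> x \<in> R \<Longrightarrow> y \<in> R \<Longrightarrow> x + y \<in> R"
  and sring_mult: "sring R \<Longrightarrow> x \<in> R \<Longrightarrow> y \<in> R \<Longrightarrow> x * y \<in> R"
  by (auto simp: sring_def)

lemma sring_zero: "sring R \<Longrightarrow> 0 \<in> R"
  by (metis sring_one sring_uminus sring_add add.right_inverse)

lemma sring_diff: "sring R \<Longrightarrow> x \<in> R \<Longrightarrow> y \<in> R \<Longrightarrow> x - y \<in> R"
  by (metis sring_uminus sring_add diff_conv_add_uminus)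

lemma sring_sum: "sring R \<Longrightarrow> (\<And>a. a \<in> A \<Longrightarrow> f a \<in> R) \<Longrightarrow> sum f A \<in> R"
  by (induction A rule: infinite_finite_induct) (auto simp: sring_zero sring_add)

lemma sring_prod: "sring R \<Longrightarrow> (\<And>a. a \<in> A \<Longrightarrow> f a \<in> R) \<Longrightarrow> prod f A \<in> R"
  by (induction A rule: infinite_finite_induct) (auto simp: sring_one sring_mult)

lemma sring_power: "sring R \<Longrightarrow> x \<in> R \<Longrightarrow> x ^ n \<in> R"
  by (induction n) (auto simp: sring_one sring_mult)

lemma sring_of_nat: "sring R \<Longrightarrow> of_nat n \<in> R"
  by (induction n) (auto simp: sring_one sring_zero sring_add)

lemmas sring_closed = sring_one sring_zero sring_uminus sring_add sring_mult sring_diff sring_sum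
  sring_prod sring_power sring_of_nat

lemma sfield_sring: "sfield K \<Longrightarrow> sring K"
  by (simp add: sfield_def)

lemma sfield_inverse: "sfield K \<Longrightarrow> x \<in> K \<Longrightarrow> inverse x \<in> K"
  by (simp add: sfield_def)

lemma sfield_divide: "sfield K \<Longrightarrow> x \<in> K \<Longrightarrow> y \<in> K \<Longrightarrow> x / y \<in> K"
  by (simp add: sfield_inverse sring_mult[OF sfield_sring] divide_inverse)

lemmas sfield_closed = sring_closed[OF sfield_sring] sfield_inverse sfield_divide

lemma sring_UNIV [simp]: "sring UNIV" by (simp add: sring_def)

section \<open>Generated subrings and subfields\<close>

inductive_set rgen :: "'a::comm_ring_1 set \<Rightarrow> 'a set" for S where
  rgen_base: "x \<in> S \<Longrightarrow> x \<in> rgen S"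
| rgen_one: "1 \<in> rgen S"
| rgen_uminus: "x \<in> rgen S \<Longrightarrow> - x \<in> rgen S"
| rgen_add: "x \<in> rgen S \<Longrightarrow> y \<in> rgen S \<Longrightarrow> x + y \<in> rgen S"
| rgen_mult: "x \<in> rgen S \<Longrightarrow> y \<in> rgen S \<Longrightarrow> x * y \<in> rgen S"

inductive_set fgen :: "'a::field set \<Rightarrow> 'a set" for S where
  fgen_base: "x \<in> S \<Longrightarrow> x \<in> fgen S"
| fgen_one: "1 \<in> fgen S"
| fgen_uminus: "x \<in> fgen S \<Longrightarrow> - x \<in> fgen S"
| fgen_add: "x \<in> fgen S \<Longrightarrow> y \<in> fgen S \<Longrightarrow> x + y \<in> fgen S"
| fgen_mult: "x \<in> fgen S \<Longrightarrow> y \<in> fgen S \<Longrightarrow> x * y \<in> fgen S"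
| fgen_inverse: "x \<in> fgen S \<Longrightarrow> inverse x \<in> fgen S"

lemma sring_rgen: "sring (rgen S)"
  by (auto simp: sring_def intro: rgen.intros)

lemma sfield_fgen: "sfield (fgen S)"
  by (auto simp: sfield_def sring_def intro: fgen.intros)

lemma rgen_least: "S \<subseteq> R \<Longrightarrow> sring R \<Longrightarrow> rgen S \<subseteq> R"
proof
  fix x assume R: "S \<subseteq> R" "sring R" and "x \<in> rgen S"
  from this(3) show "x \<in> R" by induction (use R in \<open>auto intro: sring_closed\<close>)
qed

lemma fgen_least: "S \<subseteq> R \<Longrightarrow> sfield R \<Longrightarrow> fgen S \<subseteq> R"
proof
  fix x assume R: "S \<subseteq> R" "sfield R" and "x \<in> fgen S"
  from this(3) show "x \<in> R" by induction (use R in \<open>auto intro: sfield_closed\<close>)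
qed

lemma fgen_mono: "S \<subseteq> S' \<Longrightarrow> fgen S \<subseteq> fgen S'"
  by (rule fgen_least[OF _ sfield_fgen]) (auto intro: fgen_base)

lemma rgen_subset_fgen: "rgen S \<subseteq> fgen S"
  by (rule rgen_least[OF _ sfield_sring[OF sfield_fgen]]) (auto intro: fgen_base)

lemma fgen_fraction:
  assumes "x \<in> fgen S"
  obtains a b where "a \<in> rgen S" "b \<in> rgen S" "b \<noteq> 0" "x = a / b"
proof -
  have "\<exists>a b. a \<in> rgen S \<and> b \<in> rgen S \<and> b \<noteq> 0 \<and> x = a / b"
    using assms
  proof induction
    case (fgen_base x)
    then show ?case by (intro exI[of _ x] exI[of _ 1]) (auto intro: rgen.intros)
  next
    case fgen_one
    then show ?case by (intro exI[of _ 1] exI[of _ 1]) (auto intro: rgen.intros)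
  next
    case (fgen_uminus x)
    then show ?case by (metis minus_divide_left rgen_uminus)
  next
    case (fgen_add x y)
    then obtain a b a' b' where "a \<in> rgen S" "b \<in> rgen S" "b \<noteq> 0" "x = a / b"
      "a' \<in> rgen S" "b' \<in> rgen S" "b' \<noteq> 0" "y = a' / b'" by metis
    then show ?case
      by (intro exI[of _ "a * b' + a' * b"] exI[of _ "b * b'"])
         (simp add: rgen_add rgen_mult add_frac_eq)
  next
    case (fgen_mult x y)
    then obtain a b a' b' where "a \<in> rgen S" "b \<in> rgen S" "b \<noteq> 0" "x = a / b"
      "a' \<in> rgen S" "b' \<in> rgen S" "b' \<noteq> 0" "y = a' / b'" by metis
    then show ?case
      by (intro exI[of _ "a * a'"] exI[of _ "b * b'"]) (simp add: rgen_mult)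
  next
    case (fgen_inverse x)
    then obtain a b where "a \<in> rgen S" "b \<in> rgen S" "b \<noteq> 0" "x = a / b" by metis
    then show ?case
    proof (cases "a = 0")
      case True
      then show ?thesis using \<open>x = a / b\<close>
        by (intro exI[of _ 0] exI[of _ 1]) (simp add: rgen_one sring_zero[OF sring_rgen])
    next
      case False
      then show ?thesis using \<open>x = a / b\<close> \<open>a \<in> rgen S\<close> \<open>b \<in> rgen S\<close>
        by (intro exI[of _ b] exI[of _ a]) simp
    qed
  qed
  then show ?thesis using that by blast
qed

section \<open>Polynomials with coefficients and variables in given sets\<close>

definition mpolys :: "'a::comm_ring_1 set \<Rightarrow> 'i set \<Rightarrow> ('i, 'a) mpoly set" where
  "mpolys M I = {P. (\<forall>m. Poly_Mapping.lookup P m \<in> M) \<and> (\<forall>m\<in>Poly_Mapping.keys P. Poly_Mapping.keys m \<subseteq> I)}"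

lemma mpolys_single:
  "sring M \<Longrightarrow> c \<in> M \<Longrightarrow> Poly_Mapping.keys m \<subseteq> I \<Longrightarrow> Poly_Mapping.single m c \<in> mpolys M I"
  by (auto simp: mpolys_def lookup_single when_def sring_zero)

lemma mpolys_const: "sring M \<Longrightarrow> c \<in> M \<Longrightarrow> const_poly c \<in> mpolys M I"
  by (simp add: const_poly_def mpolys_single)

lemma mpolys_var: "sring M \<Longrightarrow> i \<in> I \<Longrightarrow> var_poly i \<in> mpolys M I"
  by (auto simp: var_poly_def sring_one intro!: mpolys_single)

lemma mpolys_add: "sring M \<Longrightarrow> P \<in> mpolys M I \<Longrightarrow> Q \<in> mpolys M I \<Longrightarrow> P + Q \<in> mpolys M I"
  unfolding mpolys_def using keys_add[of P Q] by (fastforce simp: lookup_add sring_add)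

lemma mpolys_uminus: "sring M \<Longrightarrow> P \<in> mpolys M I \<Longrightarrow> - P \<in> mpolys M I"
  by (auto simp: mpolys_def sring_uminus)

lemma lookup_mult_keys:
  "Poly_Mapping.lookup (P * Q) k = (\<Sum>m\<in>Poly_Mapping.keys P. \<Sum>n\<in>Poly_Mapping.keys Q.
      (Poly_Mapping.lookup P m * Poly_Mapping.lookup Q n when k = m + n))"
    for P Q :: "('i, 'a::comm_ring_1) mpoly"
  by (subst mpoly_single_sum[of P], subst mpoly_single_sum[of Q])
     (simp add: sum_product mult_single lookup_sum lookup_single when_def eq_commute)

lemma mpolys_mult: 
  assumes "sring M" "P \<in> mpolys M I" "Q \<in> mpolys M I"
  shows "P * Q \<in> mpolys M I"
proof -
  have "Poly_Mapping.lookup (P * Q) k \<in> M" for k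
    using assms by (auto simp: lookup_mult_keys mpolys_def when_def intro!: sring_closed)
  moreover have "Poly_Mapping.keys m \<subseteq> I" if "m \<in> Poly_Mapping.keys (P * Q)" for m
  proof -
    from that obtain k l where "k \<in> Poly_Mapping.keys P" "l \<in> Poly_Mapping.keys Q" "m = k + l"
      using keys_mult[of P Q] by auto
    then show ?thesis using assms keys_add[of k l] by (fastforce simp: mpolys_def)
  qed
  ultimately show ?thesis by (simp add: mpolys_def)
qed

lemma sring_mpolys: "sring M \<Longrightarrow> sring (mpolys M I)"
  using mpolys_const[of M 1 I]
  by (auto simp: sring_def[of "mpolys M I"] mpolys_add mpolys_mult mpolys_uminus const_poly_def sring_one)

lemma mpolys_mono: "M \<subseteq> M' \<Longrightarrow> I \<subseteq> I' \<Longrightarrow> mpolys M I \<subseteq> mpolys M' I'"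
  unfolding mpolys_def by fast

lemma meval_in_rgen:
  assumes "rhom h" "P \<in> mpolys M I"
  shows "meval h z P \<in> rgen (h ` M \<union> z ` I)"
  unfolding meval_def mono_ev_def using assms(2)
  by (intro sring_closed sring_rgen) (fastforce simp: mpolys_def intro: rgen_base)+

lemma rgen_eq_meval:
  assumes "rhom h" "sring M"
  shows "rgen (h ` M \<union> z ` I) = meval h z ` mpolys M I"
proof
  interpret rhom h by fact
  interpret e: rhom "meval h z" by (rule rhom_meval)
  note R = sring_mpolys[OF assms(2), of I]
  have "sring (meval h z ` mpolys M I)"
    unfolding sring_def
  proof (intro conjI ballI)
    show "1 \<in> meval h z ` mpolys M I"
      using imageI[OF sring_one[OF R], of "meval h z"] by simp
  next
    fix x assume "x \<in> meval h z ` mpolys M I"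
    then show "- x \<in> meval h z ` mpolys M I"
      by (metis (no_types, lifting) e.hom_uminus image_iff R sring_uminus)
  next
    fix x y assume "x \<in> meval h z ` mpolys M I" "y \<in> meval h z ` mpolys M I"
    then obtain P Q where "P \<in> mpolys M I" "Q \<in> mpolys M I" "x = meval h z P" "y = meval h z Q"
      by blast
    then show "x + y \<in> meval h z ` mpolys M I" "x * y \<in> meval h z ` mpolys M I"
      using sring_add[OF R] sring_mult[OF R]
      by (simp_all add: e.hom_add[symmetric] e.hom_mult[symmetric])
  qed
  moreover have "h ` M \<subseteq> meval h z ` mpolys M I"
    using mpolys_const[OF assms(2)] by (fastforce simp: image_iff intro: meval_const[symmetric])
  moreover have "z ` I \<subseteq> meval h z ` mpolys M I"
    using mpolys_var[OF assms(2)] by (fastforce simp: image_iff intro: meval_var[symmetric])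
  ultimately show "rgen (h ` M \<union> z ` I) \<subseteq> meval h z ` mpolys M I" by (intro rgen_least) auto
  show "meval h z ` mpolys M I \<subseteq> rgen (h ` M \<union> z ` I)"
    using meval_in_rgen[OF assms(1)] by blast
qed

section \<open>Algebraic independence\<close>

text \<open>The target is a ring and the coefficients reach it through \<open>h\<close>, since
  independence is also needed among power series.\<close>

definition alg_indep :: "('a::comm_ring_1 \<Rightarrow> 'r::comm_ring_1) \<Rightarrow> 'a set \<Rightarrow> 'i set \<Rightarrow> ('i \<Rightarrow> 'r) \<Rightarrow> bool" where
  "alg_indep h M I z \<longleftrightarrow> (\<forall>P\<in>mpolys M I. meval h z P = 0 \<longrightarrow> P = 0)"

lemma alg_indepD: "alg_indep h M I z \<Longrightarrow> P \<in> mpolys M I \<Longrightarrow> meval h z P = 0 \<Longrightarrow> P = 0"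
  by (auto simp: alg_indep_def)

lemma alg_indep_subset: "alg_indep h M I z \<Longrightarrow> M' \<subseteq> M \<Longrightarrow> I' \<subseteq> I \<Longrightarrow> alg_indep h M' I' z"
  using mpolys_mono[of M' M I' I] by (auto simp: alg_indep_def)

lemma alg_indep_variables:
  fixes f :: "'i \<Rightarrow> 'j"
  assumes "inj_on f I"
  shows "alg_indep const_poly (UNIV :: 'a::comm_ring_1 set) I (\<lambda>i. var_poly (f i))"
  unfolding alg_indep_def
proof (intro ballI impI)
  fix P :: "('i, 'a) mpoly" assume P: "P \<in> mpolys UNIV I" "meval const_poly (\<lambda>i. var_poly (f i)) P = 0"
  define fm where "fm m = (\<Sum>i\<in>Poly_Mapping.keys m. Poly_Mapping.single (f i) (Poly_Mapping.lookup m i))"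
    for m :: "'i \<Rightarrow>\<^sub>0 nat"
  have ev: "mono_ev (\<lambda>i. var_poly (f i)) m = Poly_Mapping.single (fm m) (1::'a)" for m
  proof -
    have v: "var_poly j ^ n = Poly_Mapping.single (Poly_Mapping.single j n) (1::'a)" for j :: 'j and n
      by (induction n) (auto simp: var_poly_def mult_single single_add[symmetric])
    have "finite A \<Longrightarrow> (\<Prod>i\<in>A. var_poly (f i) ^ Poly_Mapping.lookup m i) =
        Poly_Mapping.single (\<Sum>i\<in>A. Poly_Mapping.single (f i) (Poly_Mapping.lookup m i)) (1::'a)" for A
      by (induction A rule: finite_induct) (auto simp: v mult_single)
    then show ?thesis by (simp add: mono_ev_def fm_def)
  qed
  have fm: "Poly_Mapping.lookup (fm m) (f i) = Poly_Mapping.lookup m i"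
    if "Poly_Mapping.keys m \<subseteq> I" "i \<in> I" for m i
  proof -
    have "Poly_Mapping.lookup (fm m) (f i) = (\<Sum>j\<in>Poly_Mapping.keys m. if j = i then Poly_Mapping.lookup m j else 0)"
      unfolding fm_def lookup_sum using that assms
      by (intro sum.cong) (auto simp: lookup_single when_def inj_on_def subset_iff)
    then show ?thesis by (auto simp: sum.delta in_keys_iff)
  qed
  have inj: "inj_on fm (Poly_Mapping.keys P)"
  proof (rule inj_onI)
    fix m n assume mn: "m \<in> Poly_Mapping.keys P" "n \<in> Poly_Mapping.keys P" "fm m = fm n"
    then have "Poly_Mapping.keys m \<subseteq> I" "Poly_Mapping.keys n \<subseteq> I" using P(1) by (auto simp: mpolys_def)
    then show "m = n"
      using fm[of m] fm[of n] mn(3) by (intro poly_mapping_eqI) (metis in_keys_iff subsetD)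
  qed
  have "Poly_Mapping.lookup P m = 0" for m
  proof (cases "m \<in> Poly_Mapping.keys P")
    case True
    have "0 = Poly_Mapping.lookup (meval const_poly (\<lambda>i. var_poly (f i)) P) (fm m)"
      by (simp add: P)
    also have "\<dots> = (\<Sum>n\<in>Poly_Mapping.keys P. Poly_Mapping.lookup (const_poly (Poly_Mapping.lookup P n) * Poly_Mapping.single (fm n) 1) (fm m))"
      by (simp add: meval_def ev lookup_sum)
    also have "\<dots> = (\<Sum>n\<in>Poly_Mapping.keys P. if n = m then Poly_Mapping.lookup P n else 0)"
      using inj True by (intro sum.cong) (auto simp: const_poly_def mult_single lookup_single when_def inj_on_def)
    finally show ?thesis using True by (simp add: sum.delta)
  qed (simp add: in_keys_iff)
  then show "P = 0" by (intro poly_mapping_eqI) simp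
qed

text \<open>Only finitely many variables occur in the two factors, so an injection into
  \<open>nat\<close> carries them to a polynomial ring known to be a domain.\<close>

lemma mpoly_no_zero_divisors:
  fixes P Q :: "('i, 'a::idom) mpoly"
  assumes "P * Q = 0"
  shows "P = 0 \<or> Q = 0"
proof -
  define I where "I = (\<Union>m\<in>Poly_Mapping.keys P \<union> Poly_Mapping.keys Q. Poly_Mapping.keys m)"
  have "finite I" by (auto simp: I_def)
  then obtain f :: "'i \<Rightarrow> nat" where f: "inj_on f I" using finite_imp_inj_to_nat_seg by blast
  define e where "e = meval (const_poly :: 'a \<Rightarrow> (nat, 'a) mpoly) (\<lambda>i. var_poly (f i))"
  interpret e: rhom e unfolding e_def by (rule rhom.rhom_meval[OF rhom_const_poly])
  have "e P * e Q = 0" using assms by (simp add: e.hom_mult[symmetric])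
  then have "e P = 0 \<or> e Q = 0" by simp
  moreover have "P \<in> mpolys UNIV I" "Q \<in> mpolys UNIV I" by (auto simp: mpolys_def I_def)
  ultimately show ?thesis
    using alg_indep_variables[OF f, where 'a = 'a] by (auto simp: alg_indep_def e_def)
qed

lemma alg_indep_fract_variables:
  fixes f :: "'i \<Rightarrow> nat"
  assumes f: "inj_on f I"
  shows "alg_indep (\<lambda>a :: 'a::idom. Fract (const_poly a) 1) UNIV I (\<lambda>i. Fract (var_poly (f i)) 1)"
proof -
  have "rhom (\<lambda>P :: (nat, 'a) mpoly. Fract P 1)"
    by unfold_locales (auto simp: One_fract_def)
  then have "meval (\<lambda>a. Fract (const_poly a) 1) (\<lambda>i. Fract (var_poly (f i)) 1) P =
      Fract (meval const_poly (\<lambda>i. var_poly (f i)) P) 1" for P :: "('i, 'a) mpoly"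
    by (rule meval_hom[OF rhom_const_poly, symmetric])
  then show ?thesis
    using alg_indep_variables[OF f, where 'a = 'a] by (auto simp: alg_indep_def Zero_fract_def eq_fract)
qed

section \<open>Homogeneous linear systems over a subfield\<close>

text \<open>Gaussian elimination divides only by entries of the matrix and therefore stays in
  \<open>M\<close>.\<close>

lemma underdetermined_system:
  fixes m :: "'x \<Rightarrow> 'e \<Rightarrow> 'a::field"
  assumes "sfield M" "finite E" "finite A" "card E < card A"
    and "\<And>a e. a \<in> A \<Longrightarrow> e \<in> E \<Longrightarrow> m a e \<in> M"
  shows "\<exists>c. (\<forall>a\<in>A. c a \<in> M) \<and> (\<exists>a\<in>A. c a \<noteq> 0) \<and> (\<forall>e\<in>E. (\<Sum>a\<in>A. c a * m a e) = 0)"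
  using assms(2-)
proof (induction E arbitrary: A m rule: finite_induct)
  case empty
  then have "A \<noteq> {}" by auto
  then show ?case using sfield_closed(1)[OF assms(1)] by (intro exI[of _ "\<lambda>_. 1"]) auto
next
  case (insert e E)
  show ?case
  proof (cases "\<forall>a\<in>A. m a e = 0")
    case True
    from insert.prems insert.hyps have "card E < card A" by simp
    then obtain c where "\<forall>a\<in>A. c a \<in> M" "\<exists>a\<in>A. c a \<noteq> 0" "\<forall>e\<in>E. (\<Sum>a\<in>A. c a * m a e) = 0"
      using insert.IH[of A m] insert.prems by auto
    with True show ?thesis by (intro exI[of _ c]) auto
  next
    case False
    then obtain a0 where a0: "a0 \<in> A" "m a0 e \<noteq> 0" by blast
    define A' where "A' = A - {a0}"
    have A: "A = insert a0 A'" "a0 \<notin> A'" "finite A'" using a0 insert.prems by (auto simp: A'_def)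
    define m' where "m' a e' = m a e' - m a e / m a0 e * m a0 e'" for a e'
    have "card E < card A'" using insert.prems insert.hyps A by auto
    moreover have "m' a e' \<in> M" if "a \<in> A'" "e' \<in> E" for a e'
      using that A(1) insert.prems(3) by (auto simp: m'_def intro!: sfield_closed[OF assms(1)])
    ultimately obtain c where c: "\<forall>a\<in>A'. c a \<in> M" "\<exists>a\<in>A'. c a \<noteq> 0" "\<forall>e'\<in>E. (\<Sum>a\<in>A'. c a * m' a e') = 0"
      using insert.IH[of A' m'] A(3) by auto
    define s where "s = - (\<Sum>a\<in>A'. c a * (m a e / m a0 e))"
    define c' where "c' = c(a0 := s)"
    have eq: "(\<Sum>a\<in>A. c' a * m a e') = s * m a0 e' + (\<Sum>a\<in>A'. c a * m a e')" for e'
      using A by (auto simp: c'_def intro!: sum.cong)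
    have "s \<in> M" using c(1) insert.prems(3) A(1)
      by (auto simp: s_def intro!: sfield_closed[OF assms(1)])
    then have "\<forall>a\<in>A. c' a \<in> M" using c(1) A by (auto simp: c'_def)
    moreover have "\<exists>a\<in>A. c' a \<noteq> 0" using c(2) A by (auto simp: c'_def)
    moreover have "(\<Sum>a\<in>A. c' a * m a e') = 0" if "e' \<in> E" for e'
    proof -
      have "0 = (\<Sum>a\<in>A'. c a * m a e') - (\<Sum>a\<in>A'. c a * (m a e / m a0 e) * m a0 e')"
        using c(3) that by (simp add: m'_def right_diff_distrib sum_subtractf mult.assoc)
      also have "\<dots> = (\<Sum>a\<in>A. c' a * m a e')"
        by (simp add: eq s_def sum_distrib_right)
      finally show ?thesis by simp
    qed
    moreover have "(\<Sum>a\<in>A. c' a * m a e) = 0"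
      using a0 by (simp add: eq s_def sum_distrib_right mult.assoc)
    ultimately show ?thesis by (intro exI[of _ c']) auto
  qed
qed

text \<open>Elimination uses only entries of the matrix, so a larger field creates no new
  solvability. The given \<open>c\<close> need not take values in \<open>M\<close>; it only excludes
  that the elimination ends with full rank.\<close>

lemma system_descent:
  fixes m :: "'x \<Rightarrow> 'e \<Rightarrow> 'a::field"
  assumes "sfield M" "finite A"
    and "\<And>a e. a \<in> A \<Longrightarrow> e \<in> E \<Longrightarrow> m a e \<in> M"
    and "\<exists>a\<in>A. c a \<noteq> 0" "\<And>e. e \<in> E \<Longrightarrow> (\<Sum>a\<in>A. c a * m a e) = 0"
  shows "\<exists>c. (\<forall>a\<in>A. c a \<in> M) \<and> (\<exists>a\<in>A. c a \<noteq> 0) \<and> (\<forall>e\<in>E. (\<Sum>a\<in>A. c a * m a e) = 0)"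
  using assms(2-)
proof (induction "card A" arbitrary: A c m)
  case 0
  then show ?case by auto
next
  case (Suc n)
  show ?case
  proof (cases "\<forall>a\<in>A. \<forall>e\<in>E. m a e = 0")
    case True
    then show ?thesis using Suc.prems(3) sfield_closed(1)[OF assms(1)] by (intro exI[of _ "\<lambda>_. 1"]) auto
  next
    case False
    then obtain a0 e0 where a0: "a0 \<in> A" "e0 \<in> E" "m a0 e0 \<noteq> 0" by blast
    define A' where "A' = A - {a0}"
    have A: "A = insert a0 A'" "a0 \<notin> A'" "finite A'" using a0 Suc.prems by (auto simp: A'_def)
    define m' where "m' a e' = m a e' - m a e0 / m a0 e0 * m a0 e'" for a e'
    have split: "(\<Sum>a\<in>A. d a * m a e') = d a0 * m a0 e' + (\<Sum>a\<in>A'. d a * m a e')" for e' d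
      using A by auto
    have expand: "(\<Sum>a\<in>A'. d a * m' a e') = (\<Sum>a\<in>A'. d a * m a e') - (\<Sum>a\<in>A'. d a * m a e0) / m a0 e0 * m a0 e'" for d e'
      by (simp add: m'_def right_diff_distrib sum_subtractf sum_distrib_right sum_divide_distrib mult.assoc)
    have c0: "c a0 = - (\<Sum>a\<in>A'. c a * m a e0) / m a0 e0"
      using Suc.prems(4)[OF a0(2)] a0(3) by (simp add: split field_simps eq_neg_iff_add_eq_0)
    have "\<exists>a\<in>A'. c a \<noteq> 0"
    proof (rule ccontr)
      assume "\<not> ?thesis"
      then have "\<forall>a\<in>A'. c a = 0" by blast
      moreover from this have "c a0 = 0" using c0 by simp
      ultimately show False using Suc.prems(3) A(1) by auto
    qed
    moreover have "(\<Sum>a\<in>A'. c a * m' a e) = 0" if "e \<in> E" for e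
      using Suc.prems(4)[OF that] by (simp add: split expand c0)
    moreover have "m' a e' \<in> M" if "a \<in> A'" "e' \<in> E" for a e'
      using that A(1) Suc.prems(2) a0 by (auto simp: m'_def intro!: sfield_closed[OF assms(1)])
    moreover have "n = card A'" using Suc.hyps A by auto
    ultimately obtain d where d: "\<forall>a\<in>A'. d a \<in> M" "\<exists>a\<in>A'. d a \<noteq> 0" "\<forall>e'\<in>E. (\<Sum>a\<in>A'. d a * m' a e') = 0"
      using Suc.hyps(1)[of A' m' c] A(3) by blast
    define s where "s = - (\<Sum>a\<in>A'. d a * m a e0) / m a0 e0"
    have "s \<in> M" using d(1) Suc.prems(2) A(1) a0
      by (auto simp: s_def intro!: sfield_closed[OF assms(1)])
    moreover have "(\<Sum>a\<in>A. (d(a0 := s)) a * m a e') = s * m a0 e' + (\<Sum>a\<in>A'. d a * m a e')" for e'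
      using A by (auto simp: intro!: sum.cong)
    moreover have "s * m a0 e' + (\<Sum>a\<in>A'. d a * m a e') = 0" if "e' \<in> E" for e'
      using d(3) that by (simp add: expand s_def)
    moreover have "\<exists>a\<in>A. (d(a0 := s)) a \<noteq> 0"
      using d(2) A by (metis fun_upd_apply insertI2)
    ultimately show ?thesis using d(1) A(1) by (intro exI[of _ "d(a0 := s)"]) simp
  qed
qed

section \<open>Rational generation and algebraic independence\<close>

text \<open>Bounding each exponent, and not the total degree, makes the number of monomials an exact
  power.\<close>

definition box :: "nat \<Rightarrow> 'i set \<Rightarrow> ('i \<Rightarrow>\<^sub>0 nat) set" where
  "box e I = {m. Poly_Mapping.keys m \<subseteq> I \<and> (\<forall>i. Poly_Mapping.lookup m i \<le> e)}"

lemma card_box: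
  assumes "finite I"
  shows "finite (box e I)" "card (box e I) = (e + 1) ^ card I"
proof -
  have inj: "inj_on (\<lambda>m. restrict (Poly_Mapping.lookup m) I) (box e I)"
  proof (rule inj_onI)
    fix m n assume mn: "m \<in> box e I" "n \<in> box e I"
      "restrict (Poly_Mapping.lookup m) I = restrict (Poly_Mapping.lookup n) I"
    show "m = n"
    proof (rule poly_mapping_eqI)
      fix i show "Poly_Mapping.lookup m i = Poly_Mapping.lookup n i"
      proof (cases "i \<in> I")
        case True
        then show ?thesis using fun_cong[OF mn(3), of i] by simp
      next
        case False
        then have "i \<notin> Poly_Mapping.keys m" "i \<notin> Poly_Mapping.keys n" using mn(1,2) by (auto simp: box_def)
        then show ?thesis by (simp add: in_keys_iff)
      qed
    qed
  qed
  have img: "(\<lambda>m. restrict (Poly_Mapping.lookup m) I) ` box e I = I \<rightarrow>\<^sub>E {..e}"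
  proof
    show "(\<lambda>m. restrict (Poly_Mapping.lookup m) I) ` box e I \<subseteq> I \<rightarrow>\<^sub>E {..e}"
      by (auto simp: box_def)
    show "I \<rightarrow>\<^sub>E {..e} \<subseteq> (\<lambda>m. restrict (Poly_Mapping.lookup m) I) ` box e I"
    proof
      fix f assume f: "f \<in> I \<rightarrow>\<^sub>E {..e}"
      define m where "m = Abs_poly_mapping (\<lambda>i. if i \<in> I then f i else 0)"
      have "finite {i. (if i \<in> I then f i else 0) \<noteq> 0}"
        by (rule finite_subset[OF _ assms]) auto
      then have l: "Poly_Mapping.lookup m = (\<lambda>i. if i \<in> I then f i else 0)"
        unfolding m_def by (rule lookup_Abs_poly_mapping)
      have "m \<in> box e I" using f by (auto simp: box_def l in_keys_iff split: if_splits)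
      moreover have "restrict (Poly_Mapping.lookup m) I = f"
        using f by (auto simp: l fun_eq_iff PiE_def extensional_def)
      ultimately show "f \<in> (\<lambda>m. restrict (Poly_Mapping.lookup m) I) ` box e I" by blast
    qed
  qed
  show "finite (box e I)"
    using inj img assms by (metis finite_PiE finite_atMost finite_imageD)
  show "card (box e I) = (e + 1) ^ card I"
    using card_image[OF inj] img assms by (simp add: card_PiE)
qed

lemma box_zero: "0 \<in> box e I"
  by (simp add: box_def)

lemma box_add: "m \<in> box e I \<Longrightarrow> n \<in> box d I \<Longrightarrow> m + n \<in> box (e + d) I"
  using keys_add[of m n] by (fastforce simp: box_def lookup_add add_mono)

lemma box_mono: "e \<le> d \<Longrightarrow> box e I \<subseteq> box d I"
  by (auto simp: box_def intro: order_trans)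

lemma box_exists:
  assumes "P \<in> mpolys M I"
  shows "\<exists>d. Poly_Mapping.keys P \<subseteq> box d I"
proof -
  define d where "d = (\<Sum>m\<in>Poly_Mapping.keys P. \<Sum>j\<in>Poly_Mapping.keys m. Poly_Mapping.lookup m j)"
  have "Poly_Mapping.lookup m i \<le> d" if "m \<in> Poly_Mapping.keys P" for m i
  proof -
    have "Poly_Mapping.lookup m i \<le> (\<Sum>j\<in>Poly_Mapping.keys m. Poly_Mapping.lookup m j)"
      by (cases "i \<in> Poly_Mapping.keys m") (auto intro: member_le_sum simp: in_keys_iff)
    also have "\<dots> \<le> d"
      unfolding d_def using that by (intro member_le_sum) auto
    finally show ?thesis .
  qed
  then show ?thesis using assms unfolding box_def mpolys_def by blast
qed

lemma box_mult:
  fixes P Q :: "('i, 'a::comm_ring_1) mpoly"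
  assumes "Poly_Mapping.keys P \<subseteq> box d I" "Poly_Mapping.keys Q \<subseteq> box e I"
  shows "Poly_Mapping.keys (P * Q) \<subseteq> box (d + e) I"
  using keys_mult[of P Q] assms by (auto intro!: box_add)

lemma box_power:
  fixes P :: "('i, 'a::comm_ring_1) mpoly"
  shows "Poly_Mapping.keys P \<subseteq> box d I \<Longrightarrow> Poly_Mapping.keys (P ^ n) \<subseteq> box (n * d) I"
proof (induction n)
  case (Suc n)
  then show ?case using box_mult[of P d I "P ^ n" "n * d"] by simp
qed (simp add: box_zero)

lemma box_prod:
  fixes P :: "'x \<Rightarrow> ('i, 'a::comm_ring_1) mpoly"
  assumes "\<And>a. a \<in> A \<Longrightarrow> Poly_Mapping.keys (P a) \<subseteq> box d I"
  shows "Poly_Mapping.keys (\<Prod>a\<in>A. P a) \<subseteq> box (card A * d) I"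
  using assms
proof (induction A rule: infinite_finite_induct)
  case (insert a A)
  then show ?case using box_mult[of "P a" d I "\<Prod>a\<in>A. P a" "card A * d"] by (simp add: add.commute)
qed (auto simp: box_zero)

lemma power_diff_bound: "((x::nat) + q) ^ Suc n \<le> x ^ Suc n + Suc n * q * (x + q) ^ n"
proof (induction n)
  case (Suc n)
  have "(x + q) ^ Suc (Suc n) \<le> (x + q) * (x ^ Suc n + Suc n * q * (x + q) ^ n)"
    using Suc by (metis mult_le_mono2 power_Suc)
  also have "\<dots> = x ^ Suc (Suc n) + q * x ^ Suc n + Suc n * q * (x + q) ^ Suc n"
    by (simp add: algebra_simps)
  also have "\<dots> \<le> x ^ Suc (Suc n) + q * (x + q) ^ Suc n + Suc n * q * (x + q) ^ Suc n"
    by (intro add_mono order_refl mult_le_mono2 power_mono) auto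
  finally show ?case by (simp add: algebra_simps)
qed auto

text \<open>With \<open>D = d * n * e\<close>, enlarging a box from \<open>D\<close> to
  \<open>D + q\<close> adds a number of monomials of order \<open>e ^ (n - 1)\<close> only, which is
  eventually below the \<open>(e + 1) ^ n\<close> monomials of a box of size
  \<open>e\<close>.\<close>

lemma counting_bound: "\<exists>e. (d * n * e + q + 1) ^ n < (e + 1) ^ n + (d * n * e + 1) ^ n" for d n q :: nat
proof (cases n)
  case (Suc k)
  define L where "L = d * n + q + 1"
  \<comment> \<open>This choice turns the bound \<open>n * q * (L * (e + 1)) ^ k\<close> for the
    increment into \<open>e * (e + 1) ^ k\<close>, which is less than
    \<open>(e + 1) ^ n\<close>.\<close>
  define e where "e = n * q * L ^ k"
  have le: "d * n * e + 1 + q \<le> L * (e + 1)" by (simp add: L_def algebra_simps)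
  have "(d * n * e + 1 + q) ^ n \<le> (d * n * e + 1) ^ n + n * q * (d * n * e + 1 + q) ^ k"
    using power_diff_bound[of "d * n * e + 1" q k] Suc by simp
  also have "n * q * (d * n * e + 1 + q) ^ k \<le> n * q * (L * (e + 1)) ^ k"
    by (intro mult_le_mono2 power_mono le) auto
  also have "\<dots> = n * q * L ^ k * (e + 1) ^ k" by (simp only: power_mult_distrib mult_ac)
  also have "\<dots> = e * (e + 1) ^ k" by (simp only: e_def)
  also have "\<dots> < (e + 1) ^ n" using Suc by simp
  finally show ?thesis by (intro exI[of _ e]) (simp add: add_ac)
qed auto

text \<open>A dimension count replaces transcendence degrees. Suppose that \<open>P\<close> vanishes
  at \<open>z\<close>. The monomials in the \<open>X i\<close> from a large box, brought to a common
  denominator, are values at \<open>z\<close> of polynomials in a box of size \<open>D\<close>.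
  Together with the multiples of \<open>P\<close> these are too many to be linearly independent, and
  a relation between them evaluates at \<open>z\<close> to a relation between the
  \<open>X i\<close>. Denominators are multiplied out because \<open>'r\<close> may be a ring of
  power series.\<close>

theorem alg_indep_generators:
  fixes h :: "'a::field \<Rightarrow> 'r::idom" and X :: "'i \<Rightarrow> 'r" and z :: "'k \<Rightarrow> 'r"
  assumes h: "rhom h" and M: "sfield M" and fin: "finite I" "finite K" and card: "card I = card K"
    and X: "alg_indep h M I X"
    and gen: "\<And>i. i \<in> I \<Longrightarrow> \<exists>A B. A \<in> mpolys M K \<and> B \<in> mpolys M K \<and> meval h z B \<noteq> 0 \<and>
                meval h z B * X i = meval h z A"
  shows "alg_indep h M K z"
proof (rule ccontr)
  interpret rhom h by fact
  note R = sring_mpolys[OF sfield_sring[OF M], of K]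
  assume "\<not> ?thesis"
  then obtain P where P: "P \<in> mpolys M K" "meval h z P = 0" "P \<noteq> 0" by (auto simp: alg_indep_def)
  obtain A B where AB: "\<And>i. i \<in> I \<Longrightarrow> A i \<in> mpolys M K" "\<And>i. i \<in> I \<Longrightarrow> B i \<in> mpolys M K"
      "\<And>i. i \<in> I \<Longrightarrow> meval h z (B i) \<noteq> 0" "\<And>i. i \<in> I \<Longrightarrow> meval h z (B i) * X i = meval h z (A i)"
    using gen by metis
  obtain q where q: "Poly_Mapping.keys P \<subseteq> box q K" using box_exists[OF P(1)] by blast
  have "\<exists>d. \<forall>i\<in>I. Poly_Mapping.keys (A i) \<subseteq> box d K \<and> Poly_Mapping.keys (B i) \<subseteq> box d K"
  proof -
    have "\<forall>i\<in>I. \<exists>d. Poly_Mapping.keys (A i) \<subseteq> box d K \<and> Poly_Mapping.keys (B i) \<subseteq> box d K"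
    proof
      fix i assume i: "i \<in> I"
      obtain d1 d2 where "Poly_Mapping.keys (A i) \<subseteq> box d1 K" "Poly_Mapping.keys (B i) \<subseteq> box d2 K"
        using box_exists[OF AB(1)[OF i]] box_exists[OF AB(2)[OF i]] by blast
      then show "\<exists>d. Poly_Mapping.keys (A i) \<subseteq> box d K \<and> Poly_Mapping.keys (B i) \<subseteq> box d K"
        using box_mono[of d1 "d1 + d2" K] box_mono[of d2 "d1 + d2" K] by (intro exI[of _ "d1 + d2"]) auto
    qed
    then obtain d where d: "\<forall>i\<in>I. Poly_Mapping.keys (A i) \<subseteq> box (d i) K \<and> Poly_Mapping.keys (B i) \<subseteq> box (d i) K"
      by metis
    have "d i \<le> sum d I" if "i \<in> I" for i using fin(1) that by (simp add: member_le_sum)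
    then show ?thesis using d box_mono[of "d _" "sum d I" K] by (intro exI[of _ "sum d I"]) blast
  qed
  then obtain d where d: "\<And>i. i \<in> I \<Longrightarrow> Poly_Mapping.keys (A i) \<subseteq> box d K"
      "\<And>i. i \<in> I \<Longrightarrow> Poly_Mapping.keys (B i) \<subseteq> box d K" by blast
  define n where "n = card K"
  obtain e where e: "(d * n * e + q + 1) ^ n < (e + 1) ^ n + (d * n * e + 1) ^ n"
    using counting_bound by blast
  define D where "D = d * n * e"
  \<comment> \<open>The numerator of the monomial \<open>m\<close> in the fractions
    \<open>A i / B i\<close> over the common denominator
    \<open>\<Prod>i\<in>I. B i ^ e\<close>.\<close>
  define Q where "Q m = (\<Prod>i\<in>I. A i ^ Poly_Mapping.lookup m i * B i ^ (e - Poly_Mapping.lookup m i))"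
    for m :: "'i \<Rightarrow>\<^sub>0 nat"
  have QM: "Q m \<in> mpolys M K" for m
    unfolding Q_def by (intro sring_closed R AB)
  have Qbox: "Poly_Mapping.keys (Q m) \<subseteq> box D K" if "m \<in> box e I" for m
  proof -
    have "Poly_Mapping.keys (A i ^ Poly_Mapping.lookup m i * B i ^ (e - Poly_Mapping.lookup m i)) \<subseteq> box (e * d) K"
      if i: "i \<in> I" for i
    proof -
      have "Poly_Mapping.lookup m i \<le> e" using \<open>m \<in> box e I\<close> by (simp add: box_def)
      then have "Poly_Mapping.lookup m i * d + (e - Poly_Mapping.lookup m i) * d = e * d"
        by (metis add_mult_distrib le_add_diff_inverse)
      then show ?thesis
        using box_mult[OF box_power[OF d(1)[OF i]] box_power[OF d(2)[OF i]]] by metis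
    qed
    from box_prod[OF this, of I] show ?thesis
      by (simp add: Q_def D_def n_def card mult_ac)
  qed
  \<comment> \<open>The unknowns of the linear system belong to the \<open>Q \<mu>\<close> and to
    the multiples of \<open>P\<close> by monomials; its equations belong to the monomials of the box
    of size \<open>D + q\<close>.\<close>
  define m where "m a \<nu> = (case a of Inl \<mu> \<Rightarrow> Poly_Mapping.lookup (Q \<mu>) \<nu>
      | Inr \<mu> \<Rightarrow> Poly_Mapping.lookup (P * Poly_Mapping.single \<mu> 1) \<nu>)" for a :: "('i \<Rightarrow>\<^sub>0 nat) + ('k \<Rightarrow>\<^sub>0 nat)" and \<nu>
  define S where "S = box e I <+> box D K"
  have "card S = (e + 1) ^ n + (D + 1) ^ n"
    using fin by (simp add: S_def card_Plus card_box n_def card)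
  then have "card (box (D + q) K) < card S"
    using e fin by (simp add: card_box D_def n_def)
  moreover have "finite S" using fin by (simp add: S_def card_box)
  moreover have "m a \<nu> \<in> M" for a \<nu>
  proof -
    have "P * Poly_Mapping.single \<mu> 1 \<in> mpolys M UNIV" for \<mu>
      using P(1) mpolys_mono[of M M K UNIV] 
      by (intro mpolys_mult mpolys_single sfield_closed sfield_sring M) auto
    then show ?thesis using QM by (auto simp: m_def mpolys_def split: sum.splits)
  qed
  ultimately obtain c where c: "\<forall>a\<in>S. c a \<in> M" "\<exists>a\<in>S. c a \<noteq> 0"
      "\<forall>\<nu>\<in>box (D + q) K. (\<Sum>a\<in>S. c a * m a \<nu>) = 0"
    using underdetermined_system[OF M, of "box (D + q) K" S m] fin card_box(1)[of K] by blast
  define H where "H = (\<Sum>\<mu>\<in>box D K. Poly_Mapping.single \<mu> (c (Inr \<mu>)))"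
  define G where "G = (\<Sum>\<mu>\<in>box e I. const_poly (c (Inl \<mu>)) * Q \<mu>)"
  have lc: "Poly_Mapping.lookup (const_poly r * F) \<nu> = r * Poly_Mapping.lookup F \<nu>" for r :: 'a and F and \<nu> :: "'k \<Rightarrow>\<^sub>0 nat"
    by (simp add: const_poly_def mult_map_scale_conv_mult[symmetric] Poly_Mapping.map.rep_eq when_def)
  have PH: "P * H = (\<Sum>\<mu>\<in>box D K. const_poly (c (Inr \<mu>)) * (P * Poly_Mapping.single \<mu> 1))"
    unfolding H_def sum_distrib_left
    by (intro sum.cong refl) (simp add: const_poly_def mult_single mult.left_commute)
  have sum0: "G + P * H = 0"
  proof (rule poly_mapping_eqI)
    fix \<nu>
    have L: "Poly_Mapping.lookup (G + P * H) \<nu> = (\<Sum>a\<in>S. c a * m a \<nu>)"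
      using fin by (simp add: S_def sum.Plus card_box G_def PH lookup_add lookup_sum lc m_def)
    show "Poly_Mapping.lookup (G + P * H) \<nu> = Poly_Mapping.lookup 0 \<nu>"
    proof (cases "\<nu> \<in> box (D + q) K")
      case True then show ?thesis using c(3) L by simp
    next
      case False
      have "m (Inl \<mu>) \<nu> = 0" if "\<mu> \<in> box e I" for \<mu>
        using Qbox[OF that] False box_mono[of D "D + q" K] by (auto simp: m_def in_keys_iff)
      moreover have "m (Inr \<mu>) \<nu> = 0" if "\<mu> \<in> box D K" for \<mu>
      proof -
        have "Poly_Mapping.keys (P * Poly_Mapping.single \<mu> 1) \<subseteq> box (q + D) K"
          using that by (intro box_mult[OF q]) auto
        then show ?thesis using False by (auto simp: m_def in_keys_iff add.commute)
      qed
      ultimately have "(\<Sum>a\<in>S. c a * m a \<nu>) = 0" by (auto simp: S_def intro!: sum.neutral)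
      with L show ?thesis by simp
    qed
  qed
  \<comment> \<open>At \<open>z\<close> the multiple of \<open>P\<close> drops out, and
    \<open>G\<close> becomes the common denominator times the value of \<open>W\<close> at
    \<open>X\<close>.\<close>
  define W where "W = (\<Sum>\<mu>\<in>box e I. Poly_Mapping.single \<mu> (c (Inl \<mu>)))"
  have evQ: "meval h z (Q \<mu>) = (\<Prod>i\<in>I. meval h z (B i) ^ e) * mono_ev X \<mu>" if "\<mu> \<in> box e I" for \<mu>
  proof -
    have "meval h z (Q \<mu>) = (\<Prod>i\<in>I. meval h z (A i) ^ Poly_Mapping.lookup \<mu> i * meval h z (B i) ^ (e - Poly_Mapping.lookup \<mu> i))"
      by (simp add: Q_def meval_prod meval_mult meval_power)
    also have "\<dots> = (\<Prod>i\<in>I. meval h z (B i) ^ e * X i ^ Poly_Mapping.lookup \<mu> i)"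
    proof (intro prod.cong refl)
      fix i assume i: "i \<in> I"
      have "Poly_Mapping.lookup \<mu> i \<le> e" using that by (simp add: box_def)
      then have "meval h z (B i) ^ e = meval h z (B i) ^ Poly_Mapping.lookup \<mu> i * meval h z (B i) ^ (e - Poly_Mapping.lookup \<mu> i)"
        by (simp add: power_add[symmetric])
      then show "meval h z (A i) ^ Poly_Mapping.lookup \<mu> i * meval h z (B i) ^ (e - Poly_Mapping.lookup \<mu> i) =
          meval h z (B i) ^ e * X i ^ Poly_Mapping.lookup \<mu> i"
        by (simp add: AB(4)[OF i, symmetric] power_mult_distrib mult_ac)
    qed
    also have "\<dots> = (\<Prod>i\<in>I. meval h z (B i) ^ e) * mono_ev X \<mu>"
      using that fin by (simp add: prod.distrib mono_ev_superset[of I] box_def)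
    finally show ?thesis .
  qed
  have "0 = meval h z (G + P * H)" by (simp add: sum0)
  also have "\<dots> = meval h z G" by (simp add: meval_add meval_mult P(2))
  also have "\<dots> = (\<Prod>i\<in>I. meval h z (B i) ^ e) * meval h X W"
    by (simp add: G_def W_def meval_sum meval_mult evQ sum_distrib_left mult_ac)
  finally have "meval h X W = 0" using AB(3) fin by simp
  moreover have "W \<in> mpolys M I"
    unfolding W_def using c(1) 
    by (intro sring_sum sring_mpolys mpolys_single sfield_sring M) (auto simp: S_def box_def)
  ultimately have W: "W = 0" using X by (simp add: alg_indep_def)
  have coeff: "Poly_Mapping.lookup (\<Sum>\<mu>\<in>T. Poly_Mapping.single \<mu> (f \<mu>)) \<nu> = f \<nu>"
    if "finite T" "\<nu> \<in> T" for T and f :: "_ \<Rightarrow> 'a" and \<nu>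
    using that by (simp add: lookup_sum lookup_single when_def)
  have cl: "c (Inl \<mu>) = 0" if "\<mu> \<in> box e I" for \<mu>
    using coeff[OF card_box(1)[OF fin(1)] that, of "\<lambda>\<mu>. c (Inl \<mu>)"] W by (simp add: W_def)
  then have "G = 0" by (simp add: G_def const_poly_def)
  with sum0 have "P * H = 0" by simp
  with P(3) have "H = 0" using mpoly_no_zero_divisors by blast
  then have "c (Inr \<mu>) = 0" if "\<mu> \<in> box D K" for \<mu>
    using coeff[OF card_box(1)[OF fin(2)] that, of "\<lambda>\<mu>. c (Inr \<mu>)"] by (simp add: H_def)
  with cl c(2) show False by (auto simp: S_def)
qed

section \<open>Linear dependence over subfields\<close>

text \<open>Indexed families and not sets, so that a repeated value is a dependence.
  \<open>K\<close> may be a mere subring, as happens after denominators have been cleared.\<close>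

definition ldep :: "'r::comm_ring_1 set \<Rightarrow> 'x set \<Rightarrow> ('x \<Rightarrow> 'r) \<Rightarrow> bool" where
  "ldep K A v \<longleftrightarrow> (\<exists>c. (\<forall>a\<in>A. c a \<in> K) \<and> (\<exists>a\<in>A. c a \<noteq> 0) \<and> (\<Sum>a\<in>A. c a * v a) = 0)"

lemma ldepI: "(\<And>a. a \<in> A \<Longrightarrow> c a \<in> K) \<Longrightarrow> a \<in> A \<Longrightarrow> c a \<noteq> 0 \<Longrightarrow> (\<Sum>a\<in>A. c a * v a) = 0 \<Longrightarrow> ldep K A v"
  unfolding ldep_def by blast

lemma ldepE:
  assumes "ldep K A v"
  obtains c a where "\<forall>a\<in>A. c a \<in> K" "a \<in> A" "c a \<noteq> 0" "(\<Sum>a\<in>A. c a * v a) = 0"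
  using assms unfolding ldep_def by (elim exE conjE bexE) (rule that)

lemma ldep_mono: "ldep K A v \<Longrightarrow> K \<subseteq> K' \<Longrightarrow> ldep K' A v"
  unfolding ldep_def by (metis subsetD)

lemma common_denominator:
  assumes "finite A" "\<And>a. a \<in> A \<Longrightarrow> c a \<in> fgen S"
  obtains d where "d \<in> rgen S" "d \<noteq> 0" "\<And>a. a \<in> A \<Longrightarrow> d * c a \<in> rgen S"
proof -
  have "\<exists>d. d \<in> rgen S \<and> d \<noteq> 0 \<and> (\<forall>a\<in>A. d * c a \<in> rgen S)"
    using assms
  proof (induction A rule: finite_induct)
    case empty
    then show ?case by (auto intro!: exI[of _ 1] rgen_one)
  next
    case (insert a A)
    then obtain d where d: "d \<in> rgen S" "d \<noteq> 0" "\<forall>a\<in>A. d * c a \<in> rgen S" by auto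
    obtain n e where ne: "n \<in> rgen S" "e \<in> rgen S" "e \<noteq> 0" "c a = n / e"
      using insert.prems[of a] by (auto elim: fgen_fraction)
    have "d * e * c b \<in> rgen S" if "b \<in> insert a A" for b
    proof (cases "b = a")
      case True
      then show ?thesis using d ne by (simp add: rgen_mult)
    next
      case False
      then have "d * c b \<in> rgen S" using that d(3) by auto
      then have "e * (d * c b) \<in> rgen S" by (rule rgen_mult[OF ne(2)])
      then show ?thesis by (simp add: mult_ac)
    qed
    then show ?case using d ne by (intro exI[of _ "d * e"]) (auto intro: rgen_mult)
  qed
  then show ?thesis using that by blast
qed

lemma ldep_rgen:
  assumes "finite A" "ldep (fgen S) A v"
  shows "ldep (rgen S) A v"
proof -
  obtain c where c: "\<forall>a\<in>A. c a \<in> fgen S" "\<exists>a\<in>A. c a \<noteq> 0" "(\<Sum>a\<in>A. c a * v a) = 0"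
    using assms by (auto simp: ldep_def)
  obtain d where d: "d \<in> rgen S" "d \<noteq> 0" "\<And>a. a \<in> A \<Longrightarrow> d * c a \<in> rgen S"
    using common_denominator[of A c S] assms(1) c(1) by blast
  have "(\<Sum>a\<in>A. (d * c a) * v a) = 0"
    using c(3) by (simp add: mult.assoc sum_distrib_left[symmetric])
  then show ?thesis using c(2) d unfolding ldep_def by (intro exI[of _ "\<lambda>a. d * c a"]) auto
qed

lemma mpoly_add_unique:
  assumes "k + m = k' + (n :: 'i \<Rightarrow>\<^sub>0 nat)" "Poly_Mapping.keys k \<subseteq> I" "Poly_Mapping.keys k' \<subseteq> I"
    "Poly_Mapping.keys m \<subseteq> J" "Poly_Mapping.keys n \<subseteq> J" "I \<inter> J = {}"
  shows "k = k'" "m = n"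
proof -
  have eq: "Poly_Mapping.lookup k i + Poly_Mapping.lookup m i = Poly_Mapping.lookup k' i + Poly_Mapping.lookup n i" for i
    using assms(1) by (metis lookup_add)
  have z: "Poly_Mapping.lookup f i = 0" if "Poly_Mapping.keys f \<subseteq> A" "i \<notin> A" for f :: "'i \<Rightarrow>\<^sub>0 nat" and A i
    using that by (auto simp: in_keys_iff)
  show "k = k'"
  proof (rule poly_mapping_eqI)
    fix i show "Poly_Mapping.lookup k i = Poly_Mapping.lookup k' i"
    proof (cases "i \<in> I")
      case True
      then have "i \<notin> J" using assms(6) by auto
      then show ?thesis using eq[of i] z[of m J i] z[of n J i] assms by simp
    next
      case False
      then show ?thesis using z[of k I i] z[of k' I i] assms by simp
    qed
  qed
  then show "m = n" using assms(1) by simp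
qed

text \<open>After denominators are cleared, the coefficients of a relation over the larger field are
  polynomials in the \<open>z i\<close> with \<open>i \<in> I\<close>, so it becomes one polynomial
  relation in all variables.\<close>

lemma alg_indep_tower:
  fixes h :: "'a::comm_ring_1 \<Rightarrow> 'r::field"
  assumes h: "rhom h" and M: "sring M" and Z: "alg_indep h M (I \<union> J) z" and disj: "I \<inter> J = {}"
  shows "alg_indep (\<lambda>x. x) (fgen (h ` M \<union> z ` I)) J z"
  unfolding alg_indep_def
proof (intro ballI impI)
  interpret rhom h by fact
  let ?G = "h ` M \<union> z ` I"
  fix P :: "('b, 'r) mpoly" assume P: "P \<in> mpolys (fgen ?G) J" "meval (\<lambda>x. x) z P = 0"
  obtain d where d: "d \<in> rgen ?G" "d \<noteq> 0"
      "\<And>m. m \<in> Poly_Mapping.keys P \<Longrightarrow> d * Poly_Mapping.lookup P m \<in> rgen ?G"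
    using common_denominator[of "Poly_Mapping.keys P" "Poly_Mapping.lookup P" ?G] P(1)
    by (auto simp: mpolys_def)
  have "\<exists>Q\<in>mpolys M I. d * Poly_Mapping.lookup P m = meval h z Q" if "m \<in> Poly_Mapping.keys P" for m
    using d(3)[OF that] rgen_eq_meval[OF h M, of z I] by auto
  then obtain Q where Q: "\<And>m. m \<in> Poly_Mapping.keys P \<Longrightarrow> Q m \<in> mpolys M I"
      "\<And>m. m \<in> Poly_Mapping.keys P \<Longrightarrow> d * Poly_Mapping.lookup P m = meval h z (Q m)" by metis
  have keys: "Poly_Mapping.keys m \<subseteq> J" if "m \<in> Poly_Mapping.keys P" for m
    using P(1) that by (auto simp: mpolys_def)
  define R where "R = (\<Sum>m\<in>Poly_Mapping.keys P. Q m * Poly_Mapping.single m 1)"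
  have "R \<in> mpolys M (I \<union> J)"
    unfolding R_def using Q(1) keys mpolys_mono[of M M I "I \<union> J"]
    by (intro sring_sum sring_mpolys M mpolys_mult mpolys_single sring_one) auto
  moreover have "meval h z R = d * meval (\<lambda>x. x) z P"
    by (simp add: R_def meval_sum meval_mult Q(2)[symmetric] meval_def[of "\<lambda>x. x"] sum_distrib_left mult.assoc)
  ultimately have R: "R = 0" using Z P(2) by (simp add: alg_indep_def)
  have "Q m = 0" if m: "m \<in> Poly_Mapping.keys P" for m
  proof (rule poly_mapping_eqI)
    fix k
    show "Poly_Mapping.lookup (Q m) k = Poly_Mapping.lookup 0 k"
    proof (cases "k \<in> Poly_Mapping.keys (Q m)")
      case True
      then have k: "Poly_Mapping.keys k \<subseteq> I" using Q(1)[OF m] by (auto simp: mpolys_def)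
      have "Poly_Mapping.lookup (Q n * Poly_Mapping.single n 1) (k + m) = (if n = m then Poly_Mapping.lookup (Q m) k else 0)"
        if n: "n \<in> Poly_Mapping.keys P" for n
      proof (cases "(1::'a) = 0")
        case True
        then have "x = y" for x y :: 'a by (metis mult_1 mult_zero_left)
        then show ?thesis .
      next
        case False
        have "Poly_Mapping.lookup (Q n * Poly_Mapping.single n 1) (k + m) =
            (\<Sum>k'\<in>Poly_Mapping.keys (Q n). (Poly_Mapping.lookup (Q n) k' when k + m = k' + n))"
          using False by (simp add: lookup_mult_keys)
        also have "\<dots> = (\<Sum>k'\<in>Poly_Mapping.keys (Q n). if k' = k then (if n = m then Poly_Mapping.lookup (Q m) k else 0) else 0)"
        proof (intro sum.cong refl)
          fix k' assume "k' \<in> Poly_Mapping.keys (Q n)"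
          then have "Poly_Mapping.keys k' \<subseteq> I" using Q(1)[OF n] by (auto simp: mpolys_def)
          then have "k + m = k' + n \<longleftrightarrow> k' = k \<and> n = m"
            using mpoly_add_unique[of k m k' n I J] k keys[OF m] keys[OF n] disj by auto
          then show "(Poly_Mapping.lookup (Q n) k' when k + m = k' + n) =
              (if k' = k then (if n = m then Poly_Mapping.lookup (Q m) k else 0) else 0)"
            by (auto simp: when_def)
        qed
        also have "\<dots> = (if n = m then Poly_Mapping.lookup (Q m) k else 0)"
          using \<open>k \<in> Poly_Mapping.keys (Q m)\<close> by auto
        finally show ?thesis .
      qed
      then have "Poly_Mapping.lookup R (k + m) = (\<Sum>n\<in>Poly_Mapping.keys P. if n = m then Poly_Mapping.lookup (Q m) k else 0)"
        unfolding R_def lookup_sum by (intro sum.cong) auto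
      then show ?thesis using R m by simp
    qed (simp add: in_keys_iff)
  qed
  then have "Poly_Mapping.lookup P m = 0" if "m \<in> Poly_Mapping.keys P" for m
    using Q(2)[OF that] d(2) that by simp
  then show "P = 0" by (metis in_keys_iff lookup_zero poly_mapping_eqI)
qed

text \<open>With denominators cleared, the relation is a polynomial in the \<open>z i\<close> over
  \<open>A\<close>, hence identically zero. Its coefficient at one monomial is a relation over
  \<open>D\<close>; the monomial is taken from a nonzero coefficient of the given relation.\<close>

lemma ldep_transcendental_descent:
  fixes v :: "'x \<Rightarrow> 'r::field"
  assumes A: "sfield A" "sfield D" "D \<subseteq> A" and z: "alg_indep (\<lambda>x. x) A I z"
    and fin: "finite X" and v: "\<And>a. a \<in> X \<Longrightarrow> v a \<in> A" and dep: "ldep (fgen (D \<union> z ` I)) X v"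
  shows "ldep D X v"
proof -
  note meval_sum = rhom.meval_sum[OF rhom_id] and meval_mult = rhom.meval_mult[OF rhom_id]
    and meval_const = rhom.meval_const[OF rhom_id] and meval_0 = rhom.meval_0[OF rhom_id]
  obtain c where c: "\<forall>a\<in>X. c a \<in> rgen (D \<union> z ` I)" "\<exists>a\<in>X. c a \<noteq> 0" "(\<Sum>a\<in>X. c a * v a) = 0"
    using ldep_rgen[OF fin dep] unfolding ldep_def by blast
  have "\<exists>Q\<in>mpolys D I. c a = meval (\<lambda>x. x) z Q" if "a \<in> X" for a
  proof -
    have "rgen (D \<union> z ` I) = meval (\<lambda>x. x) z ` mpolys D I"
      using rgen_eq_meval[OF rhom_id sfield_sring[OF A(2)], of z I] by simp
    then show ?thesis using c(1) that by blast
  qed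
  then obtain Q where Q: "\<And>a. a \<in> X \<Longrightarrow> Q a \<in> mpolys D I" "\<And>a. a \<in> X \<Longrightarrow> c a = meval (\<lambda>x. x) z (Q a)"
    by metis
  define R where "R = (\<Sum>a\<in>X. const_poly (v a) * Q a)"
  have RA: "R \<in> mpolys A I"
    unfolding R_def using Q(1) mpolys_mono[OF A(3), of I I] v
    by (intro sring_sum sring_mpolys mpolys_mult mpolys_const sfield_sring A) auto
  have "meval (\<lambda>x. x) z R = (\<Sum>a\<in>X. c a * v a)"
    unfolding R_def meval_sum meval_mult meval_const
    by (intro sum.cong refl) (simp only: Q(2) mult.commute)
  then have "meval (\<lambda>x. x) z R = 0" unfolding c(3) .
  then have R: "R = 0" by (rule alg_indepD[OF z RA])
  obtain a where a: "a \<in> X" "c a \<noteq> 0" using c(2) by blast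
  then have "Q a \<noteq> 0" using Q(2) by (auto simp: meval_0)
  then obtain m where m: "Poly_Mapping.lookup (Q a) m \<noteq> 0" by (metis lookup_zero poly_mapping_eqI)
  have lc: "Poly_Mapping.lookup (const_poly r * F) \<nu> = r * Poly_Mapping.lookup F \<nu>" for r :: 'r and F :: "('b, 'r) mpoly" and \<nu>
    by (simp add: const_poly_def mult_map_scale_conv_mult[symmetric] Poly_Mapping.map.rep_eq when_def)
  have "(\<Sum>a\<in>X. Poly_Mapping.lookup (Q a) m * v a) = Poly_Mapping.lookup R m"
    unfolding R_def lookup_sum lc by (intro sum.cong refl mult.commute)
  then show ?thesis
    using a(1) m R Q(1) by (intro ldepI[of X "\<lambda>a. Poly_Mapping.lookup (Q a) m" D a]) (auto simp: mpolys_def)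
qed

inductive_set vspan :: "'r::comm_ring_1 set \<Rightarrow> 'r set \<Rightarrow> 'r set" for K F where
  vspan_zero: "0 \<in> vspan K F"
| vspan_step: "k \<in> K \<Longrightarrow> f \<in> F \<Longrightarrow> x \<in> vspan K F \<Longrightarrow> k * f + x \<in> vspan K F"

lemma vspan_add: "x \<in> vspan K F \<Longrightarrow> y \<in> vspan K F \<Longrightarrow> x + y \<in> vspan K F"
  by (induction rule: vspan.induct) (auto simp: add.assoc intro: vspan_step)

lemma vspan_prod: "k \<in> K \<Longrightarrow> f \<in> F \<Longrightarrow> k * f \<in> vspan K F"
  using vspan_step[OF _ _ vspan_zero] by fastforce

lemma rgen_subset_vspan:
  assumes K: "sring K" and F: "sring F"
  shows "rgen (K \<union> F) \<subseteq> vspan K F"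
proof (rule rgen_least)
  show "K \<union> F \<subseteq> vspan K F"
    using vspan_prod[of _ K 1 F] vspan_prod[of 1 K _ F] sring_one[OF K] sring_one[OF F] by fastforce
  have step: "k * f * y \<in> vspan K F" if "y \<in> vspan K F" "k \<in> K" "f \<in> F" for k f y
    using that(1)
  proof induction
    case (vspan_step k' f' x)
    have "(k * k') * (f * f') + k * f * x \<in> vspan K F"
      using vspan_step that by (intro vspan.vspan_step sring_mult[OF K] sring_mult[OF F])
    then show ?case by (simp add: algebra_simps)
  qed (simp add: vspan_zero)
  have mult: "x * y \<in> vspan K F" if "x \<in> vspan K F" "y \<in> vspan K F" for x y
    using that(1)
  proof induction
    case (vspan_step k f x)
    then have "k * f * y + x * y \<in> vspan K F" using step[OF that(2)] by (intro vspan_add) auto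
    then show ?case by (simp add: algebra_simps)
  qed (simp add: vspan_zero)
  have one: "1 \<in> vspan K F" using vspan_prod[of 1 K 1 F] sring_one[OF K] sring_one[OF F] by simp
  have "- 1 \<in> vspan K F"
    using vspan_prod[of "- 1" K 1 F] sring_one[OF K] sring_one[OF F] sring_uminus[OF K] by simp
  then have "- x \<in> vspan K F" if "x \<in> vspan K F" for x using mult[OF _ that, of "- 1"] by simp
  then show "sring (vspan K F)" using one mult vspan_add by (auto simp: sring_def)
qed

lemma vspan_repr:
  assumes "x \<in> vspan K F" "sring K"
  shows "\<exists>E m. finite E \<and> E \<subseteq> F \<and> (\<forall>e. m e \<in> K) \<and> (\<forall>e. e \<notin> E \<longrightarrow> m e = 0) \<and> x = (\<Sum>e\<in>E. m e * e)"
  using assms(1)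
proof induction
  case vspan_zero
  then show ?case using sring_zero[OF assms(2)] by (intro exI[of _ "{}"] exI[of _ "\<lambda>_. 0"]) auto
next
  case (vspan_step k f x)
  then obtain E m where Em: "finite E" "E \<subseteq> F" "\<forall>e. m e \<in> K" "\<forall>e. e \<notin> E \<longrightarrow> m e = 0" "x = (\<Sum>e\<in>E. m e * e)"
    by blast
  have x: "x = (\<Sum>e\<in>insert f E. m e * e)"
    using Em by (cases "f \<in> E") (auto simp: insert_absorb)
  have "(\<Sum>e\<in>insert f E. (m(f := k + m f)) e * e) = (\<Sum>e\<in>insert f E. (if e = f then k * e else 0) + m e * e)"
    by (intro sum.cong) (auto simp: algebra_simps)
  also have "\<dots> = k * f + x" unfolding sum.distrib x using Em(1) by simp
  finally show ?case
    using Em vspan_step(1,2) sring_add[OF assms(2)]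
    by (intro exI[of _ "insert f E"] exI[of _ "m(f := k + m f)"]) auto
qed

text \<open>Linear disjointness of \<open>F\<close> and \<open>K'\<close> over \<open>k\<close> passes to the compositum with an
  intermediate field \<open>K\<close>.\<close>

lemma ldep_compositum_descent:
  fixes v :: "'x \<Rightarrow> 'r::field"
  assumes k: "sfield k" and K: "sfield K" and F: "sfield F" and sub: "k \<subseteq> K" "K \<subseteq> K'" "sring K'"
    and ld: "\<And>E. finite E \<Longrightarrow> E \<subseteq> F \<Longrightarrow> ldep K' E (\<lambda>x. x) \<Longrightarrow> ldep k E (\<lambda>x. x)"
    and fin: "finite N" and v: "\<And>a. a \<in> N \<Longrightarrow> v a \<in> rgen (K \<union> F)" and dep: "ldep K' N v"
  shows "ldep K N v"
proof -
  define spans where "spans E \<longleftrightarrow> finite E \<and> E \<subseteq> F \<and> (\<exists>m. \<forall>a\<in>N. (\<forall>e. m a e \<in> K) \<and> v a = (\<Sum>e\<in>E. m a e * e))" for E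
  have "\<exists>E. spans E"
  proof -
    define rep where "rep a E m \<longleftrightarrow> finite E \<and> E \<subseteq> F \<and> (\<forall>e. m e \<in> K) \<and> (\<forall>e. e \<notin> E \<longrightarrow> m e = 0) \<and>
        v a = (\<Sum>e\<in>E. m e * e)" for a E m
    have "\<forall>a\<in>N. \<exists>E m. rep a E m"
      unfolding rep_def
      using vspan_repr[OF subsetD[OF rgen_subset_vspan[OF sfield_sring[OF K] sfield_sring[OF F]]] sfield_sring[OF K]] v
      by blast
    then obtain E m where rep: "\<And>a. a \<in> N \<Longrightarrow> rep a (E a) (m a)" by metis
    then have Em: "\<And>a. a \<in> N \<Longrightarrow> finite (E a)" "\<And>a. a \<in> N \<Longrightarrow> E a \<subseteq> F"
      "\<And>a e. a \<in> N \<Longrightarrow> m a e \<in> K" "\<And>a e. a \<in> N \<Longrightarrow> e \<notin> E a \<Longrightarrow> m a e = 0"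
      "\<And>a. a \<in> N \<Longrightarrow> v a = (\<Sum>e\<in>E a. m a e * e)" unfolding rep_def by blast+
    define E' where "E' = (\<Union>a\<in>N. E a)"
    have fE: "finite E'" using fin Em(1) by (auto simp: E'_def)
    have "v a = (\<Sum>e\<in>E'. m a e * e)" if "a \<in> N" for a
      unfolding Em(5)[OF that] using fE Em(4)[OF that] that by (intro sum.mono_neutral_left) (auto simp: E'_def)
    then show ?thesis using fE Em(2,3) unfolding spans_def by (intro exI[of _ E'] conjI exI[of _ m]) (auto simp: E'_def)
  qed
  \<comment> \<open>A minimal spanning set inside \<open>F\<close> is independent over
    \<open>K'\<close>: a relation would descend to \<open>k\<close> by disjointness and allow one
    element to be eliminated with coefficients in \<open>K\<close>.\<close>
  then obtain E where E: "spans E" "\<And>E'. spans E' \<Longrightarrow> card E \<le> card E'"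
    using ex_has_least_nat[of spans _ card] by metis
  then obtain m where m: "\<And>a e. a \<in> N \<Longrightarrow> m a e \<in> K" "\<And>a. a \<in> N \<Longrightarrow> v a = (\<Sum>e\<in>E. m a e * e)"
    and fE: "finite E" "E \<subseteq> F" unfolding spans_def by blast
  have indep: "\<not> ldep K' E (\<lambda>x. x)"
  proof
    assume "ldep K' E (\<lambda>x. x)"
    then obtain c e0 where c: "\<forall>e\<in>E. c e \<in> k" "e0 \<in> E" "c e0 \<noteq> 0" "(\<Sum>e\<in>E. c e * e) = 0"
      using ld[OF fE] by (auto simp: ldep_def)
    define E' where "E' = E - {e0}"
    have E': "E = insert e0 E'" "e0 \<notin> E'" "finite E'" using c fE by (auto simp: E'_def)
    define m' where "m' a e = (if e \<in> E' then m a e - m a e0 * (c e / c e0) else 0)" for a e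
    define s where "s = (\<Sum>e\<in>E'. c e * e)"
    have "c e0 * e0 = - s" using c(4) E' by (simp add: eq_neg_iff_add_eq_0 s_def)
    then have e0: "e0 = - s / c e0" using c(3) by (metis nonzero_mult_div_cancel_left)
    have "v a = (\<Sum>e\<in>E'. m' a e * e)" if "a \<in> N" for a
    proof -
      have "(\<Sum>e\<in>E'. m' a e * e) = (\<Sum>e\<in>E'. m a e * e - m a e0 / c e0 * (c e * e))"
        by (intro sum.cong) (auto simp: m'_def field_simps)
      also have "\<dots> = (\<Sum>e\<in>E'. m a e * e) + m a e0 * (- s / c e0)"
        unfolding sum_subtractf sum_distrib_left[symmetric] s_def by simp
      also have "\<dots> = (\<Sum>e\<in>E. m a e * e)" unfolding e0[symmetric] using E' by simp
      finally show ?thesis using m(2)[OF that] by simp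
    qed
    moreover have "m' a e \<in> K" if "a \<in> N" for a e
      using m(1)[OF that] c sub(1) E' by (auto simp: m'_def intro!: sfield_closed[OF K])
    ultimately have "spans E'" unfolding spans_def using E' fE by blast
    then show False using E(2)[of E'] E' by simp
  qed
  obtain c where c: "\<forall>a\<in>N. c a \<in> K'" "\<exists>a\<in>N. c a \<noteq> 0" "(\<Sum>a\<in>N. c a * v a) = 0"
    using dep by (auto simp: ldep_def)
  have "0 = (\<Sum>a\<in>N. \<Sum>e\<in>E. c a * m a e * e)"
    unfolding c(3)[symmetric] by (intro sum.cong refl) (simp add: m(2) sum_distrib_left mult.assoc)
  also have "\<dots> = (\<Sum>e\<in>E. (\<Sum>a\<in>N. c a * m a e) * e)"
    by (subst sum.swap) (simp add: sum_distrib_right)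
  finally have s: "(\<Sum>e\<in>E. (\<Sum>a\<in>N. c a * m a e) * e) = 0" by simp
  have "(\<Sum>a\<in>N. c a * m a e) \<in> K'" for e
    using c(1) m(1) sub(2) by (intro sring_closed sub(3)) auto
  then have zero: "(\<Sum>a\<in>N. c a * m a e) = 0" if "e \<in> E" for e
    using indep s that ldepI[of E "\<lambda>e. \<Sum>a\<in>N. c a * m a e" K' e "\<lambda>x. x"] by blast
  \<comment> \<open>The dependence over \<open>K'\<close> has become a solution of a linear system
    whose matrix \<open>m\<close> has entries in \<open>K\<close>.\<close>
  obtain d where d: "\<forall>a\<in>N. d a \<in> K" "\<exists>a\<in>N. d a \<noteq> 0" "\<forall>e\<in>E. (\<Sum>a\<in>N. d a * m a e) = 0"
    using system_descent[OF K fin, of E m c] m(1) c(2) zero by blast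
  have "(\<Sum>a\<in>N. d a * v a) = (\<Sum>a\<in>N. \<Sum>e\<in>E. d a * m a e * e)"
    by (intro sum.cong refl) (simp add: m(2) sum_distrib_left mult.assoc)
  also have "\<dots> = (\<Sum>e\<in>E. (\<Sum>a\<in>N. d a * m a e) * e)"
    by (subst sum.swap) (simp add: sum_distrib_right)
  also have "\<dots> = 0" using d(3) by simp
  finally show ?thesis using d(1,2) by (auto simp: ldep_def)
qed

section \<open>Frobenius and simple purely inseparable extensions\<close>

lemma frobenius_sum:
  fixes f :: "'x \<Rightarrow> 'r::comm_ring_1"
  assumes "prime p" "CHAR('r) = p"
  shows "(\<Sum>a\<in>A. f a) ^ p = (\<Sum>a\<in>A. f a ^ p)"
  by (rule freshmans_dream_sum) (simp_all only: assms)

lemma frobenius_add: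
  fixes x :: "'r::comm_ring_1"
  assumes "prime p" "CHAR('r) = p"
  shows "(x + y) ^ p = x ^ p + y ^ p"
  by (rule freshmans_dream) (simp_all only: assms)

lemma frobenius_uminus:
  fixes x :: "'r::comm_ring_1"
  assumes "prime p" "CHAR('r) = p"
  shows "(- x) ^ p = - (x ^ p)"
proof -
  have "(- x + x) ^ p = (- x) ^ p + x ^ p" by (rule frobenius_add[OF assms])
  moreover have "p > 0" using assms(1) prime_gt_0_nat by blast
  ultimately show ?thesis by (simp add: power_0_left eq_neg_iff_add_eq_0)
qed

lemma rgen_power_in:
  fixes S :: "'r::field set"
  assumes p: "prime p" "CHAR('r) = p" and K: "sring K" and S: "\<And>s. s \<in> S \<Longrightarrow> s ^ p \<in> K" and x: "x \<in> rgen S"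
  shows "x ^ p \<in> K"
  using x
  by induction (auto simp: S frobenius_add[OF p] frobenius_uminus[OF p] power_mult_distrib intro: sring_closed K)

text \<open>Since \<open>inverse x = x ^ (p - 1) * inverse (x ^ p)\<close> for
  \<open>x \<noteq> 0\<close>, only elements of \<open>K\<close> have to be inverted.\<close>

lemma sfield_if_powers_in:
  fixes R :: "'r::field set"
  assumes "p > 0" "sring R" "sfield K" "K \<subseteq> R" "\<And>x. x \<in> R \<Longrightarrow> x ^ p \<in> K"
  shows "sfield R"
proof -
  have "inverse x \<in> R" if "x \<in> R" for x
  proof (cases "x = 0")
    case False
    have "inverse x = x ^ (p - 1) * inverse (x ^ p)"
      using False assms(1) by (cases p) (auto simp: field_simps)
    then show ?thesis
      using that assms(2,4) sfield_inverse[OF assms(3) assms(5)[OF that]] by (auto intro: sring_closed)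
  qed (simp add: sring_zero assms)
  then show ?thesis using assms(2) by (simp add: sfield_def)
qed

text \<open>The combinations of powers of \<alpha> form a ring because \<open>\<alpha> ^ p\<close>
  lies in \<open>K\<close>. Their \<open>p\<close>-th powers lie in \<open>K\<close> again, so this
  ring is already a field.\<close>

lemma fgen_power_basis:
  fixes \<alpha> :: "'r::field"
  assumes p: "prime p" "CHAR('r) = p" and K: "sfield K" and \<alpha>: "\<alpha> ^ p \<in> K" and x: "x \<in> fgen (insert \<alpha> K)"
  shows "\<exists>c. (\<forall>i. c i \<in> K) \<and> x = (\<Sum>i<p. c i * \<alpha> ^ i)"
proof -
  have p0: "p > 0" using p(1) prime_gt_0_nat by blast
  define R where "R = {x. \<exists>c. (\<forall>i. c i \<in> K) \<and> x = (\<Sum>i<p. c i * \<alpha> ^ i)}"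
  note Kc = sfield_closed[OF K]
  have scale: "s * x \<in> R" if sx: "s \<in> K" "x \<in> R" for s x
  proof -
    obtain c where "\<forall>i. c i \<in> K" "x = (\<Sum>i<p. c i * \<alpha> ^ i)" using sx unfolding R_def by blast
    then show ?thesis unfolding R_def using sx(1) Kc(5)
      by (auto simp: sum_distrib_left mult.assoc[symmetric] intro!: exI[of _ "\<lambda>i. s * c i"])
  qed
  have add: "x + y \<in> R" if xy: "x \<in> R" "y \<in> R" for x y
  proof -
    obtain c d where "\<forall>i. c i \<in> K" "x = (\<Sum>i<p. c i * \<alpha> ^ i)" "\<forall>i. d i \<in> K" "y = (\<Sum>i<p. d i * \<alpha> ^ i)"
      using xy unfolding R_def by blast
    then show ?thesis unfolding R_def
      by (auto simp: sum.distrib[symmetric] distrib_right[symmetric] intro!: exI[of _ "\<lambda>i. c i + d i"] Kc)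
  qed
  have zero: "0 \<in> R" unfolding R_def using Kc(2) by (auto intro!: exI[of _ "\<lambda>_. 0"])
  have sum: "(\<Sum>a\<in>A. f a) \<in> R" if "\<And>a. a \<in> A \<Longrightarrow> f a \<in> R" for A :: "nat set" and f
    using that by (induction A rule: infinite_finite_induct) (auto simp: zero add)
  have pow: "\<alpha> ^ n \<in> R" for n
  proof -
    have "\<alpha> ^ (n mod p) = (\<Sum>i<p. (if i = n mod p then 1 else 0) * \<alpha> ^ i)"
      using p0 by (simp add: if_distrib[of "\<lambda>x. x * _"] sum.delta cong: if_cong)
    then have "\<alpha> ^ (n mod p) \<in> R"
      unfolding R_def using Kc(1,2) by (auto intro!: exI[of _ "\<lambda>i. if i = n mod p then 1 else 0"])
    moreover have "\<alpha> ^ n = (\<alpha> ^ p) ^ (n div p) * \<alpha> ^ (n mod p)"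
      by (metis power_add power_mult mult_div_mod_eq)
    ultimately show ?thesis using scale[OF Kc(9)[OF \<alpha>]] by metis
  qed
  have mult: "x * y \<in> R" if "x \<in> R" "y \<in> R" for x y
  proof -
    obtain c d where cd: "\<forall>i. c i \<in> K" "x = (\<Sum>i<p. c i * \<alpha> ^ i)" "\<forall>i. d i \<in> K" "y = (\<Sum>i<p. d i * \<alpha> ^ i)"
      using \<open>x \<in> R\<close> \<open>y \<in> R\<close> unfolding R_def by blast
    have "x * y = (\<Sum>i<p. \<Sum>j<p. c i * d j * \<alpha> ^ (i + j))"
      unfolding cd(2,4) sum_product by (simp add: power_add mult_ac)
    also have "\<dots> \<in> R" using cd(1,3) Kc(5) by (intro sum scale pow) auto
    finally show ?thesis .
  qed
  have KR: "K \<subseteq> R" using scale[of _ "\<alpha> ^ 0"] pow[of 0] by auto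
  have "- x \<in> R" if "x \<in> R" for x using scale[OF Kc(3)[OF Kc(1)] that] by simp
  then have "sring R" using KR Kc(1) add mult by (auto simp: sring_def)
  moreover have "x ^ p \<in> K" if x: "x \<in> R" for x
  proof -
    obtain c where c: "\<forall>i. c i \<in> K" "x = (\<Sum>i<p. c i * \<alpha> ^ i)" using x unfolding R_def by blast
    have "(\<alpha> ^ i) ^ p \<in> K" for i
      using Kc(9)[OF \<alpha>, of i] by (simp add: power_mult[symmetric] mult.commute)
    then have "c i ^ p * (\<alpha> ^ i) ^ p \<in> K" for i using Kc(5)[OF Kc(9)] c(1) by blast
    then show ?thesis unfolding c(2) frobenius_sum[OF p] power_mult_distrib by (intro Kc(7))
  qed
  ultimately have "sfield R" by (intro sfield_if_powers_in[OF p0 _ K KR])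
  moreover have "insert \<alpha> K \<subseteq> R" using KR pow[of 1] by auto
  ultimately show ?thesis using fgen_least[of "insert \<alpha> K" R] x by (auto simp: R_def)
qed

text \<open>This translates dependences over the simple extension into polynomials
  \<open>\<Sum>j. x j * s j(T)\<close> with the root \<alpha>, where each \<open>s j\<close> has
  degree below \<open>p\<close> over \<open>K\<close>.\<close>

lemma ldep_fgen_power_basis:
  fixes \<alpha> :: "'r::field"
  assumes p: "prime p" "CHAR('r) = p" and K: "sfield K" and \<alpha>: "\<alpha> ^ p \<in> K" "\<not> ldep K {..<p} (\<lambda>i. \<alpha> ^ i)"
    and J: "finite J"
  shows "ldep (fgen (insert \<alpha> K)) J x \<longleftrightarrow> ldep K (J \<times> {..<p}) (\<lambda>(j, i). x j * \<alpha> ^ i)"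
proof
  assume "ldep (fgen (insert \<alpha> K)) J x"
  then obtain c where c: "\<forall>a\<in>J. c a \<in> fgen (insert \<alpha> K)" "\<exists>a\<in>J. c a \<noteq> 0" "(\<Sum>a\<in>J. c a * x a) = 0"
    unfolding ldep_def by blast
  have "\<forall>a\<in>J. \<exists>s. (\<forall>i. s i \<in> K) \<and> c a = (\<Sum>i<p. s i * \<alpha> ^ i)"
    using c(1) fgen_power_basis[OF p K \<alpha>(1)] by blast
  then obtain s where s: "\<And>a i. a \<in> J \<Longrightarrow> s a i \<in> K" "\<And>a. a \<in> J \<Longrightarrow> c a = (\<Sum>i<p. s a i * \<alpha> ^ i)"
    by metis
  obtain a where a: "a \<in> J" "c a \<noteq> 0" using c(2) by blast
  have "\<exists>i<p. s a i \<noteq> 0"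
  proof (rule ccontr)
    assume "\<not> ?thesis"
    then have "c a = 0" unfolding s(2)[OF a(1)] by (intro sum.neutral) auto
    with a(2) show False by contradiction
  qed
  then obtain i where i: "i < p" "s a i \<noteq> 0" by blast
  have "(\<Sum>(j, i)\<in>J \<times> {..<p}. s j i * (x j * \<alpha> ^ i)) = (\<Sum>a\<in>J. c a * x a)"
    by (simp add: sum.cartesian_product[symmetric] s(2) sum_distrib_left mult_ac)
  then show "ldep K (J \<times> {..<p}) (\<lambda>(j, i). x j * \<alpha> ^ i)"
    using a i c(3) s(1) by (intro ldepI[of _ "\<lambda>(j, i). s j i" _ "(a, i)"]) (auto simp: case_prod_unfold)
next
  assume "ldep K (J \<times> {..<p}) (\<lambda>(j, i). x j * \<alpha> ^ i)"
  then obtain s where s: "\<And>j i. j \<in> J \<Longrightarrow> i < p \<Longrightarrow> s (j, i) \<in> K" "\<exists>a\<in>J \<times> {..<p}. s a \<noteq> 0"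
    "(\<Sum>a\<in>J \<times> {..<p}. s a * (\<lambda>(j, i). x j * \<alpha> ^ i) a) = 0"
    unfolding ldep_def by auto
  define c where "c j = (\<Sum>i<p. s (j, i) * \<alpha> ^ i)" for j
  have "c j \<in> fgen (insert \<alpha> K)" if "j \<in> J" for j
    unfolding c_def using s(1)[OF that] by (intro sfield_closed[OF sfield_fgen]) (auto intro: fgen_base)
  moreover obtain j i where ji: "j \<in> J" "i < p" "s (j, i) \<noteq> 0" using s(2) by auto
  have "c j \<noteq> 0"
    using \<alpha>(2) ldepI[of "{..<p}" "\<lambda>i. s (j, i)" K i "\<lambda>i. \<alpha> ^ i"] s(1)[OF ji(1)] ji by (auto simp: c_def)
  moreover have "(\<Sum>j\<in>J. c j * x j) = 0"
    using s(3) by (simp add: sum.cartesian_product' c_def sum_distrib_left mult_ac)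
  ultimately show "ldep (fgen (insert \<alpha> K)) J x" using ji(1) by (intro ldepI[of J c]) auto
qed

text \<open>In other words, \<open>x\<close> has degree \<open>p\<close> over \<open>K\<close>.
  Degree one is excluded by \<open>x \<notin> K\<close>, which settles \<open>p = 2\<close> and
  leaves a quadratic relation for \<open>p = 3\<close>.\<close>

lemma not_ldep_powers:
  fixes x :: "'r::field"
  assumes p: "p = 2 \<or> p = 3" "CHAR('r) = p" and K: "sfield K" and x: "x \<notin> K" "x ^ p \<in> K"
  shows "\<not> ldep K {..<p} (\<lambda>i. x ^ i)"
proof
  note Kc = sfield_closed[OF K]
  have linear: "c1 = 0 \<and> c0 = 0" if "c0 \<in> K" "c1 \<in> K" "c0 + c1 * x = 0" for c0 c1
  proof -
    have "c1 = 0"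
    proof (rule ccontr)
      assume "c1 \<noteq> 0"
      then have "x = - c0 / c1" using that(3) by (simp add: field_simps eq_neg_iff_add_eq_0)
      then show False using x(1) that Kc by metis
    qed
    then show ?thesis using that by simp
  qed
  assume "ldep K {..<p} (\<lambda>i. x ^ i)"
  then obtain c where c: "\<forall>i<p. c i \<in> K" "\<exists>i<p. c i \<noteq> 0" "(\<Sum>i<p. c i * x ^ i) = 0"
    unfolding ldep_def by auto
  show False
  proof (cases "p = 2")
    case True
    then have "c 0 + c 1 * x = 0" "\<forall>i<p. i = 0 \<or> i = 1" using c(3) by (auto simp: numeral_2_eq_2)
    then show False using linear[of "c 0" "c 1"] c True by auto
  next
    case False
    then have p3: "p = 3" using p by simp
    have i3: "\<forall>i<p. i = 0 \<or> i = 1 \<or> i = 2" using p3 by auto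
    have rel: "c 0 + c 1 * x + c 2 * x ^ 2 = 0" using c(3) p3 by (simp add: numeral_3_eq_3 numeral_2_eq_2)
    have cK: "c 0 \<in> K" "c 1 \<in> K" "c 2 \<in> K" using c(1) p3 by auto
    have three: "(3::'r) = 0" using of_nat_CHAR[where 'a = 'r] p p3 by simp
    show False
    proof (cases "c 2 = 0")
      case True
      then show False using linear[of "c 0" "c 1"] c(2) i3 rel cK by auto
    next
      case c2: False
      define a b where "a = - c 1 / c 2" and "b = - c 0 / c 2"
      have ab: "a \<in> K" "b \<in> K" using cK Kc by (simp_all add: a_def b_def)
      have x2: "x ^ 2 = a * x + b"
        using rel c2 by (simp add: a_def b_def field_simps eq_neg_iff_add_eq_0)
      have "x ^ 3 = x * x ^ 2" by (simp add: power3_eq_cube power2_eq_square)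
      also have "\<dots> = x * (a * x + b)" by (simp only: x2)
      also have "\<dots> = a * x ^ 2 + b * x" by (simp add: algebra_simps power2_eq_square)
      also have "\<dots> = a * (a * x + b) + b * x" by (simp only: x2)
      also have "\<dots> = (a ^ 2 + b) * x + a * b" by (simp add: algebra_simps power2_eq_square)
      finally have "(a * b - x ^ 3) + (a ^ 2 + b) * x = 0" by simp
      \<comment> \<open>As \<open>x ^ 3\<close> is in \<open>K\<close>, the coefficient of
        \<open>x\<close> vanishes. The relation is then \<open>x ^ 2 = a * x - a ^ 2\<close>, which
        in characteristic three says \<open>(x + a) ^ 2 = 0\<close>.\<close>
      then have b: "b = - (a ^ 2)"
        using linear[of "a * b - x ^ 3" "a ^ 2 + b"] ab x(2) p3 Kc by (simp add: eq_neg_iff_add_eq_0 add.commute)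
      have "(x + a) ^ 2 = 3 * (a * x)" using x2 b by (simp add: power2_sum)
      then have "x = - a" using three by (simp add: eq_neg_iff_add_eq_0)
      then show False using x(1) ab Kc by simp
    qed
  qed
qed

section \<open>Transfer between generic points\<close>

lemma alg_indep_generators':
  fixes h :: "'a::field \<Rightarrow> 'r::idom" and X :: "'i \<Rightarrow> 'r" and z :: "'k \<Rightarrow> 'r"
  assumes h: "rhom h" and M: "sfield M" and fin: "finite I" "finite K" and card: "card I = card K"
    and X: "alg_indep h M I X"
    and gen: "\<And>i. i \<in> I \<Longrightarrow> \<exists>A B. A \<in> rgen (h ` M \<union> z ` K) \<and> B \<in> rgen (h ` M \<union> z ` K) \<and> B \<noteq> 0 \<and> B * X i = A"
  shows "alg_indep h M K z"
  using gen unfolding rgen_eq_meval[OF h sfield_sring[OF M]]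
  by (intro alg_indep_generators[OF h M fin card X]) blast

lemma alg_indep_reindex:
  fixes h :: "'a::field \<Rightarrow> 'r::idom" and f :: "'i \<Rightarrow> 'j"
  assumes h: "rhom h" and M: "sfield M" and fin: "finite I" and inj: "inj_on f I"
    and X: "alg_indep h M (f ` I) X"
  shows "alg_indep h M I (\<lambda>i. X (f i))"
proof (rule alg_indep_generators'[OF h M _ fin card_image[OF inj] X])
  show "finite (f ` I)" using fin by simp
  fix j assume "j \<in> f ` I"
  then show "\<exists>A B. A \<in> rgen (h ` M \<union> (\<lambda>i. X (f i)) ` I) \<and> B \<in> rgen (h ` M \<union> (\<lambda>i. X (f i)) ` I) \<and> B \<noteq> 0 \<and> B * X j = A"
    by (intro exI[of _ "X j"] exI[of _ 1]) (auto intro: rgen_one rgen_base)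
qed

lemma alg_indep_cong: "(\<And>i. i \<in> I \<Longrightarrow> z i = z' i) \<Longrightarrow> alg_indep h M I z \<longleftrightarrow> alg_indep h M I z'"
proof -
  assume "\<And>i. i \<in> I \<Longrightarrow> z i = z' i"
  then have "meval h z P = meval h z' P" if "P \<in> mpolys M I" for P
    using that by (intro meval_cong) (auto simp: mpolys_def)
  then show ?thesis by (simp add: alg_indep_def)
qed

text \<open>\<open>None\<close> indexes the power series variable. The coefficient of its
  \<open>n\<close>-th power in the value of \<open>P\<close> is the value at \<open>z\<close> of a
  polynomial over \<open>M\<close>, and these polynomials together contain all coefficients of
  \<open>P\<close>.\<close>

lemma alg_indep_fps:
  fixes z :: "'i \<Rightarrow> 'r::field"
  assumes z: "alg_indep (\<lambda>x. x) M I z" and M: "sring M"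
  shows "alg_indep fps_const M (insert None (Some ` I)) (case_option fps_X (\<lambda>i. fps_const (z i)))"
  unfolding alg_indep_def
proof (intro ballI impI)
  let ?z = "case_option fps_X (\<lambda>i. fps_const (z i)) :: _ \<Rightarrow> 'r fps"
  fix P assume P: "P \<in> mpolys M (insert None (Some ` I))" "meval fps_const ?z P = 0"
  have inj: "inj (Some :: 'i \<Rightarrow> _)" by simp
  have lk: "Poly_Mapping.lookup (Poly_Mapping.map_key Some m) i = Poly_Mapping.lookup m (Some i)"
    for m :: "'i option \<Rightarrow>\<^sub>0 nat" and i
    by (simp add: map_key.rep_eq[OF inj])
  have kk: "Poly_Mapping.keys (Poly_Mapping.map_key Some m) = Some -` Poly_Mapping.keys m" for m :: "'i option \<Rightarrow>\<^sub>0 nat"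
    by (auto simp: in_keys_iff lk)
  have mono: "mono_ev ?z m = fps_X ^ Poly_Mapping.lookup m None * fps_const (mono_ev z (Poly_Mapping.map_key Some m))" for m
  proof -
    define S where "S = Some -` Poly_Mapping.keys m"
    have S: "finite S" "S = Poly_Mapping.keys (Poly_Mapping.map_key Some m)"
      by (auto simp: S_def kk finite_vimageI)
    have "Poly_Mapping.keys m \<subseteq> insert None (Some ` S)"
    proof
      fix x assume "x \<in> Poly_Mapping.keys m"
      then show "x \<in> insert None (Some ` S)" by (cases x) (auto simp: S_def)
    qed
    then have "mono_ev ?z m = (\<Prod>i\<in>insert None (Some ` S). ?z i ^ Poly_Mapping.lookup m i)"
      using S by (intro mono_ev_superset) auto
    also have "\<dots> = fps_X ^ Poly_Mapping.lookup m None * (\<Prod>i\<in>S. fps_const (z i) ^ Poly_Mapping.lookup m (Some i))"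
      using S(1) by (subst prod.insert) (auto simp: prod.reindex)
    also have "(\<Prod>i\<in>S. fps_const (z i) ^ Poly_Mapping.lookup m (Some i)) = fps_const (\<Prod>i\<in>S. z i ^ Poly_Mapping.lookup m (Some i))"
      by (induction S rule: infinite_finite_induct) (auto simp: fps_const_power)
    finally show ?thesis by (simp add: mono_ev_def S(2)[symmetric] lk)
  qed
  define Q where "Q n = (\<Sum>m\<in>{m \<in> Poly_Mapping.keys P. Poly_Mapping.lookup m None = n}.
      Poly_Mapping.single (Poly_Mapping.map_key Some m) (Poly_Mapping.lookup P m))" for n
  have "Q n \<in> mpolys M I" for n
    unfolding Q_def using P(1)
    by (intro sring_sum sring_mpolys M mpolys_single) (auto simp: mpolys_def kk)
  moreover have "meval (\<lambda>x. x) z (Q n) = 0" for n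
  proof -
    have "meval (\<lambda>x. x) z (Q n) = (\<Sum>m\<in>{m \<in> Poly_Mapping.keys P. Poly_Mapping.lookup m None = n}.
        Poly_Mapping.lookup P m * mono_ev z (Poly_Mapping.map_key Some m))"
      unfolding Q_def rhom.meval_sum[OF rhom_id] rhom.meval_single[OF rhom_id] ..
    also have "\<dots> = (\<Sum>m\<in>Poly_Mapping.keys P. if Poly_Mapping.lookup m None = n then
        Poly_Mapping.lookup P m * mono_ev z (Poly_Mapping.map_key Some m) else 0)"
      by (simp add: sum.inter_filter)
    also have "\<dots> = fps_nth (meval fps_const ?z P) n"
      unfolding meval_def fps_sum_nth mono
      by (intro sum.cong refl) (auto simp: fps_X_power_mult_nth)
    finally show ?thesis by (simp add: P)
  qed
  ultimately have Q0: "Q n = 0" for n by (rule alg_indepD[OF z])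
  show "P = 0"
  proof (rule ccontr)
    assume "P \<noteq> 0"
    then obtain m where m: "m \<in> Poly_Mapping.keys P" by (metis keys_eq_empty ex_in_conv)
    define n where "n = Poly_Mapping.lookup m None"
    let ?S = "{m \<in> Poly_Mapping.keys P. Poly_Mapping.lookup m None = n}"
    have eq: "Poly_Mapping.map_key Some m' = Poly_Mapping.map_key Some m \<longleftrightarrow> m' = m" if "m' \<in> ?S" for m'
    proof
      assume e: "Poly_Mapping.map_key Some m' = Poly_Mapping.map_key Some m"
      show "m' = m"
      proof (rule poly_mapping_eqI)
        fix i show "Poly_Mapping.lookup m' i = Poly_Mapping.lookup m i"
          using that arg_cong[OF e, of "\<lambda>m. Poly_Mapping.lookup m (the i)"] by (cases i) (auto simp: n_def lk)
      qed
    qed auto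
    have "Poly_Mapping.lookup (Q n) (Poly_Mapping.map_key Some m) = (\<Sum>m'\<in>?S. if m' = m then Poly_Mapping.lookup P m' else 0)"
      unfolding Q_def lookup_sum by (intro sum.cong refl) (auto simp: lookup_single when_def eq)
    also have "\<dots> = Poly_Mapping.lookup P m" using m by (simp add: n_def)
    finally show False using m by (simp add: Q0 in_keys_iff)
  qed
qed

text \<open>Independence of \<open>z1\<close> makes the substitution of \<open>z2\<close> for
  \<open>z1\<close> well defined. The map is meaningful only on the generated subring, hence the
  relativised homomorphism laws.\<close>

lemma free_hom:
  assumes h: "rhom h1" "rhom h2" and M: "sring M" and z: "alg_indep h1 M I z1"
  obtains \<theta> where "\<forall>a\<in>M. \<theta> (h1 a) = h2 a" "\<forall>i\<in>I. \<theta> (z1 i) = z2 i"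
    "\<forall>u\<in>rgen (h1 ` M \<union> z1 ` I). \<forall>v\<in>rgen (h1 ` M \<union> z1 ` I). \<theta> (u + v) = \<theta> u + \<theta> v \<and> \<theta> (u * v) = \<theta> u * \<theta> v"
    "alg_indep h2 M I z2 \<longrightarrow> (\<forall>u\<in>rgen (h1 ` M \<union> z1 ` I). \<theta> u = 0 \<longrightarrow> u = 0)"
proof -
  interpret h1: rhom h1 by fact
  interpret h2: rhom h2 by fact
  note R = rgen_eq_meval[OF h(1) M, of z1 I] and S = sring_mpolys[OF M, of I]
  have inj: "P = Q" if "P \<in> mpolys M I" "Q \<in> mpolys M I" "meval h1 z1 P = meval h1 z1 Q" for P Q
    using alg_indepD[OF z sring_diff[OF S that(1,2)]] that(3) by (simp add: h1.meval_diff)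
  define \<theta> where "\<theta> u = meval h2 z2 (SOME P. P \<in> mpolys M I \<and> meval h1 z1 P = u)" for u
  have \<theta>: "\<theta> (meval h1 z1 P) = meval h2 z2 P" if "P \<in> mpolys M I" for P
  proof -
    have "(SOME Q. Q \<in> mpolys M I \<and> meval h1 z1 Q = meval h1 z1 P) = P"
      by (rule some_equality) (use that inj in auto)
    then show ?thesis by (simp add: \<theta>_def)
  qed
  show ?thesis
  proof (rule that)
    show "\<forall>a\<in>M. \<theta> (h1 a) = h2 a" using \<theta>[OF mpolys_const[OF M]] by simp
    show "\<forall>i\<in>I. \<theta> (z1 i) = z2 i" using \<theta>[OF mpolys_var[OF M]] by simp
    show "\<forall>u\<in>rgen (h1 ` M \<union> z1 ` I). \<forall>v\<in>rgen (h1 ` M \<union> z1 ` I). \<theta> (u + v) = \<theta> u + \<theta> v \<and> \<theta> (u * v) = \<theta> u * \<theta> v"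
    proof (intro ballI)
      fix u v assume uv: "u \<in> rgen (h1 ` M \<union> z1 ` I)" "v \<in> rgen (h1 ` M \<union> z1 ` I)"
      obtain P Q where "P \<in> mpolys M I" "Q \<in> mpolys M I" "u = meval h1 z1 P" "v = meval h1 z1 Q"
        using uv unfolding R by blast
      then show "\<theta> (u + v) = \<theta> u + \<theta> v \<and> \<theta> (u * v) = \<theta> u * \<theta> v"
        using \<theta>[OF sring_add[OF S]] \<theta>[OF sring_mult[OF S]] \<theta>
        by (simp add: h1.meval_add h2.meval_add h1.meval_mult h2.meval_mult)
    qed
    show "alg_indep h2 M I z2 \<longrightarrow> (\<forall>u\<in>rgen (h1 ` M \<union> z1 ` I). \<theta> u = 0 \<longrightarrow> u = 0)"
    proof (intro impI ballI)
      fix u assume u: "alg_indep h2 M I z2" "u \<in> rgen (h1 ` M \<union> z1 ` I)" "\<theta> u = 0"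
      obtain P where P: "P \<in> mpolys M I" "u = meval h1 z1 P" using u(2) unfolding R by blast
      then have "P = 0" using alg_indepD[OF u(1) P(1)] u(3) \<theta> by simp
      then show "u = 0" by (simp add: P)
    qed
  qed
qed

text \<open>While all constant terms vanish, \<pi> can be divided out; the subdegree of the nonzero
  \<open>c l\<close> bounds the number of divisions. As \<Lambda> need not contain all power series,
  divisibility within \<Lambda> is a hypothesis.\<close>

lemma normalise_family:
  fixes \<pi> :: "'r::field fps"
  assumes \<pi>: "fps_nth \<pi> 0 = 0" "\<pi> \<noteq> 0"
    and \<Lambda>: "\<And>r. r \<in> \<Lambda> \<Longrightarrow> fps_nth r 0 = 0 \<Longrightarrow> \<exists>s\<in>\<Lambda>. r = \<pi> * s"
    and c: "\<And>a. a \<in> N \<Longrightarrow> c a \<in> \<Lambda>" "l \<in> N" "c l \<noteq> 0"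
  shows "\<exists>e c'. (\<forall>a\<in>N. c' a \<in> \<Lambda> \<and> c a = \<pi> ^ e * c' a) \<and> (\<exists>a\<in>N. fps_nth (c' a) 0 \<noteq> 0)"
  using c
proof (induction "subdegree (c l)" arbitrary: c rule: less_induct)
  case less
  show ?case
  proof (cases "\<exists>a\<in>N. fps_nth (c a) 0 \<noteq> 0")
    case True
    then show ?thesis using less.prems by (intro exI[of _ 0] exI[of _ c]) auto
  next
    case False
    then have "\<forall>a\<in>N. \<exists>s\<in>\<Lambda>. c a = \<pi> * s" using \<Lambda> less.prems(1) by blast
    then obtain s where s: "\<And>a. a \<in> N \<Longrightarrow> s a \<in> \<Lambda>" "\<And>a. a \<in> N \<Longrightarrow> c a = \<pi> * s a" by metis
    have s0: "s l \<noteq> 0" using s(2) less.prems(2,3) by auto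
    have "subdegree \<pi> > 0" using \<pi> by (metis gr0I nth_subdegree_nonzero)
    then have "subdegree (s l) < subdegree (c l)" using s(2)[OF less.prems(2)] s0 \<pi>(2) by simp
    then obtain e c' where "\<forall>a\<in>N. c' a \<in> \<Lambda> \<and> s a = \<pi> ^ e * c' a" "\<exists>a\<in>N. fps_nth (c' a) 0 \<noteq> 0"
      using less.hyps[of s] s(1) less.prems(2) s0 by blast
    then show ?thesis using s(2) by (intro exI[of _ "Suc e"] exI[of _ c']) (auto simp: mult.assoc)
  qed
qed

section \<open>Dependence over the generic ratio\<close>

text \<open>For \<open>a b0 \<noteq> 0\<close> this is the value forced on \<open>y b0\<close> by
  the linear equation \<open>\<Sum>b\<in>B. h (a b) * y b = 0\<close>.\<close>

definition lin_ratio :: "('o::field \<Rightarrow> 'r::comm_ring_1) \<Rightarrow> 'b set \<Rightarrow> 'b \<Rightarrow> ('b \<Rightarrow> 'o) \<Rightarrow> ('b \<Rightarrow> 'r) \<Rightarrow> 'r" where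
  "lin_ratio h B b0 a y = - (\<Sum>b\<in>B - {b0}. h (a b / a b0) * y b)"

text \<open>\<open>F\<close> is the copy of the base field in a large field, and \<open>X\<close> is
  an infinite supply of parameters from which generic elements are drawn.\<close>

locale ground =
  fixes p :: nat and F :: "'o::field set" and X :: "nat \<Rightarrow> 'o"
  assumes prime_p: "prime p" and char_p: "CHAR('o) = p" and F: "sfield F"
    and X: "alg_indep (\<lambda>x. x) F UNIV X"
begin

lemmas pc = prime_p char_p

lemma p_pos: "p > 0" using prime_p prime_gt_0_nat by blast

lemma p_ge_2: "p \<ge> 2" using prime_p prime_ge_2_nat by blast

definition Fp :: "'o set" where "Fp = (\<lambda>x. x ^ p) ` F"

lemma Fp_subset: "Fp \<subseteq> F"
  using sfield_closed(9)[OF F] by (auto simp: Fp_def)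

lemma power_in_Fp: "x \<in> F \<Longrightarrow> x ^ p \<in> Fp"
  by (simp add: Fp_def)

lemma sfield_Fp: "sfield Fp"
  unfolding sfield_def sring_def
proof (intro conjI ballI)
  note Fc = sfield_closed[OF F]
  show "1 \<in> Fp" using power_in_Fp[OF Fc(1)] by simp
  fix x assume "x \<in> Fp"
  then obtain u where u: "u \<in> F" "x = u ^ p" by (auto simp: Fp_def)
  show "- x \<in> Fp" using power_in_Fp[OF Fc(3)[OF u(1)]] by (simp add: u(2) frobenius_uminus[OF pc])
  show "inverse x \<in> Fp" using power_in_Fp[OF Fc(11)[OF u(1)]] by (simp add: u(2) power_inverse)
  fix y assume "y \<in> Fp"
  then obtain v where v: "v \<in> F" "y = v ^ p" by (auto simp: Fp_def)
  show "x + y \<in> Fp" using power_in_Fp[OF Fc(4)[OF u(1) v(1)]] by (simp add: u(2) v(2) frobenius_add[OF pc])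
  show "x * y \<in> Fp" using power_in_Fp[OF Fc(5)[OF u(1) v(1)]] by (simp add: u(2) v(2) power_mult_distrib)
qed

lemma fresh:
  assumes "finite I"
  shows "\<exists>z :: 'i \<Rightarrow> 'o. alg_indep (\<lambda>x. x) F I z"
proof -
  obtain f :: "'i \<Rightarrow> nat" where f: "inj_on f I" using finite_imp_inj_to_nat_seg[OF assms] by blast
  show ?thesis
    using alg_indep_reindex[OF rhom_id F assms f, of X] alg_indep_subset[OF X, of F "f ` I"] by blast
qed

text \<open>With \<open>y b = x\<^sub>b\<^sup>p\<close> for the homogeneous coordinates \<open>x\<^sub>b\<close> of \<open>\<Sum>b\<in>B. a b x\<^sub>b\<^sup>p = 0\<close>, \<open>lin_ratio\<close> is
  \<open>x\<^sub>b\<^sub>0\<^sup>p\<close>. For \<open>q = p\<close> the relation below is thus a linear dependence of the \<open>x j\<close> over the \<open>p\<close>-th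
  powers of the function field of the affine cone.\<close>

definition ratio_dep :: "nat \<Rightarrow> 'b set \<Rightarrow> 'b \<Rightarrow> ('b \<Rightarrow> 'o) \<Rightarrow> 'j set \<Rightarrow> ('j \<Rightarrow> 'o) \<Rightarrow> bool" where
  "ratio_dep q B b0 a J x \<longleftrightarrow> (\<exists>r. (\<forall>u\<in>J \<times> {..<q}. r u \<in> mpolys Fp (B - {b0})) \<and> (\<exists>u\<in>J \<times> {..<q}. r u \<noteq> 0) \<and>
     (\<Sum>u\<in>J \<times> {..<q}. r u * const_poly (x (fst u)) * lin_ratio const_poly B b0 a var_poly ^ snd u) = 0)"

lemma ratio_depI:
  assumes "\<And>u. u \<in> J \<times> {..<q} \<Longrightarrow> r u \<in> mpolys Fp (B - {b0})" "u \<in> J \<times> {..<q}" "r u \<noteq> 0"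
    "(\<Sum>u\<in>J \<times> {..<q}. r u * const_poly (x (fst u)) * lin_ratio const_poly B b0 a var_poly ^ snd u) = 0"
  shows "ratio_dep q B b0 a J x"
  unfolding ratio_dep_def by (intro exI[of _ r] conjI ballI bexI[of _ u]) (fact assms)+

lemma ratio_depE:
  assumes "ratio_dep q B b0 a J x"
  obtains r u where "\<forall>u\<in>J \<times> {..<q}. r u \<in> mpolys Fp (B - {b0})" "u \<in> J \<times> {..<q}" "r u \<noteq> 0"
    "(\<Sum>u\<in>J \<times> {..<q}. r u * const_poly (x (fst u)) * lin_ratio const_poly B b0 a var_poly ^ snd u) = 0"
  using assms unfolding ratio_dep_def by (elim exE conjE bexE) (rule that)

lemma meval_lin_ratio:
  assumes "rhom h"
  shows "meval h y (lin_ratio const_poly B b0 a var_poly) = lin_ratio h B b0 a y"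
proof -
  interpret rhom h by fact
  show ?thesis by (simp add: lin_ratio_def meval_uminus meval_sum meval_mult)
qed

lemma lin_ratio_in:
  assumes R: "sring R" and h: "\<And>x. x \<in> F \<Longrightarrow> h x \<in> R" and a: "\<And>b. b \<in> B \<Longrightarrow> a b \<in> F" "b0 \<in> B"
    and y: "\<And>b. b \<in> B - {b0} \<Longrightarrow> y b \<in> R"
  shows "lin_ratio h B b0 a y \<in> R"
  unfolding lin_ratio_def using assms
  by (intro sring_closed(3)[OF R] sring_closed(7)[OF R] sring_closed(5)[OF R]) (auto intro: sfield_closed(12)[OF F])

text \<open>Independent elements of the large field realise the polynomial ring over
  \<open>F\<close>; the passage from fractions to polynomials only clears denominators.\<close>

lemma ratio_dep_iff:
  fixes y :: "'b \<Rightarrow> 'o"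
  assumes fin: "finite J" and a: "\<And>b. b \<in> B \<Longrightarrow> a b \<in> F" "b0 \<in> B" and x: "\<And>j. j \<in> J \<Longrightarrow> x j \<in> F"
    and y: "alg_indep (\<lambda>x. x) F (B - {b0}) y"
  shows "ratio_dep q B b0 a J x \<longleftrightarrow>
    ldep (fgen (Fp \<union> y ` (B - {b0}))) (J \<times> {..<q}) (\<lambda>(j, i). x j * lin_ratio (\<lambda>x. x) B b0 a y ^ i)"
    (is "_ \<longleftrightarrow> ldep (fgen ?S) ?A ?v")
proof -
  note ms = rhom.meval_sum[OF rhom_id] and mm = rhom.meval_mult[OF rhom_id]
    and mc = rhom.meval_const[OF rhom_id] and mp = rhom.meval_power[OF rhom_id]
    and m0 = rhom.meval_0[OF rhom_id]
  have ev: "meval (\<lambda>x. x) y (\<Sum>u\<in>?A. r u * const_poly (x (fst u)) * lin_ratio const_poly B b0 a var_poly ^ snd u) =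
      (\<Sum>u\<in>?A. meval (\<lambda>x. x) y (r u) * ?v u)" for r
    unfolding ms mm mc mp meval_lin_ratio[OF rhom_id] by (simp add: case_prod_unfold mult.assoc)
  show ?thesis
  proof
    assume "ratio_dep q B b0 a J x"
    then obtain r u where r: "\<forall>u\<in>?A. r u \<in> mpolys Fp (B - {b0})" "u \<in> ?A" "r u \<noteq> 0"
      "(\<Sum>u\<in>?A. r u * const_poly (x (fst u)) * lin_ratio const_poly B b0 a var_poly ^ snd u) = 0"
      by (rule ratio_depE)
    have "(\<Sum>u\<in>?A. meval (\<lambda>x. x) y (r u) * ?v u) = 0"
      unfolding ev[symmetric] r(4) m0 ..
    moreover have "meval (\<lambda>x. x) y (r u) \<noteq> 0"
      using alg_indepD[OF y subsetD[OF mpolys_mono[OF Fp_subset order_refl] bspec[OF r(1) r(2)]]] r(3) by blast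
    moreover have "meval (\<lambda>x. x) y (r u) \<in> fgen ?S" if "u \<in> ?A" for u
      using meval_in_rgen[OF rhom_id bspec[OF r(1) that], of y] rgen_subset_fgen[of ?S] by auto
    ultimately show "ldep (fgen ?S) ?A ?v" using r(2) by (intro ldepI[of _ "\<lambda>u. meval (\<lambda>x. x) y (r u)"])
  next
    assume "ldep (fgen ?S) ?A ?v"
    then have "ldep (rgen ?S) ?A ?v" by (intro ldep_rgen) (use fin in auto)
    then obtain c u where c: "\<forall>u\<in>?A. c u \<in> rgen ?S" "u \<in> ?A" "c u \<noteq> 0" "(\<Sum>u\<in>?A. c u * ?v u) = 0"
      by (rule ldepE)
    have S: "rgen ?S = meval (\<lambda>x. x) y ` mpolys Fp (B - {b0})"
      using rgen_eq_meval[OF rhom_id sfield_sring[OF sfield_Fp], of y "B - {b0}"] by simp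
    have "\<forall>u\<in>?A. \<exists>P\<in>mpolys Fp (B - {b0}). c u = meval (\<lambda>x. x) y P" using c(1) unfolding S by blast
    then obtain r where r: "\<And>u. u \<in> ?A \<Longrightarrow> r u \<in> mpolys Fp (B - {b0})" "\<And>u. u \<in> ?A \<Longrightarrow> c u = meval (\<lambda>x. x) y (r u)"
      by metis
    let ?R = "\<Sum>u\<in>?A. r u * const_poly (x (fst u)) * lin_ratio const_poly B b0 a var_poly ^ snd u"
    note M = sring_mpolys[OF sfield_sring[OF F], of "B - {b0}"]
    have "lin_ratio const_poly B b0 a var_poly \<in> mpolys F (B - {b0})"
      by (rule lin_ratio_in[OF M]) (auto intro: a mpolys_const mpolys_var sfield_sring F)
    then have "?R \<in> mpolys F (B - {b0})"
      using subsetD[OF mpolys_mono[OF Fp_subset order_refl] r(1)] x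
      by (intro sring_closed(7)[OF M] sring_closed(5)[OF M] sring_closed(9)[OF M] mpolys_const sfield_sring F) auto
    moreover have "meval (\<lambda>x. x) y ?R = 0"
      unfolding ev c(4)[symmetric] by (intro sum.cong refl) (simp only: r(2))
    ultimately have "?R = 0" by (rule alg_indepD[OF y])
    moreover have "r u \<noteq> 0" using c(3) r(2)[OF c(2)] by (auto simp: m0)
    ultimately show "ratio_dep q B b0 a J x" using r(1) c(2) by (intro ratio_depI)
  qed
qed

text \<open>If the ratio were a quotient \<open>N / D\<close> over \<open>Fp\<close>, then
  \<open>a b0 * N + (\<Sum>b. a b * y b * D) = 0\<close>, summed over \<open>b \<noteq> b0\<close>,
  would be an identity of polynomials. Its coefficient at a monomial occurring in
  \<open>y b1 * D\<close>, for some \<open>b1 \<noteq> b0\<close>, is a nontrivial relation of the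
  \<open>a b\<close> over \<open>Fp\<close>.\<close>

lemma lin_ratio_not_in:
  fixes y :: "'b \<Rightarrow> 'o"
  assumes fin: "finite B" and a: "\<And>b. b \<in> B \<Longrightarrow> a b \<in> F" "b0 \<in> B" and B: "card B \<ge> 2" and ind: "\<not> ldep Fp B a"
    and y: "alg_indep (\<lambda>x. x) F (B - {b0}) y"
  shows "lin_ratio (\<lambda>x. x) B b0 a y \<notin> fgen (Fp \<union> y ` (B - {b0}))"
proof
  let ?B = "B - {b0}" and ?S = "Fp \<union> y ` (B - {b0})"
  note ms = rhom.meval_sum[OF rhom_id] and mm = rhom.meval_mult[OF rhom_id]
    and mc = rhom.meval_const[OF rhom_id] and ma = rhom.meval_add[OF rhom_id]
    and m0 = rhom.meval_0[OF rhom_id] and mv = rhom.meval_var[OF rhom_id]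
  assume "lin_ratio (\<lambda>x. x) B b0 a y \<in> fgen ?S"
  then obtain n d where nd: "n \<in> rgen ?S" "d \<in> rgen ?S" "d \<noteq> 0" "lin_ratio (\<lambda>x. x) B b0 a y = n / d"
    by (rule fgen_fraction)
  have S: "rgen ?S = meval (\<lambda>x. x) y ` mpolys Fp ?B"
    using rgen_eq_meval[OF rhom_id sfield_sring[OF sfield_Fp], of y ?B] by simp
  obtain N D where ND: "N \<in> mpolys Fp ?B" "D \<in> mpolys Fp ?B" "n = meval (\<lambda>x. x) y N" "d = meval (\<lambda>x. x) y D"
    using nd(1,2) unfolding S by blast
  have a0: "a b0 \<noteq> 0"
  proof
    assume "a b0 = 0"
    then have "ldep Fp B a"
      using a(2) fin sfield_closed(1,2)[OF sfield_Fp]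
      by (intro ldepI[of B "\<lambda>b. if b = b0 then 1 else 0" Fp b0]) (auto simp: if_distrib[of "\<lambda>x. x * _"] cong: if_cong)
    with ind show False by contradiction
  qed
  define P where "P = const_poly (a b0) * N + (\<Sum>b\<in>?B. const_poly (a b) * (var_poly b * D))"
  have PM: "P \<in> mpolys F ?B"
    unfolding P_def using subsetD[OF mpolys_mono[OF Fp_subset order_refl]] ND(1,2) a
    by (intro mpolys_add mpolys_mult mpolys_const sring_sum sring_mpolys mpolys_var sfield_sring F) auto
  have "n = lin_ratio (\<lambda>x. x) B b0 a y * d" using nd(3,4) by simp
  also have "\<dots> = - (\<Sum>b\<in>?B. a b * (y b * d)) / a b0"
    by (simp add: lin_ratio_def sum_distrib_left sum_divide_distrib mult_ac)
  finally have "a b0 * n = - (\<Sum>b\<in>?B. a b * (y b * d))" using a0 by (metis nonzero_mult_div_cancel_left times_divide_eq_right)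
  then have "meval (\<lambda>x. x) y P = 0"
    unfolding P_def ma mm ms mc mv ND(3,4)[symmetric] by simp
  then have P0: "P = 0" by (rule alg_indepD[OF y PM])
  have lc: "Poly_Mapping.lookup (const_poly r * G) \<nu> = r * Poly_Mapping.lookup G \<nu>" for r :: 'o and G :: "('b, 'o) mpoly" and \<nu>
    by (simp add: const_poly_def mult_map_scale_conv_mult[symmetric] Poly_Mapping.map.rep_eq when_def)
  have coeff: "a b0 * Poly_Mapping.lookup N \<nu> + (\<Sum>b\<in>?B. a b * Poly_Mapping.lookup (var_poly b * D) \<nu>) = 0" for \<nu>
    using arg_cong[OF P0, of "\<lambda>P. Poly_Mapping.lookup P \<nu>"] by (simp add: P_def lookup_add lookup_sum lc)
  obtain b1 where b1: "b1 \<in> ?B"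
  proof -
    have "card ?B \<ge> 1" using B a(2) fin by simp
    then have "?B \<noteq> {}" by (metis card.empty not_one_le_zero)
    then show ?thesis using that by blast
  qed
  have "D \<noteq> 0" using nd(3) ND(4) by (auto simp: m0)
  then have "var_poly b1 * D \<noteq> 0"
  proof -
    have "var_poly b1 \<noteq> (0 :: ('b, 'o) mpoly)"
      unfolding var_poly_def by (metis lookup_single_eq lookup_zero zero_neq_one)
    then show ?thesis using mpoly_no_zero_divisors[of "var_poly b1" D] \<open>D \<noteq> 0\<close> by blast
  qed
  then obtain \<nu> where \<nu>: "Poly_Mapping.lookup (var_poly b1 * D) \<nu> \<noteq> 0" by (metis lookup_zero poly_mapping_eqI)
  define c where "c b = (if b = b0 then Poly_Mapping.lookup N \<nu> else Poly_Mapping.lookup (var_poly b * D) \<nu>)" for b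
  have "c b \<in> Fp" if "b \<in> B" for b
    using that ND(1) mpolys_mult[OF sfield_sring[OF sfield_Fp] mpolys_var[OF sfield_sring[OF sfield_Fp]] ND(2), of b]
    by (auto simp: c_def mpolys_def)
  moreover have "c b1 \<noteq> 0" using b1 \<nu> by (simp add: c_def)
  moreover have "(\<Sum>b\<in>B. c b * a b) = 0"
  proof -
    have "(\<Sum>b\<in>B. c b * a b) = c b0 * a b0 + (\<Sum>b\<in>?B. c b * a b)" using a(2) fin by (simp add: sum.remove)
    also have "(\<Sum>b\<in>?B. c b * a b) = (\<Sum>b\<in>?B. a b * Poly_Mapping.lookup (var_poly b * D) \<nu>)"
      by (intro sum.cong refl) (simp add: c_def)
    finally show ?thesis using coeff[of \<nu>] by (simp add: c_def mult.commute)
  qed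
  ultimately show False using ind ldepI[of B c Fp b1 a] b1 by blast
qed

lemma lin_ratio_power_in:
  fixes y :: "'b \<Rightarrow> 'o"
  assumes "\<And>b. b \<in> B \<Longrightarrow> a b \<in> F" "b0 \<in> B"
  shows "lin_ratio (\<lambda>x. x) B b0 a y ^ p \<in> rgen (Fp \<union> y ` (B - {b0}))"
proof -
  let ?S = "F \<union> y ` (B - {b0})"
  have "lin_ratio (\<lambda>x. x) B b0 a y \<in> rgen ?S"
    by (rule lin_ratio_in[OF sring_rgen]) (auto intro: assms rgen_base)
  moreover have "s ^ p \<in> rgen (Fp \<union> y ` (B - {b0}))" if "s \<in> ?S" for s
  proof (cases "s \<in> F")
    case True
    then show ?thesis by (intro rgen_base UnI1 power_in_Fp)
  next
    case False
    then have "s \<in> y ` (B - {b0})" using that by blast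
    then show ?thesis by (intro sring_power[OF sring_rgen] rgen_base UnI2)
  qed
  ultimately show ?thesis by (rule rgen_power_in[OF pc sring_rgen, rotated])
qed

end

section \<open>Degeneration of a generic root to the generic ratio\<close>

lemma alg_indep_linear:
  fixes z :: "'i \<Rightarrow> 'r::field"
  assumes z: "alg_indep (\<lambda>x. x) A I z" and A: "sring A" and fin: "finite J" "J \<subseteq> I"
    and c: "\<And>i. i \<in> J \<Longrightarrow> c i \<in> A" "l \<in> J" "c l \<noteq> 0"
  shows "(\<Sum>i\<in>J. c i * z i) \<noteq> 0"
proof
  assume eq: "(\<Sum>i\<in>J. c i * z i) = 0"
  define P where "P = (\<Sum>i\<in>J. Poly_Mapping.single (Poly_Mapping.single i (1::nat)) (c i))"
  have "P \<in> mpolys A I"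
    unfolding P_def using c(1) fin(2) by (intro sring_sum sring_mpolys A mpolys_single) auto
  moreover have "meval (\<lambda>x. x) z P = 0"
    unfolding P_def rhom.meval_sum[OF rhom_id] rhom.meval_single[OF rhom_id] mono_ev_single eq[symmetric]
    by simp
  ultimately have "P = 0" by (rule alg_indepD[OF z])
  have inj: "Poly_Mapping.single i (1::nat) = Poly_Mapping.single l 1 \<longleftrightarrow> i = l" for i
    by (metis lookup_single_eq lookup_single_not_eq zero_neq_one)
  have "0 = Poly_Mapping.lookup P (Poly_Mapping.single l 1)" by (simp add: \<open>P = 0\<close>)
  also have "\<dots> = (\<Sum>i\<in>J. if i = l then c i else 0)"
    unfolding P_def lookup_sum by (intro sum.cong refl) (auto simp: lookup_single when_def inj[unfolded One_nat_def])
  also have "\<dots> = c l" using fin(1) c(2) by simp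
  finally show False using c(3) by simp
qed

lemma rhom_fps_const: "rhom (fps_const :: 'a::comm_ring_1 \<Rightarrow> 'a fps)"
  by unfold_locales auto

lemma fps_const_sum: "fps_const (\<Sum>a\<in>A. f a) = (\<Sum>a\<in>A. fps_const (f a))" for f :: "'x \<Rightarrow> 'a::comm_ring_1"
  by (rule rhom.hom_sum[OF rhom_fps_const])

text \<open>The elements of the required form are a subring, so only the generators of \<Lambda>
  have to be examined.\<close>

lemma rgen_uniformizer:
  fixes k :: "'r::comm_ring_1 set"
  assumes \<Lambda>: "\<Lambda> = rgen S" and k: "sring k" and ck: "\<And>x. x \<in> k \<Longrightarrow> fps_const x \<in> \<Lambda>" and \<tau>: "\<tau> \<in> \<Lambda>"
    and S: "\<And>r. r \<in> S \<Longrightarrow> \<exists>\<rho>\<in>k. \<exists>s\<in>\<Lambda>. r = fps_const \<rho> + \<tau> * s" and r: "r \<in> \<Lambda>"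
  shows "\<exists>\<rho>\<in>k. \<exists>s\<in>\<Lambda>. r = fps_const \<rho> + \<tau> * s"
proof -
  have L: "sring \<Lambda>" unfolding \<Lambda> by (rule sring_rgen)
  define R where "R = {fps_const \<rho> + \<tau> * s | \<rho> s. \<rho> \<in> k \<and> s \<in> \<Lambda>}"
  have RI: "\<rho> \<in> k \<Longrightarrow> s \<in> \<Lambda> \<Longrightarrow> x = fps_const \<rho> + \<tau> * s \<Longrightarrow> x \<in> R" for \<rho> s x
    unfolding R_def by blast
  have "sring R"
    unfolding sring_def
  proof (intro conjI ballI)
    show "1 \<in> R" by (rule RI[OF sring_one[OF k] sring_zero[OF L]]) simp
    fix x assume "x \<in> R"
    then obtain \<rho> s where x: "\<rho> \<in> k" "s \<in> \<Lambda>" "x = fps_const \<rho> + \<tau> * s" unfolding R_def by blast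
    show "- x \<in> R"
      by (rule RI[OF sring_uminus[OF k x(1)] sring_uminus[OF L x(2)]]) (simp add: x(3) flip: fps_const_neg)
    fix y assume "y \<in> R"
    then obtain \<rho>' s' where y: "\<rho>' \<in> k" "s' \<in> \<Lambda>" "y = fps_const \<rho>' + \<tau> * s'" unfolding R_def by blast
    show "x + y \<in> R"
      by (rule RI[OF sring_add[OF k x(1) y(1)] sring_add[OF L x(2) y(2)]])
         (simp add: x(3) y(3) algebra_simps flip: fps_const_add)
    have "fps_const \<rho> * s' + fps_const \<rho>' * s + \<tau> * (s * s') \<in> \<Lambda>"
      by (intro sring_add[OF L] sring_mult[OF L] ck \<tau> x y)
    then show "x * y \<in> R"
      by (rule RI[OF sring_mult[OF k x(1) y(1)]]) (simp add: x(3) y(3) algebra_simps flip: fps_const_mult)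
  qed
  moreover have "S \<subseteq> R" using S unfolding R_def by blast
  ultimately have "\<Lambda> \<subseteq> R" unfolding \<Lambda> by (intro rgen_least)
  then show ?thesis using r unfolding R_def by blast
qed

context ground begin

lemmas pc_fps = prime_p trans[OF semiring_char_fps[where 'a = 'o] char_p]

definition hindex :: "'b set \<Rightarrow> 'b \<Rightarrow> ('b \<times> nat) option set" where
  "hindex B b0 = insert None (Some ` (B \<times> {..<p} - {(b0, 0)}))"

text \<open>The root and all coefficients but the one at \<open>(b0, 0)\<close> are chosen freely; that coefficient is
  then determined. In \<open>hindex B b0\<close>, \<open>None\<close> is the index of the root.\<close>

definition generic_root :: "'b set \<Rightarrow> 'b \<Rightarrow> ('b \<Rightarrow> 'o) \<Rightarrow> ('b \<Rightarrow> nat \<Rightarrow> 'o) \<Rightarrow> 'o \<Rightarrow> bool" where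
  "generic_root B b0 a y \<alpha> \<longleftrightarrow> alg_indep (\<lambda>x. x) F (hindex B b0) (case_option \<alpha> (\<lambda>(b, i). y b i)) \<and>
     (\<Sum>b\<in>B. \<Sum>i<p. a b * y b i * \<alpha> ^ i) = 0"

text \<open>\<open>F\<close> and \<alpha> themselves are left out on purpose: \<open>F\<close> is to
  be linearly disjoint from this field over \<open>Fp\<close>, and \<alpha> is to have degree
  \<open>p\<close> over it.\<close>

definition root_field :: "'b set \<Rightarrow> ('b \<Rightarrow> nat \<Rightarrow> 'o) \<Rightarrow> 'o \<Rightarrow> 'o set" where
  "root_field B y \<alpha> = fgen (Fp \<union> (\<lambda>(b, i). y b i) ` (B \<times> {..<p}) \<union> {\<alpha> ^ p})"

text \<open>The special polynomial is \<open>a b0 * T + (\<Sum>b. a b * y0 b)\<close>, summed over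
  \<open>b \<noteq> b0\<close>; its root \<gamma> is the generic ratio. All coefficients are moved
  in a generic direction \<open>y1\<close> by a multiple \<tau>, and \<tau> is solved from the
  requirement that \<open>\<gamma> + fps_X\<close> be a root. \<Lambda> contains the moved
  coefficients and \<open>T ^ p\<close>, and its elements without constant term are multiples of
  \<tau> within \<Lambda>.\<close>

lemma degenerate_curve:
  assumes fin: "finite B" and a: "\<And>b. b \<in> B \<Longrightarrow> a b \<in> F" "b0 \<in> B" "a b0 \<noteq> 0"
  obtains w :: "'b + 'b \<times> nat \<Rightarrow> 'o" and T \<tau> :: "'o fps" and yt and k \<Lambda> where
    "alg_indep (\<lambda>x. x) F (Inl ` (B - {b0}) \<union> Inr ` (B \<times> {..<p})) w"
    "k = fgen (Fp \<union> w ` (Inl ` (B - {b0}) \<union> Inr ` (B \<times> {..<p})))"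
    "fps_nth T 0 = lin_ratio (\<lambda>x. x) B b0 a (\<lambda>b. w (Inl b))"
    "alg_indep fps_const F (hindex B b0) (case_option T (\<lambda>(b, i). yt b i))"
    "(\<Sum>b\<in>B. \<Sum>i<p. fps_const (a b) * yt b i * T ^ i) = 0"
    "fps_nth \<tau> 0 = 0" "\<tau> \<noteq> 0"
    "sring \<Lambda>" "\<forall>x\<in>k. fps_const x \<in> \<Lambda>" "T ^ p \<in> \<Lambda>" "\<forall>b\<in>B. \<forall>i<p. yt b i \<in> \<Lambda>"
    "\<forall>r\<in>\<Lambda>. fps_nth r 0 \<in> k \<and> (fps_nth r 0 = 0 \<longrightarrow> (\<exists>s\<in>\<Lambda>. r = \<tau> * s))"
proof -
  define IV where "IV = Inl ` (B - {b0}) \<union> Inr ` (B \<times> {..<p})"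
  have finIV: "finite IV" using fin by (simp add: IV_def)
  obtain w :: "'b + 'b \<times> nat \<Rightarrow> 'o" where w: "alg_indep (\<lambda>x. x) F IV w" using fresh[OF finIV] by (rule exE)
  define k where "k = fgen (Fp \<union> w ` IV)"
  have kf: "sfield k" by (simp add: k_def sfield_fgen)
  define y0 where "y0 b = w (Inl b)" for b
  define y1 where "y1 b i = w (Inr (b, i))" for b i
  have wk: "v \<in> IV \<Longrightarrow> w v \<in> k" for v by (auto simp: k_def intro: fgen_base)
  have y0k: "y0 b \<in> k" if "b \<in> B - {b0}" for b using that wk by (auto simp: y0_def IV_def)
  have y1k: "y1 b i \<in> k" if "b \<in> B" "i < p" for b i using that wk by (auto simp: y1_def IV_def)
  have Fpk: "Fp \<subseteq> k" by (auto simp: k_def intro: fgen_base)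
  define \<gamma> where "\<gamma> = lin_ratio (\<lambda>x. x) B b0 a y0"
  define T where "T = fps_const \<gamma> + fps_X"
  have T0: "fps_nth T 0 = \<gamma>" by (simp add: T_def)
  define f1 where "f1 = (\<Sum>b\<in>B. \<Sum>i<p. fps_const (a b * y1 b i) * T ^ i)"
  \<comment> \<open>The constant term is a nontrivial linear form in the free \<open>y1 b i\<close>.
    Hence \<open>f1\<close> is invertible.\<close>
  have f10: "fps_nth f1 0 \<noteq> 0"
  proof -
    let ?A = "fgen (F \<union> w ` Inl ` (B - {b0}))"
    have "alg_indep (\<lambda>x. x) ?A (Inr ` (B \<times> {..<p})) w"
      using alg_indep_tower[OF rhom_id sfield_sring[OF F], of "Inl ` (B - {b0})" "Inr ` (B \<times> {..<p})" w] w
      by (auto simp: IV_def)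
    moreover have "\<gamma> \<in> ?A"
      unfolding \<gamma>_def by (rule lin_ratio_in[OF sfield_sring[OF sfield_fgen]]) (auto intro: a fgen_base simp: y0_def)
    then have "a b * \<gamma> ^ i \<in> ?A" if "b \<in> B" for b i
      using a(1)[OF that] by (intro sfield_closed[OF sfield_fgen]) (auto intro: fgen_base)
    ultimately have "(\<Sum>v\<in>Inr ` (B \<times> {..<p}). (case v of Inl _ \<Rightarrow> 0 | Inr (b, i) \<Rightarrow> a b * \<gamma> ^ i) * w v) \<noteq> 0"
      using fin a(2,3) p_pos
      by (intro alg_indep_linear[OF _ sfield_sring[OF sfield_fgen], where l = "Inr (b0, 0)"]) auto
    also have "(\<Sum>v\<in>Inr ` (B \<times> {..<p}). (case v of Inl _ \<Rightarrow> 0 | Inr (b, i) \<Rightarrow> a b * \<gamma> ^ i) * w v) =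
        (\<Sum>b\<in>B. \<Sum>i<p. a b * y1 b i * \<gamma> ^ i)"
      by (simp add: sum.reindex sum.cartesian_product y1_def case_prod_unfold mult_ac)
    also have "\<dots> = fps_nth f1 0" by (simp add: f1_def fps_sum_nth T0 fps_power_zeroth)
    finally show ?thesis .
  qed
  \<comment> \<open>The special polynomial takes the value \<open>fps_const (a b0) * fps_X\<close>
    at \<open>T\<close>, which \<open>\<tau> * f1\<close> has to cancel.\<close>
  define \<tau> where "\<tau> = fps_const (- a b0) * fps_X * inverse f1"
  have f1inv: "inverse f1 * f1 = 1" using f10 by (rule inverse_mult_eq_1)
  have tf1: "\<tau> * f1 = fps_const (- a b0) * fps_X"
    using f1inv by (simp add: \<tau>_def mult.assoc)
  have t0: "fps_nth \<tau> 0 = 0" by (simp add: \<tau>_def mult.assoc)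
  have tn0: "\<tau> \<noteq> 0" using tf1 a(3) by auto
  define yi where "yi b i = (if b \<noteq> b0 \<and> i = 0 then y0 b else if b = b0 \<and> i = 1 then 1 else 0)" for b and i :: nat
  define yt where "yt b i = fps_const (yi b i) + \<tau> * fps_const (y1 b i)" for b i
  have ag: "a b0 * \<gamma> = - (\<Sum>b\<in>B - {b0}. a b * y0 b)"
    using a(3) by (simp add: \<gamma>_def lin_ratio_def sum_distrib_left)
  have first: "(\<Sum>b\<in>B. \<Sum>i<p. fps_const (a b) * fps_const (yi b i) * T ^ i) = fps_const (a b0) * fps_X"
  proof -
    have "(\<Sum>i<p. fps_const (a b) * fps_const (yi b i) * T ^ i) = (if b = b0 then fps_const (a b0) * T else fps_const (a b * y0 b))" for b
    proof (cases "b = b0")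
      case True
      have "(\<Sum>i<p. fps_const (a b) * fps_const (yi b i) * T ^ i) = (\<Sum>i<p. if i = 1 then fps_const (a b0) * T else 0)"
        by (intro sum.cong refl) (auto simp: yi_def True)
      then show ?thesis using True p_ge_2 by simp
    next
      case False
      have "(\<Sum>i<p. fps_const (a b) * fps_const (yi b i) * T ^ i) = (\<Sum>i<p. if i = 0 then fps_const (a b * y0 b) else 0)"
        by (intro sum.cong refl) (auto simp: yi_def False)
      then show ?thesis using False p_pos by simp
    qed
    then have "(\<Sum>b\<in>B. \<Sum>i<p. fps_const (a b) * fps_const (yi b i) * T ^ i) =
        fps_const (a b0) * T + (\<Sum>b\<in>B - {b0}. fps_const (a b * y0 b))"
      using fin a(2) by (simp add: sum.remove)
    also have "\<dots> = fps_const (a b0 * \<gamma> + (\<Sum>b\<in>B - {b0}. a b * y0 b)) + fps_const (a b0) * fps_X"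
      by (simp add: T_def fps_const_sum algebra_simps flip: fps_const_add)
    finally show ?thesis by (simp add: ag)
  qed
  have rel: "(\<Sum>b\<in>B. \<Sum>i<p. fps_const (a b) * yt b i * T ^ i) = 0"
  proof -
    have "(\<Sum>b\<in>B. \<Sum>i<p. fps_const (a b) * yt b i * T ^ i) =
        (\<Sum>b\<in>B. \<Sum>i<p. fps_const (a b) * fps_const (yi b i) * T ^ i) + \<tau> * f1"
      by (simp add: yt_def f1_def sum_distrib_left sum.distrib[symmetric] algebra_simps flip: fps_const_mult)
    then show ?thesis unfolding first tf1 by (simp flip: fps_const_neg)
  qed
  \<comment> \<open>\<open>T ^ p\<close> and not \<open>T\<close>: the constant term \<gamma> of
    \<open>T\<close> need not lie in \<open>k\<close>, but \<open>\<gamma> ^ p\<close> does.\<close>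
  define \<Lambda> where "\<Lambda> = rgen (fps_const ` k \<union> {\<tau>, T ^ p})"
  have L: "sring \<Lambda>" by (simp add: \<Lambda>_def sring_rgen)
  have ck: "fps_const x \<in> \<Lambda>" if "x \<in> k" for x using that by (auto simp: \<Lambda>_def intro: rgen_base)
  have tL: "\<tau> \<in> \<Lambda>" and TL: "T ^ p \<in> \<Lambda>" by (auto simp: \<Lambda>_def intro: rgen_base)
  have yik: "yi b i \<in> k" if "b \<in> B" for b i
    using that y0k sfield_closed(1,2)[OF kf] by (auto simp: yi_def)
  have ytL: "yt b i \<in> \<Lambda>" if "b \<in> B" "i < p" for b i
    unfolding yt_def using that by (intro sring_closed[OF L] ck tL yik y1k)
  have str: "\<exists>\<rho>\<in>k. \<exists>s\<in>\<Lambda>. r = fps_const \<rho> + \<tau> * s" if "r \<in> \<Lambda>" for r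
  proof (rule rgen_uniformizer[OF \<Lambda>_def sfield_sring[OF kf] ck tL _ that])
    fix r assume "r \<in> fps_const ` k \<union> {\<tau>, T ^ p}"
    then consider x where "x \<in> k" "r = fps_const x" | "r = \<tau>" | "r = T ^ p" by blast
    then show "\<exists>\<rho>\<in>k. \<exists>s\<in>\<Lambda>. r = fps_const \<rho> + \<tau> * s"
    proof cases
      case 1
      then show ?thesis using sring_zero[OF L] by (intro bexI[of _ x] bexI[of _ 0]) auto
    next
      case 2
      then show ?thesis using sring_one[OF L] sfield_closed(2)[OF kf]
        by (intro bexI[of _ 0] bexI[of _ 1]) auto
    next
      case 3
      have "\<gamma> ^ p \<in> rgen (Fp \<union> y0 ` (B - {b0}))"
        unfolding \<gamma>_def by (rule lin_ratio_power_in) (auto intro: a)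
      also have "\<dots> \<subseteq> k"
        using Fpk y0k by (intro rgen_least sfield_sring kf) auto
      finally have g: "\<gamma> ^ p \<in> k" .
      \<comment> \<open>\<open>T ^ p - \<gamma> ^ p\<close> is \<open>fps_X ^ p\<close>, and
        \<open>fps_X\<close> is \<open>\<tau> * f1\<close> up to a constant of \<open>F\<close>. The
        \<open>p\<close>-th power brings \<open>f1\<close> into \<Lambda> and that constant into
        \<open>Fp\<close>.\<close>
      define e where "e = fps_const ((- inverse (a b0)) ^ p) * \<tau> ^ (p - 1) * f1 ^ p"
      have i: "(- inverse (a b0)) ^ p \<in> k"
        using a(1)[OF a(2)] by (intro subsetD[OF Fpk] power_in_Fp sfield_closed(3)[OF F] sfield_closed(11)[OF F])
      have f1p: "f1 ^ p = (\<Sum>b\<in>B. \<Sum>i<p. fps_const ((a b) ^ p * y1 b i ^ p) * (T ^ p) ^ i)"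
        unfolding f1_def frobenius_sum[OF pc_fps] power_mult_distrib
        by (simp add: fps_const_power power_mult_distrib power_mult[symmetric] mult.commute)
      have ay: "(a b) ^ p * y1 b i ^ p \<in> k" if "b \<in> B" "i < p" for b i
        using subsetD[OF Fpk power_in_Fp[OF a(1)[OF that(1)]]] sfield_closed(9)[OF kf y1k[OF that]]
        by (rule sfield_closed(5)[OF kf])
      have "f1 ^ p \<in> \<Lambda>"
        unfolding f1p by (intro sring_closed(7)[OF L] sring_closed(5)[OF L] sring_closed(9)[OF L] ck TL ay) auto
      then have eL: "e \<in> \<Lambda>"
        unfolding e_def by (rule sring_mult[OF L sring_mult[OF L ck[OF i] sring_power[OF L tL]]])
      have "fps_X = fps_const (- inverse (a b0)) * (\<tau> * f1)"
        using a(3) unfolding tf1 by (simp add: mult.assoc[symmetric])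
      then have "(fps_X :: 'o fps) ^ p = (fps_const (- inverse (a b0)) * (\<tau> * f1)) ^ p" by (rule arg_cong)
      also have "\<dots> = fps_const ((- inverse (a b0)) ^ p) * (\<tau> ^ p * f1 ^ p)"
        by (simp only: power_mult_distrib fps_const_power)
      also have "\<tau> ^ p = \<tau> * \<tau> ^ (p - 1)" using p_pos by (cases p) auto
      finally have "(fps_X :: 'o fps) ^ p = \<tau> * e" by (simp only: e_def mult_ac)
      then have "r = fps_const (\<gamma> ^ p) + \<tau> * e"
        by (simp add: 3 T_def frobenius_add[OF pc_fps] fps_const_power)
      then show ?thesis using g eL by blast
    qed
  qed
  have Lk: "fps_nth r 0 \<in> k" and Ldiv: "fps_nth r 0 = 0 \<Longrightarrow> \<exists>s\<in>\<Lambda>. r = \<tau> * s" if "r \<in> \<Lambda>" for r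
    using str[OF that] t0 by auto
  have "alg_indep fps_const F (hindex B b0) (case_option T (\<lambda>(b, i). yt b i))"
  proof -
    let ?zt = "case_option T (\<lambda>(b, i). yt b i)"
    define Y where "Y = fps_const (y1 b0 1)"
    \<comment> \<open>The curve has \<open>card B * p\<close> coordinates. With \<open>Y\<close> and
      the \<open>y0 b\<close> added there are as many elements as \<open>fps_X\<close> and the
      \<open>w\<close> together, and the latter are rational in them; the dimension count then
      yields independence.\<close>
    define K where "K = Inl ` hindex B b0 \<union> Inr ` insert None (Some ` (B - {b0}))"
    define z where "z = case_sum ?zt (case_option Y (\<lambda>b. fps_const (y0 b)))"
    have finK: "finite K" using fin by (simp add: K_def hindex_def)
    define G where "G = rgen (fps_const ` F \<union> z ` K)"
    have Gr: "sring G" by (simp add: G_def sring_rgen)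
    note Gc = sring_closed[OF Gr]
    have zG: "z v \<in> G" if "v \<in> K" for v using that by (auto simp: G_def intro: rgen_base)
    have FG: "fps_const c \<in> G" if "c \<in> F" for c using that by (auto simp: G_def intro: rgen_base)
    have TG: "T \<in> G" using zG[of "Inl None"] by (simp add: K_def hindex_def z_def)
    have YG: "Y \<in> G" using zG[of "Inr None"] by (simp add: K_def z_def)
    have y0G: "fps_const (y0 b) \<in> G" if "b \<in> B - {b0}" for b
      using zG[of "Inr (Some b)"] that by (simp add: K_def z_def)
    have ytG: "yt b i \<in> G" if "b \<in> B" "i < p" "(b, i) \<noteq> (b0, 0)" for b i
      using zG[of "Inl (Some (b, i))"] that by (auto simp: K_def z_def hindex_def)
    have "lin_ratio fps_const B b0 a (\<lambda>b. fps_const (y0 b)) \<in> G"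
      by (rule lin_ratio_in[OF Gr]) (auto intro: FG a y0G)
    then have gG: "fps_const \<gamma> \<in> G"
      by (simp only: \<gamma>_def lin_ratio_def fps_const_neg[symmetric] fps_const_sum fps_const_mult[symmetric])
    have XG: "fps_X \<in> G" using Gc(6)[OF TG gG] by (simp add: T_def)
    have yiG: "fps_const (yi b i) \<in> G" if "b \<in> B" for b i
      using that y0G Gc(1,2) by (auto simp: yi_def)
    have "1 < p" using p_ge_2 by simp
    \<comment> \<open>A common denominator for the \<open>y1 b i\<close>: as
      \<open>yi b0 1 = 1\<close>, this is \<open>\<tau> * Y\<close>.\<close>
    define t where "t = yt b0 1 - 1"
    have tG: "t \<in> G" unfolding t_def using ytG[of b0 1] a(2) \<open>1 < p\<close> by (intro Gc) auto
    have t: "t = \<tau> * Y" by (simp add: t_def yt_def yi_def Y_def)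
    have "(\<Sum>v\<in>{Inr (b0, 1)}. 1 * w v) \<noteq> 0"
      using a(2) \<open>1 < p\<close> by (intro alg_indep_linear[OF w sfield_sring[OF F]]) (auto simp: IV_def intro: sfield_closed[OF F])
    then have Y0: "Y \<noteq> 0" by (simp add: Y_def y1_def)
    then have tn: "t \<noteq> 0" using t tn0 by simp
    have gen1: "t * fps_const (y1 b i) \<in> G" if bi: "b \<in> B" "i < p" for b i
    proof (cases "(b, i) = (b0, 0)")
      case False
      have "t * fps_const (y1 b i) = Y * (yt b i - fps_const (yi b i))" by (simp add: t yt_def)
      also have "\<dots> \<in> G" using ytG[OF bi False] yiG[OF bi(1)] YG by (intro Gc)
      finally show ?thesis .
    next
      case True
      let ?g = "\<lambda>(b, i). fps_const (a b) * (\<tau> * fps_const (y1 b i)) * T ^ i"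
      \<comment> \<open>The coordinate at \<open>(b0, 0)\<close> is not among the generators and is
        solved from the equation defining \<tau>.\<close>
      have "fps_const (- a b0) * fps_X = (\<Sum>v\<in>B \<times> {..<p}. ?g v)"
        unfolding tf1[symmetric] f1_def sum.cartesian_product[symmetric]
        by (simp add: sum_distrib_left mult_ac flip: fps_const_mult)
      also have "\<dots> = ?g (b0, 0) + (\<Sum>v\<in>B \<times> {..<p} - {(b0, 0)}. ?g v)"
        using fin a(2) p_pos by (intro sum.remove) auto
      finally have eq: "fps_const (a b0) * (\<tau> * fps_const (y1 b0 0)) =
          fps_const (- a b0) * fps_X - (\<Sum>v\<in>B \<times> {..<p} - {(b0, 0)}. ?g v)" by simp
      have "?g v \<in> G" if vI: "v \<in> B \<times> {..<p} - {(b0, 0)}" for v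
      proof -
        obtain b i where "v = (b, i)" by (cases v)
        then have v: "v = (b, i)" "b \<in> B" "i < p" "(b, i) \<noteq> (b0, 0)" using vI by auto
        have "?g v = fps_const (a b) * (yt b i - fps_const (yi b i)) * T ^ i" by (simp add: v(1) yt_def)
        also have "\<dots> \<in> G" using ytG[OF v(2-)] yiG[OF v(2)] TG FG[OF a(1)[OF v(2)]] by (intro Gc)
        finally show ?thesis .
      qed
      moreover have "- a b0 \<in> F" using a(1)[OF a(2)] by (intro sfield_closed[OF F])
      ultimately have m1: "fps_const (a b0) * (\<tau> * fps_const (y1 b0 0)) \<in> G"
        unfolding eq by (intro Gc(3-7) FG XG) auto
      have m2: "inverse (a b0) \<in> F" using a(1)[OF a(2)] by (intro sfield_closed[OF F])
      have "Y * (fps_const (inverse (a b0)) * (fps_const (a b0) * (\<tau> * fps_const (y1 b0 0)))) \<in> G"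
        by (rule Gc(5)[OF YG Gc(5)[OF FG[OF m2] m1]])
      also have "Y * (fps_const (inverse (a b0)) * (fps_const (a b0) * (\<tau> * fps_const (y1 b0 0)))) = t * fps_const (y1 b0 0)"
      proof -
        have "fps_const (inverse (a b0)) * fps_const (a b0) = 1" using a(3) by simp
        moreover have "Y * (fps_const (inverse (a b0)) * (fps_const (a b0) * (\<tau> * fps_const (y1 b0 0)))) =
            (fps_const (inverse (a b0)) * fps_const (a b0)) * (\<tau> * Y * fps_const (y1 b0 0))"
          by (simp only: mult_ac)
        ultimately show ?thesis unfolding t by simp
      qed
      finally show ?thesis using True by simp
    qed
    have "alg_indep fps_const F K z"
    proof (rule alg_indep_generators'[OF rhom_fps_const F _ finK _ alg_indep_fps[OF w sfield_sring[OF F]]])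
      show "finite (insert None (Some ` IV))" using finIV by simp
      have "card (insert None (Some ` IV)) = Suc (card IV)" using finIV by (simp add: card_image)
      also have "card IV = card (B - {b0}) + card B * p"
        unfolding IV_def using fin by (subst card_Un_disjoint) (auto simp: card_image inj_on_def card_cartesian_product)
      finally have c1: "card (insert None (Some ` IV)) = Suc (card (B - {b0}) + card B * p)" .
      have "card (B \<times> {..<p} - {(b0, 0)}) = card B * p - 1"
        using fin a(2) p_pos by (simp add: card_cartesian_product)
      then have "card (hindex B b0) = Suc (card B * p - 1)"
        unfolding hindex_def using fin by (subst card_insert_disjoint) (auto simp: card_image)
      moreover have "card B * p > 0" using a(2) fin p_pos by (auto simp: card_gt_0_iff)
      ultimately have "card (hindex B b0) = card B * p" by simp
      moreover have "finite (hindex B b0)" using fin by (simp add: hindex_def)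
      ultimately have "card K = card B * p + Suc (card (B - {b0}))"
        unfolding K_def using fin
        by (subst card_Un_disjoint) (auto simp: card_image inj_on_def card_insert_if)
      with c1 show "card (insert None (Some ` IV)) = card K" by simp
      fix v assume v: "v \<in> insert None (Some ` IV)"
      show "\<exists>A D. A \<in> rgen (fps_const ` F \<union> z ` K) \<and> D \<in> rgen (fps_const ` F \<union> z ` K) \<and> D \<noteq> 0 \<and>
          D * case_option fps_X (\<lambda>i. fps_const (w i)) v = A"
        unfolding G_def[symmetric]
      proof (cases v)
        case None
        then show "\<exists>A D. A \<in> G \<and> D \<in> G \<and> D \<noteq> 0 \<and> D * case_option fps_X (\<lambda>i. fps_const (w i)) v = A"
          using XG Gc(1) by (intro exI[of _ fps_X] exI[of _ 1]) auto
      next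
        case (Some u)
        with v have u: "u \<in> IV" by auto
        then consider b where "b \<in> B - {b0}" "u = Inl b" | b i where "b \<in> B" "i < p" "u = Inr (b, i)"
          by (auto simp: IV_def)
        then show "\<exists>A D. A \<in> G \<and> D \<in> G \<and> D \<noteq> 0 \<and> D * case_option fps_X (\<lambda>i. fps_const (w i)) v = A"
        proof cases
          case 1
          then show ?thesis using y0G Gc(1) Some
            by (intro exI[of _ "fps_const (y0 b)"] exI[of _ 1]) (auto simp: y0_def)
        next
          case 2
          then show ?thesis using gen1[OF 2(1,2)] tG tn Some
            by (intro exI[of _ "t * fps_const (y1 b i)"] exI[of _ t]) (auto simp: y1_def)
        qed
      qed
    qed
    then have "alg_indep fps_const F (Inl ` hindex B b0) z"
      by (rule alg_indep_subset) (auto simp: K_def)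
    then have "alg_indep fps_const F (hindex B b0) (\<lambda>i. z (Inl i))"
      using fin by (intro alg_indep_reindex[OF rhom_fps_const F, of "hindex B b0" Inl z]) (auto simp: hindex_def)
    then show ?thesis by (simp add: z_def)
  qed
  moreover have "fps_nth T 0 = lin_ratio (\<lambda>x. x) B b0 a (\<lambda>b. w (Inl b))"
    by (simp add: T0 \<gamma>_def y0_def[abs_def])
  ultimately show ?thesis
    using that[OF w[unfolded IV_def] k_def[unfolded IV_def] _ _ rel t0 tn0 L _ TL] ck ytL Lk Ldiv by blast
qed

text \<open>A dependence valid at the generic root is carried along the curve, divided by the largest
  possible power of the uniformizer \<open>\<tau>\<close>, and then evaluated at the special point.\<close>

theorem specialise_to_ratio:
  fixes B :: "'b set"
  assumes fin: "finite B" and a: "\<And>b. b \<in> B \<Longrightarrow> a b \<in> F" "b0 \<in> B" "a b0 \<noteq> 0"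
    and gen: "generic_root B b0 a y \<alpha>" and J: "finite J" and x: "\<And>j. j \<in> J \<Longrightarrow> x j \<in> F"
    and dep: "ldep (root_field B y \<alpha>) (J \<times> {..<q}) (\<lambda>(j, i). x j * \<alpha> ^ i)"
  shows "ratio_dep q B b0 a J x"
proof -
  let ?A = "J \<times> {..<q}"
  let ?S = "Fp \<union> (\<lambda>(b, i). y b i) ` (B \<times> {..<p}) \<union> {\<alpha> ^ p}"
  let ?z = "case_option \<alpha> (\<lambda>(b, i). y b i)"
  have gen1: "alg_indep (\<lambda>x. x) F (hindex B b0) ?z" and gen2: "(\<Sum>b\<in>B. \<Sum>i<p. a b * y b i * \<alpha> ^ i) = 0"
    using gen by (auto simp: generic_root_def)
  obtain w :: "'b + 'b \<times> nat \<Rightarrow> 'o" and T \<tau> :: "'o fps" and yt k \<Lambda> where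
    w: "alg_indep (\<lambda>x. x) F (Inl ` (B - {b0}) \<union> Inr ` (B \<times> {..<p})) w"
    and k: "k = fgen (Fp \<union> w ` (Inl ` (B - {b0}) \<union> Inr ` (B \<times> {..<p})))"
    and T0: "fps_nth T 0 = lin_ratio (\<lambda>x. x) B b0 a (\<lambda>b. w (Inl b))"
    and ind: "alg_indep fps_const F (hindex B b0) (case_option T (\<lambda>(b, i). yt b i))"
    and rel: "(\<Sum>b\<in>B. \<Sum>i<p. fps_const (a b) * yt b i * T ^ i) = 0"
    and t: "fps_nth \<tau> 0 = 0" "\<tau> \<noteq> 0"
    and L: "sring \<Lambda>" and ck': "\<forall>x\<in>k. fps_const x \<in> \<Lambda>" and TL: "T ^ p \<in> \<Lambda>" and ytL': "\<forall>b\<in>B. \<forall>i<p. yt b i \<in> \<Lambda>"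
    and Lk': "\<forall>r\<in>\<Lambda>. fps_nth r 0 \<in> k \<and> (fps_nth r 0 = 0 \<longrightarrow> (\<exists>s\<in>\<Lambda>. r = \<tau> * s))"
    by (rule degenerate_curve[of B a b0, OF fin a])
  have ck: "\<And>x. x \<in> k \<Longrightarrow> fps_const x \<in> \<Lambda>" and ytL: "\<And>b i. b \<in> B \<Longrightarrow> i < p \<Longrightarrow> yt b i \<in> \<Lambda>"
    and Lk: "\<And>r. r \<in> \<Lambda> \<Longrightarrow> fps_nth r 0 \<in> k"
    and Ldiv: "\<And>r. r \<in> \<Lambda> \<Longrightarrow> fps_nth r 0 = 0 \<Longrightarrow> \<exists>s\<in>\<Lambda>. r = \<tau> * s"
    using ck' ytL' Lk' by auto
  \<comment> \<open>The ring on which the curve is substituted for the generic root. The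
    substitution is injective there because the curve is still generic over \<open>F\<close>, so a
    nonzero coefficient of the relation stays nonzero.\<close>
  define G where "G = rgen ((\<lambda>x. x) ` F \<union> ?z ` hindex B b0)"
  have Gr: "sring G" by (simp add: G_def sring_rgen)
  note Gc = sring_closed[OF Gr]
  obtain \<theta> where th: "\<forall>c\<in>F. \<theta> c = fps_const c"
    "\<forall>v\<in>hindex B b0. \<theta> (?z v) = case_option T (\<lambda>(b, i). yt b i) v"
    "\<forall>u\<in>G. \<forall>v\<in>G. \<theta> (u + v) = \<theta> u + \<theta> v \<and> \<theta> (u * v) = \<theta> u * \<theta> v"
    "alg_indep fps_const F (hindex B b0) (case_option T (\<lambda>(b, i). yt b i)) \<longrightarrow> (\<forall>u\<in>G. \<theta> u = 0 \<longrightarrow> u = 0)"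
    unfolding G_def by (rule free_hom[OF rhom_id rhom_fps_const sfield_sring[OF F] gen1])
  have th_const: "\<And>c. c \<in> F \<Longrightarrow> \<theta> c = fps_const c"
    and th_var: "\<And>v. v \<in> hindex B b0 \<Longrightarrow> \<theta> (?z v) = case_option T (\<lambda>(b, i). yt b i) v"
    and th_add: "\<And>u v. u \<in> G \<Longrightarrow> v \<in> G \<Longrightarrow> \<theta> (u + v) = \<theta> u + \<theta> v"
    and th_mult: "\<And>u v. u \<in> G \<Longrightarrow> v \<in> G \<Longrightarrow> \<theta> (u * v) = \<theta> u * \<theta> v"
    and th_inj: "\<And>u. u \<in> G \<Longrightarrow> \<theta> u = 0 \<Longrightarrow> u = 0"
    using th ind by blast+
  have FG: "c \<in> G" if "c \<in> F" for c using that by (auto simp: G_def intro: rgen_base)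
  have aG: "\<alpha> \<in> G" unfolding G_def by (rule rgen_base) (auto simp: hindex_def)
  have th_a: "\<theta> \<alpha> = T" using th_var[of None] by (simp add: hindex_def)
  have yG': "y b i \<in> G" if "b \<in> B" "i < p" "(b, i) \<noteq> (b0, 0)" for b i
    unfolding G_def using that by (intro rgen_base UnI2) (force simp: hindex_def image_iff)
  have th_y': "\<theta> (y b i) = yt b i" if "b \<in> B" "i < p" "(b, i) \<noteq> (b0, 0)" for b i
    using th_var[of "Some (b, i)"] that by (simp add: hindex_def image_iff)
  have "0 \<in> F" "1 \<in> F" by (rule sfield_closed[OF F])+
  then have th0: "\<theta> 0 = 0" and th1: "\<theta> 1 = 1" by (simp_all add: th_const)
  have th_sum: "\<theta> (\<Sum>v\<in>V. f v) = (\<Sum>v\<in>V. \<theta> (f v))" if "\<And>v. v \<in> V \<Longrightarrow> f v \<in> G" for V :: "'z set" and f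
    using that
    by (induction V rule: infinite_finite_induct) (auto simp: th0 th_add Gc(7))
  have th_pow: "\<theta> (u ^ n) = \<theta> u ^ n" if "u \<in> G" for u n
    using that by (induction n) (auto simp: th1 th_mult Gc(9))
  have th_uminus: "\<theta> (- u) = - \<theta> u" if "u \<in> G" for u
    using th_add[OF that Gc(3)[OF that]] by (simp add: th0 eq_neg_iff_add_eq_0 add.commute)
  have yG: "y b i \<in> G" if "b \<in> B" "i < p" for b i
  proof (cases "(b, i) = (b0, 0)")
    case True
    let ?g = "\<lambda>(b, i). a b * y b i * \<alpha> ^ i"
    have "0 = (\<Sum>v\<in>B \<times> {..<p}. ?g v)" using gen2 by (simp add: sum.cartesian_product)
    also have "\<dots> = ?g (b0, 0) + (\<Sum>v\<in>B \<times> {..<p} - {(b0, 0)}. ?g v)"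
      using fin a(2) p_pos by (intro sum.remove) auto
    finally have eq: "a b0 * y b0 0 = - (\<Sum>v\<in>B \<times> {..<p} - {(b0, 0)}. ?g v)" by (simp add: eq_neg_iff_add_eq_0)
    have "?g v \<in> G" if vI: "v \<in> B \<times> {..<p} - {(b0, 0)}" for v
    proof -
      obtain b i where "v = (b, i)" by (cases v)
      then have v: "v = (b, i)" "b \<in> B" "i < p" "(b, i) \<noteq> (b0, 0)" using vI by auto
      have "a b * y b i * \<alpha> ^ i \<in> G"
        by (rule Gc(5)[OF Gc(5)[OF FG[OF a(1)[OF v(2)]] yG'[OF v(2-)]] Gc(9)[OF aG]])
      then show ?thesis by (simp add: v(1))
    qed
    then have "a b0 * y b0 0 \<in> G" unfolding eq by (intro Gc(3) Gc(7))
    moreover have "inverse (a b0) \<in> G" using a(1)[OF a(2)] by (intro FG sfield_closed(11)[OF F])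
    ultimately have "inverse (a b0) * (a b0 * y b0 0) \<in> G" by (rule Gc(5)[rotated])
    then show ?thesis using True a(3) by (simp add: mult.assoc[symmetric])
  qed (use yG' that in auto)
  have th_y: "\<theta> (y b i) = yt b i" if "b \<in> B" "i < p" for b i
  proof (cases "(b, i) = (b0, 0)")
    case True
    have m: "a b * y b i * \<alpha> ^ i \<in> G" if "b \<in> B" "i < p" for b i
      using that a(1) by (intro Gc(5) Gc(9) FG yG aG)
    have "0 = \<theta> (\<Sum>v\<in>B \<times> {..<p}. case v of (b, i) \<Rightarrow> a b * y b i * \<alpha> ^ i)"
      using gen2 th0 by (simp add: sum.cartesian_product)
    also have "\<dots> = (\<Sum>v\<in>B \<times> {..<p}. \<theta> (case v of (b, i) \<Rightarrow> a b * y b i * \<alpha> ^ i))"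
      using m by (intro th_sum) auto
    also have "\<dots> = (\<Sum>v\<in>B \<times> {..<p}. case v of (b, i) \<Rightarrow> fps_const (a b) * \<theta> (y b i) * T ^ i)"
    proof (intro sum.cong refl)
      fix v assume "v \<in> B \<times> {..<p}"
      then obtain b i where v: "v = (b, i)" "b \<in> B" "i < p" by auto
      have "\<theta> (a b * y b i * \<alpha> ^ i) = \<theta> (a b * y b i) * \<theta> (\<alpha> ^ i)"
        using v a(1) by (intro th_mult Gc(5) Gc(9) FG yG aG)
      also have "\<theta> (a b * y b i) = \<theta> (a b) * \<theta> (y b i)" using v a(1) by (intro th_mult FG yG)
      finally show "\<theta> (case v of (b, i) \<Rightarrow> a b * y b i * \<alpha> ^ i) = (case v of (b, i) \<Rightarrow> fps_const (a b) * \<theta> (y b i) * T ^ i)"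
        using v a(1) by (simp add: th_pow[OF aG] th_a th_const)
    qed
    finally have e1: "(\<Sum>v\<in>B \<times> {..<p}. case v of (b, i) \<Rightarrow> fps_const (a b) * \<theta> (y b i) * T ^ i) = 0" by simp
    have e2: "(\<Sum>v\<in>B \<times> {..<p}. case v of (b, i) \<Rightarrow> fps_const (a b) * yt b i * T ^ i) = 0"
      using rel by (simp add: sum.cartesian_product)
    have "0 = (\<Sum>v\<in>B \<times> {..<p}. (case v of (b, i) \<Rightarrow> fps_const (a b) * \<theta> (y b i) * T ^ i) - (case v of (b, i) \<Rightarrow> fps_const (a b) * yt b i * T ^ i))"
      unfolding sum_subtractf e1 e2 by simp
    also have "\<dots> = (\<Sum>v\<in>B \<times> {..<p}. if v = (b0, 0) then fps_const (a b0) * (\<theta> (y b0 0) - yt b0 0) else 0)"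
      by (intro sum.cong refl) (auto simp: th_y' algebra_simps split: prod.splits)
    also have "\<dots> = fps_const (a b0) * (\<theta> (y b0 0) - yt b0 0)"
      using fin a(2) p_pos by simp
    finally show ?thesis using True a(3) by simp
  qed (use th_y' that in auto)
  have SG: "?S \<subseteq> G"
    using Fp_subset FG yG Gc(9)[OF aG, of p] by auto
  \<comment> \<open>The polynomial part of the root field is carried into \<Lambda>; this is why
    \<Lambda> has to contain the \<open>yt b i\<close> and \<open>T ^ p\<close>.\<close>
  have thL: "u \<in> G \<and> \<theta> u \<in> \<Lambda>" if "u \<in> rgen ?S" for u
    using that
  proof induction
    case (rgen_base u)
    then consider "u \<in> Fp" | b i where "b \<in> B" "i < p" "u = y b i" | "u = \<alpha> ^ p" by auto
    then have "\<theta> u \<in> \<Lambda>"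
    proof cases
      case 1
      then have "u \<in> k" unfolding k by (intro fgen_base UnI1)
      then show ?thesis using ck th_const 1 Fp_subset by auto
    next
      case 2
      then show ?thesis using th_y ytL by simp
    next
      case 3
      then show ?thesis using th_pow[OF aG] th_a TL by simp
    qed
    then show ?case using rgen_base SG by auto
  next
    case rgen_one
    then show ?case using th1 sring_one[OF L] Gc(1) by simp
  next
    case (rgen_uminus u)
    then show ?case using th_uminus sring_uminus[OF L] Gc(3) by simp
  next
    case (rgen_add u v)
    then show ?case using th_add sring_add[OF L] Gc(4) by simp
  next
    case (rgen_mult u v)
    then show ?case using th_mult sring_mult[OF L] Gc(5) by simp
  qed
  have finA: "finite ?A" using J by simp
  have "ldep (rgen ?S) ?A (\<lambda>(j, i). x j * \<alpha> ^ i)"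
    using dep finA unfolding root_field_def by (intro ldep_rgen)
  then obtain c u0 where c: "\<forall>u\<in>?A. c u \<in> rgen ?S" "u0 \<in> ?A" "c u0 \<noteq> 0" "(\<Sum>u\<in>?A. c u * (case u of (j, i) \<Rightarrow> x j * \<alpha> ^ i)) = 0"
    by (rule ldepE)
  have cG: "c u \<in> G" "\<theta> (c u) \<in> \<Lambda>" if "u \<in> ?A" for u using thL bspec[OF c(1) that] by auto
  have "\<theta> (c u0) \<noteq> 0" using th_inj[OF cG(1)[OF c(2)]] c(3) by blast
  then obtain e c' where c': "\<forall>u\<in>?A. c' u \<in> \<Lambda> \<and> \<theta> (c u) = \<tau> ^ e * c' u" "\<exists>u\<in>?A. fps_nth (c' u) 0 \<noteq> 0"
    using normalise_family[OF t Ldiv, of ?A "\<lambda>u. \<theta> (c u)" u0] cG(2) c(2) by blast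
  have mG: "x j * \<alpha> ^ i \<in> G" if "j \<in> J" for j i
    by (rule Gc(5)[OF FG[OF x[OF that]] Gc(9)[OF aG]])
  have cmG: "c u * (case u of (j, i) \<Rightarrow> x j * \<alpha> ^ i) \<in> G" if u: "u \<in> ?A" for u
    using Gc(5)[OF cG(1)[OF u] mG] u by auto
  have "0 = \<theta> (\<Sum>u\<in>?A. c u * (case u of (j, i) \<Rightarrow> x j * \<alpha> ^ i))" unfolding c(4) th0 ..
  also have "\<dots> = (\<Sum>u\<in>?A. \<theta> (c u * (case u of (j, i) \<Rightarrow> x j * \<alpha> ^ i)))"
    by (rule th_sum[OF cmG])
  also have "\<dots> = (\<Sum>u\<in>?A. \<tau> ^ e * (c' u * (case u of (j, i) \<Rightarrow> fps_const (x j) * T ^ i)))"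
  proof (intro sum.cong refl)
    fix u assume u: "u \<in> ?A"
    then obtain j i where ji: "u = (j, i)" "j \<in> J" "i < q" by auto
    have "\<theta> (c u * (x j * \<alpha> ^ i)) = \<theta> (c u) * \<theta> (x j * \<alpha> ^ i)"
      by (rule th_mult[OF cG(1)[OF u] mG[OF ji(2)]])
    also have "\<theta> (x j * \<alpha> ^ i) = \<theta> (x j) * \<theta> (\<alpha> ^ i)"
      by (rule th_mult[OF FG[OF x[OF ji(2)]] Gc(9)[OF aG]])
    finally show "\<theta> (c u * (case u of (j, i) \<Rightarrow> x j * \<alpha> ^ i)) = \<tau> ^ e * (c' u * (case u of (j, i) \<Rightarrow> fps_const (x j) * T ^ i))"
      using bspec[OF c'(1) u] x[OF ji(2)] by (simp add: ji(1) th_pow[OF aG] th_a th_const mult.assoc)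
  qed
  finally have "(\<Sum>u\<in>?A. c' u * (case u of (j, i) \<Rightarrow> fps_const (x j) * T ^ i)) = 0"
    using t(2) by (simp add: sum_distrib_left[symmetric])
  from arg_cong[OF this, of "\<lambda>f. fps_nth f 0"]
  have "(\<Sum>u\<in>?A. fps_nth (c' u) 0 * (case u of (j, i) \<Rightarrow> x j * fps_nth T 0 ^ i)) = 0"
    by (simp add: fps_sum_nth case_prod_unfold fps_power_zeroth)
  moreover have "\<forall>u\<in>?A. fps_nth (c' u) 0 \<in> k" using c'(1) Lk by blast
  ultimately have "ldep k ?A (\<lambda>(j, i). x j * fps_nth T 0 ^ i)"
    unfolding ldep_def using c'(2) by (intro exI[of _ "\<lambda>u. fps_nth (c' u) 0"]) blast
  then have dk: "ldep k ?A (\<lambda>(j, i). x j * lin_ratio (\<lambda>x. x) B b0 a (\<lambda>b. w (Inl b)) ^ i)" unfolding T0 .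
  let ?D = "fgen (Fp \<union> w ` Inl ` (B - {b0}))" and ?M = "fgen (F \<union> w ` Inl ` (B - {b0}))"
  have wM: "alg_indep (\<lambda>x. x) ?M (Inr ` (B \<times> {..<p})) w"
    using alg_indep_tower[OF rhom_id sfield_sring[OF F] w] by auto
  have "k \<subseteq> fgen (?D \<union> w ` Inr ` (B \<times> {..<p}))"
    unfolding k by (intro fgen_least sfield_fgen) (auto intro: fgen_base)
  then have dep1: "ldep (fgen (?D \<union> w ` Inr ` (B \<times> {..<p}))) ?A (\<lambda>(j, i). x j * lin_ratio (\<lambda>x. x) B b0 a (\<lambda>b. w (Inl b)) ^ i)"
    by (rule ldep_mono[OF dk])
  have lM: "lin_ratio (\<lambda>x. x) B b0 a (\<lambda>b. w (Inl b)) \<in> ?M"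
    by (rule lin_ratio_in[OF sfield_sring[OF sfield_fgen]]) (auto intro: a fgen_base)
  have vM: "(case u of (j, i) \<Rightarrow> x j * lin_ratio (\<lambda>x. x) B b0 a (\<lambda>b. w (Inl b)) ^ i) \<in> ?M" if u: "u \<in> ?A" for u
  proof -
    obtain j i where ji: "u = (j, i)" "j \<in> J" using u by auto
    have "x j \<in> ?M" using x[OF ji(2)] by (intro fgen_base UnI1)
    then have "x j * lin_ratio (\<lambda>x. x) B b0 a (\<lambda>b. w (Inl b)) ^ i \<in> ?M"
      by (rule sfield_closed(5)[OF sfield_fgen _ sfield_closed(9)[OF sfield_fgen lM]])
    then show ?thesis by (simp add: ji(1))
  qed
  have "?D \<subseteq> ?M" using Fp_subset by (intro fgen_mono) auto
  then have "ldep ?D ?A (\<lambda>(j, i). x j * lin_ratio (\<lambda>x. x) B b0 a (\<lambda>b. w (Inl b)) ^ i)"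
    by (rule ldep_transcendental_descent[OF sfield_fgen sfield_fgen _ wM finA vM dep1])
  moreover have "alg_indep (\<lambda>x. x) F (Inl ` (B - {b0})) w" by (rule alg_indep_subset[OF w]) auto
  then have "alg_indep (\<lambda>x. x) F (B - {b0}) (\<lambda>b. w (Inl b))"
    using fin by (intro alg_indep_reindex[OF rhom_id F, of "B - {b0}" Inl w]) auto
  ultimately show ?thesis
    using ratio_dep_iff[OF J, of B a b0 x "\<lambda>b. w (Inl b)" q] a x by (simp add: image_image)
qed

end

section \<open>Composition at a simple root\<close>

lemma fps_linear_power:
  fixes a :: "'r::comm_ring_1"
  shows "fps_nth ((fps_const a + fps_X) ^ i) 0 = a ^ i"
    "fps_nth ((fps_const a + fps_X) ^ i) 1 = of_nat i * a ^ (i - 1)"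
proof -
  show z: "fps_nth ((fps_const a + fps_X) ^ i) 0 = a ^ i" for i
    by (induction i) (auto simp: fps_mult_nth)
  show "fps_nth ((fps_const a + fps_X) ^ i) 1 = of_nat i * a ^ (i - 1)"
  proof (induction i)
    case (Suc i)
    have "fps_nth ((fps_const a + fps_X) ^ Suc i) 1 = a * fps_nth ((fps_const a + fps_X) ^ i) 1 + fps_nth ((fps_const a + fps_X) ^ i) 0"
      by (simp add: distrib_right)
    also have "\<dots> = of_nat (Suc i) * a ^ (Suc i - 1)"
      unfolding Suc z by (cases i) (simp_all add: algebra_simps)
    finally show ?case .
  qed simp
qed

lemma coeff_pcompose_in:
  assumes L: "sring \<Lambda>" and z: "z \<in> \<Lambda>" and P: "\<And>n. coeff P n \<in> \<Lambda>"
  shows "coeff (pcompose P [:z, 1:]) n \<in> \<Lambda>"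
  using P
proof (induction P arbitrary: n)
  case 0
  then show ?case using sring_zero[OF L] by simp
next
  case (pCons a P)
  have a: "a \<in> \<Lambda>" using pCons.prems[of 0] by simp
  have "coeff P n \<in> \<Lambda>" for n using pCons.prems[of "Suc n"] by simp
  then have ih: "coeff (pcompose P [:z, 1:]) n \<in> \<Lambda>" for n by (rule pCons.IH)
  have "coeff (pcompose (pCons a P) [:z, 1:]) n =
      (if n = 0 then a else 0) + (z * coeff (pcompose P [:z, 1:]) n + (if n = 0 then 0 else coeff (pcompose P [:z, 1:]) (n - 1)))"
    by (cases n) (simp_all add: pcompose_pCons)
  also have "\<dots> \<in> \<Lambda>"
    using a ih sring_zero[OF L] by (intro sring_add[OF L] sring_mult[OF L] z) auto
  finally show ?case .
qed

context ground begin

text \<open>Elements of \<open>k[T]\<close> with \<open>T = \<alpha> + S\<close> as power series in \<open>S\<close>: since \<open>T\<^sup>p - \<alpha>\<^sup>p = S\<^sup>p\<close>,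
  the prime \<open>T\<^sup>p - \<alpha>\<^sup>p\<close> of \<open>k[T]\<close> has value \<open>p\<close>.\<close>

lemma rgen_inseparable_structure:
  fixes k :: "'o set"
  assumes k: "sring k" and \<alpha>: "\<alpha> ^ p \<in> k" and \<Lambda>: "\<Lambda> = rgen (insert (fps_const \<alpha> + fps_X) (fps_const ` k))"
    and r: "r \<in> \<Lambda>"
  shows "\<exists>s t. (\<forall>i. s i \<in> k) \<and> t \<in> \<Lambda> \<and> r = (\<Sum>i<p. fps_const (s i) * (fps_const \<alpha> + fps_X) ^ i) + fps_X ^ p * t"
proof -
  let ?T = "fps_const \<alpha> + fps_X"
  have L: "sring \<Lambda>" unfolding \<Lambda> by (rule sring_rgen)
  have ck: "fps_const x \<in> \<Lambda>" if "x \<in> k" for x using that by (auto simp: \<Lambda> intro: rgen_base)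
  have TL: "?T \<in> \<Lambda>" by (auto simp: \<Lambda> intro: rgen_base)
  have Tp: "?T ^ p = fps_const (\<alpha> ^ p) + fps_X ^ p"
    by (simp add: frobenius_add[OF pc_fps] fps_const_power)
  have XL: "fps_X ^ p \<in> \<Lambda>"
    using sring_diff[OF L sring_power[OF L TL] ck[OF \<alpha>], of p] Tp by simp
  obtain m where m: "p = Suc m" using p_pos by (cases p) auto
  define R where "R = {(\<Sum>i<p. fps_const (s i) * ?T ^ i) + fps_X ^ p * t | s t. (\<forall>i. s i \<in> k) \<and> t \<in> \<Lambda>}"
  have RI: "(\<forall>i. s i \<in> k) \<Longrightarrow> t \<in> \<Lambda> \<Longrightarrow> x = (\<Sum>i<p. fps_const (s i) * ?T ^ i) + fps_X ^ p * t \<Longrightarrow> x \<in> R" for s t x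
    unfolding R_def by blast
  have RE: "\<exists>s t. (\<forall>i. s i \<in> k) \<and> t \<in> \<Lambda> \<and> x = (\<Sum>i<p. fps_const (s i) * ?T ^ i) + fps_X ^ p * t" if "x \<in> R" for x
    using that unfolding R_def by blast
  have Rconst: "fps_const x \<in> R" if "x \<in> k" for x
  proof (rule RI)
    show "\<forall>i. (if i = 0 then x else 0) \<in> k" using that sring_zero[OF k] by auto
    have "(\<Sum>i<p. fps_const (if i = 0 then x else 0) * ?T ^ i) = (\<Sum>i<p. if i = 0 then fps_const x else 0)"
      by (intro sum.cong) auto
    then show "fps_const x = (\<Sum>i<p. fps_const (if i = 0 then x else 0) * ?T ^ i) + fps_X ^ p * 0"
      using p_pos by simp
  qed (rule sring_zero[OF L])
  have Radd: "x + y \<in> R" if xy: "x \<in> R" "y \<in> R" for x y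
  proof -
    obtain s t where s: "\<forall>i. s i \<in> k" "t \<in> \<Lambda>" "x = (\<Sum>i<p. fps_const (s i) * ?T ^ i) + fps_X ^ p * t"
      using RE[OF \<open>x \<in> R\<close>] by (elim exE conjE) (rule that)
    obtain s' t' where s': "\<forall>i. s' i \<in> k" "t' \<in> \<Lambda>" "y = (\<Sum>i<p. fps_const (s' i) * ?T ^ i) + fps_X ^ p * t'"
      using RE[OF \<open>y \<in> R\<close>] by (elim exE conjE) (rule that)
    note * = s s'
    have "(\<Sum>i<p. fps_const (s i + s' i) * ?T ^ i) = (\<Sum>i<p. fps_const (s i) * ?T ^ i) + (\<Sum>i<p. fps_const (s' i) * ?T ^ i)"
      by (simp only: fps_const_add[symmetric] distrib_right sum.distrib)
    then show ?thesis
      using * by (intro RI[of "\<lambda>i. s i + s' i" "t + t'"]) (auto intro: sring_add[OF k] sring_add[OF L] simp: distrib_left)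
  qed
  have Rscale: "fps_const c * x \<in> R" if cx: "c \<in> k" "x \<in> R" for c x
  proof -
    obtain s t where *: "\<forall>i. s i \<in> k" "t \<in> \<Lambda>" "x = (\<Sum>i<p. fps_const (s i) * ?T ^ i) + fps_X ^ p * t"
      using RE[OF \<open>x \<in> R\<close>] by (elim exE conjE) (rule that)
    have "(\<Sum>i<p. fps_const (c * s i) * ?T ^ i) = fps_const c * (\<Sum>i<p. fps_const (s i) * ?T ^ i)"
      by (simp only: fps_const_mult[symmetric] sum_distrib_left mult.assoc)
    then show ?thesis
      using * \<open>c \<in> k\<close> by (intro RI[of "\<lambda>i. c * s i" "fps_const c * t"])
        (auto intro: sring_mult[OF k] sring_mult[OF L] ck simp: distrib_left mult_ac)
  qed
  have RX: "fps_X ^ p * t \<in> R" if "t \<in> \<Lambda>" for t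
    using that sring_zero[OF k] by (intro RI[of "\<lambda>_. 0" t]) auto
  have RT: "?T * x \<in> R" if xR: "x \<in> R" for x
  proof -
    obtain s t where *: "\<forall>i. s i \<in> k" "t \<in> \<Lambda>" "x = (\<Sum>i<p. fps_const (s i) * ?T ^ i) + fps_X ^ p * t"
      using RE[OF \<open>x \<in> R\<close>] by (elim exE conjE) (rule that)
    \<comment> \<open>Multiplication by \<open>?T\<close> shifts the coefficients. The overflow
      \<open>?T ^ p\<close> splits into the constant \<open>\<alpha> ^ p\<close>, which re-enters at
      index 0, and \<open>fps_X ^ p\<close>.\<close>
    define s' where "s' i = (case i of 0 \<Rightarrow> s m * \<alpha> ^ p | Suc i \<Rightarrow> s i)" for i
    have "\<forall>i. s' i \<in> k" using *(1) sring_mult[OF k _ \<alpha>] by (auto simp: s'_def split: nat.splits)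
    moreover have "?T * t + fps_const (s m) \<in> \<Lambda>"
      using * by (intro sring_add[OF L] sring_mult[OF L] TL ck) auto
    moreover have "?T * x = (\<Sum>i<p. fps_const (s' i) * ?T ^ i) + fps_X ^ p * (?T * t + fps_const (s m))"
    proof -
      have "?T * (\<Sum>i<p. fps_const (s i) * ?T ^ i) = (\<Sum>i<m. fps_const (s i) * ?T ^ Suc i) + fps_const (s m) * ?T ^ p"
      proof -
        have "U * (\<Sum>i<Suc m. fps_const (s i) * U ^ i) = (\<Sum>i<m. fps_const (s i) * U ^ Suc i) + fps_const (s m) * U ^ Suc m" for U
          by (simp add: sum_distrib_left distrib_left mult_ac)
        then show ?thesis unfolding m .
      qed
      also have "(\<Sum>i<m. fps_const (s i) * ?T ^ Suc i) = (\<Sum>i<p. fps_const (s' i) * ?T ^ i) - fps_const (s m * \<alpha> ^ p)"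
        unfolding m sum.lessThan_Suc_shift by (simp add: s'_def m)
      finally show ?thesis unfolding *(3) Tp by (simp add: algebra_simps flip: fps_const_mult)
    qed
    ultimately show ?thesis by (rule RI)
  qed
  have RTpow: "?T ^ i * x \<in> R" if "x \<in> R" for x i
  proof (induction i)
    case (Suc i)
    then show ?case using RT[OF Suc] by (simp only: power_Suc mult.assoc)
  qed (use that in simp)
  have Rsum: "(\<Sum>i\<in>A. f i) \<in> R" if "\<And>i. i \<in> A \<Longrightarrow> f i \<in> R" for A :: "nat set" and f
    using that Rconst[OF sring_zero[OF k]] by (induction A rule: infinite_finite_induct) (auto intro: Radd)
  have Rmult: "x * y \<in> R" if xy: "x \<in> R" "y \<in> R" "y \<in> \<Lambda>" for x y
  proof -
    obtain s t where *: "\<forall>i. s i \<in> k" "t \<in> \<Lambda>" "x = (\<Sum>i<p. fps_const (s i) * ?T ^ i) + fps_X ^ p * t"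
      using RE[OF \<open>x \<in> R\<close>] by (elim exE conjE) (rule that)
    have "x * y = (\<Sum>i<p. fps_const (s i) * (?T ^ i * y)) + fps_X ^ p * (t * y)"
      unfolding *(3) by (simp only: distrib_right sum_distrib_right mult.assoc)
    also have "\<dots> \<in> R"
      using * xy(2,3) by (intro Radd Rsum Rscale RTpow RX sring_mult[OF L]) auto
    finally show ?thesis .
  qed
  have "sring (R \<inter> \<Lambda>)"
    unfolding sring_def
  proof (intro conjI ballI)
    show "1 \<in> R \<inter> \<Lambda>" using Rconst[OF sring_one[OF k]] sring_one[OF L] by simp
    fix x assume x: "x \<in> R \<inter> \<Lambda>"
    then show "- x \<in> R \<inter> \<Lambda>"
      using Rscale[OF sring_uminus[OF k sring_one[OF k]], of x] sring_uminus[OF L, of x] by (simp flip: fps_const_neg)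
    fix y assume y: "y \<in> R \<inter> \<Lambda>"
    show "x + y \<in> R \<inter> \<Lambda>" "x * y \<in> R \<inter> \<Lambda>"
      using x y Radd Rmult sring_add[OF L] sring_mult[OF L] by auto
  qed
  moreover have "?T \<in> R" using RT[OF Rconst[OF sring_one[OF k]]] by simp
  then have "insert ?T (fps_const ` k) \<subseteq> R \<inter> \<Lambda>" using Rconst ck TL by auto
  ultimately have "\<Lambda> \<subseteq> R \<inter> \<Lambda>" using rgen_least[of "insert ?T (fps_const ` k)" "R \<inter> \<Lambda>"] by (simp only: \<Lambda>[symmetric])
  then show ?thesis using r RE by blast
qed

text \<open>Near the simple root \<open>\<alpha>\<close> the polynomial is perturbed to a generic one at distance \<open>S\<^sup>p\<close>,
  so that the given dependence applies to it. As its root is simple, the powers of the local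
  parameter separate the coefficients of a normalised dependence.\<close>

theorem dep_at_simple_root:
  fixes C :: "'c set"
  assumes fin: "finite C" and d: "\<And>c. c \<in> C \<Longrightarrow> d c \<in> F" "c0 \<in> C" "d c0 \<noteq> 0"
    and K: "sfield K" "Fp \<subseteq> K" and \<alpha>: "\<alpha> ^ p \<in> K" "\<not> ldep K {..<p} (\<lambda>i. \<alpha> ^ i)"
    and w: "\<And>c i. c \<in> C \<Longrightarrow> i < p \<Longrightarrow> w c i \<in> K"
    and root: "(\<Sum>c\<in>C. \<Sum>i<p. d c * w c i * \<alpha> ^ i) = 0"
    and simple: "(\<Sum>c\<in>C. \<Sum>i<p. d c * w c i * (of_nat i * \<alpha> ^ (i - 1))) \<noteq> 0"
    and M: "sfield M" "F \<subseteq> M" "K \<subseteq> M" "\<alpha> \<in> M" and v1: "alg_indep (\<lambda>x. x) M (C - {c0}) v1"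
    and J: "finite J" and x: "\<And>j. j \<in> J \<Longrightarrow> x j \<in> F" and dep: "ratio_dep p C c0 d J x"
  shows "ldep K (J \<times> {..<p}) (\<lambda>(j, i). x j * \<alpha> ^ i)"
proof -
  let ?A = "J \<times> {..<p}" and ?C = "C - {c0}"
  define k where "k = fgen (K \<union> v1 ` ?C)"
  have kf: "sfield k" by (simp add: k_def sfield_fgen)
  have Kk: "K \<subseteq> k" by (auto simp: k_def intro: fgen_base)
  have v1k: "v1 c \<in> k" if "c \<in> ?C" for c using that by (auto simp: k_def intro: fgen_base)
  define T where "T = fps_const \<alpha> + fps_X"
  define \<Lambda> where "\<Lambda> = rgen (insert T (fps_const ` k))"
  have L: "sring \<Lambda>" unfolding \<Lambda>_def by (rule sring_rgen)
  have ck: "fps_const x \<in> \<Lambda>" if "x \<in> k" for x using that by (auto simp: \<Lambda>_def intro: rgen_base)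
  have TL: "T \<in> \<Lambda>" by (auto simp: \<Lambda>_def intro: rgen_base)
  have apk: "\<alpha> ^ p \<in> k" using \<alpha>(1) Kk by blast
  have Tp: "T ^ p = fps_const (\<alpha> ^ p) + fps_X ^ p"
    by (simp add: T_def frobenius_add[OF pc_fps] fps_const_power)
  have XL: "fps_X ^ p \<in> \<Lambda>"
    using sring_diff[OF L sring_power[OF L TL] ck[OF apk], of p] Tp by simp
  have apow: "\<not> ldep k {..<p} (\<lambda>i. \<alpha> ^ i)"
    using ldep_transcendental_descent[OF M(1) K(1) M(3) v1, of "{..<p}" "\<lambda>i. \<alpha> ^ i"] \<alpha>(2) sfield_closed(9)[OF M(1) M(4)]
    unfolding k_def by blast
  have str: "\<exists>s t. (\<forall>i. s i \<in> k) \<and> t \<in> \<Lambda> \<and> r = (\<Sum>i<p. fps_const (s i) * T ^ i) + fps_X ^ p * t" if "r \<in> \<Lambda>" for r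
    using rgen_inseparable_structure[OF sfield_sring[OF kf] apk \<Lambda>_def[unfolded T_def] that] unfolding T_def .
  have Xp0: "fps_nth (fps_X ^ p * t) n = 0" if "n < p" for t :: "'o fps" and n
    using that by (simp add: fps_X_power_mult_nth)
  have T0: "fps_nth (T ^ i) 0 = \<alpha> ^ i" and T1: "fps_nth (T ^ i) 1 = of_nat i * \<alpha> ^ (i - 1)" for i
    unfolding T_def by (rule fps_linear_power)+
  have val0: "fps_nth ((\<Sum>i<p. fps_const (s i) * T ^ i) + fps_X ^ p * t) 0 = (\<Sum>i<p. s i * \<alpha> ^ i)" for s t
    using Xp0[OF p_pos] by (simp add: fps_sum_nth T0)
  have Lval: "\<exists>s. (\<forall>i. s i \<in> k) \<and> fps_nth r 0 = (\<Sum>i<p. s i * \<alpha> ^ i)" if "r \<in> \<Lambda>" for r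
    using str[OF that] val0 by metis
  have Ldiv: "\<exists>t\<in>\<Lambda>. r = fps_X ^ p * t" if r: "r \<in> \<Lambda>" "fps_nth r 0 = 0" for r
  proof -
    obtain s t where st: "\<forall>i. s i \<in> k" "t \<in> \<Lambda>" "r = (\<Sum>i<p. fps_const (s i) * T ^ i) + fps_X ^ p * t"
      using str[OF r(1)] by blast
    have "(\<Sum>i<p. s i * \<alpha> ^ i) = 0" using r(2) unfolding st(3) val0 .
    then have "s i = 0" if "i < p" for i
      using apow ldepI[of "{..<p}" s k i "\<lambda>i. \<alpha> ^ i"] st(1) that by auto
    then have "r = fps_X ^ p * t" using st(3) by simp
    then show ?thesis using st(2) by blast
  qed
  define z where "z c = (\<Sum>i<p. fps_const (w c i) * T ^ i)" for c
  have zL: "z c \<in> \<Lambda>" if "c \<in> C" for c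
    unfolding z_def using w[OF that] Kk
    by (intro sring_sum[OF L] sring_mult[OF L] sring_power[OF L] TL ck) auto
  \<comment> \<open>Coordinates that agree with \<open>z c\<close> up to \<open>fps_X ^ p\<close>
    and are independent over \<open>F\<close> thanks to the transcendentals
    \<open>v1\<close>.\<close>
  define v where "v c = z c + fps_X ^ p * fps_const (v1 c)" for c
  have vL: "v c \<in> \<Lambda>" if "c \<in> ?C" for c
    unfolding v_def using that by (intro sring_add[OF L] sring_mult[OF L] zL XL ck v1k) auto
  have vind: "alg_indep fps_const F ?C v"
  proof -
    let ?I = "insert None (Some ` ?C)"
    have "alg_indep fps_const M ?I (case_option fps_X v)"
    proof (rule alg_indep_generators'[OF rhom_fps_const M(1) _ _ refl alg_indep_fps[OF v1 sfield_sring[OF M(1)]]])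
      show "finite ?I" using fin by simp
      then show "finite ?I" .
      define G where "G = rgen (fps_const ` M \<union> case_option fps_X v ` ?I)"
      have Gr: "sring G" by (simp add: G_def sring_rgen)
      have XG: "fps_X \<in> G" unfolding G_def by (rule rgen_base) force
      have MG: "fps_const c \<in> G" if "c \<in> M" for c using that by (auto simp: G_def intro: rgen_base)
      have vG: "v c \<in> G" if "c \<in> ?C" for c unfolding G_def using that by (intro rgen_base) force
      have TG: "T \<in> G" unfolding T_def by (intro sring_add[OF Gr] MG M(4) XG)
      have zG: "z c \<in> G" if "c \<in> C" for c
        unfolding z_def using w[OF that] M(3)
        by (intro sring_sum[OF Gr] sring_mult[OF Gr] sring_power[OF Gr] TG MG) auto
      fix i assume i: "i \<in> ?I"
      show "\<exists>A B. A \<in> rgen (fps_const ` M \<union> case_option fps_X v ` ?I) \<and> B \<in> rgen (fps_const ` M \<union> case_option fps_X v ` ?I) \<and>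
          B \<noteq> 0 \<and> B * case_option fps_X (\<lambda>i. fps_const (v1 i)) i = A"
        unfolding G_def[symmetric]
      proof (cases i)
        case None
        then show "\<exists>A B. A \<in> G \<and> B \<in> G \<and> B \<noteq> 0 \<and> B * case_option fps_X (\<lambda>i. fps_const (v1 i)) i = A"
          using XG sring_one[OF Gr] by (intro exI[of _ fps_X] exI[of _ 1]) auto
      next
        case (Some c)
        then have c: "c \<in> ?C" using i by auto
        have "v c - z c \<in> G" using c by (intro sring_diff[OF Gr] vG zG) auto
        moreover have "fps_X ^ p * fps_const (v1 c) = v c - z c" by (simp add: v_def)
        ultimately show "\<exists>A B. A \<in> G \<and> B \<in> G \<and> B \<noteq> 0 \<and> B * case_option fps_X (\<lambda>i. fps_const (v1 i)) i = A"
          using Some sring_power[OF Gr XG, of p] by (intro exI[of _ "v c - z c"] exI[of _ "fps_X ^ p"]) auto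
      qed
    qed
    then have "alg_indep fps_const F (Some ` ?C) (case_option fps_X v)"
      by (rule alg_indep_subset) (use M(2) in auto)
    then have "alg_indep fps_const F ?C (\<lambda>c. case_option fps_X v (Some c))"
      using fin by (intro alg_indep_reindex[OF rhom_fps_const F, of ?C Some "case_option fps_X v"]) auto
    then show ?thesis by simp
  qed
  define \<gamma> where "\<gamma> = lin_ratio fps_const C c0 d v"
  \<comment> \<open>The coordinates other than \<open>c0\<close> are prescribed, so the one at
    \<open>c0\<close> is \<gamma> in place of \<open>z c0\<close>. The error \<omega> has order
    exactly one: up to a constant factor it is \<open>W\<close> modulo \<open>fps_X ^ p\<close>, and
    \<open>W\<close> has a simple zero.\<close>
  define \<omega> where "\<omega> = \<gamma> - z c0"
  define W where "W = (\<Sum>c\<in>C. fps_const (d c) * z c)"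
  define V where "V = (\<Sum>c\<in>?C. fps_const (d c) * fps_const (v1 c))"
  have dw: "fps_const (d c0) * \<omega> = - (W + fps_X ^ p * V)"
  proof -
    have dc: "fps_const (d c0) * (fps_const (d c / d c0) * v c) = fps_const (d c) * v c" for c
      using d(3) by (simp add: mult.assoc[symmetric])
    have "fps_const (d c0) * \<gamma> = - (\<Sum>c\<in>?C. fps_const (d c) * v c)"
      by (simp only: \<gamma>_def lin_ratio_def mult_minus_right sum_distrib_left dc)
    also have "(\<Sum>c\<in>?C. fps_const (d c) * v c) = (\<Sum>c\<in>?C. fps_const (d c) * z c) + fps_X ^ p * V"
      by (simp only: v_def V_def distrib_left sum.distrib sum_distrib_left mult_ac)
    finally have "fps_const (d c0) * \<gamma> = - ((\<Sum>c\<in>?C. fps_const (d c) * z c) + fps_X ^ p * V)" .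
    moreover have "W = fps_const (d c0) * z c0 + (\<Sum>c\<in>?C. fps_const (d c) * z c)"
      unfolding W_def using fin d(2) by (simp add: sum.remove)
    ultimately show ?thesis by (simp add: \<omega>_def algebra_simps)
  qed
  have W0: "fps_nth W 0 = 0"
    using root by (simp add: W_def z_def fps_sum_nth T0 sum_distrib_left mult.assoc)
  have W1: "fps_nth W 1 \<noteq> 0"
    using simple by (simp add: W_def z_def fps_sum_nth T1[unfolded One_nat_def] sum_distrib_left mult.assoc)
  have p1: "1 < p" using p_ge_2 by simp
  have w0: "fps_nth \<omega> 0 = 0"
    using arg_cong[OF dw, of "\<lambda>f. fps_nth f 0"] d(3) W0 Xp0[OF p_pos, of V] p_pos by simp
  have "d c0 * fps_nth \<omega> 1 = - fps_nth W 1"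
    using arg_cong[OF dw, of "\<lambda>f. fps_nth f 1"] Xp0[OF p1] by simp
  then have w1: "fps_nth \<omega> 1 \<noteq> 0" using W1 by auto
  define \<omega>1 where "\<omega>1 = fps_shift 1 \<omega>"
  have wX: "\<omega> = fps_X * \<omega>1"
    by (rule fps_ext) (use w0 in \<open>auto simp: \<omega>1_def\<close>)
  obtain r u0 where r: "\<forall>u\<in>?A. r u \<in> mpolys Fp ?C" "u0 \<in> ?A" "r u0 \<noteq> 0"
    "(\<Sum>u\<in>?A. r u * const_poly (x (fst u)) * lin_ratio const_poly C c0 d var_poly ^ snd u) = 0"
    using dep by (rule ratio_depE)
  define \<rho> where "\<rho> u = meval fps_const v (r u)" for u
  have rhoL: "\<rho> u \<in> \<Lambda>" if "u \<in> ?A" for u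
  proof -
    have "\<rho> u \<in> rgen (fps_const ` Fp \<union> v ` ?C)"
      unfolding \<rho>_def by (rule meval_in_rgen[OF rhom_fps_const bspec[OF r(1) that]])
    also have "\<dots> \<subseteq> \<Lambda>" using K(2) Kk ck vL by (intro rgen_least L) auto
    finally show ?thesis .
  qed
  have rho0: "\<rho> u0 \<noteq> 0"
    unfolding \<rho>_def using alg_indepD[OF vind subsetD[OF mpolys_mono[OF Fp_subset order_refl] bspec[OF r(1) r(2)]]] r(3) by blast
  have rel: "(\<Sum>u\<in>?A. \<rho> u * fps_const (x (fst u)) * \<gamma> ^ snd u) = 0"
  proof -
    have "0 = meval fps_const v (\<Sum>u\<in>?A. r u * const_poly (x (fst u)) * lin_ratio const_poly C c0 d var_poly ^ snd u)"
      unfolding r(4) rhom.meval_0[OF rhom_fps_const] ..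
    also have "\<dots> = (\<Sum>u\<in>?A. \<rho> u * fps_const (x (fst u)) * \<gamma> ^ snd u)"
      unfolding rhom.meval_sum[OF rhom_fps_const] rhom.meval_mult[OF rhom_fps_const] rhom.meval_const[OF rhom_fps_const]
        rhom.meval_power[OF rhom_fps_const] meval_lin_ratio[OF rhom_fps_const] \<rho>_def \<gamma>_def ..
    finally show ?thesis by simp
  qed
  define P where "P j = (\<Sum>i<p. monom (\<rho> (j, i)) i)" for j
  \<comment> \<open>Taylor expansion at \<open>z c0\<close>: powers of \<gamma> become powers of
    \<omega>, and the coefficients stay in \<Lambda>.\<close>
  define Q where "Q j = pcompose (P j) [:z c0, 1:]" for j
  have cP: "coeff (P j) n = (if n < p then \<rho> (j, n) else 0)" for j n
    by (simp add: P_def coeff_sum)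
  have degQ: "degree (Q j) < p" for j
  proof -
    have "degree (P j) \<le> p - 1" by (rule degree_le) (use p_pos in \<open>auto simp: cP\<close>)
    then show ?thesis using p_pos by (simp add: Q_def degree_pcompose)
  qed
  have cQ: "coeff (Q j) n \<in> \<Lambda>" if "j \<in> J" for j n
    unfolding Q_def using rhoL that sring_zero[OF L]
    by (intro coeff_pcompose_in[OF L zL[OF d(2)]]) (auto simp: cP)
  have Qval: "(\<Sum>i<p. coeff (Q j) i * \<omega> ^ i) = (\<Sum>i<p. \<rho> (j, i) * \<gamma> ^ i)" for j
  proof -
    have "(\<Sum>i<p. coeff (Q j) i * \<omega> ^ i) = poly (Q j) \<omega>"
      unfolding poly_altdef using degQ[of j]
      by (intro sum.mono_neutral_right) (auto simp: coeff_eq_0)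
    also have "\<dots> = poly (P j) \<gamma>" by (simp add: Q_def poly_pcompose \<omega>_def)
    also have "\<dots> = (\<Sum>i<p. \<rho> (j, i) * \<gamma> ^ i)" by (simp add: P_def poly_sum poly_monom)
    finally show ?thesis .
  qed
  obtain j0 i1 where u0: "u0 = (j0, i1)" "j0 \<in> J" "i1 < p" using r(2) by auto
  have "P j0 \<noteq> 0"
  proof
    assume "P j0 = 0"
    then show False using cP[of j0 i1] u0 rho0 by simp
  qed
  then have "Q j0 \<noteq> 0" unfolding Q_def using pcompose_eq_0[of "P j0" "[:z c0, 1:]"] by auto
  then have lead: "coeff (Q j0) (degree (Q j0)) \<noteq> 0" by simp
  define c where "c u = (case u of (j, i) \<Rightarrow> coeff (Q j) i)" for u
  have "\<exists>e c'. (\<forall>u\<in>?A. c' u \<in> \<Lambda> \<and> c u = (fps_X ^ p) ^ e * c' u) \<and> (\<exists>u\<in>?A. fps_nth (c' u) 0 \<noteq> 0)"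
  proof (rule normalise_family[where l = "(j0, degree (Q j0))"])
    show "fps_nth ((fps_X :: 'o fps) ^ p) 0 = 0" using p_pos by simp
    show "(fps_X :: 'o fps) ^ p \<noteq> 0" by simp
    show "\<exists>s\<in>\<Lambda>. r = fps_X ^ p * s" if "r \<in> \<Lambda>" "fps_nth r 0 = 0" for r using Ldiv that by blast
    show "c u \<in> \<Lambda>" if "u \<in> ?A" for u using that cQ by (auto simp: c_def)
    show "(j0, degree (Q j0)) \<in> ?A" using u0 degQ by auto
    show "c (j0, degree (Q j0)) \<noteq> 0" using lead by (simp add: c_def)
  qed
  then obtain e c' where c': "\<forall>u\<in>?A. c' u \<in> \<Lambda> \<and> c u = (fps_X ^ p) ^ e * c' u" "\<exists>u\<in>?A. fps_nth (c' u) 0 \<noteq> 0"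
    by blast
  have rel2: "(\<Sum>j\<in>J. \<Sum>i<p. c' (j, i) * (fps_const (x j) * \<omega> ^ i)) = 0"
  proof -
    have "0 = (\<Sum>j\<in>J. fps_const (x j) * (\<Sum>i<p. \<rho> (j, i) * \<gamma> ^ i))"
      using rel by (simp add: sum.cartesian_product' sum_distrib_left mult_ac)
    also have "\<dots> = (\<Sum>j\<in>J. fps_const (x j) * (\<Sum>i<p. coeff (Q j) i * \<omega> ^ i))" by (simp only: Qval)
    also have "\<dots> = (fps_X ^ p) ^ e * (\<Sum>j\<in>J. \<Sum>i<p. c' (j, i) * (fps_const (x j) * \<omega> ^ i))"
      unfolding sum_distrib_left
    proof (intro sum.cong refl)
      fix j i assume "j \<in> J" "i \<in> {..<p}"
      then have "coeff (Q j) i = (fps_X ^ p) ^ e * c' (j, i)" using c'(1) by (auto simp: c_def)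
      then show "fps_const (x j) * (coeff (Q j) i * \<omega> ^ i) = (fps_X ^ p) ^ e * (c' (j, i) * (fps_const (x j) * \<omega> ^ i))"
        by (simp only: mult_ac)
    qed
    finally show ?thesis by simp
  qed
  \<comment> \<open>Coefficients with index below \<open>i0\<close> have no constant term and are
    thus divisible by \<open>fps_X ^ p\<close>, while \<open>\<omega> ^ i\<close> with
    \<open>i > i0\<close> has order above \<open>i0\<close>. So the coefficient of
    \<open>fps_X ^ i0\<close> sees the index \<open>i0\<close> alone.\<close>
  define i0 where "i0 = (LEAST i. i < p \<and> (\<exists>j\<in>J. fps_nth (c' (j, i)) 0 \<noteq> 0))"
  have ex: "\<exists>i. i < p \<and> (\<exists>j\<in>J. fps_nth (c' (j, i)) 0 \<noteq> 0)" using c'(2) by auto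
  have i0: "i0 < p" "\<exists>j\<in>J. fps_nth (c' (j, i0)) 0 \<noteq> 0"
    using LeastI_ex[OF ex] by (auto simp: i0_def)
  have below: "fps_nth (c' (j, i)) 0 = 0" if "i < i0" "j \<in> J" for i j
    using not_less_Least[of i "\<lambda>i. i < p \<and> (\<exists>j\<in>J. fps_nth (c' (j, i)) 0 \<noteq> 0)"] that i0(1) by (auto simp: i0_def)
  have nth: "fps_nth (c' (j, i) * (fps_const (x j) * \<omega> ^ i)) i0 =
      (if i = i0 then fps_nth (c' (j, i0)) 0 * x j * fps_nth \<omega>1 0 ^ i0 else 0)" if ji: "j \<in> J" "i < p" for j i
  proof -
    have pull: "c' (j, i) * (fps_const (x j) * \<omega> ^ i) = fps_X ^ i * (c' (j, i) * fps_const (x j) * \<omega>1 ^ i)"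
      by (simp add: wX power_mult_distrib mult_ac)
    consider "i < i0" | "i = i0" | "i > i0" by linarith
    then show ?thesis
    proof cases
      case 1
      have "c' (j, i) \<in> \<Lambda>" using c'(1) ji by auto
      then obtain t where t: "c' (j, i) = fps_X ^ p * t" using Ldiv below[OF 1 ji(1)] by blast
      have "c' (j, i) * (fps_const (x j) * \<omega> ^ i) = fps_X ^ p * (t * (fps_const (x j) * \<omega> ^ i))"
        unfolding t by (simp only: mult.assoc)
      then have "fps_nth (c' (j, i) * (fps_const (x j) * \<omega> ^ i)) i0 = 0" by (simp only: Xp0[OF i0(1)])
      moreover have "i \<noteq> i0" using 1 by simp
      ultimately show ?thesis by (simp only: if_False)
    next
      case 2
      then show ?thesis unfolding pull by (simp add: fps_X_power_mult_nth fps_power_zeroth)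
    next
      case 3
      then show ?thesis unfolding pull by (simp add: fps_X_power_mult_nth)
    qed
  qed
  have "0 = fps_nth (\<Sum>j\<in>J. \<Sum>i<p. c' (j, i) * (fps_const (x j) * \<omega> ^ i)) i0" unfolding rel2 by simp
  also have "\<dots> = (\<Sum>j\<in>J. \<Sum>i<p. if i = i0 then fps_nth (c' (j, i0)) 0 * x j * fps_nth \<omega>1 0 ^ i0 else 0)"
    unfolding fps_sum_nth by (intro sum.cong refl nth) auto
  also have "\<dots> = (\<Sum>j\<in>J. fps_nth (c' (j, i0)) 0 * x j) * fps_nth \<omega>1 0 ^ i0"
    using i0(1) by (simp add: sum_distrib_right)
  finally have fin0: "(\<Sum>j\<in>J. fps_nth (c' (j, i0)) 0 * x j) = 0" using w1 by (simp add: \<omega>1_def)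
  have "\<forall>j\<in>J. \<exists>s. (\<forall>i. s i \<in> k) \<and> fps_nth (c' (j, i0)) 0 = (\<Sum>i<p. s i * \<alpha> ^ i)"
    using Lval c'(1) i0(1) by auto
  then obtain s where s: "\<And>j i. j \<in> J \<Longrightarrow> s j i \<in> k" "\<And>j. j \<in> J \<Longrightarrow> fps_nth (c' (j, i0)) 0 = (\<Sum>i<p. s j i * \<alpha> ^ i)"
    by metis
  obtain j where j: "j \<in> J" "fps_nth (c' (j, i0)) 0 \<noteq> 0" using i0(2) by blast
  have "\<exists>i<p. s j i \<noteq> 0"
  proof (rule ccontr)
    assume "\<not> ?thesis"
    then have "(\<Sum>i<p. s j i * \<alpha> ^ i) = 0" by (intro sum.neutral) auto
    then show False using j s(2) by simp
  qed
  then obtain i where i: "i < p" "s j i \<noteq> 0" by blast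
  have "(\<Sum>u\<in>?A. (case u of (j, i) \<Rightarrow> s j i) * (case u of (j, i) \<Rightarrow> x j * \<alpha> ^ i)) = 0"
    using fin0 by (simp add: sum.cartesian_product' s(2) sum_distrib_left mult_ac)
  then have dk: "ldep (fgen (K \<union> v1 ` ?C)) ?A (\<lambda>(j, i). x j * \<alpha> ^ i)"
    using i j(1) s(1) unfolding k_def[symmetric]
    by (intro ldepI[of ?A "\<lambda>(j, i). s j i" k "(j, i)"]) auto
  have finA: "finite ?A" using J by simp
  have "(case u of (j, i) \<Rightarrow> x j * \<alpha> ^ i) \<in> M" if "u \<in> ?A" for u
    using that x M(2) by (auto intro!: sfield_closed(5)[OF M(1)] sfield_closed(9)[OF M(1)] M(4))
  from ldep_transcendental_descent[OF M(1) K(1) M(3) v1 finA this dk]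
  show ?thesis .
qed

end

section \<open>Comparison of ranks\<close>

text \<open>The inequality follows from the case of equal cardinalities: a family \<open>z\<close>
  that is too small is padded with zeros, and the padded family would have to be
  independent.\<close>

lemma alg_indep_card:
  fixes X :: "'i \<Rightarrow> 'o::field" and z :: "'k \<Rightarrow> 'o"
  assumes M: "sfield M" and fin: "finite I" "finite K" and X: "alg_indep (\<lambda>x. x) M I X"
    and gen: "\<And>i. i \<in> I \<Longrightarrow> X i \<in> fgen (M \<union> z ` K)"
  shows "card I \<le> card K" "card I = card K \<Longrightarrow> alg_indep (\<lambda>x. x) M K z"
proof -
  have frac: "\<exists>A B. A \<in> rgen (M \<union> G) \<and> B \<in> rgen (M \<union> G) \<and> B \<noteq> 0 \<and> B * X i = A"
    if "z ` K \<subseteq> G" "i \<in> I" for G i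
  proof -
    have "X i \<in> fgen (M \<union> G)" using gen[OF that(2)] fgen_mono[of "M \<union> z ` K" "M \<union> G"] that(1) by auto
    then obtain A B where "A \<in> rgen (M \<union> G)" "B \<in> rgen (M \<union> G)" "B \<noteq> 0" "X i = A / B"
      by (rule fgen_fraction)
    then show ?thesis by (intro exI[of _ A] exI[of _ B]) auto
  qed
  show "alg_indep (\<lambda>x. x) M K z" if "card I = card K"
    using frac[of "z ` K"] by (intro alg_indep_generators'[OF rhom_id M fin that X]) auto
  show "card I \<le> card K"
  proof (rule ccontr)
    assume "\<not> ?thesis"
    define n where "n = card I - card K"
    have n: "n > 0" "card I = card K + n" using \<open>\<not> card I \<le> card K\<close> by (auto simp: n_def)
    define K' :: "('k + nat) set" where "K' = Inl ` K \<union> Inr ` {..<n}"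
    define z' :: "'k + nat \<Rightarrow> 'o" where "z' = case_sum z (\<lambda>_. 0)"
    have "card K' = card I"
      unfolding K'_def n(2) using fin by (subst card_Un_disjoint) (auto simp: card_image)
    moreover have "finite K'" using fin by (simp add: K'_def)
    moreover have "z ` K \<subseteq> z' ` K'" by (force simp: K'_def z'_def)
    ultimately have "alg_indep (\<lambda>x. x) M K' z'"
      using frac[of "z' ` K'"] by (intro alg_indep_generators'[OF rhom_id M fin(1) _ _ X]) auto
    then have "(\<Sum>i\<in>{Inr 0}. 1 * z' i) \<noteq> 0"
      using n(1) by (intro alg_indep_linear[OF _ sfield_sring[OF M]]) (auto simp: K'_def intro: sfield_closed(1)[OF M])
    then show False by (simp add: z'_def)
  qed
qed

text \<open>The Euclidean algorithm for the polynomial and \<open>T ^ p - \<alpha> ^ p\<close> ends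
  with a multiple of \<open>T - \<alpha>\<close>; for \<open>p = 2\<close> and \<open>p = 3\<close>
  the outcome is written down directly.\<close>

lemma root_in_field:
  fixes \<alpha> :: "'o::field"
  assumes p: "p = 2 \<or> p = 3" "CHAR('o) = p" and R: "sfield R" and u: "\<And>i. i < p \<Longrightarrow> u i \<in> R" and \<alpha>: "\<alpha> ^ p \<in> R"
    and root: "(\<Sum>i<p. u i * \<alpha> ^ i) = 0" and simple: "(\<Sum>i<p. u i * (of_nat i * \<alpha> ^ (i - 1))) \<noteq> 0"
  shows "\<alpha> \<in> R"
proof (cases "p = 2")
  case True
  then have r: "u 0 + u 1 * \<alpha> = 0" and s: "u 1 \<noteq> 0" using root simple by (auto simp: numeral_2_eq_2)
  have "\<alpha> = - u 0 / u 1" using r s by (simp add: field_simps eq_neg_iff_add_eq_0)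
  then show ?thesis using u True sfield_divide[OF R sfield_closed(3)[OF R u[of 0]] u[of 1]] by simp
next
  case False
  then have p3: "p = 3" using p by simp
  then have r: "u 0 + u 1 * \<alpha> + u 2 * \<alpha> ^ 2 = 0" and s: "u 1 + u 2 * (2 * \<alpha>) \<noteq> 0"
    using root simple by (auto simp: numeral_3_eq_3 numeral_2_eq_2)
  have three: "(3::'o) = 0" using of_nat_CHAR[where 'a = 'o] p p3 by simp
  have u0: "u 0 = - (u 1 * \<alpha>) - u 2 * \<alpha> ^ 2" using r by (simp add: algebra_simps eq_neg_iff_add_eq_0)
  \<comment> \<open>Modulo 3 this is the discriminant \<open>u 1 ^ 2 - 4 * u 0 * u 2\<close>, which
    is the square of the derivative at the root.\<close>
  define e where "e = u 1 ^ 2 - u 0 * u 2"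
  have "(u 1 + u 2 * (2 * \<alpha>)) ^ 2 = e + 3 * (u 1 * u 2 * \<alpha> + (u 2 * \<alpha>) ^ 2)"
    unfolding e_def u0 by (simp add: power2_eq_square algebra_simps)
  then have e: "e \<noteq> 0" using s three by auto
  have "e * \<alpha> = u 2 ^ 2 * \<alpha> ^ 3 - u 0 * u 1"
    unfolding e_def u0 by (simp add: power2_eq_square power3_eq_cube algebra_simps)
  then have "\<alpha> = (u 2 ^ 2 * \<alpha> ^ 3 - u 0 * u 1) / e" using e by (simp add: nonzero_eq_divide_eq mult.commute)
  moreover have uR: "u 0 \<in> R" "u 1 \<in> R" "u 2 \<in> R" using u p3 by auto
  have "e \<in> R"
    unfolding e_def by (rule sfield_closed(6)[OF R sfield_closed(9)[OF R uR(2)] sfield_closed(5)[OF R uR(1,3)]])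
  then have "(u 2 ^ 2 * \<alpha> ^ 3 - u 0 * u 1) / e \<in> R"
    by (rule sfield_closed(12)[OF R sfield_closed(6)[OF R sfield_closed(5)[OF R sfield_closed(9)[OF R uR(3)] \<alpha>[unfolded p3]]
        sfield_closed(5)[OF R uR(1,2)]]])
  ultimately show ?thesis by simp
qed

text \<open>The argument breaks down for \<open>p \<ge> 5\<close>: a polynomial of degree at most \<open>2\<close> with the double
  root \<open>\<alpha>\<close> is \<open>u (T - \<alpha>)\<^sup>2\<close>, and for \<open>p = 3\<close> the coefficients of \<open>u (T - \<alpha>)\<close> are, up to units of the
  prime field, among those of \<open>u (T - \<alpha>)\<^sup>2\<close>.\<close>

lemma simple_root_exists:
  fixes \<alpha> :: "'o::field" and d :: "'c \<Rightarrow> 'o"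
  assumes p: "p = 2 \<or> p = 3" "CHAR('o) = p" and K: "sfield K" and C: "finite C"
    and ind: "\<not> ldep K C d" and dep: "ldep K (C \<times> {..<p}) (\<lambda>(c, i). d c * \<alpha> ^ i)"
  shows "\<exists>w. (\<forall>c\<in>C. \<forall>i<p. w c i \<in> K) \<and> (\<Sum>c\<in>C. \<Sum>i<p. d c * w c i * \<alpha> ^ i) = 0 \<and>
    (\<Sum>c\<in>C. \<Sum>i<p. d c * w c i * (of_nat i * \<alpha> ^ (i - 1))) \<noteq> 0"
proof -
  obtain s v where s: "\<forall>v\<in>C \<times> {..<p}. s v \<in> K" "v \<in> C \<times> {..<p}" "s v \<noteq> 0"
    "(\<Sum>v\<in>C \<times> {..<p}. s v * (case v of (c, i) \<Rightarrow> d c * \<alpha> ^ i)) = 0"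
    using dep by (rule ldepE)
  define w where "w c i = s (c, i)" for c i
  obtain c1 i1 where v: "v = (c1, i1)" "c1 \<in> C" "i1 < p" using s(2) by auto
  have wK: "w c i \<in> K" if "c \<in> C" "i < p" for c i using s(1) that by (auto simp: w_def)
  define U where "U i = (\<Sum>c\<in>C. d c * w c i)" for i
  have colsum: "(\<Sum>c\<in>C. \<Sum>i<p. d c * w' c i * g i) = (\<Sum>i<p. (\<Sum>c\<in>C. d c * w' c i) * g i)" for w' :: "'c \<Rightarrow> nat \<Rightarrow> 'o" and g
    by (subst sum.swap) (simp add: sum_distrib_right)
  have root: "(\<Sum>i<p. U i * \<alpha> ^ i) = 0"
  proof -
    have "(\<Sum>i<p. U i * \<alpha> ^ i) = (\<Sum>c\<in>C. \<Sum>i<p. d c * w c i * \<alpha> ^ i)"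
      unfolding U_def by (rule colsum[symmetric])
    also have "\<dots> = 0" using s(4) by (simp add: sum.cartesian_product' w_def mult_ac)
    finally show ?thesis .
  qed
  have U0: "\<not> (\<forall>i<p. U i = 0)"
  proof
    assume "\<forall>i<p. U i = 0"
    then have "(\<Sum>c\<in>C. w c i1 * d c) = 0" using v(3) by (simp add: U_def mult.commute)
    then have "ldep K C d" using wK v s(3) by (intro ldepI[of C "\<lambda>c. w c i1" K c1]) (auto simp: w_def)
    with ind show False by contradiction
  qed
  show ?thesis
  proof (cases "(\<Sum>i<p. U i * (of_nat i * \<alpha> ^ (i - 1))) = 0")
    case False
    then show ?thesis using wK root by (intro exI[of _ w]) (simp add: colsum U_def[symmetric])
  next
    case True
    have p3: "p = 3"
    proof (rule ccontr)
      assume "p \<noteq> 3"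
      then have "p = 2" using p by simp
      moreover from this have "U 1 = 0" using True by (simp add: numeral_2_eq_2)
      moreover have "U 0 + U 1 * \<alpha> = 0" using root \<open>p = 2\<close> by (simp add: numeral_2_eq_2)
      ultimately have "\<forall>i<p. U i = 0" by (auto simp: numeral_2_eq_2 less_Suc_eq)
      with U0 show False by contradiction
    qed
    have three: "(3::'o) = 0" using of_nat_CHAR[where 'a = 'o] p p3 by simp
    have r: "U 0 + U 1 * \<alpha> + U 2 * \<alpha> ^ 2 = 0" and d2: "U 1 + U 2 * (2 * \<alpha>) = 0"
      using root True p3 by (auto simp: numeral_3_eq_3 numeral_2_eq_2)
    have "U 1 = U 2 * \<alpha> - 3 * (U 2 * \<alpha>)" using d2 by (simp add: algebra_simps eq_neg_iff_add_eq_0)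
    then have U1: "U 1 = U 2 * \<alpha>" using three by simp
    have U2: "U 2 \<noteq> 0"
    proof
      assume "U 2 = 0"
      moreover from this have "U 1 = 0" using U1 by simp
      moreover from calculation have "U 0 = 0" using r by simp
      ultimately have "\<forall>i<p. U i = 0" unfolding p3 by (auto simp: numeral_3_eq_3 numeral_2_eq_2 less_Suc_eq)
      with U0 show False by contradiction
    qed
    define w' where "w' c i = (if i = 0 then - w c 1 else if i = 1 then w c 2 else 0)" for c and i :: nat
    have w0: "(\<Sum>c\<in>C. d c * w' c 0) = - U 1" and w1: "(\<Sum>c\<in>C. d c * w' c 1) = U 2" and w2: "(\<Sum>c\<in>C. d c * w' c 2) = 0"
      by (simp_all add: w'_def U_def sum_negf)
    have "w' c i \<in> K" if "c \<in> C" for c i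
      using wK[OF that] p3 by (auto simp: w'_def intro: sfield_closed[OF K])
    moreover have "(\<Sum>i<p. (\<Sum>c\<in>C. d c * w' c i) * \<alpha> ^ i) = 0"
      unfolding p3 using w0 w1[unfolded One_nat_def] w2[unfolded numeral_2_eq_2] U1
      by (simp add: numeral_3_eq_3)
    moreover have "(\<Sum>i<p. (\<Sum>c\<in>C. d c * w' c i) * (of_nat i * \<alpha> ^ (i - 1))) \<noteq> 0"
      unfolding p3 using w0 w1[unfolded One_nat_def] w2[unfolded numeral_2_eq_2] U2
      by (simp add: numeral_3_eq_3)
    ultimately show ?thesis by (intro exI[of _ w']) (simp add: colsum)
  qed
qed

context ground begin

text \<open>For \<open>q = 1\<close> the ratio does not occur, and independent coordinates alone
  create no dependence between elements of \<open>F\<close>.\<close>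

lemma ratio_dep_1_descent:
  assumes fin: "finite B" "finite J" and a: "\<And>b. b \<in> B \<Longrightarrow> a b \<in> F" "b0 \<in> B" and x: "\<And>j. j \<in> J \<Longrightarrow> x j \<in> F"
    and dep: "ratio_dep 1 B b0 a J x"
  shows "ldep Fp J x"
proof -
  obtain y :: "'a \<Rightarrow> 'o" where y: "alg_indep (\<lambda>x. x) F (B - {b0}) y"
    using fresh[of "B - {b0}"] fin(1) by auto
  have "ldep (fgen (Fp \<union> y ` (B - {b0}))) (J \<times> {..<1}) (\<lambda>(j, i). x j * lin_ratio (\<lambda>x. x) B b0 a y ^ i)"
    using ratio_dep_iff[of J B a b0 x y 1] fin(2) a x y dep by blast
  then have "ldep Fp (J \<times> {..<1}) (\<lambda>(j, i). x j * lin_ratio (\<lambda>x. x) B b0 a y ^ i)"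
    by (rule ldep_transcendental_descent[OF F sfield_Fp Fp_subset y, rotated 2]) (use fin(2) x in auto)
  then obtain c u where c: "\<forall>u\<in>J \<times> {..<1}. c u \<in> Fp" "u \<in> J \<times> {..<1}" "c u \<noteq> 0"
    "(\<Sum>u\<in>J \<times> {..<1}. c u * (case u of (j, i) \<Rightarrow> x j * lin_ratio (\<lambda>x. x) B b0 a y ^ i)) = 0"
    by (rule ldepE)
  have "(\<Sum>j\<in>J. c (j, 0) * x j) = 0" using c(4) by (simp add: sum.cartesian_product')
  then show ?thesis using c(1-3) by (intro ldepI[of J "\<lambda>j. c (j, 0)" Fp "fst u"]) auto
qed

text \<open>For the single vector 1 the relation would make the powers of the ratio below
  \<open>p\<close> dependent over \<open>Fp(y)\<close>, but the ratio has degree \<open>p\<close>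
  over this field.\<close>

lemma not_ratio_dep_one:
  assumes p: "p = 2 \<or> p = 3"
    and fin: "finite B" and a: "\<And>b. b \<in> B \<Longrightarrow> a b \<in> F" "b0 \<in> B" and B: "card B \<ge> 2" and ind: "\<not> ldep Fp B a"
  shows "\<not> ratio_dep p B b0 a {()} (\<lambda>_. 1)"
proof
  assume dep: "ratio_dep p B b0 a {()} (\<lambda>_. 1)"
  obtain y :: "'a \<Rightarrow> 'o" where y: "alg_indep (\<lambda>x. x) F (B - {b0}) y"
    using fresh[of "B - {b0}"] fin(1) by auto
  let ?g = "lin_ratio (\<lambda>x. x) B b0 a y" and ?K = "fgen (Fp \<union> y ` (B - {b0}))"
  have "ldep ?K ({()} \<times> {..<p}) (\<lambda>(j, i). 1 * ?g ^ i)"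
    using ratio_dep_iff[of "{()}" B a b0 "\<lambda>_. 1" y p] a y dep sfield_closed(1)[OF F] by auto
  then obtain c u where c: "\<forall>u\<in>{()} \<times> {..<p}. c u \<in> ?K" "u \<in> {()} \<times> {..<p}" "c u \<noteq> 0"
    "(\<Sum>u\<in>{()} \<times> {..<p}. c u * (case u of (j, i) \<Rightarrow> 1 * ?g ^ i)) = 0"
    by (rule ldepE)
  have "(\<Sum>i<p. c ((), i) * ?g ^ i) = 0" using c(4) by (simp add: sum.cartesian_product')
  then have "ldep ?K {..<p} (\<lambda>i. ?g ^ i)" using c(1-3) by (intro ldepI[of _ "\<lambda>i. c ((), i)" ?K "snd u"]) auto
  moreover have "?g \<notin> ?K" by (rule lin_ratio_not_in[OF fin a B ind y])
  moreover have "?g ^ p \<in> ?K" using lin_ratio_power_in[of B a b0 y] a rgen_subset_fgen by blast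
  ultimately show False using not_ldep_powers[OF p char_p sfield_fgen] by blast
qed

lemma remaining_coord:
  fixes B :: "'b set"
  assumes fin: "finite B" and a: "\<And>b. b \<in> B \<Longrightarrow> a b \<in> F" "b0 \<in> B" "a b0 \<noteq> 0"
    and rel: "(\<Sum>b\<in>B. \<Sum>i<p. a b * y b i * \<alpha> ^ i) = 0" and R: "sfield R" "F \<subseteq> R" "\<alpha> \<in> R"
    and y: "\<And>b i. b \<in> B \<Longrightarrow> i < p \<Longrightarrow> (b, i) \<noteq> (b0, 0) \<Longrightarrow> y b i \<in> R"
  shows "b \<in> B \<Longrightarrow> i < p \<Longrightarrow> y b i \<in> R"
proof (cases "(b, i) = (b0, 0)")
  case True
  let ?g = "\<lambda>(b, i). a b * y b i * \<alpha> ^ i"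
  have "0 = (\<Sum>v\<in>B \<times> {..<p}. ?g v)" using rel by (simp add: sum.cartesian_product)
  also have "\<dots> = ?g (b0, 0) + (\<Sum>v\<in>B \<times> {..<p} - {(b0, 0)}. ?g v)"
    using fin a(2) p_pos by (intro sum.remove) auto
  finally have "a b0 * y b0 0 = - (\<Sum>v\<in>B \<times> {..<p} - {(b0, 0)}. ?g v)"
    by (simp add: eq_neg_iff_add_eq_0)
  then have eq: "y b0 0 = - (\<Sum>v\<in>B \<times> {..<p} - {(b0, 0)}. ?g v) / a b0"
    using a(3) by (metis nonzero_mult_div_cancel_left)
  have "?g v \<in> R" if vI: "v \<in> B \<times> {..<p} - {(b0, 0)}" for v
  proof -
    obtain b i where "v = (b, i)" by (cases v)
    then have v: "v = (b, i)" "b \<in> B" "i < p" "(b, i) \<noteq> (b0, 0)" using vI by auto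
    show ?thesis unfolding v(1) using y[OF v(2-)] a(1)[OF v(2)] R(2,3)
      by (auto intro!: sfield_closed(5)[OF R(1)] sfield_closed(9)[OF R(1)])
  qed
  then have "- (\<Sum>v\<in>B \<times> {..<p} - {(b0, 0)}. ?g v) / a b0 \<in> R"
    using a(1,2) R(2) by (intro sfield_closed(12)[OF R(1)] sfield_closed(3)[OF R(1)] sfield_closed(7)[OF R(1)]) auto
  then show ?thesis using True eq by simp
qed (use y in auto)

lemma card_hindex: "finite B \<Longrightarrow> b0 \<in> B \<Longrightarrow> card (hindex B b0) = card B * p"
proof -
  assume B: "finite B" "b0 \<in> B"
  then have "card (B \<times> {..<p} - {(b0, 0)}) = card B * p - 1"
    using p_pos by (simp add: card_cartesian_product)
  then have "card (hindex B b0) = Suc (card B * p - 1)"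
    unfolding hindex_def using B by (subst card_insert_disjoint) (auto simp: card_image)
  moreover have "card B * p > 0" using B p_pos by (auto simp: card_gt_0_iff)
  ultimately show ?thesis by simp
qed

end

lemma ldep_insertE:
  assumes K: "sfield K" and J: "finite J" "c \<notin> J" and ind: "\<not> ldep K J d" and dep: "ldep K (insert c J) d"
  shows "\<exists>l. (\<forall>j\<in>J. l j \<in> K) \<and> d c = (\<Sum>j\<in>J. l j * d j)"
proof -
  obtain s u where s: "\<forall>u\<in>insert c J. s u \<in> K" "u \<in> insert c J" "s u \<noteq> 0" "(\<Sum>u\<in>insert c J. s u * d u) = 0"
    using dep by (rule ldepE)
  have sum: "s c * d c + (\<Sum>j\<in>J. s j * d j) = 0" using s(4) J by simp
  have sc: "s c \<noteq> 0"
  proof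
    assume "s c = 0"
    then have "ldep K J d" using s sum by (intro ldepI[of J s K u]) auto
    with ind show False by contradiction
  qed
  have "s c * d c = - (\<Sum>j\<in>J. s j * d j)" using sum by (simp add: eq_neg_iff_add_eq_0)
  then have "d c = - (\<Sum>j\<in>J. s j * d j) / s c" using sc by (metis nonzero_mult_div_cancel_left)
  also have "\<dots> = (\<Sum>j\<in>J. (- s j / s c) * d j)"
    by (simp add: sum_divide_distrib sum_negf[symmetric])
  finally show ?thesis
    using s(1) by (intro exI[of _ "\<lambda>j. - s j / s c"]) (auto intro!: sfield_closed(12)[OF K] sfield_closed(3)[OF K])
qed

context ground begin

text \<open>Independence of the coefficients over \<open>Fp\<close> is anisotropy, as a zero of the
  form is a relation with \<open>p\<close>-th powers as coefficients.\<close>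

definition datum :: "'b set \<Rightarrow> 'b \<Rightarrow> ('b \<Rightarrow> 'o) \<Rightarrow> bool" where
  "datum B b0 a \<longleftrightarrow> finite B \<and> (\<forall>b\<in>B. a b \<in> F) \<and> b0 \<in> B \<and> card B \<ge> 2 \<and> \<not> ldep Fp B a"

lemma datumD:
  assumes "datum B b0 a"
  shows "finite B" "\<And>b. b \<in> B \<Longrightarrow> a b \<in> F" "b0 \<in> B" "a b0 \<noteq> 0" "card B \<ge> 2" "\<not> ldep Fp B a"
proof -
  show fin: "finite B" and "\<And>b. b \<in> B \<Longrightarrow> a b \<in> F" and b0: "b0 \<in> B" and "card B \<ge> 2" and ind: "\<not> ldep Fp B a"
    using assms by (auto simp: datum_def)
  show "a b0 \<noteq> 0"
  proof
    assume "a b0 = 0"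
    then have "(\<Sum>b\<in>B. (if b = b0 then 1 else 0) * a b) = 0" by (intro sum.neutral) auto
    then have "ldep Fp B a"
      using b0 sfield_closed(1,2)[OF sfield_Fp]
      by (intro ldepI[of B "\<lambda>b. if b = b0 then 1 else 0" Fp b0]) auto
    with ind show False by contradiction
  qed
qed

text \<open>A relation would specialise to one between the powers of the generic ratio. Hence
  \<alpha> has degree \<open>p\<close> over the root field.\<close>

lemma generic_root_powers:
  assumes p: "p = 2 \<or> p = 3" and X: "datum B b0 a" and gen: "generic_root B b0 a y \<alpha>"
  shows "\<not> ldep (root_field B y \<alpha>) {..<p} (\<lambda>i. \<alpha> ^ i)"
proof
  note D = datumD[OF X]
  assume "ldep (root_field B y \<alpha>) {..<p} (\<lambda>i. \<alpha> ^ i)"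
  then obtain c u where c: "\<forall>i\<in>{..<p}. c i \<in> root_field B y \<alpha>" "u \<in> {..<p}" "c u \<noteq> 0" "(\<Sum>i<p. c i * \<alpha> ^ i) = 0"
    by (rule ldepE)
  have "(\<Sum>v\<in>{()} \<times> {..<p}. c (snd v) * (case v of (j, i) \<Rightarrow> 1 * \<alpha> ^ i)) = 0"
    using c(4) by (simp add: sum.cartesian_product')
  then have "ldep (root_field B y \<alpha>) ({()} \<times> {..<p}) (\<lambda>(j, i). 1 * \<alpha> ^ i)"
    using c(1-3) by (intro ldepI[of _ "\<lambda>v. c (snd v)" _ "((), u)"]) auto
  then have "ratio_dep p B b0 a {()} (\<lambda>_. 1)"
    using specialise_to_ratio[OF D(1-4) gen, of "{()}" "\<lambda>_. 1" p] sfield_closed(1)[OF F] by auto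
  then show False using not_ratio_dep_one[OF p D(1-3,5,6)] by blast
qed

text \<open>Linear disjointness of \<open>F\<close> and the root field over \<open>Fp\<close>, by
  specialising relations that contain no powers of \<alpha> (the case \<open>q = 1\<close>).\<close>

lemma generic_root_disjoint:
  assumes X: "datum B b0 a" and gen: "generic_root B b0 a y \<alpha>"
    and J: "finite J" and x: "\<And>j. j \<in> J \<Longrightarrow> x j \<in> F" and dep: "ldep (root_field B y \<alpha>) J x"
  shows "ldep Fp J x"
proof -
  note D = datumD[OF X]
  obtain c u where c: "\<forall>j\<in>J. c j \<in> root_field B y \<alpha>" "u \<in> J" "c u \<noteq> 0" "(\<Sum>j\<in>J. c j * x j) = 0"
    using dep by (rule ldepE)
  have "(\<Sum>v\<in>J \<times> {..<1}. c (fst v) * (case v of (j, i) \<Rightarrow> x j * \<alpha> ^ i)) = 0"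
    using c(4) by (simp add: sum.cartesian_product')
  then have "ldep (root_field B y \<alpha>) (J \<times> {..<1}) (\<lambda>(j, i). x j * \<alpha> ^ i)"
    using c(1-3) by (intro ldepI[of _ "\<lambda>v. c (fst v)" _ "(u, 0)"]) auto
  from specialise_to_ratio[OF D(1-4) gen J x this] have "ratio_dep 1 B b0 a J x" .
  from ratio_dep_1_descent[OF D(1) J D(2,3) x this] show ?thesis .
qed

text \<open>The constant coefficients, among them the dependent one at \<open>(b0, 0)\<close>, drop
  out of the derivative. What remains is a linear form in free parameters with coefficient
  \<open>a b0\<close> at \<open>y b0 1\<close>.\<close>

lemma generic_root_simple:
  assumes X: "datum B b0 a" and gen: "generic_root B b0 a y \<alpha>"
  shows "(\<Sum>b\<in>B. \<Sum>i<p. a b * y b i * (of_nat i * \<alpha> ^ (i - 1))) \<noteq> 0"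
proof -
  note D = datumD[OF X]
  let ?z = "case_option \<alpha> (\<lambda>(b, i). y b i)" and ?J = "B \<times> {1..<p}"
  have "hindex B b0 = {None} \<union> Some ` (B \<times> {..<p} - {(b0, 0)})" by (auto simp: hindex_def)
  then have "alg_indep (\<lambda>x. x) F ({None} \<union> Some ` (B \<times> {..<p} - {(b0, 0)})) ?z"
    using gen by (simp add: generic_root_def)
  from alg_indep_tower[OF rhom_id sfield_sring[OF F] this]
  have ind: "alg_indep (\<lambda>x. x) (fgen (F \<union> {\<alpha>})) (Some ` (B \<times> {..<p} - {(b0, 0)})) ?z" by auto
  have p1: "1 < p" using p_ge_2 by simp
  have cin: "a b * (of_nat i * \<alpha> ^ (i - 1)) \<in> fgen (F \<union> {\<alpha>})" if "b \<in> B" for b i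
    using D(2)[OF that]
    by (intro sfield_closed(5)[OF sfield_fgen] sfield_closed(10)[OF sfield_fgen] sfield_closed(9)[OF sfield_fgen] fgen_base) auto
  have "(\<Sum>v\<in>Some ` ?J. (\<lambda>(b, i). a b * (of_nat i * \<alpha> ^ (i - 1))) (the v) * ?z v) \<noteq> 0"
    using D p1 cin
    by (intro alg_indep_linear[OF ind sfield_sring[OF sfield_fgen], where l = "Some (b0, 1)"]) auto
  also have "(\<Sum>v\<in>Some ` ?J. (\<lambda>(b, i). a b * (of_nat i * \<alpha> ^ (i - 1))) (the v) * ?z v) =
      (\<Sum>b\<in>B. \<Sum>i\<in>{1..<p}. a b * y b i * (of_nat i * \<alpha> ^ (i - 1)))"
    by (simp add: sum.reindex sum.cartesian_product case_prod_unfold mult_ac)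
  also have "\<dots> = (\<Sum>b\<in>B. \<Sum>i<p. a b * y b i * (of_nat i * \<alpha> ^ (i - 1)))"
    by (intro sum.cong refl sum.mono_neutral_left) (auto simp: not_le)
  finally show ?thesis .
qed

lemma root_field_props:
  shows "sfield (root_field B y \<alpha>)" "Fp \<subseteq> root_field B y \<alpha>" "\<alpha> ^ p \<in> root_field B y \<alpha>"
    "\<And>b i. b \<in> B \<Longrightarrow> i < p \<Longrightarrow> y b i \<in> root_field B y \<alpha>"
proof -
  show "sfield (root_field B y \<alpha>)" by (simp add: root_field_def sfield_fgen)
  show "Fp \<subseteq> root_field B y \<alpha>" "\<alpha> ^ p \<in> root_field B y \<alpha>" by (auto simp: root_field_def intro: fgen_base)
  show "y b i \<in> root_field B y \<alpha>" if "b \<in> B" "i < p" for b i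
    unfolding root_field_def by (rule fgen_base) (use that in force)
qed

lemma root_field_subset:
  assumes R: "sfield R" "F \<subseteq> R" "\<alpha> \<in> R" and y: "\<And>b i. b \<in> B \<Longrightarrow> i < p \<Longrightarrow> y b i \<in> R"
  shows "root_field B y \<alpha> \<subseteq> R"
  unfolding root_field_def using Fp_subset R(2) y sfield_closed(9)[OF R(1,3), of p]
  by (intro fgen_least R) auto

text \<open>Let \<open>\<alpha>\<close> be a generic root for \<open>X\<close>. It is also a root of polynomials over the span of \<open>Y\<close>; let
  \<open>w\<close> be a generic one, which has \<open>\<alpha>\<close> as a simple root, so that \<open>\<alpha>\<close> is rational in \<open>w\<close> and
  \<open>\<alpha>\<^sup>p\<close>. Counting parameters of the pair of the two polynomials from both sides gives the inequality of
  ranks. In case of equality \<open>\<alpha>\<close> is a generic root for \<open>Y\<close> as well.\<close>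

theorem rank_le:
  fixes B :: "'b set" and C :: "'c set"
  assumes p: "p = 2 \<or> p = 3" and X: "datum B b0 a" and Y: "datum C c0 d"
    and XY: "ratio_dep p B b0 a C d" and I: "I \<subseteq> B" "\<not> ratio_dep p B b0 a I a"
  shows "\<exists>J\<subseteq>C. \<not> ratio_dep p C c0 d J d \<and> card I \<le> card J \<and> (card I = card J \<longrightarrow> ratio_dep p C c0 d B a)"
proof -
  note DX = datumD[OF X] and DY = datumD[OF Y]
  \<comment> \<open>Parameters for the root of \<open>X\<close>, for the polynomial of
    \<open>Y\<close>, and one auxiliary set for each of the two hypersurfaces to which composition
    at a simple root is applied.\<close>
  define All :: "(('b \<times> nat) option + ('c \<times> nat) + 'b + 'c) set" where
    "All = Inl ` hindex B b0 \<union> Inr ` (Inl ` (C \<times> {..<p}) \<union> Inr ` (Inl ` (B - {b0}) \<union> Inr ` (C - {c0})))"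
  have "finite All" using DX(1) DY(1) by (simp add: All_def hindex_def)
  then have "\<exists>Z. alg_indep (\<lambda>x. x) F All Z" by (rule fresh)
  then obtain Z where Z: "alg_indep (\<lambda>x. x) F All Z" ..
  have finI: "finite I" using I(1) DX(1) by (rule finite_subset)

  \<comment> \<open>The generic root for \<open>X\<close>\<close>
  define \<alpha> where "\<alpha> = Z (Inl None)"
  define y where "y b i = (if (b, i) = (b0, 0)
      then - (\<Sum>v\<in>B \<times> {..<p} - {(b0, 0)}. a (fst v) * Z (Inl (Some v)) * \<alpha> ^ snd v) / a b0
      else Z (Inl (Some (b, i))))" for b i
  have gen: "generic_root B b0 a y \<alpha>"
    unfolding generic_root_def
  proof
    have "alg_indep (\<lambda>x. x) F (Inl ` hindex B b0) Z" by (rule alg_indep_subset[OF Z]) (auto simp: All_def)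
    then have "alg_indep (\<lambda>x. x) F (hindex B b0) (\<lambda>v. Z (Inl v))"
      using DX(1) by (intro alg_indep_reindex[OF rhom_id F, of "hindex B b0" Inl Z]) (auto simp: hindex_def)
    moreover have "Z (Inl v) = case_option \<alpha> (\<lambda>(b, i). y b i) v" if "v \<in> hindex B b0" for v
      using that by (auto simp: hindex_def \<alpha>_def y_def split: if_splits)
    ultimately show "alg_indep (\<lambda>x. x) F (hindex B b0) (case_option \<alpha> (\<lambda>(b, i). y b i))"
      using alg_indep_cong[of "hindex B b0" "\<lambda>v. Z (Inl v)" "case_option \<alpha> (\<lambda>(b, i). y b i)"] by blast
    let ?g = "\<lambda>(b, i). a b * y b i * \<alpha> ^ i"
    have "(\<Sum>b\<in>B. \<Sum>i<p. a b * y b i * \<alpha> ^ i) = (\<Sum>v\<in>B \<times> {..<p}. ?g v)" by (simp add: sum.cartesian_product)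
    also have "\<dots> = ?g (b0, 0) + (\<Sum>v\<in>B \<times> {..<p} - {(b0, 0)}. ?g v)"
      using DX(1,3) p_pos by (intro sum.remove) auto
    also have "(\<Sum>v\<in>B \<times> {..<p} - {(b0, 0)}. ?g v) =
        (\<Sum>v\<in>B \<times> {..<p} - {(b0, 0)}. a (fst v) * Z (Inl (Some v)) * \<alpha> ^ snd v)"
      by (intro sum.cong refl) (auto simp: y_def split: if_splits)
    also have "?g (b0, 0) + \<dots> = 0" using DX(4) by (simp add: y_def)
    finally show "(\<Sum>b\<in>B. \<Sum>i<p. a b * y b i * \<alpha> ^ i) = 0" .
  qed
  have yrel: "(\<Sum>b\<in>B. \<Sum>i<p. a b * y b i * \<alpha> ^ i) = 0" using gen by (simp add: generic_root_def)
  define M where "M = fgen (F \<union> Z ` Inl ` hindex B b0)"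
  have M: "sfield M" "F \<subseteq> M" by (auto simp: M_def sfield_fgen intro: fgen_base)
  have aM: "\<alpha> \<in> M" unfolding M_def \<alpha>_def by (rule fgen_base) (auto simp: hindex_def)
  have "y b i \<in> M" if "b \<in> B" "i < p" "(b, i) \<noteq> (b0, 0)" for b i
    unfolding M_def using that by (intro fgen_base UnI2) (force simp: hindex_def y_def)
  then have yM: "y b i \<in> M" if "b \<in> B" "i < p" for b i
    using remaining_coord[of B a b0 y \<alpha> M b i] DX yrel M aM that by blast
  have "alg_indep (\<lambda>x. x) (fgen ((\<lambda>x. x) ` F \<union> Z ` Inl ` hindex B b0)) (Inr ` (Inl ` (C \<times> {..<p}) \<union> Inr ` (Inl ` (B - {b0}) \<union> Inr ` (C - {c0})))) Z"
    by (rule alg_indep_tower[OF rhom_id sfield_sring[OF F] Z[unfolded All_def]]) auto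
  then have ZM: "alg_indep (\<lambda>x. x) M (Inr ` (Inl ` (C \<times> {..<p}) \<union> Inr ` (Inl ` (B - {b0}) \<union> Inr ` (C - {c0})))) Z"
    by (simp add: M_def)
  define t where "t c i = Z (Inr (Inl (c, i)))" for c i
  have vB: "alg_indep (\<lambda>x. x) M (B - {b0}) (\<lambda>b. Z (Inr (Inr (Inl b))))"
    using DX(1) by (intro alg_indep_reindex[OF rhom_id M(1), of "B - {b0}" "\<lambda>b. Inr (Inr (Inl b))" Z] alg_indep_subset[OF ZM])
      (auto simp: inj_on_def)
  have vC: "alg_indep (\<lambda>x. x) M (C - {c0}) (\<lambda>c. Z (Inr (Inr (Inr c))))"
    using DY(1) by (intro alg_indep_reindex[OF rhom_id M(1), of "C - {c0}" "\<lambda>c. Inr (Inr (Inr c))" Z] alg_indep_subset[OF ZM])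
      (auto simp: inj_on_def)
  have tM: "alg_indep (\<lambda>x. x) M (C \<times> {..<p}) (\<lambda>v. Z (Inr (Inl v)))"
    using DY(1) by (intro alg_indep_reindex[OF rhom_id M(1), of "C \<times> {..<p}" "\<lambda>v. Inr (Inl v)" Z] alg_indep_subset[OF ZM])
      (auto simp: inj_on_def)
  define K where "K = root_field B y \<alpha>"
  note Kp = root_field_props[where B = B and y = y and \<alpha> = \<alpha>, folded K_def]
  have KM: "K \<subseteq> M" unfolding K_def by (rule root_field_subset[OF M aM yM])
  have apow: "\<not> ldep K {..<p} (\<lambda>i. \<alpha> ^ i)" unfolding K_def by (rule generic_root_powers[OF p X gen])

  \<comment> \<open>Polynomials for \<open>Y\<close> with the root \<alpha>\<close>
  have D1: "ldep K (C \<times> {..<p}) (\<lambda>(c, i). d c * \<alpha> ^ i)"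
    by (rule dep_at_simple_root[OF DX(1-4) Kp(1,2,3) apow Kp(4) yrel generic_root_simple[OF X gen] M KM aM vB DY(1,2) XY])
  have indC: "\<not> ldep K C d"
    using generic_root_disjoint[OF X gen DY(1), of d] DY(2,6) by (auto simp: K_def)
  obtain w0 where w0K: "\<forall>c\<in>C. \<forall>i<p. w0 c i \<in> K" and w0r: "(\<Sum>c\<in>C. \<Sum>i<p. d c * w0 c i * \<alpha> ^ i) = 0"
    and w0s: "(\<Sum>c\<in>C. \<Sum>i<p. d c * w0 c i * (of_nat i * \<alpha> ^ (i - 1))) \<noteq> 0"
    using simple_root_exists[OF p char_p Kp(1) DY(1) indC D1] by (elim exE conjE) (rule that)
  define k1 where "k1 = fgen (insert \<alpha> K)"
  have k1: "sfield k1" by (simp add: k1_def sfield_fgen)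
  have a1: "\<alpha> \<in> k1" by (simp add: k1_def fgen_base)
  have basis: "ldep k1 J d \<longleftrightarrow> ldep K (J \<times> {..<p}) (\<lambda>(j, i). d j * \<alpha> ^ i)" if "finite J" for J
    unfolding k1_def by (rule ldep_fgen_power_basis[OF pc Kp(1,3) apow that])
  \<comment> \<open>The size of \<open>J\<close> is the rank of the \<open>d c\<close> over
    \<open>K(\<alpha>)\<close>; the root condition on \<open>w\<close> leaves
    \<open>(card C - card J) * p\<close> coefficients free.\<close>
  have "\<exists>J. (J \<subseteq> C \<and> \<not> ldep k1 J d) \<and> (\<forall>J'. J' \<subseteq> C \<and> \<not> ldep k1 J' d \<longrightarrow> card J' \<le> card J)"
  proof (rule ex_has_greatest_nat[of "\<lambda>J. J \<subseteq> C \<and> \<not> ldep k1 J d" "{}" card "Suc (card C)"])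
    show "{} \<subseteq> C \<and> \<not> ldep k1 {} d" by (simp add: ldep_def)
    show "\<forall>J. J \<subseteq> C \<and> \<not> ldep k1 J d \<longrightarrow> card J < Suc (card C)"
      using DY(1) card_mono by (auto simp: less_Suc_eq_le)
  qed
  then obtain J where J: "J \<subseteq> C" "\<not> ldep k1 J d" and Jmax: "\<And>J'. J' \<subseteq> C \<Longrightarrow> \<not> ldep k1 J' d \<Longrightarrow> card J' \<le> card J"
    by blast
  have finJ: "finite J" using J(1) DY(1) by (rule finite_subset)
  have indJ: "\<not> ldep K (J \<times> {..<p}) (\<lambda>(j, i). d j * \<alpha> ^ i)" using basis[OF finJ] J(2) by blast
  \<comment> \<open>A dependence of \<open>J\<close> at the generic point of \<open>Y\<close> would
    appear at the simple root of \<open>w0\<close>, against the choice of \<open>J\<close>.\<close>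
  have notJ: "\<not> ratio_dep p C c0 d J d"
  proof
    assume r: "ratio_dep p C c0 d J d"
    have "ldep K (J \<times> {..<p}) (\<lambda>(j, i). d j * \<alpha> ^ i)"
      by (rule dep_at_simple_root[OF DY(1-4) Kp(1,2,3) apow _ w0r w0s M KM aM vC finJ _ r]) (use w0K J(1) DY(2) in auto)
    with indJ show False by contradiction
  qed

  \<comment> \<open>Parametrisation of these polynomials\<close>
  have "\<exists>\<Lambda>. (\<forall>j\<in>J. \<forall>i. \<Lambda> j i \<in> K) \<and> d c * \<alpha> ^ l = (\<Sum>j\<in>J. \<Sum>i<p. \<Lambda> j i * (d j * \<alpha> ^ i))" if c: "c \<in> C - J" for c l
  proof -
    have "ldep k1 (insert c J) d"
    proof (rule ccontr)
      assume "\<not> ?thesis"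
      then have "card (insert c J) \<le> card J" using Jmax[of "insert c J"] J(1) c by auto
      then show False using c finJ by simp
    qed
    then obtain \<mu> where l: "\<forall>j\<in>J. \<mu> j \<in> k1" "d c = (\<Sum>j\<in>J. \<mu> j * d j)"
      using ldep_insertE[OF k1 finJ _ J(2), of c] c by blast
    have "\<forall>j\<in>J. \<exists>s. (\<forall>i. s i \<in> K) \<and> \<mu> j * \<alpha> ^ l = (\<Sum>i<p. s i * \<alpha> ^ i)"
    proof
      fix j assume "j \<in> J"
      then have "\<mu> j * \<alpha> ^ l \<in> fgen (insert \<alpha> K)"
        using l(1) sfield_closed(5)[OF k1 _ sfield_closed(9)[OF k1 a1]] unfolding k1_def by blast
      then show "\<exists>s. (\<forall>i. s i \<in> K) \<and> \<mu> j * \<alpha> ^ l = (\<Sum>i<p. s i * \<alpha> ^ i)"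
        by (rule fgen_power_basis[OF pc Kp(1,3)])
    qed
    then have "\<exists>s. \<forall>j\<in>J. (\<forall>i. s j i \<in> K) \<and> \<mu> j * \<alpha> ^ l = (\<Sum>i<p. s j i * \<alpha> ^ i)" by (rule bchoice)
    then obtain s where s: "\<forall>j\<in>J. (\<forall>i. s j i \<in> K) \<and> \<mu> j * \<alpha> ^ l = (\<Sum>i<p. s j i * \<alpha> ^ i)" ..
    have "d c * \<alpha> ^ l = (\<Sum>j\<in>J. (\<mu> j * \<alpha> ^ l) * d j)" unfolding l(2) sum_distrib_right by (simp add: mult_ac)
    also have "\<dots> = (\<Sum>j\<in>J. (\<Sum>i<p. s j i * \<alpha> ^ i) * d j)" by (intro sum.cong refl) (simp only: s)
    also have "\<dots> = (\<Sum>j\<in>J. \<Sum>i<p. s j i * (d j * \<alpha> ^ i))"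
      by (intro sum.cong refl) (simp add: sum_distrib_left mult_ac)
    finally show ?thesis using s by blast
  qed
  note Lex = this
  define \<Lambda> where "\<Lambda> c l = (SOME \<Lambda>. (\<forall>j\<in>J. \<forall>i. \<Lambda> j i \<in> K) \<and> d c * \<alpha> ^ l = (\<Sum>j\<in>J. \<Sum>i<p. \<Lambda> j i * (d j * \<alpha> ^ i)))" for c l
  have L: "(\<forall>j\<in>J. \<forall>i. \<Lambda> c l j i \<in> K) \<and> d c * \<alpha> ^ l = (\<Sum>j\<in>J. \<Sum>i<p. \<Lambda> c l j i * (d j * \<alpha> ^ i))"
    if "c \<in> C - J" for c l
    unfolding \<Lambda>_def by (rule someI_ex[OF Lex[OF that]])
  have LK: "\<Lambda> c l j i \<in> K" if "c \<in> C - J" "j \<in> J" for c l j i using L[OF that(1)] that(2) by blast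
  have Lrel: "d c * \<alpha> ^ l = (\<Sum>j\<in>J. \<Sum>i<p. \<Lambda> c l j i * (d j * \<alpha> ^ i))" if "c \<in> C - J" for c l
    using L[OF that] by blast
  \<comment> \<open>The root condition is solved for the coefficients with index in
    \<open>J\<close>; the others, given by \<open>u\<close>, are free.\<close>
  define W where "W u c i = (if c \<in> J then - (\<Sum>c'\<in>C - J. \<Sum>l<p. u c' l * \<Lambda> c' l c i) else u c i)" for u c and i :: nat
  have Wsum: "(\<Sum>c\<in>C. \<Sum>i<p. d c * W u c i * g i) =
      (\<Sum>c\<in>C - J. \<Sum>l<p. u c l * (d c * g l - (\<Sum>j\<in>J. \<Sum>i<p. \<Lambda> c l j i * (d j * g i))))" for u and g :: "nat \<Rightarrow> 'o"
  proof -
    have "(\<Sum>j\<in>J. \<Sum>i<p. d j * W u j i * g i) = - (\<Sum>j\<in>J. \<Sum>i<p. \<Sum>c\<in>C - J. \<Sum>l<p. u c l * (\<Lambda> c l j i * (d j * g i)))"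
      unfolding sum_negf[symmetric]
    proof (intro sum.cong refl)
      fix j i assume "j \<in> J" "i \<in> {..<p}"
      then have "d j * W u j i * g i = - ((\<Sum>c\<in>C - J. \<Sum>l<p. u c l * \<Lambda> c l j i) * (d j * g i))"
        by (simp add: W_def)
      then show "d j * W u j i * g i = (\<Sum>c\<in>C - J. \<Sum>l<p. - (u c l * (\<Lambda> c l j i * (d j * g i))))"
        by (simp add: sum_distrib_right sum_negf mult.assoc)
    qed
    also have "(\<Sum>j\<in>J. \<Sum>i<p. \<Sum>c\<in>C - J. \<Sum>l<p. u c l * (\<Lambda> c l j i * (d j * g i))) =
        (\<Sum>j\<in>J. \<Sum>c\<in>C - J. \<Sum>i<p. \<Sum>l<p. u c l * (\<Lambda> c l j i * (d j * g i)))"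
      by (intro sum.cong refl sum.swap)
    also have "\<dots> = (\<Sum>c\<in>C - J. \<Sum>j\<in>J. \<Sum>i<p. \<Sum>l<p. u c l * (\<Lambda> c l j i * (d j * g i)))"
      by (rule sum.swap)
    also have "\<dots> = (\<Sum>c\<in>C - J. \<Sum>j\<in>J. \<Sum>l<p. \<Sum>i<p. u c l * (\<Lambda> c l j i * (d j * g i)))"
      by (intro sum.cong refl sum.swap)
    also have "\<dots> = (\<Sum>c\<in>C - J. \<Sum>l<p. \<Sum>j\<in>J. \<Sum>i<p. u c l * (\<Lambda> c l j i * (d j * g i)))"
      by (intro sum.cong refl sum.swap)
    finally have J1: "(\<Sum>j\<in>J. \<Sum>i<p. d j * W u j i * g i) =
        - (\<Sum>c\<in>C - J. \<Sum>l<p. u c l * (\<Sum>j\<in>J. \<Sum>i<p. \<Lambda> c l j i * (d j * g i)))"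
      by (simp only: sum_distrib_left)
    have J2: "(\<Sum>c\<in>C - J. \<Sum>i<p. d c * W u c i * g i) = (\<Sum>c\<in>C - J. \<Sum>l<p. u c l * (d c * g l))"
      by (intro sum.cong refl) (auto simp: W_def mult_ac)
    have "(\<Sum>c\<in>C. \<Sum>i<p. d c * W u c i * g i) = (\<Sum>c\<in>C - J. \<Sum>i<p. d c * W u c i * g i) + (\<Sum>j\<in>J. \<Sum>i<p. d j * W u j i * g i)"
      using DY(1) J(1) by (rule sum.subset_diff[rotated])
    then show ?thesis unfolding J1 J2 by (simp add: right_diff_distrib sum_subtractf)
  qed
  have Wroot: "(\<Sum>c\<in>C. \<Sum>i<p. d c * W u c i * \<alpha> ^ i) = 0" for u
    unfolding Wsum using Lrel by (intro sum.neutral ballI) simp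
  \<comment> \<open>\<open>w0\<close> belongs to the family: it could differ from
    \<open>W w0\<close> only on \<open>J\<close>, where the root condition has a unique solution
    over \<open>K\<close>.\<close>
  have W0: "W w0 c i = w0 c i" if c: "c \<in> C" "i < p" for c i
  proof (cases "c \<in> J")
    case True
    define \<delta> where "\<delta> c i = w0 c i - W w0 c i" for c i
    have WK: "W w0 c i \<in> K" if "c \<in> C" "i < p" for c i
      unfolding W_def using w0K LK that
      by (auto intro!: sfield_closed(3)[OF Kp(1)] sfield_closed(7)[OF Kp(1)] sfield_closed(5)[OF Kp(1)])
    have dK: "\<delta> c i \<in> K" if "c \<in> C" "i < p" for c i
      unfolding \<delta>_def using w0K WK that by (auto intro: sfield_closed(6)[OF Kp(1)])
    have "0 = (\<Sum>c\<in>C. \<Sum>i<p. d c * \<delta> c i * \<alpha> ^ i)"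
      using w0r Wroot[of w0] by (simp add: \<delta>_def left_diff_distrib right_diff_distrib sum_subtractf)
    also have "\<dots> = (\<Sum>c\<in>J. \<Sum>i<p. d c * \<delta> c i * \<alpha> ^ i)"
      using DY(1) J(1) by (intro sum.mono_neutral_right) (auto simp: \<delta>_def W_def)
    finally have "(\<Sum>v\<in>J \<times> {..<p}. \<delta> (fst v) (snd v) * (case v of (j, i) \<Rightarrow> d j * \<alpha> ^ i)) = 0"
      by (simp add: sum.cartesian_product' mult_ac)
    then have "\<delta> c i = 0"
      using indJ ldepI[of "J \<times> {..<p}" "\<lambda>v. \<delta> (fst v) (snd v)" K "(c, i)" "\<lambda>(j, i). d j * \<alpha> ^ i"] dK J(1) True c by fastforce
    then show ?thesis by (simp add: \<delta>_def)
  qed (simp add: W_def)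
  define w where "w = W t"
  have wroot: "(\<Sum>c\<in>C. \<Sum>i<p. d c * w c i * \<alpha> ^ i) = 0" unfolding w_def by (rule Wroot)
  \<comment> \<open>The derivative at \<alpha> is a linear form in the free coefficients over
    \<open>M\<close>. It does not vanish at \<open>w0\<close>, so its coefficients are not all zero
    and it cannot vanish at the independent \<open>t\<close>.\<close>
  have wsimple: "(\<Sum>c\<in>C. \<Sum>i<p. d c * w c i * (of_nat i * \<alpha> ^ (i - 1))) \<noteq> 0"
  proof -
    define g where "g i = of_nat i * \<alpha> ^ (i - 1)" for i
    define \<sigma> where "\<sigma> c l = d c * g l - (\<Sum>j\<in>J. \<Sum>i<p. \<Lambda> c l j i * (d j * g i))" for c l
    have gM: "g i \<in> M" for i
      unfolding g_def by (intro sfield_closed(5)[OF M(1)] sfield_closed(10)[OF M(1)] sfield_closed(9)[OF M(1)] aM)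
    have sM: "\<sigma> c l \<in> M" if c: "c \<in> C - J" for c l
    proof -
      have "d c \<in> M" using c DY(2) M(2) by auto
      moreover have "\<Lambda> c l j i \<in> M" "d j \<in> M" if "j \<in> J" for j i
        using LK[OF c that, of l i] KM that J(1) DY(2) M(2) by auto
      ultimately show ?thesis
        unfolding \<sigma>_def by (intro sfield_closed(6)[OF M(1)] sfield_closed(7)[OF M(1)] sfield_closed(5)[OF M(1)] gM)
    qed
    have "(\<Sum>c\<in>C. \<Sum>i<p. d c * w0 c i * g i) = (\<Sum>c\<in>C. \<Sum>i<p. d c * W w0 c i * g i)"
      by (intro sum.cong refl) (simp add: W0)
    also have "\<dots> = (\<Sum>c\<in>C - J. \<Sum>l<p. w0 c l * \<sigma> c l)" unfolding Wsum \<sigma>_def ..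
    finally have "(\<Sum>c\<in>C - J. \<Sum>l<p. w0 c l * \<sigma> c l) \<noteq> 0" using w0s by (simp add: g_def)
    then have "\<exists>c\<in>C - J. \<exists>l<p. \<sigma> c l \<noteq> 0"
      by (metis (no_types, lifting) lessThan_iff mult_zero_right sum.neutral)
    then obtain c l where cl: "c \<in> C - J" "l < p" "\<sigma> c l \<noteq> 0" by blast
    have "(\<Sum>v\<in>(C - J) \<times> {..<p}. (case v of (c, l) \<Rightarrow> \<sigma> c l) * Z (Inr (Inl v))) \<noteq> 0"
      using cl sM DY(1) by (intro alg_indep_linear[OF tM sfield_sring[OF M(1)], where l = "(c, l)"]) auto
    also have "(\<Sum>v\<in>(C - J) \<times> {..<p}. (case v of (c, l) \<Rightarrow> \<sigma> c l) * Z (Inr (Inl v))) = (\<Sum>c\<in>C - J. \<Sum>l<p. t c l * \<sigma> c l)"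
      by (simp add: sum.cartesian_product' t_def mult.commute)
    also have "\<dots> = (\<Sum>c\<in>C. \<Sum>i<p. d c * w c i * g i)" unfolding w_def Wsum \<sigma>_def ..
    finally show ?thesis by (simp add: g_def)
  qed

  \<comment> \<open>Recovering the polynomial of \<open>X\<close> from that of
    \<open>Y\<close>\<close>
  define Kt where "Kt = fgen (K \<union> (\<lambda>v. Z (Inr (Inl v))) ` ((C - J) \<times> {..<p}))"
  have Kt: "sfield Kt" "K \<subseteq> Kt" by (auto simp: Kt_def sfield_fgen intro: fgen_base)
  have tKt: "t c i \<in> Kt" if "c \<in> C - J" "i < p" for c i
    unfolding Kt_def t_def using that by (intro fgen_base) auto
  have wKt: "w c i \<in> Kt" if "c \<in> C" "i < p" for c i
  proof (cases "c \<in> J")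
    case True
    have "t c' l * \<Lambda> c' l c i \<in> Kt" if "c' \<in> C - J" "l < p" for c' l
      using tKt[OF that] LK[OF that(1) True, of l i] Kt(2) by (intro sfield_closed(5)[OF Kt(1)]) auto
    then show ?thesis unfolding w_def W_def using True
      by (auto intro!: sfield_closed(3)[OF Kt(1)] sfield_closed(7)[OF Kt(1)])
  qed (use that tKt in \<open>simp add: w_def W_def\<close>)
  have tJ: "alg_indep (\<lambda>x. x) M ((C - J) \<times> {..<p}) (\<lambda>v. Z (Inr (Inl v)))"
    by (rule alg_indep_subset[OF tM]) auto
  have descKt: "ldep K V f" if "finite V" "\<And>v. v \<in> V \<Longrightarrow> f v \<in> M" "ldep Kt V f" for V :: "'z set" and f
    by (rule ldep_transcendental_descent[OF M(1) Kp(1) KM tJ that(1,2)]) (use that(3) in \<open>auto simp: Kt_def\<close>)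
  \<comment> \<open>What is known from the side of \<open>Y\<close>. The aim is that this field also
    contains the missing \<open>y b i\<close> with \<open>b \<in> I\<close>.\<close>
  define \<kappa> where "\<kappa> = fgen (Fp \<union> {\<alpha> ^ p} \<union> (\<lambda>(c, i). w c i) ` (C \<times> {..<p}) \<union> (\<lambda>(b, i). y b i) ` ((B - I) \<times> {..<p}))"
  have kf: "sfield \<kappa>" "Fp \<subseteq> \<kappa>" "\<alpha> ^ p \<in> \<kappa>" by (auto simp: \<kappa>_def sfield_fgen intro: fgen_base)
  have wk: "w c i \<in> \<kappa>" if "c \<in> C" "i < p" for c i unfolding \<kappa>_def by (rule fgen_base) (use that in force)
  have yk0: "y b i \<in> \<kappa>" if "b \<in> B - I" "i < p" for b i unfolding \<kappa>_def by (rule fgen_base) (use that in force)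
  have kKt: "\<kappa> \<subseteq> Kt"
    unfolding \<kappa>_def using Kp(2-4) Kt(2) wKt by (intro fgen_least Kt(1)) auto
  define R where "R = rgen (\<kappa> \<union> F)"
  have Rr: "sring R" by (simp add: R_def sring_rgen)
  have RR: "\<kappa> \<subseteq> R" "F \<subseteq> R" by (auto simp: R_def intro: rgen_base)
  have R: "sfield R"
  proof (rule sfield_if_powers_in[OF p_pos Rr kf(1) RR(1)])
    fix x assume "x \<in> R"
    then show "x ^ p \<in> \<kappa>"
      unfolding R_def by (rule rgen_power_in[OF pc sfield_sring[OF kf(1)], rotated])
        (use sfield_closed(9)[OF kf(1)] power_in_Fp kf(2) in blast)
  qed
  have aR: "\<alpha> \<in> R"
  proof (rule root_in_field[OF p char_p R, of "\<lambda>i. \<Sum>c\<in>C. d c * w c i"])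
    show "(\<Sum>c\<in>C. d c * w c i) \<in> R" if "i < p" for i
      using that wk RR DY(2) by (intro sring_sum[OF Rr] sring_mult[OF Rr]) auto
    show "\<alpha> ^ p \<in> R" using kf(3) RR(1) by blast
    have colsum: "(\<Sum>i<p. (\<Sum>c\<in>C. d c * w c i) * g i) = (\<Sum>c\<in>C. \<Sum>i<p. d c * w c i * g i)" for g
      unfolding sum_distrib_right by (rule sum.swap)
    show "(\<Sum>i<p. (\<Sum>c\<in>C. d c * w c i) * \<alpha> ^ i) = 0" unfolding colsum by (rule wroot)
    show "(\<Sum>i<p. (\<Sum>c\<in>C. d c * w c i) * (of_nat i * \<alpha> ^ (i - 1))) \<noteq> 0" unfolding colsum by (rule wsimple)
  qed
  have indI: "\<not> ldep Kt (I \<times> {..<p}) (\<lambda>(b, i). a b * \<alpha> ^ i)"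
  proof
    assume "ldep Kt (I \<times> {..<p}) (\<lambda>(b, i). a b * \<alpha> ^ i)"
    then have "ldep K (I \<times> {..<p}) (\<lambda>(b, i). a b * \<alpha> ^ i)"
      using finI I(1) DX(2) M(2)
      by (intro descKt) (auto intro!: sfield_closed(5)[OF M(1)] sfield_closed(9)[OF M(1)] aM)
    then have "ratio_dep p B b0 a I a"
      unfolding K_def by (intro specialise_to_ratio[OF DX(1-4) gen finI]) (use I(1) DX(2) in auto)
    with I(2) show False by contradiction
  qed
  have ykI: "y b i \<in> \<kappa>" if bi: "b \<in> I" "i < p" for b i
  proof -
    \<comment> \<open>\<open>None\<close> stands for the part of the relation with
      \<open>b \<in> I\<close>. It is minus the part with \<open>b \<notin> I\<close>, hence lies in
      the compositum of \<kappa> and \<open>F\<close>. The unknown \<open>y b i\<close> express it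
      by the \<open>a b * \<alpha> ^ i\<close> over \<open>Kt\<close>, and this dependence descends
      to \<kappa>.\<close>
    define N where "N = insert None (Some ` (I \<times> {..<p}))"
    define f where "f = case_option (\<Sum>b\<in>I. \<Sum>i<p. a b * y b i * \<alpha> ^ i) (\<lambda>(b, i). a b * \<alpha> ^ i)"
    have split: "(\<Sum>v\<in>N. c v * f v) = c None * f None + (\<Sum>v\<in>I \<times> {..<p}. c (Some v) * (case v of (b, i) \<Rightarrow> a b * \<alpha> ^ i))" for c
    proof -
      have "(\<Sum>v\<in>N. c v * f v) = c None * f None + (\<Sum>v\<in>Some ` (I \<times> {..<p}). c v * f v)"
        unfolding N_def using finI by (intro sum.insert) auto
      then show ?thesis by (simp add: sum.reindex f_def)
    qed
    have "ldep Kt N f"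
    proof (rule ldepI)
      define c where "c = case_option 1 (\<lambda>(b, i). - y b i)"
      show "None \<in> N" "c None \<noteq> 0" by (auto simp: N_def c_def)
      show "c v \<in> Kt" if "v \<in> N" for v
      proof (cases v)
        case None
        then show ?thesis using sfield_closed(1)[OF Kt(1)] by (simp add: c_def)
      next
        case (Some u)
        then have "fst u \<in> B" "snd u < p" using that I(1) by (auto simp: N_def)
        then have "y (fst u) (snd u) \<in> Kt" using Kp(4)[of "fst u" "snd u"] Kt(2) by blast
        then show ?thesis unfolding Some by (simp add: c_def case_prod_unfold sfield_closed(3)[OF Kt(1)])
      qed
      show "(\<Sum>v\<in>N. c v * f v) = 0"
        unfolding split by (simp add: c_def f_def sum.cartesian_product' sum_negf mult_ac)
    qed
    moreover have "f v \<in> rgen (\<kappa> \<union> F)" if v: "v \<in> N" for v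
    proof (cases v)
      case None
      have "0 = (\<Sum>b\<in>B - I. \<Sum>i<p. a b * y b i * \<alpha> ^ i) + (\<Sum>b\<in>I. \<Sum>i<p. a b * y b i * \<alpha> ^ i)"
        unfolding yrel[symmetric] using DX(1) I(1) by (rule sum.subset_diff[rotated])
      then have "f v = - (\<Sum>b\<in>B - I. \<Sum>i<p. a b * y b i * \<alpha> ^ i)"
        by (simp add: f_def None eq_neg_iff_add_eq_0 add.commute)
      also have "\<dots> \<in> R"
        using yk0 RR DX(2)
        by (intro sring_uminus[OF Rr] sring_sum[OF Rr] sring_mult[OF Rr] sring_power[OF Rr] aR) auto
      finally show ?thesis by (simp add: R_def)
    next
      case (Some u)
      then obtain b i where "u = (b, i)" "b \<in> I" using v by (auto simp: N_def)
      then have "f v \<in> R"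
        unfolding Some f_def using I(1) DX(2) RR(2) by (auto intro!: sring_mult[OF Rr] sring_power[OF Rr] aR)
      then show ?thesis by (simp add: R_def)
    qed
    moreover have "ldep Fp E (\<lambda>x. x)" if E: "finite E" "E \<subseteq> F" "ldep Kt E (\<lambda>x. x)" for E
    proof -
      have "ldep K E (\<lambda>x. x)" using E M(2) by (intro descKt) auto
      then show ?thesis using generic_root_disjoint[OF X gen E(1), of "\<lambda>x. x"] E(2) by (auto simp: K_def)
    qed
    moreover have "finite N" using finI by (simp add: N_def)
    ultimately have "ldep \<kappa> N f"
      by (intro ldep_compositum_descent[OF sfield_Fp kf(1) F kf(2) kKt sfield_sring[OF Kt(1)]])
    then obtain c v where c: "\<forall>v\<in>N. c v \<in> \<kappa>" "v \<in> N" "c v \<noteq> 0" "(\<Sum>v\<in>N. c v * f v) = 0"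
      by (rule ldepE)
    have cr: "c None * f None + (\<Sum>v\<in>I \<times> {..<p}. c (Some v) * (case v of (b, i) \<Rightarrow> a b * \<alpha> ^ i)) = 0"
      using c(4) unfolding split .
    have cK: "c u \<in> \<kappa>" if "u \<in> N" for u using c(1) that by blast
    have cN: "c None \<noteq> 0"
    proof
      assume c0: "c None = 0"
      then obtain u where u: "v = Some u" "u \<in> I \<times> {..<p}" using c(2,3) by (auto simp: N_def)
      have "ldep Kt (I \<times> {..<p}) (\<lambda>(b, i). a b * \<alpha> ^ i)"
        by (rule ldepI[of _ "\<lambda>u. c (Some u)" _ u]) (use cK kKt u c(3) cr c0 in \<open>auto simp: N_def\<close>)
      with indI show False by contradiction
    qed
    define e where "e b i = c (Some (b, i)) / c None" for b i
    have ek: "e b i \<in> \<kappa>" if "b \<in> I" "i < p" for b i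
      unfolding e_def using cK that by (intro sfield_closed(12)[OF kf(1)]) (auto simp: N_def)
    have "(\<Sum>b\<in>I. \<Sum>i<p. (y b i + e b i) * (a b * \<alpha> ^ i)) = (c None * f None + (\<Sum>v\<in>I \<times> {..<p}. c (Some v) * (case v of (b, i) \<Rightarrow> a b * \<alpha> ^ i))) / c None"
      using cN by (simp add: e_def f_def sum.cartesian_product' add_divide_distrib distrib_right distrib_left sum.distrib sum_divide_distrib mult_ac)
    also have "\<dots> = 0" unfolding cr by simp
    finally have "(\<Sum>v\<in>I \<times> {..<p}. (y (fst v) (snd v) + e (fst v) (snd v)) * (case v of (b, i) \<Rightarrow> a b * \<alpha> ^ i)) = 0"
      by (simp add: sum.cartesian_product')
    moreover have "y b i + e b i \<in> Kt" if "b \<in> I" "i < p" for b i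
      using Kp(4)[of b i] that Kt(2) ek[OF that] kKt I(1) by (intro sfield_closed(4)[OF Kt(1)]) auto
    \<comment> \<open>The same element is expressed twice by the \<open>a b * \<alpha> ^ i\<close>,
      which are independent over \<open>Kt\<close>.\<close>
    ultimately have "y b i + e b i = 0"
      using indI bi ldepI[of "I \<times> {..<p}" "\<lambda>v. y (fst v) (snd v) + e (fst v) (snd v)" Kt "(b, i)" "\<lambda>(b, i). a b * \<alpha> ^ i"] by fastforce
    then have "y b i = - e b i" by (simp add: eq_neg_iff_add_eq_0)
    then show ?thesis using ek[OF bi] sfield_closed(3)[OF kf(1)] by simp
  qed
  have yk: "y b i \<in> \<kappa>" if "b \<in> B" "i < p" for b i
    using ykI yk0 that by (cases "b \<in> I") auto

  \<comment> \<open>Counting the parameters of the pair from both sides\<close>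
  define IX :: "(('b \<times> nat) option + ('c \<times> nat) + 'b + 'c) set" where "IX = Inl ` hindex B b0 \<union> Inr ` Inl ` ((C - J) \<times> {..<p})"
  define IZ :: "(('c \<times> nat) option + 'b \<times> nat) set" where "IZ = Inl ` hindex C c0 \<union> Inr ` ((B - I) \<times> {..<p})"
  define z where "z = case_sum (case_option \<alpha> (\<lambda>(c, i). w c i)) (\<lambda>(b, i). y b i)"
  define Q where "Q = fgen (F \<union> z ` IZ)"
  have Q: "sfield Q" "F \<subseteq> Q" by (auto simp: Q_def sfield_fgen intro: fgen_base)
  have zQ: "z v \<in> Q" if "v \<in> IZ" for v using that by (auto simp: Q_def intro: fgen_base)
  have aQ: "\<alpha> \<in> Q" using zQ[of "Inl None"] by (simp add: IZ_def hindex_def z_def)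
  have "w c i \<in> Q" if "c \<in> C" "i < p" "(c, i) \<noteq> (c0, 0)" for c i
    using zQ[of "Inl (Some (c, i))"] that by (auto simp: IZ_def hindex_def z_def)
  then have wQ: "w c i \<in> Q" if "c \<in> C" "i < p" for c i
    using remaining_coord[of C d c0 w \<alpha> Q c i] DY wroot Q aQ that by blast
  have sQ: "y b i \<in> Q" if "b \<in> B - I" "i < p" for b i
    using zQ[of "Inr (b, i)"] that by (auto simp: IZ_def z_def)
  have kQ: "\<kappa> \<subseteq> Q"
    unfolding \<kappa>_def using Fp_subset Q(2) wQ sQ sfield_closed(9)[OF Q(1) aQ, of p] by (intro fgen_least Q(1)) auto
  have finX: "finite IX" and finZ: "finite IZ" using DX(1) DY(1) by (auto simp: IX_def IZ_def hindex_def)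
  have XX: "alg_indep (\<lambda>x. x) F IX Z" by (rule alg_indep_subset[OF Z]) (auto simp: IX_def All_def)
  \<comment> \<open>The independent data seen from \<open>X\<close> are rational in the data seen
    from \<open>Y\<close>, so \<open>card B * p + (card C - card J) * p\<close> is at most
    \<open>card C * p + (card B - card I) * p\<close>.\<close>
  have genX: "Z v \<in> fgen (F \<union> z ` IZ)" if v: "v \<in> IX" for v
  proof -
    have "v = Inl None \<or> (\<exists>b i. v = Inl (Some (b, i)) \<and> b \<in> B \<and> i < p \<and> (b, i) \<noteq> (b0, 0)) \<or>
        (\<exists>c i. v = Inr (Inl (c, i)) \<and> c \<in> C - J \<and> i < p)"
      using v by (auto simp: IX_def hindex_def)
    then consider "v = Inl None" | b i where "v = Inl (Some (b, i))" "b \<in> B" "i < p" "(b, i) \<noteq> (b0, 0)"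
      | c i where "v = Inr (Inl (c, i))" "c \<in> C - J" "i < p" by (elim disjE exE conjE)
    then have "Z v \<in> Q"
    proof cases
      case 1 then show ?thesis using aQ by (simp add: \<alpha>_def)
    next
      case 2
      then have "Z v = y b i" by (auto simp: y_def)
      then show ?thesis using yk[OF 2(2,3)] kQ by auto
    next
      case 3
      then have "Z v = w c i" by (simp add: w_def W_def t_def)
      then show ?thesis using wQ 3 by auto
    qed
    then show ?thesis by (simp add: Q_def)
  qed
  have finhX: "finite (hindex B b0)" and finhY: "finite (hindex C c0)" using DX(1) DY(1) by (auto simp: hindex_def)
  have cX: "card IX = card B * p + (card C - card J) * p"
    unfolding IX_def using DX(1,3) DY(1) finJ J(1)
    by (subst card_Un_disjoint) (auto simp: card_image inj_on_def card_hindex card_cartesian_product card_Diff_subset finhX finhY)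
  have cZ: "card IZ = card C * p + (card B - card I) * p"
    unfolding IZ_def using DY(1,3) DX(1) finI I(1)
    by (subst card_Un_disjoint) (auto simp: card_image inj_on_def card_hindex card_cartesian_product card_Diff_subset finhX finhY)
  have cJ: "card J \<le> card C" and cI: "card I \<le> card B" using J(1) I(1) DX(1) DY(1) by (auto intro: card_mono)
  have "(card B + (card C - card J)) * p \<le> (card C + (card B - card I)) * p"
    using alg_indep_card(1)[OF F finX finZ XX genX] unfolding cX cZ by (simp only: add_mult_distrib)
  then have "card B + (card C - card J) \<le> card C + (card B - card I)" using p_pos by simp
  then have IJ: "card I \<le> card J" using cJ cI by linarith

  \<comment> \<open>Equal ranks: the morphism back\<close>
  moreover have "ratio_dep p C c0 d B a" if eq: "card I = card J"
  proof -
    have "card B + (card C - card J) = card C + (card B - card I)" using cJ cI eq by linarith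
    then have "card IX = card IZ" unfolding cX cZ by (metis add_mult_distrib)
    from alg_indep_card(2)[OF F finX finZ XX genX this] have zI: "alg_indep (\<lambda>x. x) F IZ z" .
    have "alg_indep (\<lambda>x. x) F (Inl ` hindex C c0) z" by (rule alg_indep_subset[OF zI]) (auto simp: IZ_def)
    then have "alg_indep (\<lambda>x. x) F (hindex C c0) (\<lambda>v. z (Inl v))"
      using DY(1) by (intro alg_indep_reindex[OF rhom_id F, of "hindex C c0" Inl z]) (auto simp: hindex_def)
    then have genY: "generic_root C c0 d w \<alpha>" using wroot by (simp add: generic_root_def z_def)
    have p1: "1 < p" using p_ge_2 by simp
    have "(\<Sum>v\<in>{Inl (Some (b0, 1))}. 1 * Z v) \<noteq> 0"
      using DX(3) p1 by (intro alg_indep_linear[OF Z sfield_sring[OF F]]) (auto simp: All_def hindex_def intro: sfield_closed(1)[OF F])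
    then have "y b0 1 \<noteq> 0" by (simp add: y_def)
    moreover have "(\<Sum>v\<in>B \<times> {..<p}. y (fst v) (snd v) * (case v of (b, i) \<Rightarrow> a b * \<alpha> ^ i)) = 0"
      using yrel by (simp add: sum.cartesian_product' mult_ac)
    \<comment> \<open>The polynomial of \<open>X\<close> is itself a dependence of the
      \<open>a b\<close> at \<alpha> with coefficients in \<kappa>. It is nontrivial because
      \<open>y b0 1\<close> is a free parameter.\<close>
    ultimately have dep: "ldep \<kappa> (B \<times> {..<p}) (\<lambda>(b, i). a b * \<alpha> ^ i)"
      using yk DX(3) p1 by (intro ldepI[of _ "\<lambda>v. y (fst v) (snd v)" _ "(b0, 1)"]) auto
    define A where "A = fgen (F \<union> z ` Inl ` hindex C c0)"
    have A: "sfield A" "F \<subseteq> A" by (auto simp: A_def sfield_fgen intro: fgen_base)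
    have aA: "\<alpha> \<in> A" unfolding A_def by (rule fgen_base) (force simp: hindex_def z_def)
    have "w c i \<in> A" if "c \<in> C" "i < p" "(c, i) \<noteq> (c0, 0)" for c i
      unfolding A_def using that by (intro fgen_base UnI2) (force simp: hindex_def z_def image_iff)
    then have wA: "w c i \<in> A" if "c \<in> C" "i < p" for c i
      using remaining_coord[of C d c0 w \<alpha> A c i] DY wroot A aA that by blast
    have zA: "alg_indep (\<lambda>x. x) A (Inr ` ((B - I) \<times> {..<p})) z"
      using alg_indep_tower[OF rhom_id sfield_sring[OF F] zI[unfolded IZ_def]] by (auto simp: A_def)
    note rp = root_field_props[where B = C and y = w and \<alpha> = \<alpha>]
    \<comment> \<open>Beyond the root field of \<open>Y\<close> there are only the
      \<open>y b i\<close> with \<open>b \<notin> I\<close>. In the case of equality they are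
      independent of the data of \<open>Y\<close> and drop out.\<close>
    have "\<kappa> \<subseteq> fgen (root_field C w \<alpha> \<union> z ` Inr ` ((B - I) \<times> {..<p}))"
      unfolding \<kappa>_def using rp(2-4)
      by (intro fgen_least sfield_fgen) (auto simp: z_def image_image intro!: fgen_base)
    from ldep_mono[OF dep this]
    have dep2: "ldep (fgen (root_field C w \<alpha> \<union> z ` Inr ` ((B - I) \<times> {..<p}))) (B \<times> {..<p}) (\<lambda>(b, i). a b * \<alpha> ^ i)" .
    have "ldep (root_field C w \<alpha>) (B \<times> {..<p}) (\<lambda>(b, i). a b * \<alpha> ^ i)"
    proof (rule ldep_transcendental_descent[OF A(1) rp(1) root_field_subset[OF A aA wA] zA _ _ dep2])
      show "finite (B \<times> {..<p})" using DX(1) by simp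
      show "(case v of (b, i) \<Rightarrow> a b * \<alpha> ^ i) \<in> A" if "v \<in> B \<times> {..<p}" for v
        using that DX(2) A(2) by (auto intro!: sfield_closed(5)[OF A(1)] sfield_closed(9)[OF A(1)] aA)
    qed
    from specialise_to_ratio[OF DY(1-4) genY DX(1,2) this] show ?thesis .
  qed
  ultimately show ?thesis using J(1) notJ by blast
qed

end

section \<open>The generic point of a hypersurface\<close>

lemma rhom_CHAR:
  fixes h :: "'a::field \<Rightarrow> 'r::comm_ring_1"
  assumes "rhom h"
  shows "CHAR('r) = CHAR('a)"
proof (rule CHAR_eqI)
  have *: "h (of_nat n) = of_nat n" for n
    by (induction n) (auto simp: rhom.hom_add[OF assms] rhom.hom_one[OF assms] rhom.hom_zero[OF assms])
  show "of_nat CHAR('a) = (0 :: 'r)" using *[of "CHAR('a)"] rhom.hom_zero[OF assms] by simp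
  show "CHAR('a) dvd n" if "of_nat n = (0 :: 'r)" for n
    using that *[of n] rhom_field_inj[OF assms, of "of_nat n"] unfolding of_nat_eq_0_iff_char_dvd[symmetric] by simp
qed

lemma sfield_range:
  fixes h :: "'a::field \<Rightarrow> 'r::field"
  assumes "rhom h"
  shows "sfield (range h)"
proof -
  interpret h: rhom h by fact
  have "inverse (h x) = h (inverse x)" for x
  proof (cases "x = 0")
    case False
    then have "h x * h (inverse x) = 1" by (simp add: h.hom_mult[symmetric])
    then show ?thesis by (rule inverse_unique)
  qed simp
  moreover have "1 \<in> range h" by (rule range_eqI[of _ _ 1]) simp
  ultimately show ?thesis
    by (auto simp: sfield_def sring_def h.hom_add[symmetric] h.hom_mult[symmetric] h.hom_uminus[symmetric])
qed

lemma alg_indep_pullback: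
  fixes h :: "'a::field \<Rightarrow> 'r::field"
  assumes h: "rhom h" and z: "alg_indep (\<lambda>x. x) M I z" and sub: "range h \<subseteq> M" and M: "sring M"
  shows "alg_indep h UNIV I z"
  unfolding alg_indep_def
proof (intro ballI impI)
  fix P assume P: "P \<in> mpolys UNIV I" and P0: "meval h z P = 0"
  define Q where "Q = (\<Sum>m\<in>Poly_Mapping.keys P. Poly_Mapping.single m (h (Poly_Mapping.lookup P m)))"
  have "Q \<in> mpolys M I"
    unfolding Q_def using P sub
    by (intro sring_sum[OF sring_mpolys[OF M]] mpolys_single M) (auto simp: mpolys_def)
  moreover have "meval (\<lambda>x. x) z Q = 0"
    unfolding Q_def rhom.meval_sum[OF rhom_id] rhom.meval_single[OF rhom_id] using P0 by (simp add: meval_def)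
  ultimately have "Q = 0" by (rule alg_indepD[OF z])
  have "Poly_Mapping.lookup P k = 0" for k
  proof (rule ccontr)
    assume "Poly_Mapping.lookup P k \<noteq> 0"
    then have "Poly_Mapping.lookup Q k = h (Poly_Mapping.lookup P k)"
      unfolding Q_def lookup_sum by (subst sum.remove[of _ k]) (auto simp: lookup_single in_keys_iff when_def intro!: sum.neutral)
    then show False using \<open>Q = 0\<close> \<open>Poly_Mapping.lookup P k \<noteq> 0\<close> rhom_field_inj[OF h] by simp
  qed
  then show "P = 0" by (intro poly_mapping_eqI) simp
qed

lemma poly_ring_eq: "poly_ring B = mpolys UNIV B"
  by (simp add: poly_ring_def mpolys_def)

locale generic_point = ground p F X for p and F :: "'o::field set" and X +
  fixes emb :: "'a::field \<Rightarrow> 'o" and B :: "'v set" and b0 :: 'v and \<phi> :: "'v \<Rightarrow> 'a" and y :: "'v \<Rightarrow> 'o"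
  assumes p23: "p = 2 \<or> p = 3" and emb: "rhom emb" and F_eq: "F = range emb"
    and D: "datum B b0 (\<lambda>b. emb (\<phi> b))" and y: "alg_indep (\<lambda>x. x) F (B - {b0}) y"
begin

definition a :: "'v \<Rightarrow> 'o" where "a b = emb (\<phi> b)"
definition \<gamma> :: 'o where "\<gamma> = lin_ratio (\<lambda>x. x) B b0 a y"
definition \<eta> :: "'v \<Rightarrow> 'o" where "\<eta> b = (if b = b0 then \<gamma> else y b)"
text \<open>As \<open>\<eta> b\<close> stands for \<open>x\<^sub>b\<^sup>p\<close>, evaluation at \<open>\<eta>\<close> with the coefficients raised to their \<open>p\<close>-th
  powers yields \<open>p\<close>-th powers of functions on the cone: \<open>E f\<close> is \<open>f\<^sup>p\<close>.\<close>

definition \<sigma> :: "'a \<Rightarrow> 'o" where "\<sigma> c = emb c ^ p"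
definition E :: "('v, 'a) mpoly \<Rightarrow> 'o" where "E = meval \<sigma> \<eta>"
definition K :: "'o set" where "K = fgen (Fp \<union> y ` (B - {b0}))"

lemma a_eq: "a = (\<lambda>b. emb (\<phi> b))" by (simp add: a_def fun_eq_iff)

lemmas DD = datumD[OF D[folded a_eq]]

lemma emb_in: "emb c \<in> F" by (simp add: F_eq)

lemma rhom_\<sigma>: "rhom \<sigma>"
  unfolding \<sigma>_def using frobenius_add[OF prime_p char_p]
  by unfold_locales (simp_all add: rhom.hom_add[OF emb] rhom.hom_mult[OF emb] rhom.hom_one[OF emb] power_mult_distrib)

lemma range_\<sigma>: "range \<sigma> = Fp" unfolding \<sigma>_def Fp_def by (subst F_eq) (simp add: image_image)

sublocale E: rhom E unfolding E_def by (rule rhom.rhom_meval[OF rhom_\<sigma>])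

lemma E_const: "E (const_poly c) = emb c ^ p"
  by (simp add: E_def rhom.meval_const[OF rhom_\<sigma>] \<sigma>_def)

lemma E_var: "E (var_poly b) = \<eta> b" by (simp add: E_def rhom.meval_var[OF rhom_\<sigma>])

lemma generic_relation: "(\<Sum>b\<in>B. a b * \<eta> b) = 0"
proof -
  have "a b0 * \<gamma> = - (\<Sum>b\<in>B - {b0}. a b * y b)"
    using DD(4) by (simp add: \<gamma>_def lin_ratio_def sum_distrib_left del: sum_divide_distrib)
  moreover have "(\<Sum>b\<in>B. a b * \<eta> b) = a b0 * \<gamma> + (\<Sum>b\<in>B - {b0}. a b * y b)"
    using DD(1,3) by (subst sum.remove[of _ b0]) (auto simp: \<eta>_def intro!: sum.cong)
  ultimately show ?thesis by simp
qed

lemma E_sum_power: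
  "E (\<Sum>j\<in>J. const_poly (x j) * g j ^ p) = (\<Sum>j\<in>J. emb (x j) * E (g j)) ^ p"
  by (simp add: E.hom_sum E.hom_mult E_const E.hom_power frobenius_sum[OF prime_p char_p] power_mult_distrib)

lemma E_form: "E (form_poly p B \<phi>) = 0"
  unfolding form_poly_def E_sum_power E_var using generic_relation p_pos by (simp add: a_def)

lemma E_ideal: "h \<in> form_ideal p B \<phi> \<Longrightarrow> E h = 0"
  by (auto simp: form_ideal_def E.hom_mult E_form)

lemma E_in: "r \<in> poly_ring (B - {b0}) \<Longrightarrow> E r \<in> rgen (Fp \<union> y ` (B - {b0}))"
proof -
  assume "r \<in> poly_ring (B - {b0})"
  then have "E r \<in> rgen (\<sigma> ` UNIV \<union> \<eta> ` (B - {b0}))" unfolding E_def poly_ring_eq by (rule meval_in_rgen[OF rhom_\<sigma>])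
  also have "\<eta> ` (B - {b0}) = y ` (B - {b0})" by (auto simp: \<eta>_def)
  finally show ?thesis by (simp add: range_\<sigma>)
qed

lemma E_inj: "r \<in> poly_ring (B - {b0}) \<Longrightarrow> E r = 0 \<Longrightarrow> r = 0"
proof -
  assume r: "r \<in> poly_ring (B - {b0})" "E r = 0"
  have "alg_indep (\<lambda>x. x) F (B - {b0}) \<eta>" using y by (subst alg_indep_cong[of _ _ y]) (auto simp: \<eta>_def)
  then have "alg_indep \<sigma> UNIV (B - {b0}) \<eta>"
    by (rule alg_indep_pullback[OF rhom_\<sigma>]) (use Fp_subset range_\<sigma> sfield_sring[OF F] in auto)
  then show "r = 0" using r unfolding E_def poly_ring_eq by (intro alg_indepD)
qed

text \<open>Division with remainder by the form in the variable \<open>b0\<close>, possible because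
  the leading coefficient \<open>\<phi> b0\<close> is a unit.\<close>

lemma power_reduction:
  assumes "g \<in> poly_ring B"
  shows "\<exists>h\<in>poly_ring B. \<exists>r. (\<forall>i. r i \<in> poly_ring (B - {b0})) \<and>
    g = h * form_poly p B \<phi> + (\<Sum>i<p. r i * var_poly b0 ^ i)"
proof -
  have R: "sring (poly_ring B :: ('v, 'a) mpoly set)" and R0: "sring (poly_ring (B - {b0}) :: ('v, 'a) mpoly set)"
    unfolding poly_ring_eq by (rule sring_mpolys[OF sring_UNIV])+
  have sub: "(poly_ring (B - {b0}) :: ('v, 'a) mpoly set) \<subseteq> poly_ring B" unfolding poly_ring_eq by (rule mpolys_mono) auto
  define S where "S = {g. \<exists>h\<in>poly_ring B. \<exists>r. (\<forall>i. r i \<in> poly_ring (B - {b0})) \<and>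
    g = h * form_poly p B \<phi> + (\<Sum>i<p. r i * var_poly b0 ^ i)}"
  have SI: "h * form_poly p B \<phi> + (\<Sum>i<p. r i * var_poly b0 ^ i) \<in> S"
    if "h \<in> poly_ring B" "\<forall>i. r i \<in> poly_ring (B - {b0})" for h r
    unfolding S_def using that by blast
  have add: "f + g \<in> S" if fg: "f \<in> S" "g \<in> S" for f g
  proof -
    obtain h r where f: "h \<in> poly_ring B" "\<forall>i. r i \<in> poly_ring (B - {b0})"
      "f = h * form_poly p B \<phi> + (\<Sum>i<p. r i * var_poly b0 ^ i)" using fg(1) unfolding S_def by blast
    obtain h' r' where g: "h' \<in> poly_ring B" "\<forall>i. r' i \<in> poly_ring (B - {b0})"
      "g = h' * form_poly p B \<phi> + (\<Sum>i<p. r' i * var_poly b0 ^ i)" using fg(2) unfolding S_def by blast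
    have "f + g = (h + h') * form_poly p B \<phi> + (\<Sum>i<p. (r i + r' i) * var_poly b0 ^ i)"
      unfolding f(3) g(3) by (simp add: distrib_right sum.distrib)
    moreover have "h + h' \<in> poly_ring B" "\<forall>i. r i + r' i \<in> poly_ring (B - {b0})"
      using f g sring_add[OF R] sring_add[OF R0] by auto
    ultimately show ?thesis using SI[of "h + h'" "\<lambda>i. r i + r' i"] by simp
  qed
  have base: "r \<in> S" if "r \<in> poly_ring (B - {b0})" for r
  proof -
    have "r = 0 * form_poly p B \<phi> + (\<Sum>i<p. (if i = 0 then r else 0) * var_poly b0 ^ i)"
      using p_pos by (simp add: if_distrib[of "\<lambda>x. x * _"] sum.delta' cong: if_cong)
    moreover have "\<forall>i. (if i = 0 then r else 0) \<in> poly_ring (B - {b0})"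
      using that sring_zero[OF R0] by simp
    ultimately show ?thesis using SI[of 0 "\<lambda>i. if i = 0 then r else 0"] sring_zero[OF R] by simp
  qed
  have \<phi>0: "\<phi> b0 \<noteq> 0" using DD(4) rhom.hom_zero[OF emb] by (auto simp: a_def)
  define \<tau> where "\<tau> = - (\<Sum>b\<in>B - {b0}. const_poly (\<phi> b / \<phi> b0) * var_poly b ^ p)"
  have \<tau>: "\<tau> \<in> poly_ring (B - {b0})"
    unfolding \<tau>_def poly_ring_eq
    by (intro sring_uminus[OF sring_mpolys] sring_sum[OF sring_mpolys] sring_mult[OF sring_mpolys]
        sring_power[OF sring_mpolys] mpolys_const mpolys_var sring_UNIV UNIV_I)
  have top: "var_poly b0 ^ p = const_poly (inverse (\<phi> b0)) * form_poly p B \<phi> + \<tau>"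
  proof -
    interpret c: rhom "const_poly :: 'a \<Rightarrow> ('v, 'a) mpoly" by (rule rhom_const_poly)
    have "form_poly p B \<phi> = const_poly (\<phi> b0) * var_poly b0 ^ p + (\<Sum>b\<in>B - {b0}. const_poly (\<phi> b) * var_poly b ^ p)"
      unfolding form_poly_def using DD(1,3) by (rule sum.remove)
    moreover have "const_poly (inverse (\<phi> b0)) * const_poly (\<phi> b) = (const_poly (\<phi> b / \<phi> b0) :: ('v, 'a) mpoly)" for b
      unfolding c.hom_mult[symmetric] by (simp add: divide_inverse mult.commute)
    moreover have "const_poly (\<phi> b0 / \<phi> b0) = (1 :: ('v, 'a) mpoly)" using \<phi>0 by simp
    ultimately show ?thesis
      unfolding \<tau>_def by (simp only: distrib_left sum_distrib_left mult.assoc[symmetric]) simp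
  qed
  have shift: "var_poly b0 * g \<in> S" if gS: "g \<in> S" for g
  proof -
    obtain h r where g: "h \<in> poly_ring B" "\<forall>i. r i \<in> poly_ring (B - {b0})"
      "g = h * form_poly p B \<phi> + (\<Sum>i<p. r i * var_poly b0 ^ i)" using gS unfolding S_def by blast
    obtain q where q: "p = Suc q" using p_pos by (cases p) auto
    define r' where "r' i = (case i of 0 \<Rightarrow> r q * \<tau> | Suc i \<Rightarrow> r i)" for i
    have "(\<Sum>i<p. r' i * var_poly b0 ^ i) = r q * \<tau> + (\<Sum>i<q. r i * var_poly b0 ^ Suc i)"
      unfolding q by (subst sum.lessThan_Suc_shift) (simp add: r'_def)
    moreover have "var_poly b0 * g = var_poly b0 * h * form_poly p B \<phi> + (\<Sum>i<q. r i * var_poly b0 ^ Suc i) + r q * var_poly b0 ^ p"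
      unfolding g(3) q by (simp add: distrib_left sum_distrib_left mult_ac)
    ultimately have "var_poly b0 * g = (var_poly b0 * h + r q * const_poly (inverse (\<phi> b0))) * form_poly p B \<phi> + (\<Sum>i<p. r' i * var_poly b0 ^ i)"
      unfolding top by (simp add: algebra_simps)
    moreover have "var_poly b0 * h + r q * const_poly (inverse (\<phi> b0)) \<in> poly_ring B"
      using g(1,2) sub DD(3) mpolys_var[OF sring_UNIV, of b0 B] mpolys_const[OF sring_UNIV UNIV_I, of "inverse (\<phi> b0)" B]
      unfolding poly_ring_eq[symmetric] by (intro sring_add[OF R] sring_mult[OF R]) auto
    moreover have "r' i \<in> poly_ring (B - {b0})" for i
      using g(2) \<tau> by (auto simp: r'_def intro: sring_mult[OF R0] split: nat.split)
    ultimately show ?thesis unfolding S_def by blast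
  qed
  have mono: "Poly_Mapping.single m c \<in> S" if m: "Poly_Mapping.keys m \<subseteq> B" for m c
  proof -
    define n where "n = Poly_Mapping.lookup m b0"
    define m' where "m' = m - Poly_Mapping.single b0 n"
    have "m = m' + Poly_Mapping.single b0 n"
      by (intro poly_mapping_eqI) (auto simp: m'_def n_def lookup_add lookup_minus lookup_single when_def)
    then have "Poly_Mapping.single m c = Poly_Mapping.single (Poly_Mapping.single b0 n) 1 * Poly_Mapping.single m' c"
      by (simp add: mult_single add.commute)
    also have "Poly_Mapping.single (Poly_Mapping.single b0 n) 1 = (var_poly b0 :: ('v, 'a) mpoly) ^ n"
    proof (induction n)
      case (Suc n)
      then have "(var_poly b0 :: ('v, 'a) mpoly) ^ Suc n = var_poly b0 * Poly_Mapping.single (Poly_Mapping.single b0 n) 1" by simp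
      then show ?case by (simp add: var_poly_def mult_single single_add[symmetric])
    qed simp
    finally have eq: "Poly_Mapping.single m c = var_poly b0 ^ n * Poly_Mapping.single m' c" .
    have "b \<in> B - {b0}" if "b \<in> Poly_Mapping.keys m'" for b
      using that m by (auto simp: m'_def n_def in_keys_iff lookup_minus lookup_single when_def split: if_splits)
    then have m0: "Poly_Mapping.single m' c \<in> S"
      by (intro base) (auto simp: poly_ring_def)
    have "var_poly b0 ^ k * Poly_Mapping.single m' c \<in> S" for k
      by (induction k) (use m0 shift in \<open>auto simp: mult.assoc\<close>)
    then show ?thesis unfolding eq by blast
  qed
  have "(\<Sum>m\<in>T. Poly_Mapping.single m (Poly_Mapping.lookup g m)) \<in> S" if "finite T" "T \<subseteq> Poly_Mapping.keys g" for T
    using that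
  proof (induction T rule: finite_induct)
    case empty
    then show ?case using base[OF sring_zero[OF R0]] by simp
  next
    case (insert m T)
    then have "Poly_Mapping.keys m \<subseteq> B" using assms by (auto simp: poly_ring_def)
    with insert show ?case by (auto intro: add mono)
  qed
  from this[of "Poly_Mapping.keys g"] have "g \<in> S" using mpoly_single_sum[of g] by simp
  then show ?thesis unfolding S_def by blast
qed

lemma sfield_K: "sfield K" by (simp add: K_def sfield_fgen)

lemma \<gamma>_power: "\<gamma> ^ p \<in> K"
  
proof -
  have "\<gamma> ^ p \<in> rgen (Fp \<union> y ` (B - {b0}))" unfolding \<gamma>_def by (rule lin_ratio_power_in[OF DD(2,3)])
  then show ?thesis using rgen_subset_fgen unfolding K_def by blast
qed

lemma \<gamma>_basis: "\<not> ldep K {..<p} (\<lambda>i. \<gamma> ^ i)"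
proof (rule not_ldep_powers[OF p23 char_p sfield_K _ \<gamma>_power])
  show "\<gamma> \<notin> K" unfolding \<gamma>_def K_def by (rule lin_ratio_not_in[OF DD(1) _ DD(3,5,6) y]) (rule DD(2))
qed

text \<open>The remainder of \<open>g\<close> modulo the form is mapped to a combination of powers
  of \<gamma> below \<open>p\<close> over \<open>K\<close>. These powers are independent and
  \<open>E\<close> is injective on polynomials without the variable \<open>b0\<close>, so the
  remainder is zero.\<close>

lemma E_kernel: "g \<in> poly_ring B \<Longrightarrow> E g = 0 \<longleftrightarrow> g \<in> form_ideal p B \<phi>"
proof
  assume g: "g \<in> poly_ring B" "E g = 0"
  obtain h r where h: "h \<in> poly_ring B" "\<forall>i. r i \<in> poly_ring (B - {b0})"
    "g = h * form_poly p B \<phi> + (\<Sum>i<p. r i * var_poly b0 ^ i)" using power_reduction[OF g(1)] by blast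
  have "(\<Sum>i<p. E (r i) * \<gamma> ^ i) = 0"
    using g(2) unfolding h(3) by (simp add: E.hom_add E.hom_mult E_form E.hom_sum E.hom_power E_var \<eta>_def)
  moreover have "E (r i) \<in> K" for i using E_in h(2) rgen_subset_fgen unfolding K_def by blast
  ultimately have "E (r i) = 0" if "i < p" for i
    using \<gamma>_basis ldepI[of "{..<p}" "\<lambda>i. E (r i)" K i "\<lambda>i. \<gamma> ^ i"] that by blast
  then have "r i = 0" if "i < p" for i using E_inj h(2) that by blast
  then have "g = h * form_poly p B \<phi>" unfolding h(3) by simp
  then show "g \<in> form_ideal p B \<phi>" using h(1) unfolding form_ideal_def by blast
qed (rule E_ideal)

end

section \<open>Homogeneous polynomials and their components\<close>

definition mdeg :: "('i \<Rightarrow>\<^sub>0 nat) \<Rightarrow> nat" where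
  "mdeg m = (\<Sum>i\<in>Poly_Mapping.keys m. Poly_Mapping.lookup m i)"

lemma mdeg_superset: "finite S \<Longrightarrow> Poly_Mapping.keys m \<subseteq> S \<Longrightarrow> mdeg m = (\<Sum>i\<in>S. Poly_Mapping.lookup m i)"
  unfolding mdeg_def by (intro sum.mono_neutral_left) (auto simp: in_keys_iff)

lemma mdeg_0 [simp]: "mdeg 0 = 0" by (simp add: mdeg_def)

lemma mdeg_add: "mdeg (m + n) = mdeg m + mdeg n"
proof -
  let ?S = "Poly_Mapping.keys m \<union> Poly_Mapping.keys n"
  have "mdeg (m + n) = (\<Sum>i\<in>?S. Poly_Mapping.lookup (m + n) i)"
    by (intro mdeg_superset) (auto dest: subsetD[OF keys_add])
  then show ?thesis by (simp add: lookup_add sum.distrib mdeg_superset[of ?S m] mdeg_superset[of ?S n])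
qed

lemma homogeneous_iff: "f \<in> homogeneous B e \<longleftrightarrow> f \<in> poly_ring B \<and> (\<forall>m\<in>Poly_Mapping.keys f. mdeg m = e)"
  by (simp add: homogeneous_def mdeg_def)

lemma homogeneous_poly_ring: "f \<in> homogeneous B e \<Longrightarrow> f \<in> poly_ring B"
  by (simp add: homogeneous_iff)

lemma homogeneous_const: "const_poly c \<in> homogeneous B 0"
  by (auto simp: homogeneous_iff poly_ring_def const_poly_def)

lemma homogeneous_zero: "0 \<in> homogeneous B e"
  by (auto simp: homogeneous_iff poly_ring_def)

lemma homogeneous_one: "1 \<in> homogeneous B 0"
  using homogeneous_const[of 1] by (simp add: const_poly_def flip: single_one)

lemma homogeneous_add:
  fixes f g :: "('i, 'a::comm_ring_1) mpoly"
  assumes "f \<in> homogeneous B e" "g \<in> homogeneous B e"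
  shows "f + g \<in> homogeneous B e"
  using assms sring_add[OF sring_mpolys[OF sring_UNIV], of f B g]
  by (auto simp: homogeneous_iff poly_ring_eq dest!: subsetD[OF keys_add])

lemma homogeneous_uminus:
  fixes f :: "('i, 'a::comm_ring_1) mpoly"
  shows "f \<in> homogeneous B e \<Longrightarrow> - f \<in> homogeneous B e"
  using sring_uminus[OF sring_mpolys[OF sring_UNIV], of f B]
  by (auto simp: homogeneous_iff poly_ring_eq)

lemma homogeneous_mult:
  fixes f g :: "('i, 'a::comm_ring_1) mpoly"
  assumes "f \<in> homogeneous B d" "g \<in> homogeneous B e"
  shows "f * g \<in> homogeneous B (d + e)"
  using assms sring_mult[OF sring_mpolys[OF sring_UNIV], of f B g]
  by (auto simp: homogeneous_iff poly_ring_eq mdeg_add dest!: subsetD[OF keys_mult])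

lemma homogeneous_prod:
  fixes f :: "'x \<Rightarrow> ('i, 'a::comm_ring_1) mpoly"
  assumes "\<And>x. x \<in> A \<Longrightarrow> f x \<in> homogeneous B (e x)"
  shows "prod f A \<in> homogeneous B (sum e A)"
  using assms by (induction A rule: infinite_finite_induct) (auto intro: homogeneous_one homogeneous_mult)

definition homogeneous_part :: "nat \<Rightarrow> ('i, 'a::comm_ring_1) mpoly \<Rightarrow> ('i, 'a) mpoly" where
  "homogeneous_part e f = (\<Sum>m | m \<in> Poly_Mapping.keys f \<and> mdeg m = e. Poly_Mapping.single m (Poly_Mapping.lookup f m))"

lemma homogeneous_part_in:
  assumes "f \<in> poly_ring B"
  shows "homogeneous_part e f \<in> homogeneous B e"
proof -
  have "(\<Sum>m\<in>T. Poly_Mapping.single m (Poly_Mapping.lookup f m)) \<in> homogeneous B e"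
    if "finite T" "T \<subseteq> {m \<in> Poly_Mapping.keys f. mdeg m = e}" for T
    using that
  proof (induction T rule: finite_induct)
    case (insert m T)
    then have "Poly_Mapping.single m (Poly_Mapping.lookup f m) \<in> homogeneous B e"
      using assms by (auto simp: homogeneous_iff poly_ring_def)
    with insert show ?case by (auto intro: homogeneous_add)
  qed (simp add: homogeneous_zero)
  then show ?thesis unfolding homogeneous_part_def by auto
qed

text \<open>Replacing each \<open>z i\<close> by \<open>z i * T\<close> lets the exponent of
  \<open>T\<close> record the degree.\<close>

lemma coeff_graded_meval:
  fixes \<sigma> :: "'a::comm_ring_1 \<Rightarrow> 'r::comm_ring_1"
  assumes \<sigma>: "rhom \<sigma>"
  shows "coeff (meval (\<lambda>c. [:\<sigma> c:]) (\<lambda>i. monom (z i) 1) f) e = meval \<sigma> z (homogeneous_part e f)"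
proof -
  have "mono_ev (\<lambda>i. monom (z i) 1) m = monom (mono_ev z m) (mdeg m)" for m :: "'b \<Rightarrow>\<^sub>0 nat"
  proof -
    have "(\<Prod>i\<in>A. monom (z i) 1 ^ n i) = monom (\<Prod>i\<in>A. z i ^ n i) (\<Sum>i\<in>A. n i)" for A :: "'b set" and n
      by (induction A rule: infinite_finite_induct) (auto simp: monom_power mult_monom monom_0)
    then show ?thesis by (simp add: mono_ev_def mdeg_def)
  qed
  then have "coeff (meval (\<lambda>c. [:\<sigma> c:]) (\<lambda>i. monom (z i) 1) f) e =
      (\<Sum>m\<in>Poly_Mapping.keys f. if mdeg m = e then \<sigma> (Poly_Mapping.lookup f m) * mono_ev z m else 0)"
    by (simp add: meval_def coeff_sum smult_monom)
  also have "\<dots> = (\<Sum>m | m \<in> Poly_Mapping.keys f \<and> mdeg m = e. \<sigma> (Poly_Mapping.lookup f m) * mono_ev z m)"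
    by (simp add: sum.inter_filter)
  also have "\<dots> = meval \<sigma> z (homogeneous_part e f)"
    by (simp add: homogeneous_part_def rhom.meval_sum[OF \<sigma>] rhom.meval_single[OF \<sigma>])
  finally show ?thesis .
qed

context generic_point begin

lemma \<eta>_in: "b \<in> B \<Longrightarrow> \<eta> b \<in> fgen (insert \<gamma> K)"
  by (auto simp: \<eta>_def K_def intro: fgen_base)

lemma E_in_field:
  assumes "g \<in> poly_ring B"
  shows "E g \<in> fgen (insert \<gamma> K)"
proof -
  have "E g \<in> rgen (range \<sigma> \<union> \<eta> ` B)"
    using assms unfolding E_def poly_ring_eq by (rule meval_in_rgen[OF rhom_\<sigma>])
  moreover have "rgen (range \<sigma> \<union> \<eta> ` B) \<subseteq> fgen (insert \<gamma> K)"
    unfolding range_\<sigma> using \<eta>_in by (intro rgen_least sfield_sring sfield_fgen) (auto simp: K_def intro: fgen_base)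
  ultimately show ?thesis by blast
qed

lemma field_subset: "fgen (insert \<gamma> K) \<subseteq> fgen (range \<sigma> \<union> \<eta> ` B)"
proof (rule fgen_least[OF _ sfield_fgen])
  have "K \<subseteq> fgen (range \<sigma> \<union> \<eta> ` B)"
    unfolding K_def range_\<sigma> by (intro fgen_mono) (auto simp: \<eta>_def image_iff intro!: bexI)
  moreover have "\<gamma> \<in> fgen (range \<sigma> \<union> \<eta> ` B)"
    using DD(3) by (intro fgen_base) (force simp: \<eta>_def)
  ultimately show "insert \<gamma> K \<subseteq> fgen (range \<sigma> \<union> \<eta> ` B)" by blast
qed

lemma ratio_dep_iff_point:
  assumes J: "finite J" and x: "\<And>j. j \<in> J \<Longrightarrow> x j \<in> F"
  shows "ratio_dep p B b0 a J x \<longleftrightarrow> ldep (fgen (insert \<gamma> K)) J x"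
  unfolding ldep_fgen_power_basis[OF pc sfield_K \<gamma>_power \<gamma>_basis J]
  using ratio_dep_iff[OF J DD(2,3) x y, where q = p] by (simp only: K_def \<gamma>_def)

text \<open>The \<open>p\<close>-th powers of the function field of the hypersurface.\<close>

definition Lp :: "'o set" where
  "Lp = {E f / E g | f g. (\<exists>e. f \<in> homogeneous B e \<and> g \<in> homogeneous B e) \<and> E g \<noteq> 0}"

text \<open>The condition on a morphism is that \<open>E\<close> of
  \<open>\<Sum>j. x j * g j ^ p\<close> vanishes. By \<open>E_sum_power\<close> this value is the
  \<open>p\<close>-th power of the linear expression used here.\<close>

definition morphic :: "'j set \<Rightarrow> ('j \<Rightarrow> 'a) \<Rightarrow> bool" where
  "morphic J x \<longleftrightarrow> (\<exists>e g. (\<forall>j\<in>J. g j \<in> homogeneous B e) \<and> (\<exists>j\<in>J. E (g j) \<noteq> 0) \<and> (\<Sum>j\<in>J. emb (x j) * E (g j)) = 0)"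

text \<open>The equation \<open>\<Sum>b. a b * \<eta> b = 0\<close> is homogeneous, so the form
  still vanishes when \<eta> is scaled by a new variable. The relation persists with that variable
  and can be split by its exponents.\<close>

lemma homogeneous_relation:
  assumes g: "\<And>j. j \<in> J \<Longrightarrow> g j \<in> poly_ring B" and rel: "(\<Sum>j\<in>J. emb (x j) * E (g j)) = 0"
  shows "(\<Sum>j\<in>J. emb (x j) * E (homogeneous_part e (g j))) = 0"
proof -
  let ?\<sigma> = "\<lambda>c. [:\<sigma> c:]" and ?\<eta> = "\<lambda>i. monom (\<eta> i) 1"
  have \<sigma>': "rhom ?\<sigma>" using rhom_\<sigma> by (simp add: rhom_def one_pCons)
  interpret P: rhom "meval ?\<sigma> ?\<eta>" by (rule rhom.rhom_meval[OF \<sigma>'])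
  have C: "CHAR('o poly) = p" using char_p by simp
  have Pc: "meval ?\<sigma> ?\<eta> (const_poly c) = [:emb c:] ^ p" for c
    unfolding rhom.meval_const[OF \<sigma>'] by (simp add: \<sigma>_def poly_const_pow)
  have Ps: "meval ?\<sigma> ?\<eta> (\<Sum>j\<in>I. const_poly (z j) * h j ^ p) = (\<Sum>j\<in>I. [:emb (z j):] * meval ?\<sigma> ?\<eta> (h j)) ^ p"
    for I :: "'i set" and z h
    by (simp add: P.hom_sum P.hom_mult P.hom_power Pc frobenius_sum[OF prime_p C] power_mult_distrib del: One_nat_def mult_pCons_left)
  have "(\<Sum>j\<in>B. [:a j:] * monom (\<eta> j) 1) = monom (\<Sum>j\<in>B. a j * \<eta> j) 1"
    by (simp add: smult_monom monom_sum)
  then have "meval ?\<sigma> ?\<eta> (form_poly p B \<phi>) = 0"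
    unfolding form_poly_def Ps rhom.meval_var[OF \<sigma>'] using p_pos generic_relation by (simp add: a_def)
  moreover have "(\<Sum>j\<in>J. const_poly (x j) * g j ^ p) \<in> form_ideal p B \<phi>"
  proof -
    have "(\<Sum>j\<in>J. const_poly (x j) * g j ^ p) \<in> poly_ring B"
      using g unfolding poly_ring_eq
      by (intro sring_sum[OF sring_mpolys] sring_mult[OF sring_mpolys] sring_power[OF sring_mpolys] mpolys_const sring_UNIV UNIV_I) auto
    then show ?thesis using rel p_pos by (simp add: E_sum_power flip: E_kernel)
  qed
  ultimately have "meval ?\<sigma> ?\<eta> (\<Sum>j\<in>J. const_poly (x j) * g j ^ p) = 0"
    by (auto simp: form_ideal_def P.hom_mult simp del: One_nat_def)
  then have "(\<Sum>j\<in>J. [:emb (x j):] * meval ?\<sigma> ?\<eta> (g j)) = 0" unfolding Ps by simp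
  from arg_cong[OF this, of "\<lambda>q. coeff q e"] show ?thesis
    by (simp add: coeff_sum coeff_graded_meval[OF rhom_\<sigma>] E_def del: One_nat_def)
qed

text \<open>A relation over the field of the affine cone is cleared of denominators. Its homogeneous
  components are relations, and one of them is nontrivial because the components of a nonzero
  coefficient add up to it.\<close>

lemma morphic_iff_ratio_dep:
  assumes J: "finite J"
  shows "morphic J x \<longleftrightarrow> ratio_dep p B b0 a J (\<lambda>j. emb (x j))"
proof -
  have "morphic J x \<longleftrightarrow> ldep (fgen (insert \<gamma> K)) J (\<lambda>j. emb (x j))"
  proof
    assume "morphic J x"
    then obtain e g j where g: "\<forall>j\<in>J. g j \<in> homogeneous B e" "j \<in> J" "E (g j) \<noteq> 0" "(\<Sum>j\<in>J. emb (x j) * E (g j)) = 0"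
      unfolding morphic_def by blast
    then show "ldep (fgen (insert \<gamma> K)) J (\<lambda>j. emb (x j))"
      by (intro ldepI[of J "\<lambda>j. E (g j)" _ j]) (auto simp: mult.commute intro: E_in_field homogeneous_poly_ring)
  next
    assume "ldep (fgen (insert \<gamma> K)) J (\<lambda>j. emb (x j))"
    then have "ldep (rgen (range \<sigma> \<union> \<eta> ` B)) J (\<lambda>j. emb (x j))"
      using ldep_rgen[OF J] ldep_mono[OF _ field_subset] by blast
    then obtain c l where c: "\<forall>j\<in>J. c j \<in> rgen (range \<sigma> \<union> \<eta> ` B)" "l \<in> J" "c l \<noteq> 0" "(\<Sum>j\<in>J. c j * emb (x j)) = 0"
      by (rule ldepE)
    have "\<forall>j\<in>J. \<exists>g. g \<in> poly_ring B \<and> c j = E g"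
      using c(1) unfolding rgen_eq_meval[OF rhom_\<sigma> sring_UNIV] E_def poly_ring_eq by blast
    then have "\<exists>g. \<forall>j\<in>J. g j \<in> poly_ring B \<and> c j = E (g j)" by (rule bchoice)
    then obtain g where g: "\<And>j. j \<in> J \<Longrightarrow> g j \<in> poly_ring B" "\<And>j. j \<in> J \<Longrightarrow> c j = E (g j)" by blast
    have rel: "(\<Sum>j\<in>J. emb (x j) * E (g j)) = 0" using c(4) g(2) by (simp add: mult.commute)
    have "\<exists>e. E (homogeneous_part e (g l)) \<noteq> 0"
    proof (rule ccontr)
      assume n: "\<not> ?thesis"
      let ?P = "meval (\<lambda>c. [:\<sigma> c:]) (\<lambda>i. monom (\<eta> i) 1) (g l)"
      have \<sigma>': "rhom (\<lambda>c. [:\<sigma> c:])" using rhom_\<sigma> by (simp add: rhom_def one_pCons)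
      have ev: "rhom (\<lambda>q :: 'o poly. poly q 1)" by (simp add: rhom_def)
      have "?P = 0" using n by (intro poly_eqI) (simp add: coeff_graded_meval[OF rhom_\<sigma>] E_def del: One_nat_def)
      then have "0 = poly ?P 1" by simp
      also have "\<dots> = E (g l)" unfolding E_def by (subst meval_hom[OF \<sigma>' ev]) (simp add: poly_monom)
      finally show False using c(2,3) g(2) by simp
    qed
    then obtain e where e: "E (homogeneous_part e (g l)) \<noteq> 0" by blast
    have "(\<Sum>j\<in>J. emb (x j) * E (homogeneous_part e (g j))) = 0"
      using g(1) rel by (rule homogeneous_relation)
    then show "morphic J x"
      unfolding morphic_def using e c(2) homogeneous_part_in[OF g(1)]
      by (intro exI[of _ e] exI[of _ "\<lambda>j. homogeneous_part e (g j)"]) auto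
  qed
  then show ?thesis using ratio_dep_iff_point[OF J, of "\<lambda>j. emb (x j)"] emb_in by simp
qed

text \<open>Multiplying with all denominators brings fractions of different degrees to one common
  degree.\<close>

lemma morphic_iff_Lp:
  assumes J: "finite J"
  shows "morphic J x \<longleftrightarrow> ldep Lp J (\<lambda>j. emb (x j))"
proof
  assume "morphic J x"
  then obtain e g j where g: "\<forall>j\<in>J. g j \<in> homogeneous B e" "j \<in> J" "E (g j) \<noteq> 0" "(\<Sum>j\<in>J. emb (x j) * E (g j)) = 0"
    unfolding morphic_def by blast
  have "(\<Sum>i\<in>J. E (g i) / E (g j) * emb (x i)) = (\<Sum>i\<in>J. emb (x i) * E (g i)) / E (g j)"
    by (simp add: sum_divide_distrib mult_ac)
  then show "ldep Lp J (\<lambda>j. emb (x j))"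
    using g by (intro ldepI[of J "\<lambda>i. E (g i) / E (g j)" _ j]) (auto simp: Lp_def)
next
  assume "ldep Lp J (\<lambda>j. emb (x j))"
  then obtain c l where c: "\<forall>j\<in>J. c j \<in> Lp" "l \<in> J" "c l \<noteq> 0" "(\<Sum>j\<in>J. c j * emb (x j)) = 0"
    by (rule ldepE)
  have "\<forall>j\<in>J. \<exists>u. fst u \<in> homogeneous B (snd (snd u)) \<and> fst (snd u) \<in> homogeneous B (snd (snd u)) \<and>
      E (fst (snd u)) \<noteq> 0 \<and> c j = E (fst u) / E (fst (snd u))"
    using c(1) unfolding Lp_def by fastforce
  then have "\<exists>u. \<forall>j\<in>J. fst (u j) \<in> homogeneous B (snd (snd (u j))) \<and> fst (snd (u j)) \<in> homogeneous B (snd (snd (u j))) \<and>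
      E (fst (snd (u j))) \<noteq> 0 \<and> c j = E (fst (u j)) / E (fst (snd (u j)))" by (rule bchoice)
  then obtain u where u: "\<forall>j\<in>J. fst (u j) \<in> homogeneous B (snd (snd (u j))) \<and> fst (snd (u j)) \<in> homogeneous B (snd (snd (u j))) \<and>
      E (fst (snd (u j))) \<noteq> 0 \<and> c j = E (fst (u j)) / E (fst (snd (u j)))" ..
  define f g e where "f j = fst (u j)" and "g j = fst (snd (u j))" and "e j = snd (snd (u j))" for j
  have fg: "f j \<in> homogeneous B (e j)" "g j \<in> homogeneous B (e j)" "E (g j) \<noteq> 0" "c j = E (f j) / E (g j)" if "j \<in> J" for j
    using u that by (auto simp: f_def g_def e_def)
  define q where "q j = f j * (\<Prod>i\<in>J - {j}. g i)" for j
  define D where "D = E (\<Prod>i\<in>J. g i)"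
  have D0: "D \<noteq> 0" unfolding D_def E.hom_prod using fg(3) J by simp
  have Eq: "E (q j) = c j * D" if j: "j \<in> J" for j
  proof -
    have "D = E (g j) * (\<Prod>i\<in>J - {j}. E (g i))"
      unfolding D_def E.hom_prod using J j by (rule prod.remove)
    then show ?thesis using fg(3,4)[OF j] by (simp add: q_def E.hom_mult E.hom_prod)
  qed
  have "q j \<in> homogeneous B (\<Sum>i\<in>J. e i)" if j: "j \<in> J" for j
  proof -
    have "q j \<in> homogeneous B (e j + (\<Sum>i\<in>J - {j}. e i))"
      unfolding q_def using fg j by (intro homogeneous_mult homogeneous_prod) auto
    then show ?thesis using J j by (simp add: sum.remove)
  qed
  moreover have "E (q l) \<noteq> 0" using Eq[OF c(2)] c(3) D0 by simp
  moreover have "(\<Sum>j\<in>J. emb (x j) * E (q j)) = (\<Sum>j\<in>J. c j * emb (x j)) * D"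
    unfolding sum_distrib_right using Eq by (intro sum.cong refl) simp
  ultimately show "morphic J x" unfolding morphic_def using c(2,4) by (intro exI[of _ "\<Sum>i\<in>J. e i"] exI[of _ q]) auto
qed

lemma rational_morphisms_iff:
  assumes C: "finite C"
  shows "rational_morphisms p B \<phi> C \<psi> \<noteq> {} \<longleftrightarrow> ratio_dep p B b0 a C (\<lambda>c. emb (\<psi> c))"
proof -
  have "rational_morphisms p B \<phi> C \<psi> \<noteq> {} \<longleftrightarrow> morphism_tuples p B \<phi> C \<psi> \<noteq> {}"
    unfolding rational_morphisms_def quotient_def by simp
  also have "\<dots> \<longleftrightarrow> morphic C \<psi>"
  proof -
    have tuple: "(\<Sum>c\<in>C. const_poly (\<psi> c) * g c ^ p) \<in> form_ideal p B \<phi> \<longleftrightarrow> (\<Sum>c\<in>C. emb (\<psi> c) * E (g c)) = 0"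
      if g: "\<forall>c\<in>C. g c \<in> homogeneous B e" for g e
    proof -
      have "g c \<in> mpolys UNIV B" if "c \<in> C" for c
        using homogeneous_poly_ring[OF bspec[OF g that]] by (simp add: poly_ring_eq)
      then have "(\<Sum>c\<in>C. const_poly (\<psi> c) * g c ^ p) \<in> poly_ring B"
        unfolding poly_ring_eq
        by (intro sring_sum[OF sring_mpolys] sring_mult[OF sring_mpolys] sring_power[OF sring_mpolys] mpolys_const sring_UNIV UNIV_I)
      then show ?thesis using p_pos by (simp add: E_sum_power flip: E_kernel)
    qed
    show ?thesis
    proof
      assume "morphism_tuples p B \<phi> C \<psi> \<noteq> {}"
      then have "\<exists>g e. g \<in> C \<rightarrow>\<^sub>E homogeneous B e \<and> (\<exists>c\<in>C. g c \<notin> form_ideal p B \<phi>) \<and>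
        (\<Sum>c\<in>C. const_poly (\<psi> c) * g c ^ p) \<in> form_ideal p B \<phi>"
        unfolding morphism_tuples_def by simp
      then obtain g e where g: "g \<in> C \<rightarrow>\<^sub>E homogeneous B e" "\<exists>c\<in>C. g c \<notin> form_ideal p B \<phi>"
        "(\<Sum>c\<in>C. const_poly (\<psi> c) * g c ^ p) \<in> form_ideal p B \<phi>" by (elim exE conjE)
      have h: "\<forall>c\<in>C. g c \<in> homogeneous B e" using g(1) by auto
      have "E (g c) \<noteq> 0" if "c \<in> C" "g c \<notin> form_ideal p B \<phi>" for c
        using that(2) E_kernel[OF homogeneous_poly_ring[OF bspec[OF h that(1)]]] by simp
      then have "\<exists>c\<in>C. E (g c) \<noteq> 0" using g(2) by (elim bexE) (intro bexI)
      moreover have "(\<Sum>c\<in>C. emb (\<psi> c) * E (g c)) = 0" using g(3) tuple[OF h] by simp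
      ultimately show "morphic C \<psi>" unfolding morphic_def using h by (intro exI conjI)
    next
      assume "morphic C \<psi>"
      then obtain e g where g: "\<forall>c\<in>C. g c \<in> homogeneous B e" "\<exists>c\<in>C. E (g c) \<noteq> 0" "(\<Sum>c\<in>C. emb (\<psi> c) * E (g c)) = 0"
        unfolding morphic_def by (elim exE conjE)
      have "restrict g C \<in> C \<rightarrow>\<^sub>E homogeneous B e" using g(1) by auto
      moreover have "\<exists>c\<in>C. restrict g C c \<notin> form_ideal p B \<phi>" using g(2) E_ideal by auto
      moreover have "(\<Sum>c\<in>C. const_poly (\<psi> c) * restrict g C c ^ p) \<in> form_ideal p B \<phi>"
        using tuple[OF g(1)] g(3) by simp
      ultimately show "morphism_tuples p B \<phi> C \<psi> \<noteq> {}" 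
        unfolding morphism_tuples_def by (intro ex_in_conv[THEN iffD1] exI[of _ "restrict g C"] CollectI conjI exI[of _ e])
    qed
  qed
  also have "\<dots> \<longleftrightarrow> ratio_dep p B b0 a C (\<lambda>c. emb (\<psi> c))" by (rule morphic_iff_ratio_dep[OF C])
  finally show ?thesis .
qed

end

section \<open>The function field and the defect index\<close>

text \<open>The coordinates identify the space with the functions on \<open>S\<close>; the vectors
  dual to them are a basis.\<close>

lemma (in vectorspace) dim_eq_card_coordinates:
  fixes \<pi> :: "'c \<Rightarrow> 's \<Rightarrow> 'a"
  assumes fin: "finite S"
    and closed: "\<And>v s. v \<in> carrier V \<Longrightarrow> s \<in> S \<Longrightarrow> \<pi> v s \<in> carrier K"
    and add: "\<And>v w s. v \<in> carrier V \<Longrightarrow> w \<in> carrier V \<Longrightarrow> s \<in> S \<Longrightarrow> \<pi> (v \<oplus>\<^bsub>V\<^esub> w) s = \<pi> v s \<oplus>\<^bsub>K\<^esub> \<pi> w s"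
    and smult: "\<And>c v s. c \<in> carrier K \<Longrightarrow> v \<in> carrier V \<Longrightarrow> s \<in> S \<Longrightarrow> \<pi> (c \<odot>\<^bsub>V\<^esub> v) s = c \<otimes>\<^bsub>K\<^esub> \<pi> v s"
    and inj: "\<And>v w. v \<in> carrier V \<Longrightarrow> w \<in> carrier V \<Longrightarrow> (\<And>s. s \<in> S \<Longrightarrow> \<pi> v s = \<pi> w s) \<Longrightarrow> v = w"
    and surj: "\<And>c. (\<And>s. s \<in> S \<Longrightarrow> c s \<in> carrier K) \<Longrightarrow> \<exists>v\<in>carrier V. \<forall>s\<in>S. \<pi> v s = c s"
  shows "dim = card S"
proof -
  have "\<exists>v\<in>carrier V. \<forall>t\<in>S. \<pi> v t = (if t = s then \<one>\<^bsub>K\<^esub> else \<zero>\<^bsub>K\<^esub>)" for s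
    using surj[of "\<lambda>t. if t = s then \<one>\<^bsub>K\<^esub> else \<zero>\<^bsub>K\<^esub>"] by simp
  then obtain e where eV: "\<And>s. e s \<in> carrier V"
    and e: "\<And>s t. t \<in> S \<Longrightarrow> \<pi> (e s) t = (if t = s then \<one>\<^bsub>K\<^esub> else \<zero>\<^bsub>K\<^esub>)"
    by metis
  have inje: "inj_on e S"
  proof (rule inj_onI)
    fix s t assume st: "s \<in> S" "t \<in> S" "e s = e t"
    then have "\<pi> (e s) s = \<pi> (e t) s" by simp
    then show "s = t" using e[OF st(1)] one_not_zero by (auto split: if_splits)
  qed
  have zero: "\<pi> \<zero>\<^bsub>V\<^esub> t = \<zero>\<^bsub>K\<^esub>" if t: "t \<in> S" for t
  proof -
    have "\<pi> (\<zero>\<^bsub>K\<^esub> \<odot>\<^bsub>V\<^esub> \<zero>\<^bsub>V\<^esub>) t = \<zero>\<^bsub>K\<^esub> \<otimes>\<^bsub>K\<^esub> \<pi> \<zero>\<^bsub>V\<^esub> t" using t by (intro smult) auto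
    then show ?thesis using closed[OF _ t, of "\<zero>\<^bsub>V\<^esub>"] by simp
  qed
  have coord: "\<pi> (lincomb c (e ` T)) t = (if t \<in> T then c (e t) else \<zero>\<^bsub>K\<^esub>)"
    if "finite T" "T \<subseteq> S" and c: "c \<in> e ` S \<rightarrow> carrier K" and t: "t \<in> S" for c T t
    using that(1,2)
  proof (induction T rule: finite_induct)
    case empty
    then show ?case using zero[OF t] by (simp add: lincomb_def)
  next
    case (insert s T)
    have s: "e s \<notin> e ` T" using insert inje by (auto simp: inj_on_def)
    have cK: "c (e u) \<in> carrier K" if "u \<in> S" for u using c that by auto
    have lin: "lincomb c (e ` T) \<in> carrier V" using insert c eV by (intro lincomb_closed) auto
    have "lincomb c (e ` insert s T) = c (e s) \<odot>\<^bsub>V\<^esub> e s \<oplus>\<^bsub>V\<^esub> lincomb c (e ` T)"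
      unfolding lincomb_def image_insert
      using insert s cK eV by (intro finsum_insert) auto
    then have "\<pi> (lincomb c (e ` insert s T)) t = c (e s) \<otimes>\<^bsub>K\<^esub> \<pi> (e s) t \<oplus>\<^bsub>K\<^esub> \<pi> (lincomb c (e ` T)) t"
      using lin t cK insert eV by (simp add: add smult)
    also have "\<dots> = (if t \<in> insert s T then c (e t) else \<zero>\<^bsub>K\<^esub>)"
      using insert cK[of s] cK[OF t] t by (auto simp: e)
    finally show ?case .
  qed
  have "basis (e ` S)"
    unfolding basis_def
  proof (intro conjI)
    show sub: "e ` S \<subseteq> carrier V" using eV by auto
    show "lin_indpt (e ` S)"
    proof (rule finite_lin_indpt2[OF finite_imageI[OF fin] sub])
      fix c assume c: "c \<in> e ` S \<rightarrow> carrier K" "lincomb c (e ` S) = \<zero>\<^bsub>V\<^esub>"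
      then show "\<forall>v\<in>e ` S. c v = \<zero>\<^bsub>K\<^esub>" using coord[OF fin order_refl c(1)] zero by auto
    qed
    show "gen_set (e ` S)"
    proof (rule equalityI)
      show "span (e ` S) \<subseteq> carrier V" by (rule span_is_subset2[OF sub])
      show "carrier V \<subseteq> span (e ` S)"
      proof
        fix v assume v: "v \<in> carrier V"
        define c where "c w = \<pi> v (inv_into S e w)" for w
        have ce: "c (e s) = \<pi> v s" if "s \<in> S" for s using that inje by (simp add: c_def)
        then have c: "c \<in> e ` S \<rightarrow> carrier K" using closed[OF v] by auto
        have "v = lincomb c (e ` S)"
          using coord[OF fin order_refl c] ce by (intro inj v lincomb_closed sub c) auto
        then show "v \<in> span (e ` S)" using finite_span[OF finite_imageI[OF fin] sub] c by auto
      qed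
    qed
  qed
  then have "dim = card (e ` S)" by (intro dim_basis) (use fin in auto)
  then show ?thesis using inje by (simp add: card_image)
qed

text \<open>The function field is a record on equivalence classes. An isomorphism \<open>c\<close>
  from a subfield of the large field, with inverse \<open>d\<close>, moves field axioms and linear
  algebra to arithmetic in a field type.\<close>

locale subfield_copy =
  fixes L :: "('l, 'm) ring_scheme" (structure) and Lp :: "'o::field set" and c :: "'o \<Rightarrow> 'l"
  assumes Lp: "sfield Lp" and inj_c: "inj_on c Lp" and carrier_L: "carrier L = c ` Lp"
    and add_c: "\<And>x y. x \<in> Lp \<Longrightarrow> y \<in> Lp \<Longrightarrow> c x \<oplus> c y = c (x + y)"
    and mult_c: "\<And>x y. x \<in> Lp \<Longrightarrow> y \<in> Lp \<Longrightarrow> c x \<otimes> c y = c (x * y)"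
    and zero_c: "\<zero> = c 0" and one_c: "\<one> = c 1"
begin

definition d :: "'l \<Rightarrow> 'o" where "d = inv_into Lp c"

lemma d_c: "x \<in> Lp \<Longrightarrow> d (c x) = x" using inj_c by (simp add: d_def)
lemma d_in: "v \<in> carrier L \<Longrightarrow> d v \<in> Lp" by (auto simp: carrier_L d_c)
lemma c_d: "v \<in> carrier L \<Longrightarrow> c (d v) = v" by (auto simp: carrier_L d_c)
lemma c_in: "x \<in> Lp \<Longrightarrow> c x \<in> carrier L" by (simp add: carrier_L)
lemma d_inj: "v \<in> carrier L \<Longrightarrow> w \<in> carrier L \<Longrightarrow> d v = d w \<Longrightarrow> v = w" by (metis c_d)

lemma d_add: "v \<in> carrier L \<Longrightarrow> w \<in> carrier L \<Longrightarrow> d (v \<oplus> w) = d v + d w"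
  by (auto simp: carrier_L d_c add_c sfield_closed(4)[OF Lp])
lemma d_mult: "v \<in> carrier L \<Longrightarrow> w \<in> carrier L \<Longrightarrow> d (v \<otimes> w) = d v * d w"
  by (auto simp: carrier_L d_c mult_c sfield_closed(5)[OF Lp])
lemma d_zero: "d \<zero> = 0" by (simp add: zero_c d_c sfield_closed(2)[OF Lp])
lemma d_one: "d \<one> = 1" by (simp add: one_c d_c sfield_closed(1)[OF Lp])

lemma field_L: "field L"
proof -
  have closed: "v \<oplus> w \<in> carrier L" "v \<otimes> w \<in> carrier L" if "v \<in> carrier L" "w \<in> carrier L" for v w
    using that sfield_closed(4,5)[OF Lp] by (auto simp: carrier_L add_c mult_c)
  have const: "\<zero> \<in> carrier L" "\<one> \<in> carrier L"
    using sfield_closed(1,2)[OF Lp] by (auto simp: zero_c one_c c_in)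
  note d = d_add d_mult d_zero d_one closed const
  have "abelian_group L"
  proof (rule abelian_groupI)
    fix x assume x: "x \<in> carrier L"
    have "c (- d x) \<oplus> x = \<zero>"
      using x d_in[OF x] sfield_closed(3)[OF Lp] by (intro d_inj closed const c_in) (simp_all add: d_add d_zero d_c c_in)
    then show "\<exists>y\<in>carrier L. y \<oplus> x = \<zero>" using d_in[OF x] sfield_closed(3)[OF Lp] c_in by blast
  qed (auto simp: d add_ac intro: d_inj)
  moreover have "comm_monoid L"
    by (rule comm_monoidI) (auto simp: d mult_ac intro: d_inj)
  ultimately have "cring L"
    by (rule cringI) (auto simp: d distrib_right intro: d_inj)
  then show ?thesis
  proof (rule cring.cring_fieldI2)
    show "\<zero> \<noteq> \<one>" using d_zero d_one by auto
    fix x assume x: "x \<in> carrier L" "x \<noteq> \<zero>"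
    then have "d x \<noteq> 0" using d_inj[OF x(1) const(1)] d_zero by auto
    then have "x \<otimes> c (inverse (d x)) = \<one>"
      using x d_in[OF x(1)] sfield_closed(11)[OF Lp]
      by (intro d_inj closed const c_in) (simp_all add: d_mult d_one d_c c_in)
    then show "\<exists>y\<in>carrier L. x \<otimes> y = \<one>" using d_in[OF x(1)] sfield_closed(11)[OF Lp] c_in by blast
  qed
qed

sublocale L: field L by (rule field_L)

lemma d_sum: "finite A \<Longrightarrow> (\<And>x. x \<in> A \<Longrightarrow> f x \<in> carrier L) \<Longrightarrow> d (\<Oplus>x\<in>A. f x) = (\<Sum>x\<in>A. d (f x))"
  by (induction A rule: finite_induct) (auto simp: d_zero d_add L.finsum_closed)

lemma d_power: "v \<in> carrier L \<Longrightarrow> d (v [^] (n::nat)) = d v ^ n"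
  by (induction n) (auto simp: d_one d_mult mult.commute)

text \<open>Rank and nullity for one equation over a subfield: for a maximal independent subfamily
  \<open>I\<close>, the coordinates of a solution outside \<open>I\<close> can be prescribed and
  determine those inside.\<close>

lemma dim_solutions:
  fixes a :: "'b \<Rightarrow> 'o" and W :: "('b \<Rightarrow> 'l) set"
  assumes B: "finite B" and I: "I \<subseteq> B" "\<not> ldep Lp I a"
    and max: "\<And>b. b \<in> B - I \<Longrightarrow> \<exists>l. (\<forall>i\<in>I. l i \<in> Lp) \<and> a b = (\<Sum>i\<in>I. l i * a i)"
    and W: "\<And>v. v \<in> W \<longleftrightarrow> v \<in> B \<rightarrow>\<^sub>E carrier L \<and> (\<Sum>b\<in>B. a b * d (v b)) = 0"
  shows "vectorspace.dim L (ring.func_space L B\<lparr>carrier := W\<rparr>) = card B - card I"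
proof -
  let ?V = "ring.func_space L B"
  interpret V: module L ?V by (rule L.func_space_is_module)
  interpret V: vectorspace L ?V by unfold_locales
  have V: "carrier ?V = B \<rightarrow>\<^sub>E carrier L" "\<zero>\<^bsub>?V\<^esub> = restrict (\<lambda>_. \<zero>) B"
    "v \<oplus>\<^bsub>?V\<^esub> w = restrict (\<lambda>b. v b \<oplus> w b) B" "r \<odot>\<^bsub>?V\<^esub> v = restrict (\<lambda>b. r \<otimes> v b) B" for v w r
    by (simp_all add: L.func_space_def)
  have WV: "W \<subseteq> carrier ?V" using W by (auto simp: V)
  have "LinearCombinations.submodule L W ?V"
  proof (rule LinearCombinations.submodule.intro[OF V.module_axioms WV])
    show "\<zero>\<^bsub>?V\<^esub> \<in> W" unfolding W V by (auto simp: d_zero intro!: sum.neutral)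
    show "v \<oplus>\<^bsub>?V\<^esub> w \<in> W" if "v \<in> W" "w \<in> W" for v w
    proof -
      have vw: "v b \<in> carrier L" "w b \<in> carrier L" if "b \<in> B" for b using \<open>v \<in> W\<close> \<open>w \<in> W\<close> that by (auto simp: W)
      have "(\<Sum>b\<in>B. a b * d (v b \<oplus> w b)) = (\<Sum>b\<in>B. a b * d (v b)) + (\<Sum>b\<in>B. a b * d (w b))"
        using vw by (simp add: d_add distrib_left sum.distrib)
      then show ?thesis using that vw by (auto simp: W V)
    qed
    show "r \<odot>\<^bsub>?V\<^esub> v \<in> W" if "r \<in> carrier L" "v \<in> W" for r v
    proof -
      have v: "v b \<in> carrier L" if "b \<in> B" for b using \<open>v \<in> W\<close> that by (auto simp: W)
      have "(\<Sum>b\<in>B. a b * d (r \<otimes> v b)) = d r * (\<Sum>b\<in>B. a b * d (v b))"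
        unfolding sum_distrib_left using v that(1) by (intro sum.cong) (simp_all add: d_mult mult_ac)
      then show ?thesis using that v by (auto simp: W V)
    qed
  qed
  then have "VectorSpace.subspace L W ?V" by (intro VectorSpace.subspace.intro V.vectorspace_axioms)
  then interpret W: vectorspace L "?V\<lparr>carrier := W\<rparr>" by (rule V.subspace_is_vs)
  have "W.dim = card (B - I)"
  proof (rule W.dim_eq_card_coordinates[where \<pi> = "\<lambda>v. v"])
    show "finite (B - I)" using B by simp
    show "v s \<in> carrier L" if "v \<in> carrier (?V\<lparr>carrier := W\<rparr>)" "s \<in> B - I" for v s
      using that by (auto simp: W)
    show "(v \<oplus>\<^bsub>?V\<lparr>carrier := W\<rparr>\<^esub> w) s = v s \<oplus> w s" if "s \<in> B - I" for v w s
      using that by (simp add: V)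
    show "(r \<odot>\<^bsub>?V\<lparr>carrier := W\<rparr>\<^esub> v) s = r \<otimes> v s" if "s \<in> B - I" for r v s
      using that by (simp add: V)
  next
    fix v w assume "v \<in> carrier (?V\<lparr>carrier := W\<rparr>)" "w \<in> carrier (?V\<lparr>carrier := W\<rparr>)"
      and eq: "\<And>s. s \<in> B - I \<Longrightarrow> v s = w s"
    then have v: "v \<in> B \<rightarrow>\<^sub>E carrier L" "(\<Sum>b\<in>B. a b * d (v b)) = 0"
      and w: "w \<in> B \<rightarrow>\<^sub>E carrier L" "(\<Sum>b\<in>B. a b * d (w b)) = 0" by (auto simp: W)
    have vL: "v b \<in> carrier L" and wL: "w b \<in> carrier L" if "b \<in> B" for b using v w that by auto
    have "0 = (\<Sum>b\<in>B. (d (v b) - d (w b)) * a b)"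
      using v(2) w(2) by (simp add: right_diff_distrib sum_subtractf mult.commute[of _ "a _"])
    also have "\<dots> = (\<Sum>b\<in>I. (d (v b) - d (w b)) * a b)"
      using B I(1) eq by (intro sum.mono_neutral_right) auto
    finally have rel: "(\<Sum>b\<in>I. (d (v b) - d (w b)) * a b) = 0" by simp
    have "d (v b) - d (w b) = 0" if b: "b \<in> I" for b
    proof (rule ccontr)
      assume "d (v b) - d (w b) \<noteq> 0"
      then have "ldep Lp I a"
        using b rel I(1) vL wL
        by (intro ldepI[of I "\<lambda>b. d (v b) - d (w b)" Lp b]) (auto intro!: sfield_closed(6)[OF Lp] d_in)
      with I(2) show False by contradiction
    qed
    then have "v b = w b" if "b \<in> B" for b
      using eq[of b] d_inj[OF vL[OF that] wL[OF that]] that by (cases "b \<in> I") auto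
    then show "v = w" using v(1) w(1) by (intro PiE_ext) 
  next
    fix r :: "'b \<Rightarrow> 'l" assume r: "\<And>s. s \<in> B - I \<Longrightarrow> r s \<in> carrier L"
    have "\<exists>l. \<forall>b\<in>B - I. (\<forall>i\<in>I. l b i \<in> Lp) \<and> a b = (\<Sum>i\<in>I. l b i * a i)"
      by (rule bchoice) (use max in blast)
    then obtain l where l: "\<And>b i. b \<in> B - I \<Longrightarrow> i \<in> I \<Longrightarrow> l b i \<in> Lp"
      and la: "\<And>b. b \<in> B - I \<Longrightarrow> a b = (\<Sum>i\<in>I. l b i * a i)" by blast
    \<comment> \<open>On \<open>I\<close> these are the values forced by expressing every
      \<open>a s\<close> with \<open>s \<notin> I\<close> through the \<open>a b\<close> with
      \<open>b \<in> I\<close>.\<close>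
    define u where "u b = (if b \<in> I then - (\<Sum>s\<in>B - I. d (r s) * l s b) else d (r b))" for b
    have uL: "u b \<in> Lp" if "b \<in> B" for b
      using that r l by (auto simp: u_def intro!: sfield_closed(3,5,7)[OF Lp] d_in)
    have "(\<Sum>b\<in>B. a b * u b) = (\<Sum>b\<in>B - I. a b * u b) + (\<Sum>b\<in>I. a b * u b)"
      using B I(1) by (rule sum.subset_diff[rotated])
    also have "(\<Sum>b\<in>I. a b * u b) = - (\<Sum>b\<in>I. \<Sum>s\<in>B - I. d (r s) * (l s b * a b))"
      unfolding sum_negf[symmetric] by (intro sum.cong refl) (simp add: u_def sum_distrib_left sum_negf mult_ac)
    also have "(\<Sum>b\<in>I. \<Sum>s\<in>B - I. d (r s) * (l s b * a b)) = (\<Sum>s\<in>B - I. \<Sum>b\<in>I. d (r s) * (l s b * a b))"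
      by (rule sum.swap)
    also have "\<dots> = (\<Sum>s\<in>B - I. a s * u s)"
      by (intro sum.cong refl) (simp add: u_def la sum_distrib_left[symmetric] mult.commute)
    finally have rel: "(\<Sum>b\<in>B. a b * u b) = 0" by simp
    have "(\<Sum>b\<in>B. a b * d (restrict (\<lambda>b. c (u b)) B b)) = 0"
      using rel uL by (simp add: d_c)
    then have "restrict (\<lambda>b. c (u b)) B \<in> W" using uL by (auto simp: W c_in)
    moreover have "\<forall>s\<in>B - I. restrict (\<lambda>b. c (u b)) B s = r s"
      using r by (auto simp: u_def c_d)
    ultimately show "\<exists>v\<in>carrier (?V\<lparr>carrier := W\<rparr>). \<forall>s\<in>B - I. v s = r s"
      by (intro bexI[of _ "restrict (\<lambda>b. c (u b)) B"]) simp_all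
  qed
  then show ?thesis using B I(1) by (simp add: card_Diff_subset finite_subset)
qed

end

context generic_point begin

text \<open>Elements of the function field are represented by their \<open>p\<close>-th powers in \<open>'o\<close>.\<close>

definition cls :: "'o \<Rightarrow> (('v, 'a) mpoly \<times> ('v, 'a) mpoly) set" where
  "cls x = {u \<in> fractions p B \<phi>. E (fst u) / E (snd u) = x}"

lemma fractions_iff: "(f, g) \<in> fractions p B \<phi> \<longleftrightarrow> (\<exists>e. f \<in> homogeneous B e \<and> g \<in> homogeneous B e) \<and> E g \<noteq> 0"
  unfolding fractions_def using E_kernel[OF homogeneous_poly_ring] by fastforce

lemma Lp_iff: "x \<in> Lp \<longleftrightarrow> (\<exists>f g. (f, g) \<in> fractions p B \<phi> \<and> x = E f / E g)"
  unfolding Lp_def fractions_iff by blast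

lemma LpI: "(f, g) \<in> fractions p B \<phi> \<Longrightarrow> E f / E g \<in> Lp"
  unfolding Lp_iff by blast

lemma fraction_class_eq:
  assumes fg: "(f, g) \<in> fractions p B \<phi>"
  shows "fraction_class p B \<phi> f g = cls (E f / E g)"
proof -
  have "f * g' - f' * g \<in> form_ideal p B \<phi> \<longleftrightarrow> E f' / E g' = E f / E g" if u: "(f', g') \<in> fractions p B \<phi>" for f' g'
  proof -
    have "f \<in> poly_ring B" "g \<in> poly_ring B" "f' \<in> poly_ring B" "g' \<in> poly_ring B" and g: "E g \<noteq> 0" "E g' \<noteq> 0"
      using fg u homogeneous_poly_ring unfolding fractions_iff by blast+
    then have "f * g' - f' * g \<in> poly_ring B"
      unfolding poly_ring_eq by (intro sring_diff[OF sring_mpolys] sring_mult[OF sring_mpolys] sring_UNIV)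
    then have "f * g' - f' * g \<in> form_ideal p B \<phi> \<longleftrightarrow> E f * E g' - E f' * E g = 0"
      by (simp add: E.hom_diff E.hom_mult flip: E_kernel)
    also have "\<dots> \<longleftrightarrow> E f' / E g' = E f / E g" using g by (auto simp: field_simps)
    finally show ?thesis .
  qed
  then show ?thesis using fg by (auto simp: fraction_class_def fraction_rel_def cls_def)
qed

lemma cls_nonempty: "x \<in> Lp \<Longrightarrow> \<exists>f g. (f, g) \<in> cls x"
  unfolding Lp_iff cls_def by force

text \<open>The ring operations are unions over all representatives, which collapse when every
  choice gives the same class.\<close>

lemma cls_op:
  assumes x: "x \<in> Lp" "x' \<in> Lp"
    and op: "\<And>f g f' g'. (f, g) \<in> cls x \<Longrightarrow> (f', g') \<in> cls x' \<Longrightarrow> h f g f' g' = z"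
  shows "(\<Union>(f, g)\<in>cls x. \<Union>(f', g')\<in>cls x'. h f g f' g') = z"
proof -
  obtain f g where u: "(f, g) \<in> cls x" using cls_nonempty[OF x(1)] by blast
  obtain f' g' where u': "(f', g') \<in> cls x'" using cls_nonempty[OF x(2)] by blast
  show ?thesis
  proof (intro equalityI subsetI)
    fix s assume "s \<in> (\<Union>(f, g)\<in>cls x. \<Union>(f', g')\<in>cls x'. h f g f' g')"
    then show "s \<in> z" using op by fastforce
  next
    fix s assume "s \<in> z"
    then have "s \<in> h f g f' g'" using op[OF u u'] by simp
    then show "s \<in> (\<Union>(f, g)\<in>cls x. \<Union>(f', g')\<in>cls x'. h f g f' g')" using u u' by blast
  qed
qed

lemma sum_fraction:
  assumes "(f, g) \<in> fractions p B \<phi>" "(f', g') \<in> fractions p B \<phi>"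
  shows "(f * g' + f' * g, g * g') \<in> fractions p B \<phi>" "E (f * g' + f' * g) / E (g * g') = E f / E g + E f' / E g'"
proof -
  obtain d e where h: "f \<in> homogeneous B d" "g \<in> homogeneous B d" "f' \<in> homogeneous B e" "g' \<in> homogeneous B e"
    and n: "E g \<noteq> 0" "E g' \<noteq> 0" using assms unfolding fractions_iff by blast
  have "f * g' + f' * g \<in> homogeneous B (d + e)"
    using homogeneous_mult[OF h(1,4)] homogeneous_mult[OF h(3,2)] by (intro homogeneous_add) (simp_all add: add.commute)
  then show "(f * g' + f' * g, g * g') \<in> fractions p B \<phi>"
    using n homogeneous_mult[OF h(2,4)] unfolding fractions_iff E.hom_mult by auto
  show "E (f * g' + f' * g) / E (g * g') = E f / E g + E f' / E g'"
    using n by (simp add: E.hom_add E.hom_mult add_frac_eq)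
qed

lemma prod_fraction:
  assumes "(f, g) \<in> fractions p B \<phi>" "(f', g') \<in> fractions p B \<phi>"
  shows "(f * f', g * g') \<in> fractions p B \<phi>" "E (f * f') / E (g * g') = E f / E g * (E f' / E g')"
proof -
  obtain d e where h: "f \<in> homogeneous B d" "g \<in> homogeneous B d" "f' \<in> homogeneous B e" "g' \<in> homogeneous B e"
    and n: "E g \<noteq> 0" "E g' \<noteq> 0" using assms unfolding fractions_iff by blast
  show "(f * f', g * g') \<in> fractions p B \<phi>"
    using n homogeneous_mult[OF h(1,3)] homogeneous_mult[OF h(2,4)] unfolding fractions_iff E.hom_mult by auto
  show "E (f * f') / E (g * g') = E f / E g * (E f' / E g')" by (simp add: E.hom_mult)
qed

lemma const_fraction: "(const_poly c, 1) \<in> fractions p B \<phi>"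
  unfolding fractions_iff using homogeneous_const homogeneous_one by auto

lemma sfield_Lp: "sfield Lp"
proof -
  have "1 \<in> Lp" unfolding Lp_iff using const_fraction[of 1] by (intro exI[of _ "const_poly 1"] exI[of _ 1]) (simp add: E_const rhom.hom_one[OF emb])
  moreover have "- x \<in> Lp" if "x \<in> Lp" for x
    using that homogeneous_uminus unfolding Lp_def by (force simp: E.hom_uminus)
  moreover have "x + y \<in> Lp" "x * y \<in> Lp" if "x \<in> Lp" "y \<in> Lp" for x y
    using that sum_fraction prod_fraction unfolding Lp_iff by (metis, metis)
  moreover have "inverse x \<in> Lp" if x: "x \<in> Lp" for x
  proof -
    obtain f g where fg: "(f, g) \<in> fractions p B \<phi>" "x = E f / E g" using x unfolding Lp_iff by blast
    show ?thesis
    proof (cases "E f = 0")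
      case True
      then show ?thesis using fg x by simp
    next
      case False
      then have "(g, f) \<in> fractions p B \<phi>" using fg(1) unfolding fractions_iff by blast
      then show ?thesis unfolding Lp_iff using fg(2) by (intro exI[of _ g] exI[of _ f]) simp
    qed
  qed
  ultimately show ?thesis by (auto simp: sfield_def sring_def)
qed

lemma function_field_copy: "subfield_copy (function_field p B \<phi>) Lp cls"
proof
  show "sfield Lp" by (rule sfield_Lp)
  show "inj_on cls Lp"
  proof (rule inj_onI)
    fix x y assume "x \<in> Lp" "y \<in> Lp" "cls x = cls y"
    then obtain f g where "(f, g) \<in> cls x" "(f, g) \<in> cls y" using cls_nonempty by blast
    then show "x = y" by (simp add: cls_def)
  qed
  show "carrier (function_field p B \<phi>) = cls ` Lp"
  proof -
    have "fractions p B \<phi> // fraction_rel p B \<phi> = (\<lambda>(f, g). fraction_class p B \<phi> f g) ` fractions p B \<phi>"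
      unfolding quotient_def fraction_class_def by force
    also have "\<dots> = (\<lambda>u. cls (E (fst u) / E (snd u))) ` fractions p B \<phi>"
      by (intro image_cong refl) (auto simp: fraction_class_eq)
    also have "\<dots> = cls ` (\<lambda>u. E (fst u) / E (snd u)) ` fractions p B \<phi>" by (simp add: image_image)
    also have "(\<lambda>u. E (fst u) / E (snd u)) ` fractions p B \<phi> = Lp"
    proof (intro equalityI subsetI)
      fix x assume "x \<in> Lp"
      then obtain f g where "(f, g) \<in> fractions p B \<phi>" "x = E f / E g" unfolding Lp_iff by blast
      then show "x \<in> (\<lambda>u. E (fst u) / E (snd u)) ` fractions p B \<phi>" by force
    qed (auto intro: LpI)
    finally show ?thesis by (simp add: function_field_def)
  qed
  show "\<zero>\<^bsub>function_field p B \<phi>\<^esub> = cls 0"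
    using fraction_class_eq[OF const_fraction[of 0]] rhom.hom_zero[OF rhom_const_poly[where 'a = 'a and 'i = 'v]]
    by (simp add: function_field_def)
  show "\<one>\<^bsub>function_field p B \<phi>\<^esub> = cls 1"
    using fraction_class_eq[OF const_fraction[of 1]] rhom.hom_one[OF rhom_const_poly[where 'a = 'a and 'i = 'v]]
    by (simp add: function_field_def)
  fix x x' assume x: "x \<in> Lp" "x' \<in> Lp"
  have "cls x \<oplus>\<^bsub>function_field p B \<phi>\<^esub> cls x' =
      (\<Union>(f, g)\<in>cls x. \<Union>(f', g')\<in>cls x'. fraction_class p B \<phi> (f * g' + f' * g) (g * g'))"
    by (simp add: function_field_def)
  also have "\<dots> = cls (x + x')"
  proof (rule cls_op[OF x])
    fix f g f' g' assume "(f, g) \<in> cls x" "(f', g') \<in> cls x'"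
    then have u: "(f, g) \<in> fractions p B \<phi>" "(f', g') \<in> fractions p B \<phi>" "x = E f / E g" "x' = E f' / E g'"
      by (auto simp: cls_def)
    show "fraction_class p B \<phi> (f * g' + f' * g) (g * g') = cls (x + x')"
      unfolding fraction_class_eq[OF sum_fraction(1)[OF u(1,2)]] sum_fraction(2)[OF u(1,2)] u(3,4) ..
  qed
  finally show "cls x \<oplus>\<^bsub>function_field p B \<phi>\<^esub> cls x' = cls (x + x')" .
  have "cls x \<otimes>\<^bsub>function_field p B \<phi>\<^esub> cls x' =
      (\<Union>(f, g)\<in>cls x. \<Union>(f', g')\<in>cls x'. fraction_class p B \<phi> (f * f') (g * g'))"
    by (simp add: function_field_def)
  also have "\<dots> = cls (x * x')"
  proof (rule cls_op[OF x])
    fix f g f' g' assume "(f, g) \<in> cls x" "(f', g') \<in> cls x'"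
    then have u: "(f, g) \<in> fractions p B \<phi>" "(f', g') \<in> fractions p B \<phi>" "x = E f / E g" "x' = E f' / E g'"
      by (auto simp: cls_def)
    show "fraction_class p B \<phi> (f * f') (g * g') = cls (x * x')"
      unfolding fraction_class_eq[OF prod_fraction(1)[OF u(1,2)]] prod_fraction(2)[OF u(1,2)] u(3,4) ..
  qed
  finally show "cls x \<otimes>\<^bsub>function_field p B \<phi>\<^esub> cls x' = cls (x * x')" .
qed

sublocale L: subfield_copy "function_field p B \<phi>" Lp cls by (rule function_field_copy)

lemma base_embedding_eq: "base_embedding p B \<phi> c = cls (emb c ^ p)" "emb c ^ p \<in> Lp"
  using fraction_class_eq[OF const_fraction[of c]] LpI[OF const_fraction[of c]] unfolding base_embedding_def
  by (simp_all add: E_const)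

text \<open>With scalars represented by their \<open>p\<close>-th powers, the value of the form is
  the \<open>p\<close>-th power of a linear expression, so isotropy becomes a linear
  equation.\<close>

lemma scalar_extension_zero_iff:
  assumes v: "v \<in> B \<rightarrow>\<^sub>E carrier (function_field p B \<phi>)"
  shows "scalar_extension (function_field p B \<phi>) (base_embedding p B \<phi>) p B \<phi> v = \<zero>\<^bsub>function_field p B \<phi>\<^esub> \<longleftrightarrow>
    (\<Sum>b\<in>B. a b * L.d (v b)) = 0"
proof -
  let ?L = "function_field p B \<phi>"
  have vL: "v b \<in> carrier ?L" if "b \<in> B" for b using v that by auto
  have eL: "base_embedding p B \<phi> c \<in> carrier ?L" "L.d (base_embedding p B \<phi> c) = emb c ^ p" for c
    using base_embedding_eq[of c] by (simp_all add: L.c_in L.d_c)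
  have sL: "scalar_extension ?L (base_embedding p B \<phi>) p B \<phi> v \<in> carrier ?L"
    unfolding scalar_extension_def using vL eL by (intro L.L.finsum_closed) auto
  have "L.d (scalar_extension ?L (base_embedding p B \<phi>) p B \<phi> v) = (\<Sum>b\<in>B. emb (\<phi> b) ^ p * L.d (v b) ^ p)"
    unfolding scalar_extension_def using DD(1) vL eL by (subst L.d_sum) (auto simp: L.d_mult L.d_power)
  also have "\<dots> = (\<Sum>b\<in>B. a b * L.d (v b)) ^ p"
    by (simp add: frobenius_sum[OF prime_p char_p] power_mult_distrib a_def)
  finally have d: "L.d (scalar_extension ?L (base_embedding p B \<phi>) p B \<phi> v) = (\<Sum>b\<in>B. a b * L.d (v b)) ^ p" .
  have "scalar_extension ?L (base_embedding p B \<phi>) p B \<phi> v = \<zero>\<^bsub>?L\<^esub> \<longleftrightarrow> L.d (scalar_extension ?L (base_embedding p B \<phi>) p B \<phi> v) = 0"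
    using L.d_inj[OF sL L.L.zero_closed] L.d_zero by auto
  then show ?thesis unfolding d using p_pos by simp
qed

text \<open>Isotropic vectors over the function field correspond to solutions in \<open>Lp\<close>
  of one linear equation with coefficients \<open>a b\<close>. Their dimension is the number of
  variables minus the rank of the \<open>a b\<close> over \<open>Lp\<close>.\<close>

theorem i1_index_eq:
  shows "\<exists>I\<subseteq>B. \<not> ratio_dep p B b0 a I a \<and> (\<forall>J\<subseteq>B. \<not> ratio_dep p B b0 a J a \<longrightarrow> card J \<le> card I) \<and>
    i1_index p B \<phi> + card I = card B"
proof -
  have dep: "ratio_dep p B b0 a J a \<longleftrightarrow> ldep Lp J a" if "J \<subseteq> B" for J
    using morphic_iff_ratio_dep[of J \<phi>] morphic_iff_Lp[of J \<phi>] finite_subset[OF that DD(1)] by (simp add: a_eq)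
  have "\<exists>J. (J \<subseteq> B \<and> \<not> ldep Lp J a) \<and> (\<forall>J'. J' \<subseteq> B \<and> \<not> ldep Lp J' a \<longrightarrow> card J' \<le> card J)"
  proof (rule ex_has_greatest_nat[of "\<lambda>J. J \<subseteq> B \<and> \<not> ldep Lp J a" "{}" card "Suc (card B)"])
    show "{} \<subseteq> B \<and> \<not> ldep Lp {} a" by (simp add: ldep_def)
    show "\<forall>J. J \<subseteq> B \<and> \<not> ldep Lp J a \<longrightarrow> card J < Suc (card B)"
      using DD(1) card_mono by (auto simp: less_Suc_eq_le)
  qed
  then obtain I where I: "I \<subseteq> B" "\<not> ldep Lp I a" and max: "\<And>J. J \<subseteq> B \<Longrightarrow> \<not> ldep Lp J a \<Longrightarrow> card J \<le> card I"
    by blast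
  have finI: "finite I" using I(1) DD(1) by (rule finite_subset)
  have rel: "\<exists>l. (\<forall>i\<in>I. l i \<in> Lp) \<and> a b = (\<Sum>i\<in>I. l i * a i)" if b: "b \<in> B - I" for b
  proof (rule ldep_insertE[OF sfield_Lp finI _ I(2)])
    show "b \<notin> I" using b by simp
    show "ldep Lp (insert b I) a"
    proof (rule ccontr)
      assume "\<not> ?thesis"
      then have "card (insert b I) \<le> card I" using max[of "insert b I"] I(1) b by auto
      then show False using b finI by simp
    qed
  qed
  have space: "carrier (ring.func_space (function_field p B \<phi>) B) = B \<rightarrow>\<^sub>E carrier (function_field p B \<phi>)"
    by (simp add: ring.func_space_def[OF L.L.ring_axioms])
  have "i1_index p B \<phi> = card B - card I"
    unfolding i1_index_def Let_def defect_index_def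
  proof (rule L.dim_solutions[OF DD(1) I rel])
    fix v
    show "v \<in> {w \<in> carrier (ring.func_space (function_field p B \<phi>) B).
          scalar_extension (function_field p B \<phi>) (base_embedding p B \<phi>) p B \<phi> w = \<zero>\<^bsub>function_field p B \<phi>\<^esub>} \<longleftrightarrow>
        v \<in> B \<rightarrow>\<^sub>E carrier (function_field p B \<phi>) \<and> (\<Sum>b\<in>B. a b * L.d (v b)) = 0"
      unfolding mem_Collect_eq space using scalar_extension_zero_iff[of v] by argo
  qed
  moreover have "card I \<le> card B" using I(1) DD(1) by (rule card_mono[rotated])
  ultimately show ?thesis using I max dep by (intro exI[of _ I]) auto
qed

end

section \<open>Rational morphisms and the Izhboldin dimension\<close>

lemma rhom_constants: "rhom (\<lambda>a :: 'a::field. Fract (const_poly a :: (nat, 'a) mpoly) 1)"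
proof -
  interpret c: rhom "const_poly :: 'a \<Rightarrow> (nat, 'a) mpoly" by (rule rhom_const_poly)
  show ?thesis by unfold_locales (simp_all add: c.hom_add c.hom_mult One_fract_def)
qed

lemma alg_indep_range:
  fixes h :: "'a::comm_ring_1 \<Rightarrow> 'r::field"
  assumes "rhom h" "alg_indep h UNIV I z"
  shows "alg_indep (\<lambda>x. x) (range h) I z"
proof -
  have "alg_indep (\<lambda>x. x) (fgen (range h \<union> z ` {})) I z"
    by (rule alg_indep_tower[OF assms(1) sring_UNIV]) (use assms(2) in auto)
  then show ?thesis by (rule alg_indep_subset) (auto intro: fgen_base)
qed

lemma ground_function_field:
  fixes emb :: "'a::field \<Rightarrow> (nat, 'a) mpoly fract"
  assumes p: "prime p" "CHAR('a) = p" and emb_eq: "emb = (\<lambda>a. Fract (const_poly a) 1)"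
  shows "ground p (range emb) (\<lambda>i. Fract (var_poly i) 1)"
proof
  have emb: "rhom emb" unfolding emb_eq by (rule rhom_constants)
  show "prime p" by fact
  show "CHAR((nat, 'a) mpoly fract) = p" using rhom_CHAR[OF emb] p(2) by simp
  show "sfield (range emb)" by (rule sfield_range[OF emb])
  show "alg_indep (\<lambda>x. x) (range emb) UNIV (\<lambda>i. Fract (var_poly i) 1)"
    unfolding emb_eq by (rule alg_indep_range[OF rhom_constants alg_indep_fract_variables[where f = "\<lambda>i. i"]]) simp
qed

lemma (in anisotropic_hypersurface) form_sum: "\<phi> (\<Sum>b\<in>A. scale (c b) b) = (\<Sum>b\<in>A. c b ^ p * \<phi> b)"
proof -
  have "\<phi> 0 = 0" using form_scale[of 0 0] prime_gt_0_nat[OF prime_p] by (simp add: power_0_left)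
  then show ?thesis by (induction A rule: infinite_finite_induct) (auto simp: form_add form_scale)
qed

lemma (in ground) anisotropic_datum:
  fixes emb :: "'a::field \<Rightarrow> 'o" and scale :: "'a \<Rightarrow> 'v::ab_group_add \<Rightarrow> 'v"
  assumes p23: "p = 2 \<or> p = 3" and emb: "rhom emb" "F = range emb" and H: "anisotropic_hypersurface scale B p \<phi>"
  shows "finite B" "\<exists>b0. datum B b0 (\<lambda>b. emb (\<phi> b))" "hypersurface_dim scale = int (card B) - 2"
proof -
  interpret H: anisotropic_hypersurface scale B p \<phi> by fact
  show fin: "finite B" by (rule H.finite_Basis)
  show "hypersurface_dim scale = int (card B) - 2" by (simp add: hypersurface_dim_def H.dim_UNIV)
  have card: "2 \<le> card B" using H.dim_ge_2 by (simp add: H.dim_UNIV)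
  then obtain b0 where "b0 \<in> B" by fastforce
  moreover have "\<not> ldep Fp B (\<lambda>b. emb (\<phi> b))"
  proof
    assume "ldep Fp B (\<lambda>b. emb (\<phi> b))"
    then obtain c l where c: "\<forall>b\<in>B. c b \<in> Fp" "l \<in> B" "c l \<noteq> 0" "(\<Sum>b\<in>B. c b * emb (\<phi> b)) = 0" by (rule ldepE)
    have "\<exists>s. \<forall>b\<in>B. c b = emb (s b) ^ p"
      by (rule bchoice) (use c(1) emb(2) in \<open>unfold Fp_def, blast\<close>)
    then obtain s where s: "\<And>b. b \<in> B \<Longrightarrow> c b = emb (s b) ^ p" by blast
    \<comment> \<open>By quasilinearity the relation says that \<phi> vanishes at the vector with
      coordinates \<open>s b\<close>.\<close>
    have "emb (\<Sum>b\<in>B. s b ^ p * \<phi> b) = 0"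
      using c(4) s by (simp add: rhom.hom_sum[OF emb(1)] rhom.hom_mult[OF emb(1)] rhom.hom_power[OF emb(1)])
    then have "\<phi> (\<Sum>b\<in>B. scale (s b) b) = 0" using rhom_field_inj[OF emb(1)] by (simp add: H.form_sum)
    then have "(\<Sum>b\<in>B. scale (s b) b) = 0" by (rule H.anisotropic)
    then have "s l = 0" using H.independentD[OF H.independent_Basis fin order_refl _ c(2)] by blast
    then show False using c(2,3) s p_pos rhom.hom_zero[OF emb(1)] by simp
  qed
  ultimately show "\<exists>b0. datum B b0 (\<lambda>b. emb (\<phi> b))" unfolding datum_def using fin card emb(2) by blast
qed

lemma (in ground) izhboldin_rank:
  fixes emb :: "'a::field \<Rightarrow> 'o" and scale :: "'a \<Rightarrow> 'v::ab_group_add \<Rightarrow> 'v" and B :: "'v set"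
  assumes p23: "p = 2 \<or> p = 3" and emb: "rhom emb" "F = range emb" and H: "anisotropic_hypersurface scale B p \<phi>"
    and D: "datum B b0 (\<lambda>b. emb (\<phi> b))"
  shows "\<exists>I\<subseteq>B. \<not> ratio_dep p B b0 (\<lambda>b. emb (\<phi> b)) I (\<lambda>b. emb (\<phi> b)) \<and>
      (\<forall>J\<subseteq>B. \<not> ratio_dep p B b0 (\<lambda>b. emb (\<phi> b)) J (\<lambda>b. emb (\<phi> b)) \<longrightarrow> card J \<le> card I) \<and>
      izhboldin_dim scale B p \<phi> = int (card I) - 1"
    and "\<And>(C :: 'w set) \<psi>. finite C \<Longrightarrow> rational_morphisms p B \<phi> C \<psi> \<noteq> {} \<longleftrightarrow>
      ratio_dep p B b0 (\<lambda>b. emb (\<phi> b)) C (\<lambda>c. emb (\<psi> c))"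
proof -
  have "finite (B - {b0})" using datumD(1)[OF D] by simp
  then have "\<exists>y :: 'v \<Rightarrow> 'o. alg_indep (\<lambda>x. x) F (B - {b0}) y" by (rule fresh)
  then obtain y :: "'v \<Rightarrow> 'o" where y: "alg_indep (\<lambda>x. x) F (B - {b0}) y" ..
  interpret G: generic_point p F X emb B b0 \<phi> y
    by (rule generic_point.intro[OF ground_axioms generic_point_axioms.intro[OF p23 emb D y]])
  from G.i1_index_eq[unfolded G.a_eq]
  obtain I where I: "I \<subseteq> B" "\<not> ratio_dep p B b0 (\<lambda>b. emb (\<phi> b)) I (\<lambda>b. emb (\<phi> b))"
    "\<forall>J\<subseteq>B. \<not> ratio_dep p B b0 (\<lambda>b. emb (\<phi> b)) J (\<lambda>b. emb (\<phi> b)) \<longrightarrow> card J \<le> card I"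
    "i1_index p B \<phi> + card I = card B" by (elim exE conjE)
  \<comment> \<open>\<open>(card B - 2) - (card B - card I) + 1\<close> is
    \<open>card I - 1\<close>: the Izhboldin dimension is one less than the rank.\<close>
  have "izhboldin_dim scale B p \<phi> = int (card I) - 1"
    unfolding izhboldin_dim_def anisotropic_datum(3)[OF p23 emb H] using I(4) by simp
  with I(1-3) show "\<exists>I\<subseteq>B. \<not> ratio_dep p B b0 (\<lambda>b. emb (\<phi> b)) I (\<lambda>b. emb (\<phi> b)) \<and>
      (\<forall>J\<subseteq>B. \<not> ratio_dep p B b0 (\<lambda>b. emb (\<phi> b)) J (\<lambda>b. emb (\<phi> b)) \<longrightarrow> card J \<le> card I) \<and>
      izhboldin_dim scale B p \<phi> = int (card I) - 1" by (intro exI[of _ I] conjI)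
  show "rational_morphisms p B \<phi> C \<psi> \<noteq> {} \<longleftrightarrow> ratio_dep p B b0 (\<lambda>b. emb (\<phi> b)) C (\<lambda>c. emb (\<psi> c))"
    if "finite C" for C :: "'w set" and \<psi>
    using G.rational_morphisms_iff[OF that] unfolding G.a_eq .
qed

theorem theorem5p15:
  fixes scaleX :: "'a::field \<Rightarrow> 'v::ab_group_add \<Rightarrow> 'v" and BX :: "'v set" and \<phi> :: "'v \<Rightarrow> 'a"
    and scaleY :: "'a \<Rightarrow> 'w::ab_group_add \<Rightarrow> 'w" and BY :: "'w set" and \<psi> :: "'w \<Rightarrow> 'a"
    and p :: nat
  assumes "CHAR('a) = p"
    and "p = 2 \<or> p = 3"
    and non_perfect: "\<not> surj (\<lambda>x::'a. x ^ p)"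
    and X: "anisotropic_hypersurface scaleX BX p \<phi>"
    and Y: "anisotropic_hypersurface scaleY BY p \<psi>"
    and "rational_morphisms p BX \<phi> BY \<psi> \<noteq> {}"
  shows "izhboldin_dim scaleX BX p \<phi> \<le> izhboldin_dim scaleY BY p \<psi> \<and>
    (izhboldin_dim scaleX BX p \<phi> = izhboldin_dim scaleY BY p \<psi> \<longleftrightarrow>
       rational_morphisms p BY \<psi> BX \<phi> \<noteq> {})"
proof -
  define emb :: "'a \<Rightarrow> (nat, 'a) mpoly fract" where "emb = (\<lambda>a. Fract (const_poly a) 1)"
  have emb: "rhom emb" unfolding emb_def by (rule rhom_constants)
  have prime: "prime p"
  proof -
    interpret anisotropic_hypersurface scaleX BX p \<phi> by (rule X)
    show ?thesis by (rule prime_p)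
  qed
  note HX = X and HY = Y
  interpret ground p "range emb" "\<lambda>i. Fract (var_poly i) 1"
    by (rule ground_function_field[OF prime assms(1) emb_def])
  note p23 = assms(2)
  define a d where "a b = emb (\<phi> b)" and "d c = emb (\<psi> c)" for b c
  have ad: "a = (\<lambda>b. emb (\<phi> b))" "d = (\<lambda>c. emb (\<psi> c))" by (simp_all add: a_def d_def fun_eq_iff)
  note finX = anisotropic_datum(1)[OF p23 emb refl HX] and finY = anisotropic_datum(1)[OF p23 emb refl HY]
  obtain b0 where DX: "datum BX b0 a" using anisotropic_datum(2)[OF p23 emb refl HX] unfolding ad ..
  obtain c0 where DY: "datum BY c0 d" using anisotropic_datum(2)[OF p23 emb refl HY] unfolding ad ..
  note RX = izhboldin_rank[OF p23 emb refl HX DX[unfolded ad], folded ad]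
  note RY = izhboldin_rank[OF p23 emb refl HY DY[unfolded ad], folded ad]
  obtain I where I: "I \<subseteq> BX" "\<not> ratio_dep p BX b0 a I a"
    and maxI: "\<forall>J\<subseteq>BX. \<not> ratio_dep p BX b0 a J a \<longrightarrow> card J \<le> card I"
    and dimX: "izhboldin_dim scaleX BX p \<phi> = int (card I) - 1"
    using RX(1) by (elim exE conjE)
  obtain J where J: "J \<subseteq> BY" "\<not> ratio_dep p BY c0 d J d"
    and maxJ: "\<forall>J'\<subseteq>BY. \<not> ratio_dep p BY c0 d J' d \<longrightarrow> card J' \<le> card J"
    and dimY: "izhboldin_dim scaleY BY p \<psi> = int (card J) - 1"
    using RY(1) by (elim exE conjE)
  have XY: "ratio_dep p BX b0 a BY d" using assms(6) RX(2)[OF finY, of \<psi>] unfolding ad by simp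
  obtain J' where J': "J' \<subseteq> BY" "\<not> ratio_dep p BY c0 d J' d" "card I \<le> card J'"
    "card I = card J' \<longrightarrow> ratio_dep p BY c0 d BX a"
    using rank_le[OF p23 DX DY XY I] by (elim exE conjE)
  have le: "card J' \<le> card J" using maxJ J'(1,2) by blast
  have YX: "rational_morphisms p BY \<psi> BX \<phi> \<noteq> {} \<longleftrightarrow> ratio_dep p BY c0 d BX a"
    using RY(2)[OF finX, of \<phi>] unfolding ad .
  have "card I = card J \<longleftrightarrow> ratio_dep p BY c0 d BX a"
  proof
    assume "card I = card J"
    then show "ratio_dep p BY c0 d BX a" using J'(3,4) le by simp
  next
    assume "ratio_dep p BY c0 d BX a"
    \<comment> \<open>A morphism back allows the same comparison with \<open>X\<close> and
      \<open>Y\<close> exchanged.\<close>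
    from rank_le[OF p23 DY DX this J] maxI have "card J \<le> card I" by (meson order_trans)
    then show "card I = card J" using J'(3) le by simp
  qed
  then show ?thesis using J'(3) le unfolding dimX dimY YX by simp
qed

end
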